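(* Let $n\in\mathbb{N}$. If $P$ is a manifold, then the following assertions hold: (a) If $(C^{\infty}(P),\mathbb{T}^n,\alpha)$ is a smooth trivial NCP $\mathbb{T}^n$-bundle, then the corresponding principal bundle $(P,P/\mathbb{T}^n,\mathbb{T}^n,\mathrm{pr},\sigma)$ is trivial. (b) Conversely, if $(P,M,\mathbb{T}^n,q,\sigma)$ is a trivial principal $\mathbb{T}^n$-bundle, then the corresponding smooth dynamical system $(C^{\infty}(P),\mathbb{T}^n,\alpha)$ is a smooth trivial NCP $\mathbb{T}^n$-bundle.
   Context: Manifolds are finite-dimensional, paracompact, second countable and smooth; $C^{\infty}(P)$ is the Fréchet algebra of smooth $\mathbb{C}$-valued functions. A smooth dynamical system $(A,G,\alpha)$ consists of a unital locally convex algebra $A$, a Lie group $G$ and a group homomorphism $\alpha:G\to\operatorname{Aut}(A)$ such that $(g,a)\mapsto\alpha(g)(a)$ is smooth on $G\times A$. For a dynamical system $(A,\mathbb{T}^n,\alpha)$ and ${\bf k}\in\mathbb{Z}^n$ the isotypic component is $A_{\bf k}=\{a\in A:(\forall z\in\mathbb{T}^n)\ \alpha(z)(a)=z_1^{k_1}\cdots z_n^{k_n}\,a\}$. A smooth dynamical system $(A,\mathbb{T}^n,\alpha)$ is a smooth trivial NCP (noncommutative principal) $\mathbb{T}^n$-bundle if each $A_{\bf k}$, ${\bf k}\in\mathbb{Z}^n$, contains an invertible element of $A$. In (a), $\sigma:P\times\mathbb{T}^n\to P$ is the smooth right action determined by $\sigma(p,z)=p'$ with $\delta_{p'}=\delta_p\circ\alpha(z)$,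 $\delta_p(f)=f(p)$ ($P$ being identified with the characters of $C^\infty(P)$ via $p\mapsto\delta_p$), and $\mathrm{pr}:P\to P/\mathbb{T}^n$ is the orbit map; for a smooth trivial NCP $\mathbb{T}^n$-bundle this action is free and proper, so that $(P,P/\mathbb{T}^n,\mathbb{T}^n,\mathrm{pr},\sigma)$ is a smooth principal bundle. In (b), $\alpha$ is given by $(\alpha(z)f)(p)=f(\sigma(p,z))$. A principal bundle is trivial if it is equivalent, as a principal bundle over its base, to $(M\times G,M,G,q_M,\sigma_G)$ with $q_M(m,g)=m$, $\sigma_G((m,g),h)=(m,gh)$. *)

theory Defs
  imports "HOL-Analysis.Analysis" "HOL-Algebra.Module" "HOL-Algebra.Bij"
begin

section \<open>Locally convex spaces and algebras\<close>

definition scalar_ring :: "'k::field ring" where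
  "scalar_ring = \<lparr>carrier = UNIV, mult = (*), one = 1, zero = 0, add = (+)\<rparr>"

text \<open>A module record over a ring of scalars inherits the fields \<open>mult\<close> and \<open>one\<close>;
  they are meaningless for a mere vector space and are left \<open>undefined\<close> in that case.\<close>

record ('k, 'v) lcs = "('k, 'v) module" +
  topo :: "'v topology"

definition lc_space :: "('k::real_normed_field, 'v, 'm) lcs_scheme \<Rightarrow> bool" where
  "lc_space E \<longleftrightarrow>
     module (scalar_ring :: 'k ring) E \<and>
     topspace (topo E) = carrier E \<and>
     Hausdorff_space (topo E) \<and>
     continuous_map (prod_topology (topo E) (topo E)) (topo E) (\<lambda>(x, y). x \<oplus>\<^bsub>E\<^esub> y) \<and>
     continuous_map (prod_topology euclidean (topo E)) (topo E) (\<lambda>(c, x). c \<odot>\<^bsub>E\<^esub> x) \<and>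
     (\<forall>U. openin (topo E) U \<and> \<zero>\<^bsub>E\<^esub> \<in> U \<longrightarrow>
        (\<exists>V. openin (topo E) V \<and> \<zero>\<^bsub>E\<^esub> \<in> V \<and> V \<subseteq> U \<and>
           (\<forall>x\<in>V. \<forall>y\<in>V. \<forall>t::real. 0 \<le> t \<and> t \<le> 1 \<longrightarrow>
              (of_real t \<odot>\<^bsub>E\<^esub> x) \<oplus>\<^bsub>E\<^esub> (of_real (1 - t) \<odot>\<^bsub>E\<^esub> y) \<in> V)))"

text \<open>Unital, not necessarily commutative (so the library's \<open>algebra\<close> locale is too narrow).\<close>

definition lc_algebra :: "(complex, 'v, 'm) lcs_scheme \<Rightarrow> bool" where
  "lc_algebra A \<longleftrightarrow>
     lc_space A \<and> ring A \<and>
     (\<forall>c. \<forall>x\<in>carrier A. \<forall>y\<in>carrier A.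
        (c \<odot>\<^bsub>A\<^esub> x) \<otimes>\<^bsub>A\<^esub> y = c \<odot>\<^bsub>A\<^esub> (x \<otimes>\<^bsub>A\<^esub> y) \<and>
        x \<otimes>\<^bsub>A\<^esub> (c \<odot>\<^bsub>A\<^esub> y) = c \<odot>\<^bsub>A\<^esub> (x \<otimes>\<^bsub>A\<^esub> y)) \<and>
     continuous_map (prod_topology (topo A) (topo A)) (topo A) (\<lambda>(x, y). x \<otimes>\<^bsub>A\<^esub> y)"

definition alg_Aut :: "(complex, 'v, 'm) lcs_scheme \<Rightarrow> ('v \<Rightarrow> 'v) monoid" where
  "alg_Aut A = BijGroup (carrier A)
     \<lparr>carrier := {\<phi> \<in> Bij (carrier A). \<phi> \<in> ring_hom A A \<and>
        (\<forall>c. \<forall>x\<in>carrier A. \<phi> (c \<odot>\<^bsub>A\<^esub> x) = c \<odot>\<^bsub>A\<^esub> \<phi> x) \<and>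
        homeomorphic_map (topo A) (topo A) \<phi>}\<rparr>"

definition scalars :: "('k::real_normed_field, 'k) lcs" where
  "scalars = \<lparr>carrier = UNIV, mult = (*), one = 1, zero = 0, add = (+), smult = (*),
     topo = euclidean\<rparr>"

definition euclid :: "nat \<Rightarrow> (real, nat \<Rightarrow> real) lcs" where
  "euclid d = \<lparr>carrier = topspace (Euclidean_space d), mult = undefined, one = undefined,
     zero = (\<lambda>i. 0), add = (\<lambda>x y i. x i + y i), smult = (\<lambda>t x i. t * x i),
     topo = Euclidean_space d\<rparr>"

definition prod_lcs ::
  "('k::real_normed_field, 'e, 'm) lcs_scheme \<Rightarrow> ('l::real_normed_field, 'f, 'n) lcs_scheme
     \<Rightarrow> (real, 'e \<times> 'f) lcs" where
  "prod_lcs E F = \<lparr>carrier = carrier E \<times> carrier F, mult = undefined, one = undefined,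
     zero = (\<zero>\<^bsub>E\<^esub>, \<zero>\<^bsub>F\<^esub>),
     add = (\<lambda>(x, y) (x', y'). (x \<oplus>\<^bsub>E\<^esub> x', y \<oplus>\<^bsub>F\<^esub> y')),
     smult = (\<lambda>t (x, y). (of_real t \<odot>\<^bsub>E\<^esub> x, of_real t \<odot>\<^bsub>F\<^esub> y)),
     topo = prod_topology (topo E) (topo F)\<rparr>"


section \<open>Smooth maps between locally convex spaces\<close>

text \<open>Differential calculus in the sense of Michal and Bastiani: a map on an open set \<open>U\<close> is
  smooth if all iterated directional derivatives exist and
  \<open>(x, v\<^sub>1, \<dots>, v\<^sub>k) \<mapsto> d\<^sup>k f(x; v\<^sub>1, \<dots>, v\<^sub>k)\<close> is continuous on \<open>U \<times> E\<^sup>k\<close> for every \<open>k\<close>.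
  Derivatives are real ones, whatever the scalar fields of \<open>E\<close> and \<open>F\<close>. Between the
  spaces \<open>euclid d\<close> this is the usual notion of a smooth map.\<close>

definition has_dir_deriv ::
  "('k::real_normed_field, 'e, 'm) lcs_scheme \<Rightarrow> ('l::real_normed_field, 'f, 'n) lcs_scheme
     \<Rightarrow> ('e \<Rightarrow> 'f) \<Rightarrow> 'e \<Rightarrow> 'e \<Rightarrow> 'f \<Rightarrow> bool" where
  "has_dir_deriv E F f v x w \<longleftrightarrow>
     limitin (topo F)
       (\<lambda>t::real. of_real (1 / t) \<odot>\<^bsub>F\<^esub> (f (x \<oplus>\<^bsub>E\<^esub> (of_real t \<odot>\<^bsub>E\<^esub> v)) \<ominus>\<^bsub>F\<^esub> f x)) w (at 0)"

definition dir_deriv ::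
  "('k::real_normed_field, 'e, 'm) lcs_scheme \<Rightarrow> ('l::real_normed_field, 'f, 'n) lcs_scheme
     \<Rightarrow> ('e \<Rightarrow> 'f) \<Rightarrow> 'e \<Rightarrow> 'e \<Rightarrow> 'f" where
  "dir_deriv E F f v x = (THE w. has_dir_deriv E F f v x w)"

primrec iter_deriv ::
  "('k::real_normed_field, 'e, 'm) lcs_scheme \<Rightarrow> ('l::real_normed_field, 'f, 'n) lcs_scheme
     \<Rightarrow> ('e \<Rightarrow> 'f) \<Rightarrow> 'e list \<Rightarrow> 'e \<Rightarrow> 'f" where
  "iter_deriv E F f [] = f"
| "iter_deriv E F f (v # vs) = dir_deriv E F (iter_deriv E F f vs) v"

definition smooth_on ::
  "('k::real_normed_field, 'e, 'm) lcs_scheme \<Rightarrow> ('l::real_normed_field, 'f, 'n) lcs_scheme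
     \<Rightarrow> 'e set \<Rightarrow> ('e \<Rightarrow> 'f) \<Rightarrow> bool" where
  "smooth_on E F U f \<longleftrightarrow>
     openin (topo E) U \<and>
     (\<forall>vs. set vs \<subseteq> carrier E \<longrightarrow>
        (\<forall>v\<in>carrier E. \<forall>x\<in>U. \<exists>w. has_dir_deriv E F (iter_deriv E F f vs) v x w)) \<and>
     (\<forall>k. continuous_map
        (prod_topology (subtopology (topo E) U) (product_topology (\<lambda>_. topo E) {..<k}))
        (topo F)
        (\<lambda>(x, v). iter_deriv E F f (map v [0..<k]) x))"


section \<open>Smooth manifolds\<close>

text \<open>An atlas is a set of charts \<open>(U, \<phi>)\<close>; it need not be maximal. Only the values of \<open>\<phi>\<close>
  on \<open>U\<close> matter, and \<open>inv_into U \<phi>\<close> is the inverse chart.\<close>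

record 'a manifold =
  mtop :: "'a topology"
  mdim :: nat
  atlas :: "('a set \<times> ('a \<Rightarrow> nat \<Rightarrow> real)) set"

definition paracompact_space :: "'a topology \<Rightarrow> bool" where
  "paracompact_space X \<longleftrightarrow>
     (\<forall>\<U>. (\<forall>U\<in>\<U>. openin X U) \<and> \<Union>\<U> = topspace X \<longrightarrow>
        (\<exists>\<V>. (\<forall>V\<in>\<V>. openin X V \<and> (\<exists>U\<in>\<U>. V \<subseteq> U)) \<and> \<Union>\<V> = topspace X \<and>
              locally_finite_in X \<V>))"

definition smooth_manifold :: "'a manifold \<Rightarrow> bool" where
  "smooth_manifold M \<longleftrightarrow>
     Hausdorff_space (mtop M) \<and> paracompact_space (mtop M) \<and> second_countable (mtop M) \<and>
     (\<Union>(U, \<phi>)\<in>atlas M. U) = topspace (mtop M) \<and>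
     (\<forall>(U, \<phi>)\<in>atlas M.
        openin (mtop M) U \<and> openin (Euclidean_space (mdim M)) (\<phi> ` U) \<and>
        homeomorphic_map (subtopology (mtop M) U)
          (subtopology (Euclidean_space (mdim M)) (\<phi> ` U)) \<phi>) \<and>
     (\<forall>(U, \<phi>)\<in>atlas M. \<forall>(V, \<psi>)\<in>atlas M.
        smooth_on (euclid (mdim M)) (euclid (mdim M)) (\<phi> ` (U \<inter> V)) (\<psi> \<circ> inv_into U \<phi>))"

definition smooth_map :: "'a manifold \<Rightarrow> 'b manifold \<Rightarrow> ('a \<Rightarrow> 'b) \<Rightarrow> bool" where
  "smooth_map M N f \<longleftrightarrow>
     continuous_map (mtop M) (mtop N) f \<and>
     (\<forall>(U, \<phi>)\<in>atlas M. \<forall>(V, \<psi>)\<in>atlas N.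
        smooth_on (euclid (mdim M)) (euclid (mdim N)) (\<phi> ` (U \<inter> f -` V))
          (\<psi> \<circ> f \<circ> inv_into U \<phi>))"

definition diffeomorphism :: "'a manifold \<Rightarrow> 'b manifold \<Rightarrow> ('a \<Rightarrow> 'b) \<Rightarrow> bool" where
  "diffeomorphism M N f \<longleftrightarrow>
     smooth_map M N f \<and>
     (\<exists>g. smooth_map N M g \<and> (\<forall>x\<in>topspace (mtop M). g (f x) = x) \<and>
          (\<forall>y\<in>topspace (mtop N). f (g y) = y))"

definition submersion :: "'a manifold \<Rightarrow> 'b manifold \<Rightarrow> ('a \<Rightarrow> 'b) \<Rightarrow> bool" where
  "submersion M N f \<longleftrightarrow>
     smooth_map M N f \<and>
     (\<forall>(U, \<phi>)\<in>atlas M. \<forall>(V, \<psi>)\<in>atlas N. \<forall>p\<in>U \<inter> f -` V.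
        (\<lambda>v. dir_deriv (euclid (mdim M)) (euclid (mdim N)) (\<psi> \<circ> f \<circ> inv_into U \<phi>) v (\<phi> p))
          ` carrier (euclid (mdim M)) = carrier (euclid (mdim N)))"

definition prod_manifold :: "'a manifold \<Rightarrow> 'b manifold \<Rightarrow> ('a \<times> 'b) manifold" where
  "prod_manifold M N =
     \<lparr>mtop = prod_topology (mtop M) (mtop N),
      mdim = mdim M + mdim N,
      atlas = {(U \<times> V, \<lambda>(x, y) i. if i < mdim M then \<phi> x i else \<psi> y (i - mdim M)) |U \<phi> V \<psi>.
                 (U, \<phi>) \<in> atlas M \<and> (V, \<psi>) \<in> atlas N}\<rparr>"

definition open_submanifold :: "'a manifold \<Rightarrow> 'a set \<Rightarrow> 'a manifold" where
  "open_submanifold M W =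
     \<lparr>mtop = subtopology (mtop M) W,
      mdim = mdim M,
      atlas = (\<lambda>(U, \<phi>). (U \<inter> W, \<phi>)) ` atlas M\<rparr>"


section \<open>The algebra of smooth functions\<close>

definition smooth_functions :: "'a manifold \<Rightarrow> ('a \<Rightarrow> complex) set" where
  "smooth_functions M = {f \<in> extensional (topspace (mtop M)).
     \<forall>(U, \<phi>)\<in>atlas M. smooth_on (euclid (mdim M)) scalars (\<phi> ` U) (f \<circ> inv_into U \<phi>)}"

text \<open>The topology of uniform convergence of all derivatives on compact subsets of charts; the
  sets in the second line are the open balls of the defining seminorms
  \<open>f \<mapsto> sup\<^bsub>x \<in> K\<^esub> |d\<^sup>k(f \<circ> \<phi>\<inverse>)(x; v\<^sub>1, \<dots>, v\<^sub>k)|\<close>.\<close>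

definition smooth_functions_topology :: "'a manifold \<Rightarrow> ('a \<Rightarrow> complex) topology" where
  "smooth_functions_topology M = topology_generated_by (insert (smooth_functions M)
     {{g \<in> smooth_functions M. \<forall>x\<in>K.
         cmod (iter_deriv (euclid (mdim M)) scalars (g \<circ> inv_into U \<phi>) vs x -
               iter_deriv (euclid (mdim M)) scalars (f \<circ> inv_into U \<phi>) vs x) < \<epsilon>}
      |f U \<phi> K vs \<epsilon>.
        f \<in> smooth_functions M \<and> (U, \<phi>) \<in> atlas M \<and>
        compactin (Euclidean_space (mdim M)) K \<and> K \<subseteq> \<phi> ` U \<and>
        set vs \<subseteq> carrier (euclid (mdim M)) \<and> 0 < \<epsilon>})"

definition C_infinity :: "'a manifold \<Rightarrow> (complex, 'a \<Rightarrow> complex) lcs" where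
  "C_infinity M =
     \<lparr>carrier = smooth_functions M,
      mult = (\<lambda>f g. \<lambda>x\<in>topspace (mtop M). f x * g x),
      one = (\<lambda>x\<in>topspace (mtop M). 1),
      zero = (\<lambda>x\<in>topspace (mtop M). 0),
      add = (\<lambda>f g. \<lambda>x\<in>topspace (mtop M). f x + g x),
      smult = (\<lambda>c f. \<lambda>x\<in>topspace (mtop M). c * f x),
      topo = smooth_functions_topology M\<rparr>"


section \<open>Lie groups and the torus\<close>

record 'g lie = "'g monoid" +
  lie_manifold :: "'g manifold"

definition lie_group :: "'g lie \<Rightarrow> bool" where
  "lie_group G \<longleftrightarrow>
     group G \<and> smooth_manifold (lie_manifold G) \<and>
     topspace (mtop (lie_manifold G)) = carrier G \<and>
     smooth_map (prod_manifold (lie_manifold G) (lie_manifold G)) (lie_manifold G)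
       (\<lambda>(g, h). g \<otimes>\<^bsub>G\<^esub> h) \<and>
     smooth_map (lie_manifold G) (lie_manifold G) (\<lambda>g. inv\<^bsub>G\<^esub> g)"

definition torus_set :: "nat \<Rightarrow> (nat \<Rightarrow> complex) set" where
  "torus_set n = (\<Pi>\<^sub>E i\<in>{..<n}. sphere 0 1)"

text \<open>The chart around \<open>w\<close> records the angles relative to \<open>w\<close>; it is defined where no
  coordinate is antipodal to that of \<open>w\<close>.\<close>

definition torus :: "nat \<Rightarrow> (nat \<Rightarrow> complex) lie" where
  "torus n =
     \<lparr>carrier = torus_set n,
      mult = (\<lambda>z w. \<lambda>i\<in>{..<n}. z i * w i),
      one = (\<lambda>i\<in>{..<n}. 1),
      lie_manifold =
        \<lparr>mtop = product_topology (\<lambda>_. top_of_set (sphere 0 1)) {..<n},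
         mdim = n,
         atlas = (\<lambda>w. ({z \<in> torus_set n. \<forall>i<n. z i \<noteq> - w i},
                       \<lambda>z i. if i < n then Arg (z i / w i) else 0)) ` torus_set n\<rparr>\<rparr>"


section \<open>Smooth dynamical systems and smooth trivial NCP torus bundles\<close>

text \<open>Smoothness of \<open>G \<times> A \<rightarrow> A\<close>, where \<open>G \<times> A\<close> is the manifold with charts
  \<open>\<phi> \<times> id\<close> modelled on \<open>\<real>\<^sup>d \<times> A\<close>.\<close>

definition smooth_dynamical_system ::
  "(complex, 'v, 'm) lcs_scheme \<Rightarrow> 'g lie \<Rightarrow> ('g \<Rightarrow> 'v \<Rightarrow> 'v) \<Rightarrow> bool" where
  "smooth_dynamical_system A G \<alpha> \<longleftrightarrow>
     lc_algebra A \<and> lie_group G \<and> \<alpha> \<in> hom G (alg_Aut A) \<and>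
     (\<forall>(U, \<phi>)\<in>atlas (lie_manifold G).
        smooth_on (prod_lcs (euclid (mdim (lie_manifold G))) A) A (\<phi> ` U \<times> carrier A)
          (\<lambda>(x, a). \<alpha> (inv_into U \<phi> x) a))"

text \<open>A multi-index in \<open>\<int>\<^sup>n\<close> is a function of which only the values below \<open>n\<close> are used.\<close>

definition isotypic_component ::
  "nat \<Rightarrow> (complex, 'v, 'm) lcs_scheme \<Rightarrow> ((nat \<Rightarrow> complex) \<Rightarrow> 'v \<Rightarrow> 'v) \<Rightarrow> (nat \<Rightarrow> int) \<Rightarrow> 'v set"
  where
  "isotypic_component n A \<alpha> k =
     {a \<in> carrier A. \<forall>z\<in>carrier (torus n). \<alpha> z a = (\<Prod>i<n. z i powi k i) \<odot>\<^bsub>A\<^esub> a}"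

definition smooth_trivial_NCP_torus_bundle ::
  "nat \<Rightarrow> (complex, 'v, 'm) lcs_scheme \<Rightarrow> ((nat \<Rightarrow> complex) \<Rightarrow> 'v \<Rightarrow> 'v) \<Rightarrow> bool" where
  "smooth_trivial_NCP_torus_bundle n A \<alpha> \<longleftrightarrow>
     smooth_dynamical_system A (torus n) \<alpha> \<and>
     (\<forall>k. \<exists>a \<in> isotypic_component n A \<alpha> k. a \<in> Units A)"


section \<open>Principal bundles\<close>

definition smooth_right_action :: "'a manifold \<Rightarrow> 'g lie \<Rightarrow> ('a \<Rightarrow> 'g \<Rightarrow> 'a) \<Rightarrow> bool" where
  "smooth_right_action P G \<sigma> \<longleftrightarrow>
     smooth_map (prod_manifold P (lie_manifold G)) P (\<lambda>(p, g). \<sigma> p g) \<and>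
     (\<forall>p\<in>topspace (mtop P). \<sigma> p \<one>\<^bsub>G\<^esub> = p \<and>
        (\<forall>g\<in>carrier G. \<forall>h\<in>carrier G. \<sigma> (\<sigma> p g) h = \<sigma> p (g \<otimes>\<^bsub>G\<^esub> h)))"

definition bundle_equivalence ::
  "'g lie \<Rightarrow> 'a manifold \<Rightarrow> ('a \<Rightarrow> 'm) \<Rightarrow> ('a \<Rightarrow> 'g \<Rightarrow> 'a) \<Rightarrow>
   'b manifold \<Rightarrow> ('b \<Rightarrow> 'm) \<Rightarrow> ('b \<Rightarrow> 'g \<Rightarrow> 'b) \<Rightarrow> ('a \<Rightarrow> 'b) \<Rightarrow> bool" where
  "bundle_equivalence G P q \<sigma> P' q' \<sigma>' \<Phi> \<longleftrightarrow>
     diffeomorphism P P' \<Phi> \<and>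
     (\<forall>p\<in>topspace (mtop P). q' (\<Phi> p) = q p \<and>
        (\<forall>g\<in>carrier G. \<Phi> (\<sigma> p g) = \<sigma>' (\<Phi> p) g))"

text \<open>Triviality over the base \<open>M\<close> of the data \<open>(P, M, G, q, \<sigma>)\<close>: equivalence with
  \<open>(M \<times> G, M, G, q\<^sub>M, \<sigma>\<^sub>G)\<close>.\<close>

definition globally_trivial ::
  "'a manifold \<Rightarrow> 'm manifold \<Rightarrow> 'g lie \<Rightarrow> ('a \<Rightarrow> 'm) \<Rightarrow> ('a \<Rightarrow> 'g \<Rightarrow> 'a) \<Rightarrow> bool" where
  "globally_trivial P M G q \<sigma> \<longleftrightarrow>
     (\<exists>\<Phi>. bundle_equivalence G P q \<sigma>
        (prod_manifold M (lie_manifold G)) fst (\<lambda>(m, g) h. (m, g \<otimes>\<^bsub>G\<^esub> h)) \<Phi>)"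

definition principal_bundle ::
  "'a manifold \<Rightarrow> 'm manifold \<Rightarrow> 'g lie \<Rightarrow> ('a \<Rightarrow> 'm) \<Rightarrow> ('a \<Rightarrow> 'g \<Rightarrow> 'a) \<Rightarrow> bool" where
  "principal_bundle P M G q \<sigma> \<longleftrightarrow>
     smooth_manifold P \<and> smooth_manifold M \<and> lie_group G \<and>
     smooth_map P M q \<and> smooth_right_action P G \<sigma> \<and>
     (\<forall>p\<in>topspace (mtop P). \<forall>g\<in>carrier G. q (\<sigma> p g) = q p) \<and>
     (\<forall>m\<in>topspace (mtop M). \<exists>W. openin (mtop M) W \<and> m \<in> W \<and>
        globally_trivial (open_submanifold P {p \<in> topspace (mtop P). q p \<in> W})
          (open_submanifold M W) G q \<sigma>)"

definition trivial_principal_bundle ::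
  "'a manifold \<Rightarrow> 'm manifold \<Rightarrow> 'g lie \<Rightarrow> ('a \<Rightarrow> 'm) \<Rightarrow> ('a \<Rightarrow> 'g \<Rightarrow> 'a) \<Rightarrow> bool" where
  "trivial_principal_bundle P M G q \<sigma> \<longleftrightarrow>
     principal_bundle P M G q \<sigma> \<and> globally_trivial P M G q \<sigma>"


section \<open>Actions on a manifold and on its smooth functions\<close>

definition induced_action ::
  "'a manifold \<Rightarrow> ('g \<Rightarrow> ('a \<Rightarrow> complex) \<Rightarrow> 'a \<Rightarrow> complex) \<Rightarrow> 'a \<Rightarrow> 'g \<Rightarrow> 'a" where
  "induced_action P \<alpha> p z =
     (THE p'. p' \<in> topspace (mtop P) \<and> (\<forall>f\<in>carrier (C_infinity P). f p' = \<alpha> z f p))"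

definition pullback_action ::
  "'a manifold \<Rightarrow> ('a \<Rightarrow> 'g \<Rightarrow> 'a) \<Rightarrow> 'g \<Rightarrow> ('a \<Rightarrow> complex) \<Rightarrow> 'a \<Rightarrow> complex" where
  "pullback_action P \<sigma> z = (\<lambda>f\<in>carrier (C_infinity P). \<lambda>p\<in>topspace (mtop P). f (\<sigma> p z))"

definition orbit_map :: "'g lie \<Rightarrow> ('a \<Rightarrow> 'g \<Rightarrow> 'a) \<Rightarrow> 'a \<Rightarrow> 'a set" where
  "orbit_map G \<sigma> p = \<sigma> p ` carrier G"

text \<open>\<open>B\<close> is the orbit space \<open>P/G\<close> with the quotient topology and a smooth structure for which the
  orbit map is a submersion. Such a smooth structure is unique up to equivalence of atlases.\<close>

definition is_orbit_manifold ::
  "'a manifold \<Rightarrow> 'g lie \<Rightarrow> ('a \<Rightarrow> 'g \<Rightarrow> 'a) \<Rightarrow> 'a set manifold \<Rightarrow> bool" where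
  "is_orbit_manifold P G \<sigma> B \<longleftrightarrow>
     smooth_manifold B \<and>
     quotient_map (mtop P) (mtop B) (orbit_map G \<sigma>) \<and>
     submersion P B (orbit_map G \<sigma>)"

end

theory Submission
  imports Defs
begin

text \<open>
  Suppose that every isotypic component of \<open>C_infinity P\<close> contains a unit. The component of the \<open>i\<close>-th
  unit vector yields a nowhere vanishing function \<open>a i\<close> with \<open>a i (\<sigma> p z) = z i * a i p\<close>. Normalising
  these functions to modulus one gives a smooth map \<open>u\<close> from \<open>P\<close> to the torus with
  \<open>u (\<sigma> p z) = u p \<cdot> z\<close> (\<open>equivariant_map\<close>), and such a map trivialises the action: each orbit meets
  the slice \<open>u = 1\<close> in exactly one point, \<open>r p = \<sigma> p (u p)\<^sup>-\<^sup>1\<close>. So \<open>p \<mapsto> (pr p, u p)\<close> has the inverse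
  \<open>(Q, z) \<mapsto> \<sigma> (sec Q) z\<close>, where \<open>sec Q\<close> is the slice point of the orbit \<open>Q\<close>. For any smooth structure
  on the orbit space that makes \<open>pr\<close> a submersion, \<open>sec\<close> is smooth (\<open>submersion_factor_smooth\<close>), which
  gives triviality (\<open>orbit_manifold_trivial\<close>). Such a structure exists, because the angles of \<open>u\<close> can
  be completed to coordinates of \<open>P\<close> (\<open>straighten\<close>), whose remaining members are coordinates on the
  slice (\<open>orbit_manifold_exists\<close>).

  This requires that the automorphisms \<open>\<alpha> z\<close> come from a smooth action in the first place. The
  functional \<open>f \<mapsto> \<alpha> z f p\<close> is a continuous character, hence evaluation at a point
  (\<open>continuous_character\<close>, \<open>induced_point\<close>). Derivatives of \<open>\<alpha> z f p\<close> in \<open>z\<close> are values of the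
  derivatives of the dynamical system, which are smooth functions on \<open>P\<close> depending continuously on
  \<open>z\<close>; together this is smoothness in both arguments (\<open>joint_smooth\<close>).

  Conversely, the torus component \<open>u\<close> of a trivialisation has the units \<open>\<Prod>i<n. u p i powi k i\<close> in the
  isotypic components. The work lies in the smoothness of the pulled back action on the function
  algebra. Its derivative at the identity is given by vector fields on \<open>P\<close>, which act continuously on
  the algebra (\<open>inf_gen_limit\<close>, \<open>inf_gen_bounded\<close>). By the group law all iterated derivatives are
  the action composed with polynomials in these operators (\<open>iter_deriv_act\<close>), and these are jointly
  continuous (\<open>smooth_on_act\<close>).\<close>

section \<open>The model spaces\<close>

type_synonym vec = "nat => real"

abbreviation "open_Rn d U == openin (Euclidean_space d) U"

abbreviation near :: "nat => real => vec => vec => bool" where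
  "near d r x y == \<forall>i<d. \<bar>y i - x i\<bar> < r"

abbreviation Rn :: "nat => vec set" where
  "Rn d == topspace (Euclidean_space d)"

lemma top_of_set_Rn: "top_of_set (Rn d) = Euclidean_space d"
  by (simp add: Euclidean_space_def euclidean_product_topology)

lemma Rn_iff: "x \<in> Rn d \<longleftrightarrow> (ALL i>=d. x i = 0)"
  by (simp add: topspace_Euclidean_space)

lemma Rn_add_scale [intro]:
  "x \<in> Rn d ==> v \<in> Rn d ==> (%i. x i + t * v i) \<in> Rn d"
  by (auto simp: Rn_iff)

lemma open_box:
  assumes "x \<in> Rn d"
  shows "open_Rn d {y:Rn d. ALL i<d. \<bar>y i - x i\<bar> < r}"
proof -
  have "open {y :: nat => real. \<bar>y i - x i\<bar> < r}" for i
    by (intro open_Collect_less continuous_intros continuous_on_product_coordinates)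
  then have "open (\<Inter>i\<in>{..<d}. {y :: nat => real. \<bar>y i - x i\<bar> < r})"
    by (intro open_INT) auto
  moreover have "{y:Rn d. ALL i<d. \<bar>y i - x i\<bar> < r} = Rn d Int (\<Inter>i\<in>{..<d}. {y. \<bar>y i - x i\<bar> < r})"
    by auto
  ultimately show ?thesis
    using openin_open_Int[of _ "Rn d"] by (simp add: top_of_set_Rn)
qed

lemma openin_Euclidean_box:
  assumes "open_Rn d U" "x \<in> U"
  obtains r where "r > 0" "!!y. y \<in> Rn d ==> (!!i. i < d ==> \<bar>y i - x i\<bar> < r) ==> y \<in> U"
proof -
  obtain T where T: "openin (product_topology (%_. euclideanreal) UNIV) T" "U = T Int {x. ALL i>=d. x i = 0}"
    using assms(1) by (auto simp: Euclidean_space_def openin_subtopology)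
  have "x \<in> T" using assms T by auto
  then obtain X where X: "x \<in> (\<Pi>\<^sub>E i\<in>UNIV. X i)" "!!i. open (X i)" "(\<Pi>\<^sub>E i\<in>UNIV. X i) \<subseteq> T"
    using product_topology_open_contains_basis[OF T(1)] by (metis open_openin)
  have "EX e>0. ball (x i) e \<subseteq> X i" for i
    using X by (meson PiE_mem UNIV_I open_contains_ball)
  then obtain e where e: "!!i. e i > 0" "!!i. ball (x i) (e i) \<subseteq> X i" by metis
  define r where "r = Min (insert 1 (e ` {..<d}))"
  have r: "r > 0" "!!i. i < d ==> r <= e i"
    unfolding r_def using e by (auto)
  show ?thesis
  proof
    show "r > 0" by fact
    fix y assume y: "y \<in> Rn d" "!!i. i < d ==> \<bar>y i - x i\<bar> < r"
    have xz: "x i = 0" if "i >= d" for i using assms T that by auto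
    have "y i \<in> X i" for i
    proof (cases "i < d")
      case True
      then have "y i \<in> ball (x i) (e i)" using y(2)[OF True] r(2)[OF True] by (auto simp: dist_real_def abs_minus_commute)
      then show ?thesis using e by blast
    next
      case False
      then have "y i = x i" using y xz by (auto simp: Rn_iff)
      then show ?thesis using X by auto
    qed
    then have "y \<in> T" using X by auto
    then show "y \<in> U" using y T by (auto simp: Rn_iff)
  qed
qed

lemma openin_EuclideanI:
  assumes "U \<subseteq> Rn d"
    and "!!x. x \<in> U ==> EX r>0. ALL y:Rn d. near d r x y --> y \<in> U"
  shows "open_Rn d U"
proof (subst openin_subopen, intro ballI)
  fix x assume x: "x \<in> U"
  then obtain r where r: "r > 0" "ALL y:Rn d. near d r x y --> y \<in> U" using assms by blast
  then show "EX T. open_Rn d T & x \<in> T & T \<subseteq> U"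
    using x assms(1) open_box[of x d r] by (intro exI[of _ "{y:Rn d. ALL i<d. \<bar>y i - x i\<bar> < r}"]) auto
qed

lemma openin_continuous_preimage_Euclidean:
  assumes "open_Rn d U" "continuous_on U f" "open S"
  shows "open_Rn d {x:U. f x \<in> S}"
proof -
  have "openin (top_of_set U) (U Int f -` S)"
    using assms(2,3) by (simp add: continuous_openin_preimage_gen)
  moreover have "{x:U. f x \<in> S} = U Int f -` S" by auto
  ultimately show ?thesis
    using openin_trans[of U _ "Rn d"] assms(1) by (simp add: top_of_set_Rn)
qed

lemma continuous_on_box:
  fixes f :: "vec => 'b::metric_space"
  assumes "open_Rn d U" "continuous_on U f" "x \<in> U" "e > 0"
  obtains r where "r > 0"
    "!!y. y \<in> Rn d ==> (!!i. i < d ==> \<bar>y i - x i\<bar> < r) ==> y \<in> U & dist (f y) (f x) < e"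
proof -
  have "open_Rn d {y:U. f y \<in> ball (f x) e}"
    using assms by (intro openin_continuous_preimage_Euclidean) auto
  moreover have "x \<in> {y:U. f y \<in> ball (f x) e}" using assms by auto
  ultimately obtain r where "r > 0" "!!y. y \<in> Rn d ==> (!!i. i < d ==> \<bar>y i - x i\<bar> < r) ==> y \<in> {y:U. f y \<in> ball (f x) e}"
    by (rule openin_Euclidean_box) blast
  then show ?thesis using that by (metis (mono_tags, lifting) dist_commute mem_Collect_eq mem_ball)
qed

lemma continuous_on_boxI:
  fixes f :: "vec => 'b::metric_space"
  assumes "U \<subseteq> Rn d"
    and "!!x e. x \<in> U ==> e > 0 ==>
      EX r>0. ALL y:U. near d r x y --> dist (f y) (f x) < e"
  shows "continuous_on U f"
  unfolding continuous_on_def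
proof (intro ballI tendstoI)
  fix x e assume x: "x \<in> U" "(e::real) > 0"
  then obtain r where r: "r > 0" "ALL y:U. near d r x y --> dist (f y) (f x) < e"
    using assms by blast
  have "open {y :: nat => real. \<bar>y i - x i\<bar> < r}" for i
    by (intro open_Collect_less continuous_intros continuous_on_product_coordinates)
  then have "open (\<Inter>i\<in>{..<d}. {y :: nat => real. \<bar>y i - x i\<bar> < r})"
    by (intro open_INT) auto
  moreover have "x \<in> (\<Inter>i\<in>{..<d}. {y :: nat => real. \<bar>y i - x i\<bar> < r})" using r by auto
  ultimately show "\<forall>\<^sub>F y in at x within U. dist (f y) (f x) < e"
    unfolding eventually_at_topological using r(2) by (intro exI[of _ "\<Inter>i\<in>{..<d}. {y. \<bar>y i - x i\<bar> < r}"]) auto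
qed

section \<open>Directional derivatives\<close>

text \<open>Charts take values in functions on \<open>nat\<close> vanishing from \<open>d\<close> on.
  These do not form a normed vector space, so calculus is built on derivatives along lines.\<close>

definition unitv :: "nat => vec" where
  "unitv i = (%j. if j = i then 1 else 0)"

lemma unitv_in_Rn: "i < d ==> unitv i \<in> Rn d"
  by (auto simp: Rn_iff unitv_def)

definition has_dird ::
  "(vec => 'b::real_normed_vector) => vec => vec => 'b => bool" where
  "has_dird f v x w \<longleftrightarrow> ((%t. f (%i. x i + t * v i)) has_vector_derivative w) (at 0)"

definition dird ::
  "vec => (vec => 'b::real_normed_vector) => vec => 'b" where
  "dird v f x = vector_derivative (%t. f (%i. x i + t * v i)) (at 0)"

lemma has_dird_dird: "has_dird f v x w ==> dird v f x = w"
  unfolding has_dird_def dird_def by (rule vector_derivative_at)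

lemma curve_eventually_in:
  assumes "open_Rn d U" "\<gamma> (0::real) \<in> U" "\<forall>\<^sub>F t in nhds 0. \<gamma> t \<in> Rn d"
    and "!!i. i < d ==> isCont (%t. \<gamma> t i) 0"
  shows "\<forall>\<^sub>F t in nhds 0. \<gamma> t \<in> U"
proof -
  obtain r where r: "r > 0" "!!y. y \<in> Rn d ==> (!!i. i < d ==> \<bar>y i - \<gamma> 0 i\<bar> < r) ==> y \<in> U"
    using openin_Euclidean_box[OF assms(1,2)] by metis
  have "\<forall>\<^sub>F t in nhds 0. \<bar>\<gamma> t i - \<gamma> 0 i\<bar> < r" if "i < d" for i
  proof -
    have "((%t. \<gamma> t i) \<longlongrightarrow> \<gamma> 0 i) (nhds 0)"
      using assms(4)[OF that] tendsto_at_iff_tendsto_nhds[of "%t. \<gamma> t i" 0] by (simp add: isCont_def)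
    then show ?thesis using r(1) unfolding tendsto_iff dist_real_def by blast
  qed
  then have "\<forall>\<^sub>F t in nhds 0. ALL i:{..<d}. \<bar>\<gamma> t i - \<gamma> 0 i\<bar> < r"
    by (intro eventually_ball_finite) auto
  with assms(3) show ?thesis
    by eventually_elim (use r(2) in auto)
qed

lemma line_eventually_in:
  assumes "open_Rn d U" "x \<in> U" "v \<in> Rn d"
  shows "\<forall>\<^sub>F t in nhds 0. (%i. x i + t * v i) \<in> U"
proof -
  have "x \<in> Rn d" using assms openin_subset by blast
  then have "(%i. x i + t * v i) \<in> Rn d" for t using assms(3) by (rule Rn_add_scale)
  moreover have "isCont (%t. x i + t * v i) 0" for i by (intro continuous_intros)
  ultimately show ?thesis
    using assms(2) by (intro curve_eventually_in[OF assms(1)] always_eventually allI) simp_all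
qed

lemma line_eventually_at:
  assumes "open_Rn d U" "x \<in> U" "v \<in> Rn d"
  shows "\<forall>\<^sub>F t in at 0. (%i. x i + t * v i) \<in> U"
  using line_eventually_in[OF assms] by (simp add: eventually_at_filter eventually_mono)

lemma has_dird_cong:
  assumes "open_Rn d U" "x \<in> U" "v \<in> Rn d" "!!y. y \<in> U ==> f y = g y"
  shows "has_dird f v x w \<longleftrightarrow> has_dird g v x w"
proof -
  have *: "\<forall>\<^sub>F t in nhds 0. f (%i. x i + t * v i) = g (%i. x i + t * v i)"
    using line_eventually_in[OF assms(1-3)] by eventually_elim (use assms(4) in auto)
  then have "f (%i. x i + 0 * v i) = g (%i. x i + 0 * v i)"
    by (rule eventually_nhds_x_imp_x)
  with * show ?thesis
    unfolding has_dird_def by (intro has_vector_derivative_cong_ev) (auto elim: eventually_mono)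
qed

lemma dird_cong:
  assumes "open_Rn d U" "x \<in> U" "v \<in> Rn d" "!!y. y \<in> U ==> f y = g y"
  shows "dird v f x = dird v g x"
proof -
  have "has_dird f v x w \<longleftrightarrow> has_dird g v x w" for w
    by (rule has_dird_cong[OF assms(1-3)]) (rule assms(4))
  then show ?thesis unfolding dird_def vector_derivative_def has_dird_def by simp
qed

lemma has_dird_line:
  assumes "has_dird f v (%i. x i + s * v i) w"
  shows "((%t. f (%i. x i + t * v i)) has_vector_derivative w) (at s)"
proof -
  have "((%t. t - s) has_vector_derivative 1) (at s)"
    by (auto intro!: derivative_eq_intros)
  from vector_diff_chain_at[OF this, of "%t. f (%i. (x i + s * v i) + t * v i)" w]
  show ?thesis using assms by (simp add: has_dird_def o_def algebra_simps)
qed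

lemma vector_mvt_bound:
  fixes f :: "real => 'b::real_normed_vector"
  assumes "!!t. t \<in> closed_segment a b ==> (f has_vector_derivative f' t) (at t)"
    and "!!t. t \<in> closed_segment a b ==> norm (f' t - c) <= B"
  shows "norm (f b - f a - (b - a) *\<^sub>R c) <= B * \<bar>b - a\<bar>"
proof -
  have "((%t. f t - t *\<^sub>R c) has_derivative (%h. h *\<^sub>R (f' t - c))) (at t within closed_segment a b)"
    if "t \<in> closed_segment a b" for t
  proof -
    have "(f has_derivative (%h. h *\<^sub>R f' t)) (at t within closed_segment a b)"
      using assms(1)[OF that] unfolding has_vector_derivative_def by (rule has_derivative_at_withinI)
    moreover have "((%t. t *\<^sub>R c) has_derivative (%h. h *\<^sub>R c)) (at t within closed_segment a b)"
      by (intro has_derivative_scaleR_left has_derivative_ident)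
    ultimately show ?thesis
      using has_derivative_diff by (fastforce simp: scaleR_diff_right)
  qed
  moreover have "onorm (%h. h *\<^sub>R (f' t - c)) <= B" if "t \<in> closed_segment a b" for t
    using assms(2)[OF that] by (intro onorm_le) (auto simp: mult.commute[of B] mult_left_mono)
  ultimately have "norm ((f b - b *\<^sub>R c) - (f a - a *\<^sub>R c)) <= B * norm (b - a)"
    by (intro differentiable_bound[of "closed_segment a b"]) auto
  then show ?thesis by (simp add: algebra_simps)
qed

section \<open>Functions of class \<open>C\<^sup>k\<close> on open subsets of \<open>\<real>\<^sup>d\<close>\<close>

primrec Ck ::
  "nat => nat => vec set => (vec => 'b::real_normed_vector) => bool" where
  "Ck 0 d U f \<longleftrightarrow> continuous_on U f"
| "Ck (Suc k) d U f \<longleftrightarrow> continuous_on U f &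
     (ALL i<d. (ALL x:U. has_dird f (unitv i) x (dird (unitv i) f x)) & Ck k d U (dird (unitv i) f))"

definition Cinf ::
  "nat => vec set => (vec => 'b::real_normed_vector) => bool" where
  "Cinf d U f \<longleftrightarrow> open_Rn d U & (ALL k. Ck k d U f)"

lemma Ck_continuous: "Ck k d U f ==> continuous_on U f"
  by (cases k) auto

lemma Ck_cong:
  assumes "open_Rn d U" "!!x. x \<in> U ==> f x = g x"
  shows "Ck k d U f \<longleftrightarrow> Ck k d U g"
  using assms(2)
proof (induction k arbitrary: f g)
  case 0
  then show ?case by (auto intro: continuous_on_cong)
next
  case (Suc k)
  have "has_dird f (unitv i) x w \<longleftrightarrow> has_dird g (unitv i) x w"
    "dird (unitv i) f x = dird (unitv i) g x" if "i < d" "x \<in> U" for i x w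
    using has_dird_cong[OF assms(1) that(2) unitv_in_Rn[OF that(1)] Suc.prems]
      dird_cong[OF assms(1) that(2) unitv_in_Rn[OF that(1)] Suc.prems] by simp_all
  then have "(ALL x:U. has_dird f (unitv i) x (dird (unitv i) f x)) \<longleftrightarrow>
      (ALL x:U. has_dird g (unitv i) x (dird (unitv i) g x))"
    "Ck k d U (dird (unitv i) f) \<longleftrightarrow> Ck k d U (dird (unitv i) g)" if "i < d" for i
    using that Suc.IH[of "dird (unitv i) f" "dird (unitv i) g"] by auto
  moreover have "continuous_on U f \<longleftrightarrow> continuous_on U g"
    using Suc.prems by (auto intro: continuous_on_cong)
  ultimately show ?case by auto
qed

lemma Ck_SucI:
  assumes "open_Rn d U" "continuous_on U f"
    and "!!i. i < d ==> EX g. Ck k d U g & (ALL x:U. has_dird f (unitv i) x (g x))"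
  shows "Ck (Suc k) d U f"
proof -
  have "(ALL x:U. has_dird f (unitv i) x (dird (unitv i) f x)) & Ck k d U (dird (unitv i) f)"
    if i: "i < d" for i
  proof -
    obtain g where g: "Ck k d U g" "ALL x:U. has_dird f (unitv i) x (g x)" using assms(3)[OF i] by blast
    then have eq: "dird (unitv i) f x = g x" if "x \<in> U" for x using that has_dird_dird by blast
    then show ?thesis using g Ck_cong[OF assms(1), of "dird (unitv i) f" g] by auto
  qed
  then show ?thesis using assms(2) by auto
qed

lemma Ck_Suc_imp: "Ck (Suc k) d U f ==> Ck k d U f"
  by (induction k arbitrary: f) (auto)

lemma Ck_subset:
  assumes "open_Rn d V" "V \<subseteq> U"
  shows "Ck k d U f ==> Ck k d V f"
  using assms(2)
  by (induction k arbitrary: f) (auto intro: continuous_on_subset)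

lemma Ck_local:
  assumes "open_Rn d U"
    and "!!x. x \<in> U ==> EX V. open_Rn d V & x \<in> V & Ck k d V f"
  shows "Ck k d U f"
  using assms(2)
proof (induction k arbitrary: f)
  have cont: "continuous_on U f"
    if *: "!!x. x \<in> U ==> EX V. open_Rn d V & x \<in> V & continuous_on V f"
    for f :: "vec => 'b::real_normed_vector"
    unfolding continuous_on_def
  proof
    fix x assume x: "x \<in> U"
    then obtain V where V: "open_Rn d V" "x \<in> V" "continuous_on V f" using * by blast
    then have "openin (top_of_set (Rn d)) V" by (simp add: top_of_set_Rn)
    then obtain T where T: "open T" "V = Rn d Int T"
      unfolding openin_open by auto
    have "U \<subseteq> Rn d" using assms(1) openin_subset by blast
    then have "at x within U = at x within (U Int V)"
      using T V by (intro at_within_nhd[of _ T]) auto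
    moreover have "(f \<longlongrightarrow> f x) (at x within (U Int V))"
      using V unfolding continuous_on_def by (meson inf_le2 tendsto_within_subset)
    ultimately show "(f \<longlongrightarrow> f x) (at x within U)" by simp
  qed
  {
    case 0
    then show ?case using cont[of f] by auto
  next
    case (Suc k)
    have "continuous_on U f"
    proof (rule cont)
      fix x assume "x \<in> U"
      then obtain V where "open_Rn d V" "x \<in> V" "Ck (Suc k) d V f"
        using Suc.prems by blast
      then show "EX V. open_Rn d V & x \<in> V & continuous_on V f"
        by auto
    qed
    moreover have "has_dird f (unitv i) x (dird (unitv i) f x)" if "i < d" "x \<in> U" for i x
      using Suc.prems[OF that(2)] that by auto
    moreover have "Ck k d U (dird (unitv i) f)" if "i < d" for i
      using Suc.prems that by (intro Suc.IH) fastforce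
    ultimately show ?case by auto
  }
qed

lemma Ck_const: "open_Rn d U ==> Ck k d U (%_. c)"
proof (induction k arbitrary: c)
  case (Suc k)
  then show ?case
    by (intro Ck_SucI) (auto simp: has_dird_def intro!: exI[of _ "%_. 0"])
qed auto

lemma Ck_coord: "open_Rn d U ==> Ck k d U (%x. x j)"
proof (cases k)
  case 0
  then show ?thesis by (auto intro: continuous_on_product_coordinates continuous_on_subset)
next
  case (Suc k')
  assume U: "open_Rn d U"
  have "has_dird (%x. x j) (unitv i) x (unitv i j)" for i x
    unfolding has_dird_def by (auto intro!: derivative_eq_intros simp: has_real_derivative_iff_has_vector_derivative[symmetric])
  then show ?thesis unfolding Suc using U
    by (intro Ck_SucI) (auto intro: continuous_on_product_coordinates continuous_on_subset Ck_const)
qed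

lemma Ck_add:
  "open_Rn d U ==> Ck k d U f ==> Ck k d U g ==> Ck k d U (%x. f x + g x)"
proof (induction k arbitrary: f g)
  case 0
  then show ?case by (auto intro: continuous_intros)
next
  case (Suc k)
  show ?case
  proof (rule Ck_SucI[OF Suc.prems(1)])
    show "continuous_on U (%x. f x + g x)" using Suc.prems by (auto intro: continuous_intros)
    fix i assume "i < d"
    then show "EX h. Ck k d U h & (ALL x:U. has_dird (%x. f x + g x) (unitv i) x (h x))"
      using Suc by (intro exI[of _ "%x. dird (unitv i) f x + dird (unitv i) g x"])
        (auto simp: has_dird_def intro!: derivative_intros)
  qed
qed

lemma (in bounded_bilinear) Ck_prod:
  "open_Rn d U ==> Ck k d U f ==> Ck k d U g ==> Ck k d U (%x. prod (f x) (g x))"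
proof (induction k arbitrary: f g)
  case 0
  then show ?case by (auto intro: continuous_on)
next
  case (Suc k)
  show ?case
  proof (rule Ck_SucI[OF Suc.prems(1)])
    show "continuous_on U (%x. prod (f x) (g x))" using Suc.prems by (auto intro: continuous_on)
    fix i assume i: "i < d"
    have fg: "Ck k d U f" "Ck k d U g" using Suc.prems Ck_Suc_imp by blast+
    have "has_dird (%x. prod (f x) (g x)) (unitv i) x
        (prod (f x) (dird (unitv i) g x) + prod (dird (unitv i) f x) (g x))" if "x \<in> U" for x
    proof -
      have "((%t. f (%j. x j + t * unitv i j)) has_vector_derivative dird (unitv i) f x) (at 0)"
        "((%t. g (%j. x j + t * unitv i j)) has_vector_derivative dird (unitv i) g x) (at 0)"
        using Suc.prems that i by (auto simp: has_dird_def)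
      from has_vector_derivative[OF this] show ?thesis by (simp add: has_dird_def)
    qed
    moreover have "Ck k d U (%x. prod (f x) (dird (unitv i) g x) + prod (dird (unitv i) f x) (g x))"
      using Suc fg i by (intro Ck_add Suc.IH) auto
    ultimately show "EX h. Ck k d U h & (ALL x:U. has_dird (%x. prod (f x) (g x)) (unitv i) x (h x))"
      by blast
  qed
qed

lemma (in bounded_linear) Ck_linear:
  "open_Rn d U ==> Ck k d U g ==> Ck k d U (%x. f (g x))"
proof (induction k arbitrary: g)
  case 0
  then show ?case by (auto intro: continuous_on)
next
  case (Suc k)
  show ?case
  proof (rule Ck_SucI[OF Suc.prems(1)])
    show "continuous_on U (%x. f (g x))" using Suc.prems by (auto intro: continuous_on)
    fix i assume i: "i < d"
    then show "EX h. Ck k d U h & (ALL x:U. has_dird (%x. f (g x)) (unitv i) x (h x))"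
      using Suc by (intro exI[of _ "%x. f (dird (unitv i) g x)"]) (auto simp: has_dird_def intro!: has_vector_derivative)
  qed
qed

lemma Ck_sum:
  assumes "open_Rn d U" "!!i. i \<in> I ==> Ck k d U (f i)"
  shows "Ck k d U (%x. \<Sum>i\<in>I. f i x)"
  using assms(2) by (induction I rule: infinite_finite_induct) (auto intro: Ck_const Ck_add assms(1))

text \<open>Estimating \<open>f\<close> along one coordinate after the other.\<close>

lemma C1_linear_approximation:
  assumes "open_Rn d U" "Ck 1 d U f" "x \<in> U" "e > 0"
  obtains r where "r > 0"
    "!!y. y \<in> Rn d ==> (!!i. i < d ==> \<bar>y i - x i\<bar> < r) ==>
      norm (f y - f x - (\<Sum>i<d. (y i - x i) *\<^sub>R dird (unitv i) f x)) <= e * (\<Sum>i<d. \<bar>y i - x i\<bar>)"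
proof -
  have der: "has_dird f (unitv i) z (dird (unitv i) f z)" "continuous_on U (dird (unitv i) f)"
    if "i < d" "z \<in> U" for i z using assms(2) that by auto
  have "EX r>0. ALL y:Rn d. (ALL j<d. \<bar>y j - x j\<bar> < r) --> y \<in> U & dist (dird (unitv i) f y) (dird (unitv i) f x) < e"
    if "i < d" for i
    using continuous_on_box[OF assms(1) der(2)[OF that assms(3)] assms(3,4)] by metis
  then obtain r0 where r0: "!!i. i < d ==> r0 i > 0" "!!i y. i < d ==> y \<in> Rn d ==> (ALL j<d. \<bar>y j - x j\<bar> < r0 i) ==>
      y \<in> U & dist (dird (unitv i) f y) (dird (unitv i) f x) < e" by metis
  define r where "r = Min (insert 1 (r0 ` {..<d}))"
  have r: "r > 0" "!!i. i < d ==> r <= r0 i" unfolding r_def using r0 by auto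
  have xR: "x \<in> Rn d" using assms openin_subset by blast
  show ?thesis
  proof
    show "r > 0" by fact
    fix y assume y: "y \<in> Rn d" "!!i. i < d ==> \<bar>y i - x i\<bar> < r"
    define z where "z k = (%i. if i < k then y i else x i)" for k
    have main: "norm (f (z k) - f x - (\<Sum>i<k. (y i - x i) *\<^sub>R dird (unitv i) f x)) <= e * (\<Sum>i<k. \<bar>y i - x i\<bar>)"
      if "k <= d" for k using that
    proof (induction k)
      case 0
      then show ?case by (simp add: z_def)
    next
      case (Suc k)
      then have k: "k < d" by simp
      define F where "F s = f (%i. z k i + s * unitv k i)" for s
      have "norm (F (y k - x k) - F 0 - ((y k - x k) - 0) *\<^sub>R dird (unitv k) f x) <= e * \<bar>(y k - x k) - 0\<bar>"
      proof (rule vector_mvt_bound[where f' = "%s. dird (unitv k) f (%i. z k i + s * unitv k i)"])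
        fix s assume s: "s \<in> closed_segment 0 (y k - x k)"
        then have "\<bar>s\<bar> <= \<bar>y k - x k\<bar>" by (auto simp: closed_segment_eq_real_ivl split: if_splits)
        then have "\<bar>z k j + s * unitv k j - x j\<bar> < r" if "j < d" for j
          using y(2)[OF that] r k by (auto simp: z_def unitv_def)
        moreover have "(%i. z k i + s * unitv k i) \<in> Rn d"
          using y xR k by (auto simp: Rn_iff z_def unitv_def)
        ultimately have *: "(%i. z k i + s * unitv k i) \<in> U"
          "dist (dird (unitv k) f (%i. z k i + s * unitv k i)) (dird (unitv k) f x) < e"
          using r0(2)[OF k, of "%i. z k i + s * unitv k i"] r(2)[OF k] by (meson order_less_le_trans)+
        show "(F has_vector_derivative dird (unitv k) f (%i. z k i + s * unitv k i)) (at s)"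
          unfolding F_def by (rule has_dird_line) (rule der(1)[OF k *(1)])
        show "norm (dird (unitv k) f (%i. z k i + s * unitv k i) - dird (unitv k) f x) <= e"
          using *(2) by (simp add: dist_norm)
      qed
      moreover have "F 0 = f (z k)" by (simp add: F_def)
      moreover have "(%i. z k i + (y k - x k) * unitv k i) = z (Suc k)"
        by (auto simp: z_def unitv_def fun_eq_iff less_Suc_eq)
      then have "F (y k - x k) = f (z (Suc k))" by (simp add: F_def)
      ultimately have "norm (f (z (Suc k)) - f (z k) - (y k - x k) *\<^sub>R dird (unitv k) f x) <= e * \<bar>y k - x k\<bar>"
        by simp
      then have bound: "norm ((f (z (Suc k)) - f (z k) - (y k - x k) *\<^sub>R dird (unitv k) f x) +
         (f (z k) - f x - (\<Sum>i<k. (y i - x i) *\<^sub>R dird (unitv i) f x)))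
         <= e * \<bar>y k - x k\<bar> + e * (\<Sum>i<k. \<bar>y i - x i\<bar>)"
        by (rule norm_triangle_mono) (use Suc in simp)
      have eq: "f (z (Suc k)) - f x - (\<Sum>i<Suc k. (y i - x i) *\<^sub>R dird (unitv i) f x) =
         (f (z (Suc k)) - f (z k) - (y k - x k) *\<^sub>R dird (unitv k) f x) +
         (f (z k) - f x - (\<Sum>i<k. (y i - x i) *\<^sub>R dird (unitv i) f x))" by simp
      show ?case unfolding eq using bound by (simp add: distrib_left add.commute)
    qed
    have "z d = y" using y xR by (auto simp: z_def fun_eq_iff Rn_iff)
    then show "norm (f y - f x - (\<Sum>i<d. (y i - x i) *\<^sub>R dird (unitv i) f x)) <= e * (\<Sum>i<d. \<bar>y i - x i\<bar>)"
      using main[of d] by simp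
  qed
qed

lemma has_vector_derivative_at_0_iff:
  fixes f :: "real => 'b::real_normed_vector"
  shows "(f has_vector_derivative w) (at 0) \<longleftrightarrow> ((%t. (1 / t) *\<^sub>R (f t - f 0)) \<longlongrightarrow> w) (at 0)"
proof -
  have "(f has_vector_derivative w) (at 0) \<longleftrightarrow> ((%y. norm (f y - f 0 - y *\<^sub>R w) / norm y) \<longlongrightarrow> 0) (at 0)"
    by (auto simp: has_vector_derivative_def has_derivative_iff_norm bounded_linear_scaleR_left)
  also have "... \<longleftrightarrow> ((%y. norm ((1 / y) *\<^sub>R (f y - f 0) - w)) \<longlongrightarrow> 0) (at 0)"
  proof (rule filterlim_cong[OF refl refl])
    show "\<forall>\<^sub>F y in at 0. norm (f y - f 0 - y *\<^sub>R w) / norm y = norm ((1 / y) *\<^sub>R (f y - f 0) - w)"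
    proof (rule eventually_at_topological[THEN iffD2], intro exI[of _ UNIV] conjI ballI impI)
      fix y :: real assume "y ~= 0"
      then have "(1 / y) *\<^sub>R (f y - f 0) - w = (1 / y) *\<^sub>R (f y - f 0 - y *\<^sub>R w)"
        by (simp add: scaleR_diff_right)
      then show "norm (f y - f 0 - y *\<^sub>R w) / norm y = norm ((1 / y) *\<^sub>R (f y - f 0) - w)"
        by (simp add: divide_inverse)
    qed auto
  qed
  also have "... \<longleftrightarrow> ((%t. (1 / t) *\<^sub>R (f t - f 0)) \<longlongrightarrow> w) (at 0)"
    by (simp add: tendsto_norm_zero_iff LIM_zero_iff)
  finally show ?thesis .
qed

lemma C1_chain:
  assumes U: "open_Rn d U" and f: "Ck 1 d U f"
    and g0: "\<gamma> (0::real) \<in> U" and gR: "\<forall>\<^sub>F t in nhds 0. \<gamma> t \<in> Rn d"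
    and gd: "!!i. i < d ==> ((%t. \<gamma> t i) has_real_derivative c i) (at 0)"
  shows "((%t. f (\<gamma> t)) has_vector_derivative (\<Sum>i<d. c i *\<^sub>R dird (unitv i) f (\<gamma> 0))) (at 0)"
  unfolding has_vector_derivative_at_0_iff
proof -
  let ?D = "%i. dird (unitv i) f (\<gamma> 0)"
  define q where "q t i = (\<gamma> t i - \<gamma> 0 i) / t" for t i
  have q: "((%t. q t i) \<longlongrightarrow> c i) (at 0)" if "i < d" for i
    using gd[OF that] by (simp add: has_field_derivative_iff q_def)
  have lin: "((%t. \<Sum>i<d. q t i *\<^sub>R ?D i) \<longlongrightarrow> (\<Sum>i<d. c i *\<^sub>R ?D i)) (at 0)"
    by (intro tendsto_sum tendsto_scaleR q tendsto_const) auto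
  define M where "M = (\<Sum>i<d. \<bar>c i\<bar>) + 1"
  have M: "M > 0" unfolding M_def by (smt (verit) sum_nonneg)
  have qM: "\<forall>\<^sub>F t in at 0. (\<Sum>i<d. \<bar>q t i\<bar>) < M"
  proof -
    have "((%t. \<Sum>i<d. \<bar>q t i\<bar>) \<longlongrightarrow> (\<Sum>i<d. \<bar>c i\<bar>)) (at 0)"
      by (intro tendsto_sum tendsto_rabs q) auto
    then show ?thesis by (rule order_tendstoD) (simp add: M_def)
  qed
  have main: "((%t. (1 / t) *\<^sub>R (f (\<gamma> t) - f (\<gamma> 0)) - (\<Sum>i<d. q t i *\<^sub>R ?D i)) \<longlongrightarrow> 0) (at 0)"
  proof (rule tendstoI)
    fix e :: real assume e: "e > 0"
    obtain r where r: "r > 0"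
      "!!y. y \<in> Rn d ==> (!!i. i < d ==> \<bar>y i - \<gamma> 0 i\<bar> < r) ==>
        norm (f y - f (\<gamma> 0) - (\<Sum>i<d. (y i - \<gamma> 0 i) *\<^sub>R ?D i)) <= (e / M) * (\<Sum>i<d. \<bar>y i - \<gamma> 0 i\<bar>)"
      using C1_linear_approximation[OF U f g0 divide_pos_pos[OF e M]] by blast
    have "\<forall>\<^sub>F t in nhds 0. \<gamma> t \<in> {y:Rn d. ALL i<d. \<bar>y i - \<gamma> 0 i\<bar> < r}"
      using gd gR r(1) eventually_nhds_x_imp_x[OF gR]
      by (intro curve_eventually_in[OF open_box]) (auto intro: DERIV_isCont)
    then have ev: "\<forall>\<^sub>F t in at 0. \<gamma> t \<in> {y:Rn d. ALL i<d. \<bar>y i - \<gamma> 0 i\<bar> < r}"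
      by (simp add: eventually_at_filter eventually_mono)
    have "\<forall>\<^sub>F t in at (0::real). t ~= 0" by (simp add: eventually_at_filter)
    with ev qM show "\<forall>\<^sub>F t in at 0. dist ((1 / t) *\<^sub>R (f (\<gamma> t) - f (\<gamma> 0)) - (\<Sum>i<d. q t i *\<^sub>R ?D i)) 0 < e"
    proof eventually_elim
      case (elim t)
      have "(1 / t) *\<^sub>R (f (\<gamma> t) - f (\<gamma> 0)) - (\<Sum>i<d. q t i *\<^sub>R ?D i) =
        (1 / t) *\<^sub>R (f (\<gamma> t) - f (\<gamma> 0) - (\<Sum>i<d. (\<gamma> t i - \<gamma> 0 i) *\<^sub>R ?D i))"
        by (simp add: scaleR_diff_right scaleR_right.sum q_def)
      then have "norm ((1 / t) *\<^sub>R (f (\<gamma> t) - f (\<gamma> 0)) - (\<Sum>i<d. q t i *\<^sub>R ?D i)) =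
        norm (f (\<gamma> t) - f (\<gamma> 0) - (\<Sum>i<d. (\<gamma> t i - \<gamma> 0 i) *\<^sub>R ?D i)) / \<bar>t\<bar>" by simp
      also have "... <= ((e / M) * (\<Sum>i<d. \<bar>\<gamma> t i - \<gamma> 0 i\<bar>)) / \<bar>t\<bar>"
        using elim r(2)[of "\<gamma> t"] by (intro divide_right_mono) auto
      also have "... = (e / M) * (\<Sum>i<d. \<bar>q t i\<bar>)"
        by (simp add: q_def sum_divide_distrib[symmetric])
      also have "... < (e / M) * M" using elim e M by (intro mult_strict_left_mono) auto
      finally show ?case using M by simp
    qed
  qed
  from tendsto_add[OF this lin] show "((%t. (1 / t) *\<^sub>R (f (\<gamma> t) - f (\<gamma> 0))) \<longlongrightarrow> (\<Sum>i<d. c i *\<^sub>R ?D i)) (at 0)"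
    by simp
qed

lemma Ck_le: "k <= l ==> Ck l d U f ==> Ck k d U f"
  by (induction l rule: dec_induct) (blast dest: Ck_Suc_imp)+

text \<open>By the chain rule the partial derivatives of \<open>f \<circ> g\<close> are sums of products
  of functions to which the induction hypothesis applies.\<close>

lemma Ck_compose:
  assumes U: "open_Rn d U" and V: "open_Rn m V"
    and gV: "!!x. x \<in> U ==> g x \<in> V"
  shows "(!!j. j < m ==> Ck k d U (%x. g x j)) ==> Ck k m V f ==> Ck k d U (%x. f (g x))"
proof (induction k arbitrary: f)
  have cont: "continuous_on U (%x. f (g x))"
    if "!!j. j < m ==> continuous_on U (%x. g x j)" "continuous_on V f" for f :: "vec => 'b::real_normed_vector"
  proof -
    have "continuous_on U (%x. g x j)" for j
    proof (cases "j < m")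
      case False
      then have "g x j = 0" if "x \<in> U" for x
        using gV[OF that] openin_subset[OF V] by (auto simp: Rn_iff subset_iff)
      then show ?thesis by (simp cong: continuous_on_cong)
    qed (rule that(1))
    then have "continuous_on U g" by (rule continuous_on_coordinatewise_then_product)
    then show ?thesis
      using that(2) gV by (intro continuous_on_compose2[OF that(2)]) auto
  qed
  {
    case 0
    then show ?case using cont by simp
  next
    case (Suc k)
    have gk: "Ck k d U (%x. g x j)" if "j < m" for j using Suc.prems(1)[OF that] Ck_Suc_imp by blast
    show ?case
    proof (rule Ck_SucI[OF U])
      show "continuous_on U (%x. f (g x))" 
        by (rule cont) (use Suc.prems Ck_continuous in blast)+
      fix i assume i: "i < d"
      let ?h = "%x. \<Sum>j<m. dird (unitv i) (%x. g x j) x *\<^sub>R dird (unitv j) f (g x)"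
      have "Ck k d U ?h"
      proof (intro Ck_sum U)
        fix j assume j: "j \<in> {..<m}"
        have "Ck k d U (%x. dird (unitv j) f (g x))"
          using Suc.prems j gk by (intro Suc.IH) auto
        then show "Ck k d U (%x. dird (unitv i) (%x. g x j) x *\<^sub>R dird (unitv j) f (g x))"
          using Suc.prems(1)[of j] j i
          by (intro bounded_bilinear.Ck_prod[OF bounded_bilinear_scaleR] U) auto
      qed
      moreover have "has_dird (%x. f (g x)) (unitv i) x (?h x)" if x: "x \<in> U" for x
        unfolding has_dird_def
      proof (rule has_vector_derivative_eq_rhs)
        define \<gamma> where "\<gamma> t = g (%l. x l + t * unitv i l)" for t
        have g0: "\<gamma> 0 = g x" by (simp add: \<gamma>_def)
        have "\<forall>\<^sub>F t in nhds 0. (%l. x l + t * unitv i l) \<in> U"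
          by (rule line_eventually_in[OF U x unitv_in_Rn[OF i]])
        then have "\<forall>\<^sub>F t in nhds 0. \<gamma> t \<in> Rn m"
          by eventually_elim (use gV openin_subset[OF V] in "auto simp: \<gamma>_def")
        moreover have "((%t. \<gamma> t j) has_real_derivative dird (unitv i) (%x. g x j) x) (at 0)" if "j < m" for j
          using Suc.prems(1)[OF that] i x
          by (auto simp: has_dird_def \<gamma>_def has_real_derivative_iff_has_vector_derivative)
        moreover have "Ck 1 m V f" using Ck_le[OF _ Suc.prems(2), of 1] by simp
        ultimately show "((%t. f (g (%l. x l + t * unitv i l))) has_vector_derivative
            (\<Sum>j<m. dird (unitv i) (%x. g x j) x *\<^sub>R dird (unitv j) f (\<gamma> 0))) (at 0)"
          using C1_chain[OF V, of f \<gamma>] gV[OF x] unfolding g0 by (simp add: \<gamma>_def)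
        show "(\<Sum>j<m. dird (unitv i) (%x. g x j) x *\<^sub>R dird (unitv j) f (\<gamma> 0)) = ?h x"
          by (simp add: g0)
      qed
      ultimately show "EX h. Ck k d U h & (ALL x:U. has_dird (%x. f (g x)) (unitv i) x (h x))" by blast
    qed
  }
qed

section \<open>Smooth functions on open subsets of \<open>\<real>\<^sup>d\<close>\<close>

lemma Cinf_open: "Cinf d U f ==> open_Rn d U"
  by (simp add: Cinf_def)

lemma Cinf_continuous: "Cinf d U f ==> continuous_on U f"
  unfolding Cinf_def using Ck_continuous by blast

lemma Cinf_cong:
  assumes "!!x. x \<in> U ==> f x = g x"
  shows "Cinf d U f \<longleftrightarrow> Cinf d U g"
  unfolding Cinf_def using Ck_cong[of d U f g, OF _ assms] by blast

lemma Cinf_subset: "Cinf d U f ==> open_Rn d V ==> V \<subseteq> U ==> Cinf d V f"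
  unfolding Cinf_def using Ck_subset by blast

lemma Cinf_local:
  assumes "!!x. x \<in> U ==> EX V. x \<in> V & V \<subseteq> U & Cinf d V f"
  shows "Cinf d U f"
proof -
  have U: "open_Rn d U"
    using assms by (subst openin_subopen) (meson Cinf_open)
  moreover have "Ck k d U f" for k
    by (rule Ck_local[OF U]) (meson assms Cinf_def)
  ultimately show ?thesis by (simp add: Cinf_def)
qed

lemma Cinf_const: "open_Rn d U ==> Cinf d U (%_. c)"
  by (simp add: Cinf_def Ck_const)

lemma Cinf_coord: "open_Rn d U ==> Cinf d U (%x. x j)"
  by (simp add: Cinf_def Ck_coord)

lemma Cinf_add: "Cinf d U f ==> Cinf d U g ==> Cinf d U (%x. f x + g x)"
  by (simp add: Cinf_def Ck_add)

lemma (in bounded_bilinear) Cinf_prod: "Cinf d U f ==> Cinf d U g ==> Cinf d U (%x. prod (f x) (g x))"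
  by (simp add: Cinf_def Ck_prod)

lemma (in bounded_linear) Cinf_linear: "Cinf d U g ==> Cinf d U (%x. f (g x))"
  by (simp add: Cinf_def Ck_linear)

lemmas Cinf_mult = bounded_bilinear.Cinf_prod[OF bounded_bilinear_mult]
lemmas Cinf_scaleR = bounded_bilinear.Cinf_prod[OF bounded_bilinear_scaleR]
lemmas Cinf_minus = bounded_linear.Cinf_linear[OF bounded_linear_minus[OF bounded_linear_ident]]

lemma Cinf_diff: "Cinf d U f ==> Cinf d U g ==> Cinf d U (%x. f x - g x)"
  using Cinf_add[of d U f "%x. - g x"] Cinf_minus[of d U g] by simp

lemma Cinf_sum:
  assumes "open_Rn d U" "!!i. i \<in> I ==> Cinf d U (f i)"
  shows "Cinf d U (%x. \<Sum>i\<in>I. f i x)"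
  using assms by (auto simp: Cinf_def Ck_sum)

lemma Cinf_compose:
  assumes "open_Rn d U" "Cinf m V f" "!!x. x \<in> U ==> g x \<in> V"
    and "!!j. j < m ==> Cinf d U (%x. g x j)"
  shows "Cinf d U (%x. f (g x))"
  using assms by (auto simp: Cinf_def intro: Ck_compose)

text \<open>Coinduction: a family of continuous functions whose partial derivatives are built, by
  operations preserving \<open>C\<^sup>k\<close>, from members of the family consists of smooth functions.\<close>

lemma Cinf_coinduct:
  assumes U: "open_Rn d U" and "f \<in> S"
    and cont: "!!f. f \<in> S ==> continuous_on U f"
    and deriv: "!!f i. f \<in> S ==> i < d ==>
      EX g. (ALL x:U. has_dird f (unitv i) x (g x)) & (ALL k. (ALL h:S. Ck k d U h) --> Ck k d U g)"
  shows "Cinf d U f"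
proof -
  have "ALL h:S. Ck k d U h" for k
  proof (induction k)
    case (Suc k)
    show ?case
    proof (intro ballI Ck_SucI[OF U cont])
      fix h i assume "h \<in> S" "i < d"
      then show "EX g. Ck k d U g & (ALL x:U. has_dird h (unitv i) x (g x))"
        using deriv[of h i] Suc by blast
    qed
  qed (simp add: cont)
  then show ?thesis using assms by (simp add: Cinf_def)
qed

lemma Cinf_1: "Cinf d U f ==> Ck 1 d U f"
  by (simp add: Cinf_def del: Ck.simps)

lemma Cinf_has_dird_sum:
  assumes "Cinf d U f" "x \<in> U" "v \<in> Rn d"
  shows "has_dird f v x (\<Sum>i<d. v i *\<^sub>R dird (unitv i) f x)"
proof -
  have x: "x \<in> Rn d" using assms Cinf_open openin_subset by blast
  have "((%t. f (%i. x i + t * v i)) has_vector_derivative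
     (\<Sum>i<d. v i *\<^sub>R dird (unitv i) f (%i. x i + 0 * v i))) (at 0)"
  proof (rule C1_chain[OF Cinf_open[OF assms(1)] Cinf_1[OF assms(1)]])
    show "(%i. x i + 0 * v i) \<in> U" using assms(2) by simp
    show "\<forall>\<^sub>F t in nhds 0. (%i. x i + t * v i) \<in> Rn d"
      using Rn_add_scale[OF x assms(3)] by (intro always_eventually allI)
    show "((%t. x i + t * v i) has_real_derivative v i) (at 0)" for i
      by (auto intro!: derivative_eq_intros)
  qed
  then show ?thesis by (simp add: has_dird_def)
qed

lemma dird_sum:
  assumes "Cinf d U f" "x \<in> U" "v \<in> Rn d"
  shows "dird v f x = (\<Sum>i<d. v i *\<^sub>R dird (unitv i) f x)"
  using has_dird_dird[OF Cinf_has_dird_sum[OF assms]] .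

lemma Cinf_has_dird:
  assumes "Cinf d U f" "x \<in> U" "v \<in> Rn d"
  shows "has_dird f v x (dird v f x)"
  using Cinf_has_dird_sum[OF assms] dird_sum[OF assms] by simp

lemma Cinf_dird:
  assumes "Cinf d U f" "v \<in> Rn d"
  shows "Cinf d U (dird v f)"
proof -
  have "Cinf d U (dird (unitv i) f)" if "i < d" for i
    unfolding Cinf_def
  proof (intro conjI allI)
    fix k
    have "Ck (Suc k) d U f" using assms by (simp add: Cinf_def del: Ck.simps)
    then show "Ck k d U (dird (unitv i) f)" using that by simp
  qed (use assms Cinf_open in blast)
  then have "Cinf d U (%x. \<Sum>i<d. v i *\<^sub>R dird (unitv i) f x)"
    using Cinf_open[OF assms(1)] by (intro Cinf_sum Cinf_scaleR Cinf_const) auto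
  then show ?thesis
    using Cinf_cong[of U "dird v f", OF dird_sum[OF assms(1) _ assms(2)]] by simp
qed

lemma Cinf_of_dird:
  assumes "open_Rn d U" "continuous_on U f"
    and "!!i. i < d ==> EX g. Cinf d U g & (ALL x:U. has_dird f (unitv i) x (g x))"
  shows "Cinf d U f"
proof (rule Cinf_coinduct[of d U f "{f}"])
  fix g i assume "g \<in> {f}" "i < d"
  then show "EX h. (ALL x:U. has_dird g (unitv i) x (h x)) & (ALL k. (ALL h:{f}. Ck k d U h) --> Ck k d U h)"
    using assms(3)[of i] unfolding Cinf_def by blast
qed (use assms in auto)

lemma has_dird_compose:
  assumes U: "open_Rn d U" and f: "Cinf m V f" and gV: "!!x. x \<in> U ==> g x \<in> V"
    and g: "!!j. j < m ==> Cinf d U (%x. g x j)" and x: "x \<in> U" and v: "v \<in> Rn d"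
  shows "has_dird (%x. f (g x)) v x (\<Sum>j<m. dird v (%x. g x j) x *\<^sub>R dird (unitv j) f (g x))"
proof -
  define \<gamma> where "\<gamma> t = g (%l. x l + t * v l)" for t
  have g0: "\<gamma> 0 = g x" by (simp add: \<gamma>_def)
  have "\<forall>\<^sub>F t in nhds 0. (%l. x l + t * v l) \<in> U"
    by (rule line_eventually_in[OF U x v])
  then have "\<forall>\<^sub>F t in nhds 0. \<gamma> t \<in> Rn m"
    by eventually_elim (use gV openin_subset[OF Cinf_open[OF f]] in "auto simp: \<gamma>_def")
  moreover have "((%t. \<gamma> t j) has_real_derivative dird v (%x. g x j) x) (at 0)" if "j < m" for j
    using Cinf_has_dird[OF g[OF that] x v]
    by (auto simp: has_dird_def \<gamma>_def has_real_derivative_iff_has_vector_derivative)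
  ultimately show ?thesis
    using C1_chain[OF Cinf_open[OF f] Cinf_1[OF f], of \<gamma>] gV[OF x] unfolding g0
    by (simp add: \<gamma>_def has_dird_def)
qed

section \<open>Elementary smooth functions\<close>

lemma has_dird_field_chain:
  fixes f :: "vec => 'b::real_normed_field"
  assumes "has_dird f v x w" "(h has_field_derivative D) (at (f x))"
  shows "has_dird (%x. h (f x)) v x (w * D)"
proof -
  have "((h o (%t. f (%i. x i + t * v i))) has_vector_derivative w * D) (at 0)"
    using assms by (intro field_vector_diff_chain_at) (auto simp: has_dird_def)
  then show ?thesis by (simp add: has_dird_def o_def)
qed

lemma Cinf_inverse:
  fixes f :: "vec => 'b::real_normed_field"
  assumes f: "Cinf d U f" and "!!x. x \<in> U ==> f x ~= 0"
  shows "Cinf d U (%x. inverse (f x))"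
proof (rule Cinf_coinduct[of d U _ "{%x. inverse (f x)}"])
  note U = Cinf_open[OF f]
  show "open_Rn d U" by fact
  fix g assume g: "g \<in> {%x. inverse (f x)}"
  then show "continuous_on U g"
    using assms Cinf_continuous[OF f] by (auto intro!: continuous_intros)
  fix i assume i: "i < d"
  let ?h = "%x. dird (unitv i) f x * - (inverse (f x) * inverse (f x))"
  have "has_dird g (unitv i) x (?h x)" if x: "x \<in> U" for x
    using g has_dird_field_chain[OF Cinf_has_dird[OF f x unitv_in_Rn[OF i]] DERIV_inverse[OF assms(2)[OF x]]]
    by (simp add: power2_eq_square)
  moreover have "Ck k d U ?h" if "ALL h:{%x. inverse (f x)}. Ck k d U h" for k
    using that Cinf_dird[OF f unitv_in_Rn[OF i]]
    by (intro bounded_bilinear.Ck_prod[OF bounded_bilinear_mult] U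
        bounded_linear.Ck_linear[OF bounded_linear_minus[OF bounded_linear_ident]]) (auto simp: Cinf_def)
  ultimately show "EX h. (ALL x:U. has_dird g (unitv i) x (h x)) &
     (ALL k. (ALL h:{%x. inverse (f x)}. Ck k d U h) --> Ck k d U h)" by (intro exI[of _ ?h] conjI ballI allI impI)
qed auto

lemma Cinf_exp:
  fixes f :: "vec => 'b::{real_normed_field, banach}"
  assumes f: "Cinf d U f"
  shows "Cinf d U (%x. exp (f x))"
proof (rule Cinf_coinduct[of d U _ "{%x. exp (f x)}"])
  note U = Cinf_open[OF f]
  show "open_Rn d U" by fact
  fix g assume g: "g \<in> {%x. exp (f x)}"
  then show "continuous_on U g"
    using Cinf_continuous[OF f] by (auto intro!: continuous_intros)
  fix i assume i: "i < d"
  let ?h = "%x. dird (unitv i) f x * exp (f x)"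
  have "has_dird g (unitv i) x (?h x)" if x: "x \<in> U" for x
    using g has_dird_field_chain[OF Cinf_has_dird[OF f x unitv_in_Rn[OF i]] DERIV_exp] by simp
  moreover have "Ck k d U ?h" if "ALL h:{%x. exp (f x)}. Ck k d U h" for k
    using that Cinf_dird[OF f unitv_in_Rn[OF i]]
    by (intro bounded_bilinear.Ck_prod[OF bounded_bilinear_mult] U) (auto simp: Cinf_def)
  ultimately show "EX h. (ALL x:U. has_dird g (unitv i) x (h x)) &
     (ALL k. (ALL h:{%x. exp (f x)}. Ck k d U h) --> Ck k d U h)" by (intro exI[of _ ?h] conjI ballI allI impI)
qed auto

text \<open>Covers the branches of the logarithm.\<close>

lemma Cinf_field_antiderivative:
  fixes f :: "vec => 'b::real_normed_field"
  assumes f: "Cinf d U f" and h: "!!x. x \<in> U ==> (h has_field_derivative inverse (f x)) (at (f x))"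
    and nz: "!!x. x \<in> U ==> f x ~= 0"
  shows "Cinf d U (%x. h (f x))"
proof (rule Cinf_of_dird[OF Cinf_open[OF f]])
  have "continuous_on (f ` U) h"
    using h by (intro continuous_at_imp_continuous_on) (auto intro: DERIV_isCont)
  then show "continuous_on U (%x. h (f x))"
    using Cinf_continuous[OF f] by (auto intro: continuous_on_compose2)
  fix i assume i: "i < d"
  have "Cinf d U (%x. dird (unitv i) f x * inverse (f x))"
    using Cinf_dird[OF f unitv_in_Rn[OF i]] Cinf_inverse[OF f nz] by (intro Cinf_mult) auto
  moreover have "has_dird (%x. h (f x)) (unitv i) x (dird (unitv i) f x * inverse (f x))" if x: "x \<in> U" for x
    by (rule has_dird_field_chain[OF Cinf_has_dird[OF f x unitv_in_Rn[OF i]] h[OF x]])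
  ultimately show "EX g. Cinf d U g & (ALL x:U. has_dird (%x. h (f x)) (unitv i) x (g x))" by blast
qed

lemma Cinf_Ln:
  assumes "Cinf d U f" "!!x. x \<in> U ==> f x ~: \<real>\<^sub>\<le>\<^sub>0"
  shows "Cinf d U (%x. Ln (f x))"
proof (rule Cinf_field_antiderivative[OF assms(1)])
  fix x assume "x \<in> U"
  then have nz: "f x ~: \<real>\<^sub>\<le>\<^sub>0" by (rule assms(2))
  then show "f x ~= 0" by force
  show "(Ln has_field_derivative inverse (f x)) (at (f x))" by (rule has_field_derivative_Ln[OF nz])
qed

lemma Cinf_sqrt:
  assumes "Cinf d U f" "!!x. x \<in> U ==> f x > 0"
  shows "Cinf d U (%x. sqrt (f x))"
proof -
  have "Cinf d U (%x. ln (f x))"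
  proof (rule Cinf_field_antiderivative[OF assms(1)])
    fix x assume "x \<in> U"
    then have "f x > 0" by (rule assms(2))
    then show "f x ~= 0" "(ln has_real_derivative inverse (f x)) (at (f x))"
      by (simp, rule DERIV_ln)
  qed
  then have "Cinf d U (%x. exp ((1/2) * ln (f x)))"
    using assms by (intro Cinf_exp Cinf_mult Cinf_const Cinf_open[OF assms(1)])
  moreover have "exp ((1/2) * ln (f x)) = sqrt (f x)" if "x \<in> U" for x
    using assms(2)[OF that] by (simp add: powr_half_sqrt[symmetric] powr_def)
  ultimately show ?thesis by (simp cong: Cinf_cong)
qed

text \<open>The functions \<open>t\<^sup>-\<^sup>n exp(-1/t)\<close>, extended by zero to \<open>t \<le> 0\<close>; the derivative of each is a
  combination of two others.\<close>

definition flat :: "nat => real => real" where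
  "flat n t = (if t <= 0 then 0 else inverse t ^ n * exp (- inverse t))"

lemma flat_tendsto_0: "(flat n \<longlongrightarrow> 0) (at 0)"
proof -
  have "((%s::real. s ^ n / exp s) \<longlongrightarrow> 0) at_top" by (rule tendsto_power_div_exp_0)
  then have "((%t::real. inverse t ^ n / exp (inverse t)) \<longlongrightarrow> 0) (at_right 0)"
    by (rule filterlim_compose) (rule filterlim_inverse_at_top_right)
  moreover have "\<forall>\<^sub>F t in at_right 0. inverse t ^ n / exp (inverse t) = flat n t"
    by (auto simp: eventually_at_right_less flat_def exp_minus divide_inverse intro!: eventually_at_rightI[of 0 1])
  ultimately have "(flat n \<longlongrightarrow> 0) (at_right 0)" by (rule Lim_transform_eventually)
  moreover have "\<forall>\<^sub>F t in at_left 0. 0 = flat n t"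
    by (auto simp: flat_def intro!: eventually_at_leftI[of "-1" 0])
  then have "(flat n \<longlongrightarrow> 0) (at_left 0)" by (rule Lim_transform_eventually[OF tendsto_const])
  ultimately show ?thesis by (simp add: filterlim_split_at_real)
qed

lemma flat_deriv: "(flat n has_real_derivative flat (n + 2) t - n * flat (n + 1) t) (at t)"
proof -
  consider "t < 0" | "t = 0" | "t > 0" by linarith
  then show ?thesis
  proof cases
    case 1
    have "((%_. 0) has_real_derivative 0) (at t)" by simp
    then have "(flat n has_real_derivative 0) (at t)"
      by (rule has_field_derivative_transform_within_open[of _ _ _ "{..<0}"]) (use 1 in "auto simp: flat_def")
    then show ?thesis using 1 by (simp add: flat_def)
  next
    case 2
    have "(%h. (flat n (0 + h) - flat n 0) / h) = flat (Suc n)"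
      by (simp add: fun_eq_iff flat_def divide_inverse mult.commute)
    then have "(flat n has_real_derivative 0) (at 0)"
      using flat_tendsto_0[of "Suc n"] unfolding DERIV_def by (simp only:)
    then show ?thesis using 2 by (simp add: flat_def)
  next
    case 3
    have "((%t. inverse t ^ n * exp (- inverse t)) has_real_derivative
        flat (n + 2) t - n * flat (n + 1) t) (at t)"
    proof (cases n)
      case 0
      then show ?thesis using 3
        by (auto intro!: derivative_eq_intros simp: flat_def power2_eq_square divide_inverse)
    next
      case (Suc m)
      have "(inverse has_real_derivative - (inverse t * inverse t)) (at t)"
        using 3 by (auto intro!: derivative_eq_intros simp: power2_eq_square)
      then have "((%t. inverse t ^ Suc m) has_real_derivative
          (1 + real m) * (- (inverse t * inverse t) * inverse t ^ m)) (at t)"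
        by (rule DERIV_power_Suc)
      moreover have "((%t. exp (- inverse t)) has_real_derivative exp (- inverse t) * (inverse t * inverse t)) (at t)"
        using 3 by (auto intro!: derivative_eq_intros simp: power2_eq_square)
      ultimately have "((%t. inverse t ^ Suc m * exp (- inverse t)) has_real_derivative
          (1 + real m) * (- (inverse t * inverse t) * inverse t ^ m) * exp (- inverse t) +
           exp (- inverse t) * (inverse t * inverse t) * inverse t ^ Suc m) (at t)"
        by (rule DERIV_mult)
      then show ?thesis unfolding Suc
        by (rule DERIV_cong) (use 3 in "simp add: flat_def algebra_simps")
    qed
    then show ?thesis
      by (rule has_field_derivative_transform_within_open[of _ _ _ "{0<..}"]) (use 3 in "auto simp: flat_def")
  qed
qed

lemma Cinf_flat:
  assumes f: "Cinf d U f"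
  shows "Cinf d U (%x. flat n (f x))"
proof (rule Cinf_coinduct[of d U _ "range (%n x. flat n (f x))"])
  note U = Cinf_open[OF f]
  show "open_Rn d U" by fact
  fix g assume "g \<in> range (%n x. flat n (f x))"
  then obtain n where g: "g = (%x. flat n (f x))" by blast
  have "continuous_on UNIV (flat n)"
    by (intro continuous_at_imp_continuous_on) (auto intro: DERIV_isCont flat_deriv)
  then show "continuous_on U g"
    unfolding g using Cinf_continuous[OF f] by (auto intro: continuous_on_compose2)
  fix i assume i: "i < d"
  let ?h = "%x. dird (unitv i) f x * (flat (n + 2) (f x) + (- real n) * flat (n + 1) (f x))"
  have "has_dird g (unitv i) x (?h x)" if x: "x \<in> U" for x
    using has_dird_field_chain[OF Cinf_has_dird[OF f x unitv_in_Rn[OF i]] flat_deriv] by (simp add: g)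
  moreover have "Ck k d U ?h" if *: "ALL h:range (%n x. flat n (f x)). Ck k d U h" for k
  proof (intro bounded_bilinear.Ck_prod[OF bounded_bilinear_mult] Ck_add Ck_const U)
    show "Ck k d U (dird (unitv i) f)" using Cinf_dird[OF f unitv_in_Rn[OF i]] by (simp add: Cinf_def)
  qed (use * in blast)+
  ultimately show "EX h. (ALL x:U. has_dird g (unitv i) x (h x)) &
     (ALL k. (ALL h:range (%n x. flat n (f x)). Ck k d U h) --> Ck k d U h)" by (intro exI[of _ ?h] conjI ballI allI impI)
qed auto

section \<open>Iterated directional derivatives\<close>

primrec iter_dird ::
  "(vec => 'b::real_normed_vector) => vec list => vec => 'b" where
  "iter_dird f [] = f"
| "iter_dird f (v # vs) = dird v (iter_dird f vs)"

lemma Cinf_iter_dird: "Cinf d U f ==> set vs \<subseteq> Rn d ==> Cinf d U (iter_dird f vs)"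
  by (induction vs) (auto intro: Cinf_dird)

lemma iter_dird_snoc: "iter_dird f (vs @ [v]) = iter_dird (dird v f) vs"
  by (induction vs) auto

lemma iter_dird_cong:
  assumes "open_Rn d U" "!!y. y \<in> U ==> f y = g y"
  shows "set vs \<subseteq> Rn d ==> x \<in> U ==> iter_dird f vs x = iter_dird g vs x"
proof (induction vs arbitrary: x)
  case (Cons v vs)
  then show ?case using dird_cong[OF assms(1), of x v "iter_dird f vs" "iter_dird g vs"] by auto
qed (simp add: assms)

lemma (in bounded_linear) iter_dird_linear:
  assumes "Cinf d U g"
  shows "set vs \<subseteq> Rn d ==> x \<in> U ==> iter_dird (%x. f (g x)) vs x = f (iter_dird g vs x)"
proof (induction vs arbitrary: x)
  case (Cons v vs)
  have "dird v (iter_dird (%x. f (g x)) vs) x = dird v (%x. f (iter_dird g vs x)) x"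
    using Cons by (intro dird_cong[OF Cinf_open[OF assms]]) auto
  also have "... = f (dird v (iter_dird g vs) x)"
    using Cinf_has_dird[OF Cinf_iter_dird[OF assms], of vs x v] Cons.prems
    by (intro has_dird_dird) (auto simp: has_dird_def intro: has_vector_derivative)
  finally show ?case by simp
qed simp

lemma iter_dird_add:
  assumes "Cinf d U f" "Cinf d U g"
  shows "set vs \<subseteq> Rn d ==> x \<in> U ==>
    iter_dird (%x. f x + g x) vs x = iter_dird f vs x + iter_dird g vs x"
proof (induction vs arbitrary: x)
  case (Cons v vs)
  have "dird v (iter_dird (%x. f x + g x) vs) x = dird v (%x. iter_dird f vs x + iter_dird g vs x) x"
    using Cons by (intro dird_cong[OF Cinf_open[OF assms(1)]]) auto
  also have "... = dird v (iter_dird f vs) x + dird v (iter_dird g vs) x"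
    using Cinf_has_dird[OF Cinf_iter_dird[OF assms(1)], of vs x v]
      Cinf_has_dird[OF Cinf_iter_dird[OF assms(2)], of vs x v] Cons.prems
    by (intro has_dird_dird) (auto simp: has_dird_def intro!: has_vector_derivative_add)
  finally show ?case by simp
qed simp

lemma iter_dird_scaleR:
  assumes "Cinf d U f" "set vs \<subseteq> Rn d" "x \<in> U"
  shows "iter_dird (%x. c *\<^sub>R f x) vs x = c *\<^sub>R iter_dird f vs x"
  by (rule bounded_linear.iter_dird_linear[OF bounded_linear_scaleR_right assms])

lemma iter_dird_zero: "iter_dird (%_. 0) vs = (%_. 0)"
  by (induction vs) (auto simp: dird_def fun_eq_iff vector_derivative_const_at)

lemma iter_dird_sum:
  assumes "open_Rn d U" "finite I" "!!i. i \<in> I ==> Cinf d U (f i)" "set vs \<subseteq> Rn d" "x \<in> U"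
  shows "iter_dird (%x. \<Sum>i\<in>I. f i x) vs x = (\<Sum>i\<in>I. iter_dird (f i) vs x)"
  using assms(2,3)
proof (induction I rule: finite_induct)
  case (insert i I)
  then show ?case
    using iter_dird_add[of d U "f i" "%x. \<Sum>i\<in>I. f i x" vs x] assms by (simp add: Cinf_sum)
qed (simp add: iter_dird_zero)

lemma has_dird_sum_list:
  "(!!p. p \<in> set ps ==> has_dird (F p) v x (F' p)) ==>
    has_dird (%x. \<Sum>p\<leftarrow>ps. F p x) v x (\<Sum>p\<leftarrow>ps. F' p)"
  by (induction ps) (auto simp: has_dird_def intro!: has_vector_derivative_add)

lemma sum_list_map_concat: "(\<Sum>q\<leftarrow>concat (map h ps). F q) = (\<Sum>p\<leftarrow>ps. \<Sum>q\<leftarrow>h p. F q)"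
  by (induction ps) auto

lemma (in bounded_bilinear) iter_dird_prod:
  assumes "set vs \<subseteq> Rn d"
  obtains ps where "!!us ws. (us, ws) \<in> set ps ==> set us \<subseteq> Rn d & set ws \<subseteq> Rn d"
    "!!U (f :: _ => 'a) (g :: _ => 'b) x. Cinf d U f ==> Cinf d U g ==> x \<in> U ==>
      iter_dird (%x. prod (f x) (g x)) vs x =
        (\<Sum>(us, ws)\<leftarrow>ps. prod (iter_dird f us x) (iter_dird g ws x))"
  using assms
proof (induction vs arbitrary: thesis)
  case Nil
  show ?case by (rule Nil(1)[of "[([], [])]"]) auto
next
  case (Cons v vs)
  then obtain ps where ps: "!!us ws. (us, ws) \<in> set ps ==> set us \<subseteq> Rn d & set ws \<subseteq> Rn d"
    "!!U (f :: _ => 'a) (g :: _ => 'b) x. Cinf d U f ==> Cinf d U g ==> x \<in> U ==>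
      iter_dird (%x. prod (f x) (g x)) vs x =
        (\<Sum>(us, ws)\<leftarrow>ps. prod (iter_dird f us x) (iter_dird g ws x))" by auto
  define qs where "qs = concat (map (%(us, ws). [(us, v # ws), (v # us, ws)]) ps)"
  show ?case
  proof (rule Cons.prems(1)[of qs])
    fix us ws assume "(us, ws) \<in> set qs"
    then show "set us \<subseteq> Rn d & set ws \<subseteq> Rn d"
      using ps(1) Cons.prems(2) by (fastforce simp: qs_def)
  next
    fix U x and f :: "vec => 'a" and g :: "vec => 'b"
    assume f: "Cinf d U f" and g: "Cinf d U g" and x: "x \<in> U"
    have v: "v \<in> Rn d" using Cons.prems by auto
    have "dird v (iter_dird (%x. prod (f x) (g x)) vs) x =
      dird v (%x. \<Sum>p\<leftarrow>ps. prod (iter_dird f (fst p) x) (iter_dird g (snd p) x)) x"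
      using ps(2)[OF f g] by (intro dird_cong[OF Cinf_open[OF f] x v]) (simp add: case_prod_unfold)
    also have "... = (\<Sum>p\<leftarrow>ps. prod (iter_dird f (fst p) x) (iter_dird g (v # snd p) x) +
        prod (iter_dird f (v # fst p) x) (iter_dird g (snd p) x))"
    proof (intro has_dird_dird has_dird_sum_list)
      fix p assume p: "p \<in> set ps"
      have *: "set (fst p) \<subseteq> Rn d" "set (snd p) \<subseteq> Rn d" using ps(1)[of "fst p" "snd p"] p by auto
      have "((%t. iter_dird f (fst p) (%i. x i + t * v i)) has_vector_derivative iter_dird f (v # fst p) x) (at 0)"
        "((%t. iter_dird g (snd p) (%i. x i + t * v i)) has_vector_derivative iter_dird g (v # snd p) x) (at 0)"
        using Cinf_has_dird[OF Cinf_iter_dird[OF f *(1)] x v] Cinf_has_dird[OF Cinf_iter_dird[OF g *(2)] x v]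
        by (auto simp: has_dird_def)
      from has_vector_derivative[OF this]
      show "has_dird (%x. prod (iter_dird f (fst p) x) (iter_dird g (snd p) x)) v x
        (prod (iter_dird f (fst p) x) (iter_dird g (v # snd p) x) +
        prod (iter_dird f (v # fst p) x) (iter_dird g (snd p) x))"
        by (simp add: has_dird_def)
    qed
    also have "... = (\<Sum>(us, ws)\<leftarrow>qs. prod (iter_dird f us x) (iter_dird g ws x))"
      unfolding qs_def sum_list_map_concat by (simp add: case_prod_unfold)
    finally show "iter_dird (%x. prod (f x) (g x)) (v # vs) x =
       (\<Sum>(us, ws)\<leftarrow>qs. prod (iter_dird f us x) (iter_dird g ws x))" by simp
  qed
qed

text \<open>An iterated derivative of \<open>f \<circ> g\<close> is a combination of derivatives of \<open>f\<close> at \<open>g x\<close>, with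
  coefficients that depend on \<open>g\<close> only.\<close>

lemma iter_dird_compose:
  fixes g :: "vec => vec"
  assumes U: "open_Rn d U" and V: "open_Rn m V"
    and gV: "!!x. x \<in> U ==> g x \<in> V" and g: "!!j. j < m ==> Cinf d U (%x. g x j)"
    and vs: "set vs \<subseteq> Rn d"
  obtains cs :: "(vec list \<times> (vec => real)) list" where
    "!!us c. (us, c) \<in> set cs ==> set us \<subseteq> Rn m & Cinf d U c"
    "!!(f :: vec => 'b::real_normed_vector) x. Cinf m V f ==> x \<in> U ==>
      iter_dird (%x. f (g x)) vs x = (\<Sum>(us, c)\<leftarrow>cs. c x *\<^sub>R iter_dird f us (g x))"
  using vs
proof (induction vs arbitrary: thesis)
  case Nil
  show ?case by (rule Nil(1)[of "[([], %_. 1)]"]) (auto simp: Cinf_const U)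
next
  case (Cons v vs)
  then obtain cs :: "(vec list \<times> (vec => real)) list" where
    cs: "!!us c. (us, c) \<in> set cs ==> set us \<subseteq> Rn m & Cinf d U c"
    "!!(f :: vec => 'b::real_normed_vector) x. Cinf m V f ==> x \<in> U ==>
      iter_dird (%x. f (g x)) vs x = (\<Sum>(us, c)\<leftarrow>cs. c x *\<^sub>R iter_dird f us (g x))" by auto
  have v: "v \<in> Rn d" using Cons.prems by auto
  define cs' where "cs' = concat (map (%(us, c). (us, dird v c) #
     map (%j. (unitv j # us, %x. c x * dird v (%x. g x j) x)) [0..<m]) cs)"
  show ?case
  proof (rule Cons.prems(1)[of cs'])
    fix us c assume "(us, c) \<in> set cs'"
    then show "set us \<subseteq> Rn m & Cinf d U c"
      using cs(1) by (fastforce simp: cs'_def intro: Cinf_dird v Cinf_mult g unitv_in_Rn)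
  next
    fix f :: "vec => 'b" and x assume f: "Cinf m V f" and x: "x \<in> U"
    have "dird v (iter_dird (%x. f (g x)) vs) x =
      dird v (%x. \<Sum>p\<leftarrow>cs. snd p x *\<^sub>R iter_dird f (fst p) (g x)) x"
      using cs(2)[OF f] by (intro dird_cong[OF U x v]) (simp add: case_prod_unfold)
    also have "... = (\<Sum>p\<leftarrow>cs. snd p x *\<^sub>R (\<Sum>j<m. dird v (%x. g x j) x *\<^sub>R iter_dird f (unitv j # fst p) (g x)) +
        dird v (snd p) x *\<^sub>R iter_dird f (fst p) (g x))"
    proof (intro has_dird_dird has_dird_sum_list)
      fix p assume p: "p \<in> set cs"
      have *: "set (fst p) \<subseteq> Rn m" "Cinf d U (snd p)" using cs(1)[of "fst p" "snd p"] p by auto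
      have "((%t. snd p (%i. x i + t * v i)) has_vector_derivative dird v (snd p) x) (at 0)"
        using Cinf_has_dird[OF *(2) x v] by (auto simp: has_dird_def)
      moreover have "((%t. iter_dird f (fst p) (g (%i. x i + t * v i))) has_vector_derivative
         (\<Sum>j<m. dird v (%x. g x j) x *\<^sub>R iter_dird f (unitv j # fst p) (g x))) (at 0)"
        using has_dird_compose[OF U Cinf_iter_dird[OF f *(1)] gV g x v] by (simp add: has_dird_def)
      ultimately show "has_dird (%x. snd p x *\<^sub>R iter_dird f (fst p) (g x)) v x
        (snd p x *\<^sub>R (\<Sum>j<m. dird v (%x. g x j) x *\<^sub>R iter_dird f (unitv j # fst p) (g x)) +
        dird v (snd p) x *\<^sub>R iter_dird f (fst p) (g x))"
        using bounded_bilinear.has_vector_derivative[OF bounded_bilinear_scaleR] by (fastforce simp: has_dird_def)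
    qed
    also have "... = (\<Sum>(us, c)\<leftarrow>cs'. c x *\<^sub>R iter_dird f us (g x))"
      unfolding cs'_def sum_list_map_concat
      by (intro arg_cong[where f = sum_list] map_cong refl)
        (simp add: case_prod_unfold scaleR_sum_right o_def interv_sum_list_conv_sum_set_nat atLeast0LessThan add.commute)
    finally show "iter_dird (%x. f (g x)) (v # vs) x = (\<Sum>(us, c)\<leftarrow>cs'. c x *\<^sub>R iter_dird f us (g x))"
      by simp
  qed
qed

section \<open>Symmetry of second derivatives\<close>

text \<open>The second difference over a parallelogram is symmetric in \<open>v\<close> and
  \<open>w\<close>, so approximating it by either mixed derivative shows that the two agree.\<close>

lemma second_difference:
  assumes f: "Cinf d U f" and x: "x \<in> U" and v: "v \<in> Rn d" and w: "w \<in> Rn d" and e: "e > 0"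
  obtains \<delta> where "\<delta> > 0"
    "!!h. 0 < h ==> h < \<delta> ==>
      norm (f (%i. x i + h * v i + h * w i) - f (%i. x i + h * v i) - (f (%i. x i + h * w i) - f x)
        - (h * h) *\<^sub>R dird w (dird v f) x) <= e * (h * h)"
proof -
  note U = Cinf_open[OF f]
  have xR: "x \<in> Rn d" using x openin_subset[OF U] by blast
  let ?G = "dird w (dird v f)"
  have G: "Cinf d U ?G" by (intro Cinf_dird f v w)
  obtain r where r: "r > 0" "!!y. y \<in> Rn d ==> (!!i. i < d ==> \<bar>y i - x i\<bar> < r) ==> y \<in> U & dist (?G y) (?G x) < e"
    using continuous_on_box[OF U Cinf_continuous[OF G] x e] by blast
  define M where "M = 1 + (\<Sum>i<d. \<bar>v i\<bar> + \<bar>w i\<bar>)"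
  have "(\<Sum>i<d. \<bar>v i\<bar> + \<bar>w i\<bar>) >= 0" by (intro sum_nonneg) auto
  then have M: "M > 0" by (simp add: M_def)
  have Mi: "\<bar>v i\<bar> + \<bar>w i\<bar> <= M" if "i < d" for i
    using member_le_sum[of i "{..<d}" "%i. \<bar>v i\<bar> + \<bar>w i\<bar>"] that by (simp add: M_def)
  define P where "P s t = (%i. x i + s * v i + t * w i)" for s t
  have P': "P s t = (%i. (x i + t * w i) + s * v i)" for s t by (auto simp: P_def)
  show ?thesis
  proof
    show "r / M > 0" using r M by simp
    fix h :: real assume h: "0 < h" "h < r / M"
    have PU: "P s t \<in> U" "norm (?G (P s t) - ?G x) <= e" if "0 <= s" "s <= h" "0 <= t" "t <= h" for s t
    proof -
      have "P s t \<in> Rn d" using xR v w by (auto simp: P_def Rn_iff)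
      moreover have "\<bar>P s t i - x i\<bar> < r" if "i < d" for i
      proof -
        have "\<bar>P s t i - x i\<bar> <= \<bar>s * v i\<bar> + \<bar>t * w i\<bar>" by (simp add: P_def)
        also have "... <= h * \<bar>v i\<bar> + h * \<bar>w i\<bar>"
          unfolding abs_mult using \<open>0 <= s\<close> \<open>s <= h\<close> \<open>0 <= t\<close> \<open>t <= h\<close> by (intro add_mono mult_right_mono) auto
        also have "... <= h * M" using Mi[OF that] h by (simp add: distrib_left[symmetric])
        also have "... < r" using h M by (simp add: pos_less_divide_eq)
        finally show ?thesis .
      qed
      ultimately have "P s t \<in> U & dist (?G (P s t)) (?G x) < e" by (rule r(2))
      then show "P s t \<in> U" "norm (?G (P s t) - ?G x) <= e" by (auto simp: dist_norm)
    qed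
    have inner: "norm (dird v f (P s h) - dird v f (P s 0) - h *\<^sub>R ?G x) <= e * h" if s: "0 <= s" "s <= h" for s
    proof -
      have "norm (dird v f (P s h) - dird v f (P s 0) - (h - 0) *\<^sub>R ?G x) <= e * \<bar>h - 0\<bar>"
      proof (rule vector_mvt_bound[where f' = "%t. ?G (P s t)"])
        fix t assume "t \<in> closed_segment 0 h"
        then have t: "0 <= t" "t <= h" using h by (auto simp: closed_segment_eq_real_ivl)
        show "norm (?G (P s t) - ?G x) <= e" using PU(2) s t by blast
        have "has_dird (dird v f) w (P s t) (?G (P s t))"
          using PU(1)[OF s t] by (intro Cinf_has_dird[OF Cinf_dird[OF f v]] w)
        then show "((%t. dird v f (P s t)) has_vector_derivative ?G (P s t)) (at t)"
          unfolding P_def by (rule has_dird_line)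
      qed
      then show ?thesis using h by simp
    qed
    have "norm ((f (P h h) - f (P h 0)) - (f (P 0 h) - f (P 0 0)) - (h - 0) *\<^sub>R (h *\<^sub>R ?G x)) <= (e * h) * \<bar>h - 0\<bar>"
    proof (rule vector_mvt_bound[where f' = "%s. dird v f (P s h) - dird v f (P s 0)" and f = "%s. f (P s h) - f (P s 0)"])
      fix s assume "s \<in> closed_segment 0 h"
      then have s: "0 <= s" "s <= h" using h by (auto simp: closed_segment_eq_real_ivl)
      show "norm (dird v f (P s h) - dird v f (P s 0) - h *\<^sub>R ?G x) <= e * h" by (rule inner[OF s])
      have "((%s. f (P s t)) has_vector_derivative dird v f (P s t)) (at s)" if "0 <= t" "t <= h" for t
      proof -
        have "has_dird f v (P s t) (dird v f (P s t))"
          using PU(1)[OF s that] by (intro Cinf_has_dird[OF f] v)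
        then show ?thesis unfolding P' by (rule has_dird_line)
      qed
      then show "((%s. f (P s h) - f (P s 0)) has_vector_derivative dird v f (P s h) - dird v f (P s 0)) (at s)"
        using h by (intro has_vector_derivative_diff) auto
    qed
    then show "norm (f (%i. x i + h * v i + h * w i) - f (%i. x i + h * v i) - (f (%i. x i + h * w i) - f x)
        - (h * h) *\<^sub>R ?G x) <= e * (h * h)"
      using h by (simp add: P_def mult.assoc)
  qed
qed

lemma dird_commute:
  assumes f: "Cinf d U f" and x: "x \<in> U" and v: "v \<in> Rn d" and w: "w \<in> Rn d"
  shows "dird v (dird w f) x = dird w (dird v f) x"
proof (rule ccontr)
  let ?A = "dird w (dird v f) x" and ?B = "dird v (dird w f) x"
  assume "?B ~= ?A"
  define e where "e = norm (?A - ?B) / 4"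
  have e: "e > 0" using \<open>?B ~= ?A\<close> by (simp add: e_def)
  obtain \<delta>1 where d1: "\<delta>1 > 0" "!!h. 0 < h ==> h < \<delta>1 ==>
      norm (f (%i. x i + h * v i + h * w i) - f (%i. x i + h * v i) - (f (%i. x i + h * w i) - f x)
        - (h * h) *\<^sub>R ?A) <= e * (h * h)"
    using second_difference[OF f x v w e] by blast
  obtain \<delta>2 where d2: "\<delta>2 > 0" "!!h. 0 < h ==> h < \<delta>2 ==>
      norm (f (%i. x i + h * w i + h * v i) - f (%i. x i + h * w i) - (f (%i. x i + h * v i) - f x)
        - (h * h) *\<^sub>R ?B) <= e * (h * h)"
    using second_difference[OF f x w v e] by blast
  define h where "h = min \<delta>1 \<delta>2 / 2"
  have h: "0 < h" "h < \<delta>1" "h < \<delta>2" using d1 d2 by (auto simp: h_def)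
  have eq: "(%i. x i + h * w i + h * v i) = (%i. x i + h * v i + h * w i)" by (auto simp: add_ac)
  define \<Delta> where "\<Delta> = f (%i. x i + h * v i + h * w i) - f (%i. x i + h * v i) - (f (%i. x i + h * w i) - f x)"
  have 1: "norm (\<Delta> - (h * h) *\<^sub>R ?A) <= e * (h * h)" using d1(2)[OF h(1,2)] by (simp add: \<Delta>_def)
  have 2: "norm (\<Delta> - (h * h) *\<^sub>R ?B) <= e * (h * h)"
    using d2(2)[OF h(1,3)] unfolding eq \<Delta>_def by (simp add: algebra_simps)
  have "norm ((h * h) *\<^sub>R (?A - ?B)) = norm ((\<Delta> - (h * h) *\<^sub>R ?B) - (\<Delta> - (h * h) *\<^sub>R ?A))"
    by (simp add: scaleR_diff_right)
  also have "... <= norm (\<Delta> - (h * h) *\<^sub>R ?B) + norm (\<Delta> - (h * h) *\<^sub>R ?A)" by (rule norm_triangle_ineq4)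
  also have "... <= 2 * e * (h * h)" using 1 2 by simp
  finally have "(h * h) * norm (?A - ?B) <= (h * h) * (2 * e)" by (simp add: mult_ac)
  then have "norm (?A - ?B) <= 2 * e" using h by (simp add: mult_le_cancel_left)
  then show False using e by (simp add: e_def)
qed

lemma dird_iter_dird_commute:
  assumes f: "Cinf d U f" and v: "v \<in> Rn d"
  shows "set vs \<subseteq> Rn d ==> x \<in> U ==> dird v (iter_dird f vs) x = iter_dird (dird v f) vs x"
proof (induction vs arbitrary: x)
  case (Cons w vs)
  have "dird v (dird w (iter_dird f vs)) x = dird w (dird v (iter_dird f vs)) x"
    using Cons.prems v by (intro dird_commute[OF Cinf_iter_dird[OF f]]) auto
  also have "... = dird w (iter_dird (dird v f) vs) x"
    using Cons by (intro dird_cong[OF Cinf_open[OF f]]) auto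
  finally show ?case by simp
qed simp

section \<open>Smooth maps between the model spaces\<close>

lemma euclid_simps [simp]:
  "carrier (euclid d) = Rn d" "topo (euclid d) = Euclidean_space d"
  "x \<oplus>\<^bsub>euclid d\<^esub> y = (%i. x i + y i)" "t \<odot>\<^bsub>euclid d\<^esub> x = (%i. t * x i)"
  "\<zero>\<^bsub>euclid d\<^esub> = (%i. 0)"
  by (simp_all add: euclid_def)

lemma scalars_simps [simp]:
  "carrier scalars = UNIV" "topo scalars = euclidean"
  "x \<oplus>\<^bsub>scalars\<^esub> y = x + y" "t \<odot>\<^bsub>scalars\<^esub> x = t * x" "\<zero>\<^bsub>scalars\<^esub> = 0"
  by (simp_all add: scalars_def)

lemma abelian_group_euclid: "abelian_group (euclid d)"
proof (rule abelian_groupI)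
  fix x assume "x \<in> carrier (euclid d)"
  then show "EX y:carrier (euclid d). y \<oplus>\<^bsub>euclid d\<^esub> x = \<zero>\<^bsub>euclid d\<^esub>"
    by (intro bexI[of _ "%i. - x i"]) (auto simp: Rn_iff)
qed (auto simp: Rn_iff add_ac)

lemma abelian_group_scalars: "abelian_group (scalars :: ('k::real_normed_field, 'k) lcs)"
proof (rule abelian_groupI)
  fix x :: 'k
  show "EX y:carrier scalars. y \<oplus>\<^bsub>scalars\<^esub> x = \<zero>\<^bsub>scalars\<^esub>" by (intro bexI[of _ "- x"]) auto
qed (auto simp: add_ac)

lemma minus_euclid:
  assumes "x \<in> Rn d" "y \<in> Rn d"
  shows "x \<ominus>\<^bsub>euclid d\<^esub> y = (%i. x i - y i)"
proof -
  have "\<ominus>\<^bsub>euclid d\<^esub> y = (%i. - y i)"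
    using assms by (intro abelian_group.minus_equality[OF abelian_group_euclid]) (auto simp: Rn_iff)
  then show ?thesis by (simp add: a_minus_def)
qed

lemma minus_scalars: "x \<ominus>\<^bsub>scalars\<^esub> y = x - (y :: 'k::real_normed_field)"
proof -
  have "\<ominus>\<^bsub>scalars\<^esub> y = - y"
    by (intro abelian_group.minus_equality[OF abelian_group_scalars]) auto
  then show ?thesis by (simp add: a_minus_def)
qed

lemma limitin_Euclidean_space:
  "limitin (Euclidean_space m) F w A \<longleftrightarrow>
     w \<in> Rn m & (\<forall>\<^sub>F t in A. F t \<in> Rn m) & (ALL i<m. ((%t. F t i) \<longlongrightarrow> w i) A)"
proof -
  have "((%t. F t i) \<longlongrightarrow> w i) A" if "w \<in> Rn m" "\<forall>\<^sub>F t in A. F t \<in> Rn m" "i >= m" for i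
    using that by (intro tendsto_eventually) (auto simp: Rn_iff elim: eventually_mono)
  moreover have "limitin (Euclidean_space m) F w A \<longleftrightarrow>
     w \<in> Rn m & (\<forall>\<^sub>F t in A. F t \<in> Rn m) & (ALL i. ((%t. F t i) \<longlongrightarrow> w i) A)"
    unfolding topspace_Euclidean_space
    by (simp add: Euclidean_space_def limitin_subtopology limitin_componentwise)
  ultimately show ?thesis by (meson linorder_not_le)
qed

lemma continuous_map_Euclidean_space:
  "continuous_map X (Euclidean_space m) f \<longleftrightarrow>
     (ALL x:topspace X. f x \<in> Rn m) & (ALL i<m. continuous_map X euclideanreal (%x. f x i))"
  unfolding continuous_map_atin limitin_Euclidean_space limitin_canonical_iff
  by (auto simp: eventually_atin)

lemma has_dir_deriv_scalars:
  "has_dir_deriv (euclid d) (scalars :: ('l::real_normed_field, 'l) lcs) f v x w \<longleftrightarrow> has_dird f v x w"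
  by (simp add: has_dir_deriv_def has_dird_def has_vector_derivative_at_0_iff minus_scalars scaleR_conv_of_real)

lemma has_dir_deriv_euclid:
  assumes U: "open_Rn d U" and f: "!!y. y \<in> U ==> f y \<in> Rn m"
    and x: "x \<in> U" and v: "v \<in> Rn d"
  shows "has_dir_deriv (euclid d) (euclid m) f v x w \<longleftrightarrow>
    w \<in> Rn m & (ALL j<m. has_dird (%y. f y j) v x (w j))"
proof -
  let ?q = "%t i. (1 / t) * (f (%i. x i + t * v i) i - f x i)"
  note ev = line_eventually_at[OF U x v]
  let ?p = "%t i. (1 / t) * (f (%i. x i + t * v i) \<ominus>\<^bsub>euclid m\<^esub> f x) i"
  have "?p t = ?q t" if "(%i. x i + t * v i) \<in> U" for t
    using minus_euclid[OF f[OF that] f[OF x]] by simp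
  then have eq: "\<forall>\<^sub>F t in at 0. ?p t = ?q t" "\<forall>\<^sub>F t in at 0. ?q t = ?p t"
    using ev by (auto elim!: eventually_mono)
  have mem: "\<forall>\<^sub>F t in at 0. ?q t \<in> Rn m"
    using ev by eventually_elim (use f f[OF x] in "auto simp: Rn_iff")
  have "has_dir_deriv (euclid d) (euclid m) f v x w \<longleftrightarrow> limitin (Euclidean_space m) ?q w (at 0)"
    using limitin_transform_eventually[OF eq(1)] limitin_transform_eventually[OF eq(2)]
    by (simp add: has_dir_deriv_def) blast
  also have "... \<longleftrightarrow> w \<in> Rn m & (ALL j<m. has_dird (%y. f y j) v x (w j))"
    unfolding limitin_Euclidean_space has_dird_def has_vector_derivative_at_0_iff using mem by simp
  finally show ?thesis .
qed

lemma subtopology_Rn: "U \<subseteq> Rn d ==> subtopology (Euclidean_space d) U = top_of_set U"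
  using subtopology_subtopology[of euclidean "Rn d" U] by (simp add: top_of_set_Rn Int_absorb1)

text \<open>Joint continuity in the base point and the directions follows from that in the base point,
  because every direction expands into unit vectors.\<close>

lemma continuous_map_iter_dird:
  assumes "Cinf d U f" and a: "continuous_map X (subtopology (Euclidean_space d) U) a"
    and b: "!!j. j < k ==> continuous_map X (Euclidean_space d) (b j)"
  shows "continuous_map X euclidean (%s. iter_dird f (map (%j. b j s) [0..<k]) (a s))"
  using assms(1) b
proof (induction k arbitrary: f)
  case 0
  have "continuous_map (subtopology (Euclidean_space d) U) euclidean f"
    using Cinf_continuous[OF 0(1)] openin_subset[OF Cinf_open[OF 0(1)]]
    by (simp add: subtopology_Rn)
  from continuous_map_compose[OF a this] show ?case by (simp add: o_def)
next
  case (Suc k)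
  note U = Cinf_open[OF Suc.prems(1)]
  let ?vs = "%s. map (%j. b j s) [0..<k]"
  have aU: "a s \<in> U" if "s \<in> topspace X" for s
    using continuous_map_funspace[OF a] that by auto
  have bR: "b j s \<in> Rn d" if "s \<in> topspace X" "j < Suc k" for s j
    using continuous_map_funspace[OF Suc.prems(2)[OF that(2)]] that(1) by auto
  have eq: "iter_dird f (map (%j. b j s) [0..<Suc k]) (a s) =
     (\<Sum>i<d. b k s i *\<^sub>R iter_dird (dird (unitv i) f) (?vs s) (a s))" if s: "s \<in> topspace X" for s
  proof -
    have vs: "set (?vs s) \<subseteq> Rn d" using bR[OF s] by auto
    have C: "Cinf d U (dird (unitv i) f)" if "i < d" for i
      using Suc.prems(1) unitv_in_Rn[OF that] by (rule Cinf_dird)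
    have "iter_dird f (map (%j. b j s) [0..<Suc k]) (a s) = iter_dird (dird (b k s) f) (?vs s) (a s)"
      by (simp add: iter_dird_snoc)
    also have "... = iter_dird (%x. \<Sum>i<d. b k s i *\<^sub>R dird (unitv i) f x) (?vs s) (a s)"
      using bR[OF s, of k] by (intro iter_dird_cong[OF U _ vs aU[OF s]] dird_sum[OF Suc.prems(1)]) auto
    also have "... = (\<Sum>i<d. iter_dird (%x. b k s i *\<^sub>R dird (unitv i) f x) (?vs s) (a s))"
      using C by (intro iter_dird_sum[OF U _ _ vs aU[OF s]] Cinf_scaleR Cinf_const U) auto
    also have "... = (\<Sum>i<d. b k s i *\<^sub>R iter_dird (dird (unitv i) f) (?vs s) (a s))"
      using C by (intro sum.cong refl iter_dird_scaleR[OF _ vs aU[OF s]]) auto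
    finally show ?thesis .
  qed
  have "continuous_map X euclidean (%s. \<Sum>i<d. b k s i *\<^sub>R iter_dird (dird (unitv i) f) (?vs s) (a s))"
    unfolding continuous_map_atin limitin_canonical_iff
  proof (intro ballI tendsto_sum tendsto_scaleR)
    fix s i assume s: "s \<in> topspace X" and i: "i \<in> {..<d}"
    have "continuous_map X euclideanreal (%s. b k s i)"
      using Suc.prems(2)[of k] i by (simp add: continuous_map_Euclidean_space)
    then show "((%s. b k s i) \<longlongrightarrow> b k s i) (atin X s)"
      using s by (simp add: continuous_map_atin)
    have "continuous_map X euclidean (%s. iter_dird (dird (unitv i) f) (?vs s) (a s))"
      using i Suc.prems by (intro Suc.IH Cinf_dird unitv_in_Rn) auto
    then show "((%s. iter_dird (dird (unitv i) f) (?vs s) (a s)) \<longlongrightarrow>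
       iter_dird (dird (unitv i) f) (?vs s) (a s)) (atin X s)"
      using s by (simp add: continuous_map_atin)
  qed
  then show ?case by (rule continuous_map_eq) (simp only: eq)
qed

text \<open>The target \<open>F\<close> is described by a family of linear coordinates \<open>rd j\<close> which detect membership,
  limits and continuity. It is \<open>\<real>\<^sup>m\<close> with its coordinates or a normed field with the identity.\<close>

locale coordinatized =
  fixes d :: nat and F :: "('l::real_normed_field, 'f, 'n) lcs_scheme"
    and rd :: "'j => 'f => 'b::real_normed_vector" and J :: "'j set"
  assumes der: "!!U f x v w. open_Rn d U ==> (!!y. y \<in> U ==> f y \<in> carrier F) ==>
      x \<in> U ==> v \<in> Rn d ==> has_dir_deriv (euclid d) F f v x w \<longleftrightarrow>
        w \<in> carrier F & (ALL j:J. has_dird (%y. rd j (f y)) v x (rd j w))"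
    and cont: "!!(X :: (vec \<times> (nat => nat => real)) topology) h. continuous_map X (topo F) h \<longleftrightarrow>
        (ALL x:topspace X. h x \<in> carrier F) & (ALL j:J. continuous_map X euclidean (%x. rd j (h x)))"
    and rd_surj: "!!a. EX w:carrier F. ALL j:J. rd j w = a j"
    and rd_inj: "!!w w'. w \<in> carrier F ==> w' \<in> carrier F ==> (!!j. j \<in> J ==> rd j w = rd j w') ==> w = w'"
begin

definition reads :: "vec set => (vec => 'f) => vec list => bool" where
  "reads U f vs \<longleftrightarrow> (ALL x:U. iter_deriv (euclid d) F f vs x \<in> carrier F &
     (ALL j:J. rd j (iter_deriv (euclid d) F f vs x) = iter_dird (%y. rd j (f y)) vs x))"

lemma dir_deriv_reads:
  assumes U: "open_Rn d U" "!!y. y \<in> U ==> f y \<in> carrier F"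
    and x: "x \<in> U" and v: "v \<in> Rn d" and w: "has_dir_deriv (euclid d) F f v x w"
  shows "dir_deriv (euclid d) F f v x = w" "w \<in> carrier F"
    "!!j. j \<in> J ==> rd j w = dird v (%y. rd j (f y)) x"
proof -
  note D = der[of U f, OF U x v]
  show wF: "w \<in> carrier F" using D w by blast
  show rw: "rd j w = dird v (%y. rd j (f y)) x" if "j \<in> J" for j
    using D w that has_dird_dird by metis
  show "dir_deriv (euclid d) F f v x = w"
    unfolding dir_deriv_def
  proof (rule the_equality)
    show "has_dir_deriv (euclid d) F f v x w" by (rule w)
    fix w' assume w': "has_dir_deriv (euclid d) F f v x w'"
    then have "w' \<in> carrier F" "!!j. j \<in> J ==> rd j w' = dird v (%y. rd j (f y)) x"
      using D has_dird_dird by metis+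
    then show "w' = w" using rw wF by (intro rd_inj) auto
  qed
qed

lemma reads_Cons:
  assumes U: "open_Rn d U" and vs: "reads U f vs" and v: "v \<in> Rn d"
    and ex: "!!x. x \<in> U ==> EX w. has_dir_deriv (euclid d) F (iter_deriv (euclid d) F f vs) v x w"
  shows "reads U f (v # vs)"
  unfolding reads_def
proof
  fix x assume x: "x \<in> U"
  let ?g = "iter_deriv (euclid d) F f vs"
  obtain w where w: "has_dir_deriv (euclid d) F ?g v x w" using ex[OF x] by blast
  have g: "?g y \<in> carrier F" if "y \<in> U" for y using vs that by (simp add: reads_def)
  note * = dir_deriv_reads[OF U g x v w]
  have "dird v (%y. rd j (?g y)) x = iter_dird (%y. rd j (f y)) (v # vs) x" if "j \<in> J" for j
    using vs that dird_cong[OF U x v, of "%y. rd j (?g y)" "iter_dird (%y. rd j (f y)) vs"]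
    by (simp add: reads_def)
  then show "iter_deriv (euclid d) F f (v # vs) x \<in> carrier F &
     (ALL j:J. rd j (iter_deriv (euclid d) F f (v # vs) x) = iter_dird (%y. rd j (f y)) (v # vs) x)"
    using * by simp
qed

lemma has_dir_deriv_of_Cinf:
  assumes U: "open_Rn d U" and vs: "reads U f vs" "set vs \<subseteq> Rn d" and v: "v \<in> Rn d"
    and f: "!!j. j \<in> J ==> Cinf d U (%y. rd j (f y))" and x: "x \<in> U"
  shows "EX w. has_dir_deriv (euclid d) F (iter_deriv (euclid d) F f vs) v x w"
proof -
  let ?g = "iter_deriv (euclid d) F f vs"
  obtain w where w: "w \<in> carrier F" "!!j. j \<in> J ==> rd j w = dird v (iter_dird (%y. rd j (f y)) vs) x"
    using rd_surj[of "%j. dird v (iter_dird (%y. rd j (f y)) vs) x"] by blast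
  have "has_dird (%y. rd j (?g y)) v x (rd j w)" if j: "j \<in> J" for j
  proof -
    have "has_dird (iter_dird (%y. rd j (f y)) vs) v x (rd j w)"
      unfolding w(2)[OF j] by (rule Cinf_has_dird[OF Cinf_iter_dird[OF f[OF j] vs(2)] x v])
    then show ?thesis
      using has_dird_cong[OF U x v, of "%y. rd j (?g y)" "iter_dird (%y. rd j (f y)) vs"] vs j
      by (simp add: reads_def)
  qed
  then show ?thesis using der[of U ?g, OF U _ x v] vs w(1) by (auto simp: reads_def)
qed

lemma Cinf_reads:
  assumes U: "open_Rn d U" and fF: "!!x. x \<in> U ==> f x \<in> carrier F"
    and f: "!!j. j \<in> J ==> Cinf d U (%y. rd j (f y))"
  shows "set vs \<subseteq> Rn d ==> reads U f vs"
proof (induction vs)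
  case Nil
  then show ?case using fF by (simp add: reads_def)
next
  case (Cons v vs)
  then show ?case using has_dir_deriv_of_Cinf[OF U _ _ _ f, of vs v] by (intro reads_Cons[OF U]) auto
qed

text \<open>For maps out of \<open>euclid d\<close> this reduces smoothness in the sense of Michal and
  Bastiani to the coordinatewise notion \<open>Cinf\<close>, which is closed under the usual operations.\<close>

lemma smooth_on_iff:
  "smooth_on (euclid d) F U f \<longleftrightarrow>
     open_Rn d U & (ALL x:U. f x \<in> carrier F) & (ALL j:J. Cinf d U (%x. rd j (f x)))"
proof (intro iffI conjI)
  assume S: "smooth_on (euclid d) F U f"
  then show U: "open_Rn d U" by (simp add: smooth_on_def)
  have ex: "EX w. has_dir_deriv (euclid d) F (iter_deriv (euclid d) F f vs) v x w"
    if "set vs \<subseteq> Rn d" "v \<in> Rn d" "x \<in> U" for vs v x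
    using S that by (simp add: smooth_on_def)
  have c: "continuous_map (prod_topology (subtopology (Euclidean_space d) U)
      (product_topology (%_. Euclidean_space d) {..<k})) (topo F)
      (%(x, v). iter_deriv (euclid d) F f (map v [0..<k]) x)" for k
    using S by (simp add: smooth_on_def)
  have UR: "U \<subseteq> Rn d" using openin_subset[OF U] .
  show fF: "ALL x:U. f x \<in> carrier F"
  proof
    fix x assume "x \<in> U"
    then have "(x, %_. undefined) \<in> topspace (prod_topology (subtopology (Euclidean_space d) U)
      (product_topology (%_. Euclidean_space d) {..<(0::nat)}))" using UR by auto
    from bspec[OF conjunct1[OF c[of 0, unfolded cont]] this] show "f x \<in> carrier F" by simp
  qed
  have rds: "reads U f vs" if "set vs \<subseteq> Rn d" for vs
    using that
  proof (induction vs)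
    case Nil
    then show ?case using fF by (simp add: reads_def)
  next
    case (Cons v vs)
    then show ?case using ex by (intro reads_Cons[OF U]) auto
  qed
  show "ALL j:J. Cinf d U (%x. rd j (f x))"
  proof
    fix j assume j: "j \<in> J"
    let ?D = "%vs. iter_dird (%y. rd j (f y)) vs"
    have D: "?D vs x = rd j (iter_deriv (euclid d) F f vs x)" if "set vs \<subseteq> Rn d" "x \<in> U" for vs x
      using rds[OF that(1)] that(2) j by (simp add: reads_def)
    have ctD: "continuous_on U (?D vs)" if vs: "set vs \<subseteq> Rn d" for vs
    proof -
      let ?k = "length vs" and ?v = "restrict (nth vs) {..<length vs}"
      have m: "map ?v [0..<?k] = vs" by (intro nth_equalityI) auto
      have "continuous_map (prod_topology (subtopology (Euclidean_space d) U)
          (product_topology (%_. Euclidean_space d) {..<?k})) euclidean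
          (%p. rd j (case p of (x, v) => iter_deriv (euclid d) F f (map v [0..<?k]) x))"
        using c[of ?k] j unfolding cont by blast
      moreover have "continuous_map (subtopology (Euclidean_space d) U) (prod_topology (subtopology (Euclidean_space d) U)
          (product_topology (%_. Euclidean_space d) {..<?k})) (%x. (x, ?v))"
        using vs by (auto simp: continuous_map_pairwise o_def)
      ultimately have "continuous_map (subtopology (Euclidean_space d) U) euclidean
          ((%p. rd j (case p of (x, v) => iter_deriv (euclid d) F f (map v [0..<?k]) x)) o (%x. (x, ?v)))"
        by (intro continuous_map_compose)
      then have "continuous_map (subtopology (Euclidean_space d) U) euclidean
          (%x. rd j (iter_deriv (euclid d) F f vs x))"
        by (simp only: o_def prod.case m)
      then have "continuous_on U (%x. rd j (iter_deriv (euclid d) F f vs x))"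
        using UR by (simp add: subtopology_Rn)
      then show ?thesis using D[OF vs] by (simp cong: continuous_on_cong)
    qed
    have "Cinf d U g" if "g \<in> ?D ` {vs. set vs \<subseteq> Rn d}" for g
    proof (rule Cinf_coinduct[OF U that])
      fix g i assume "g \<in> ?D ` {vs. set vs \<subseteq> Rn d}" and i: "i < d"
      then obtain vs where vs: "set vs \<subseteq> Rn d" and g: "g = ?D vs" by blast
      have vi: "set (unitv i # vs) \<subseteq> Rn d" using vs unitv_in_Rn[OF i] by simp
      have "has_dird g (unitv i) x (?D (unitv i # vs) x)" if x: "x \<in> U" for x
      proof -
        let ?h = "iter_deriv (euclid d) F f vs"
        obtain w where w: "has_dir_deriv (euclid d) F ?h (unitv i) x w"
          using ex[OF vs unitv_in_Rn[OF i] x] by blast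
        have h: "?h y \<in> carrier F" if "y \<in> U" for y using rds[OF vs] that by (simp add: reads_def)
        have "has_dird (%y. rd j (?h y)) (unitv i) x (rd j w)"
          using der[of U ?h, OF U h x unitv_in_Rn[OF i]] w j by blast
        then have "has_dird g (unitv i) x (rd j w)"
          using has_dird_cong[OF U x unitv_in_Rn[OF i], of g "%y. rd j (?h y)"] D[OF vs] g by simp
        then show ?thesis using has_dird_dird g by fastforce
      qed
      then show "EX h. (ALL x:U. has_dird g (unitv i) x (h x)) &
         (ALL k. (ALL h:?D ` {vs. set vs \<subseteq> Rn d}. Ck k d U h) --> Ck k d U h)"
        using vi by (intro exI[of _ "?D (unitv i # vs)"]) blast
    qed (use ctD in auto)
    then show "Cinf d U (%x. rd j (f x))" by (force intro: image_eqI[of _ _ "[]"])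
  qed
next
  assume *: "open_Rn d U & (ALL x:U. f x \<in> carrier F) & (ALL j:J. Cinf d U (%x. rd j (f x)))"
  then have U: "open_Rn d U" and f: "!!j. j \<in> J ==> Cinf d U (%x. rd j (f x))" by auto
  have rds: "reads U f vs" if "set vs \<subseteq> Rn d" for vs
    using * that by (intro Cinf_reads) auto
  show "smooth_on (euclid d) F U f"
    unfolding smooth_on_def
  proof (intro conjI allI impI ballI)
    fix vs v x assume "set vs \<subseteq> carrier (euclid d)" "v \<in> carrier (euclid d)" "x \<in> U"
    then show "EX w. has_dir_deriv (euclid d) F (iter_deriv (euclid d) F f vs) v x w"
      using rds f by (intro has_dir_deriv_of_Cinf[OF U]) auto
  next
    fix k :: nat
    let ?X = "prod_topology (subtopology (topo (euclid d)) U) (product_topology (%_. topo (euclid d)) {..<k})"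
    have vs: "set (map v [0..<k]) \<subseteq> Rn d" "x \<in> U" if "(x, v) \<in> topspace ?X" for x v
      using that by (auto simp: PiE_def Pi_def)
    show "continuous_map ?X (topo F) (%(x, v). iter_deriv (euclid d) F f (map v [0..<k]) x)"
      unfolding cont
    proof (intro conjI ballI)
      fix p assume "p \<in> topspace ?X"
      then show "(case p of (x, v) => iter_deriv (euclid d) F f (map v [0..<k]) x) \<in> carrier F"
        using vs rds by (cases p) (auto simp: reads_def)
    next
      fix j assume j: "j \<in> J"
      have "continuous_map ?X euclidean (%s. iter_dird (%y. rd j (f y)) (map (%i. snd s i) [0..<k]) (fst s))"
      proof (rule continuous_map_iter_dird[OF f[OF j]])
        show "continuous_map ?X (subtopology (Euclidean_space d) U) fst"
          by (simp add: continuous_map_fst)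
        fix i assume i: "i < k"
        have "continuous_map (product_topology (%_. Euclidean_space d) {..<k}) (Euclidean_space d) (%v. v i)"
          using i by (intro continuous_map_product_projection) auto
        from continuous_map_compose[OF continuous_map_snd this]
        show "continuous_map ?X (Euclidean_space d) (%s. snd s i)" by (simp add: o_def)
      qed
      then show "continuous_map ?X euclidean (%p. rd j (case p of (x, v) => iter_deriv (euclid d) F f (map v [0..<k]) x))"
      proof (rule continuous_map_eq)
        fix p assume "p \<in> topspace ?X"
        then show "iter_dird (%y. rd j (f y)) (map (%i. snd p i) [0..<k]) (fst p) =
          rd j (case p of (x, v) => iter_deriv (euclid d) F f (map v [0..<k]) x)"
          using vs[of "fst p" "snd p"] rds[of "map (snd p) [0..<k]"] j by (auto simp: reads_def split: prod.splits)
      qed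
    qed
  qed (use U in simp)
qed

end

interpretation scalar: coordinatized d "scalars :: ('k::real_normed_field, 'k) lcs" "%_::unit. %x. x" "UNIV" for d
  by unfold_locales (auto simp: has_dir_deriv_scalars)

interpretation euclid: coordinatized d "euclid m" "%j x. x j" "{..<m}" for d m
proof unfold_locales
  fix a :: "vec"
  show "EX w:carrier (euclid m). ALL j:{..<m}. w j = a j"
    by (intro bexI[of _ "%j. if j < m then a j else 0"]) (auto simp: Rn_iff)
next
  fix w w' :: "vec"
  assume *: "w \<in> carrier (euclid m)" "w' \<in> carrier (euclid m)" "!!j. j \<in> {..<m} ==> w j = w' j"
  show "w = w'"
  proof
    fix j show "w j = w' j" using * by (cases "j < m") (auto simp: Rn_iff)
  qed
qed (auto simp: has_dir_deriv_euclid continuous_map_Euclidean_space)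

lemma smooth_on_scalars: "smooth_on (euclid d) scalars U f \<longleftrightarrow> Cinf d U f"
  unfolding scalar.smooth_on_iff using Cinf_open by auto

lemma smooth_on_euclid:
  "smooth_on (euclid d) (euclid m) U f \<longleftrightarrow>
     open_Rn d U & (ALL x:U. f x \<in> Rn m) & (ALL j<m. Cinf d U (%x. f x j))"
  unfolding euclid.smooth_on_iff by auto

lemma iter_deriv_scalars:
  assumes "Cinf d U f" "set vs \<subseteq> Rn d" "x \<in> U"
  shows "iter_deriv (euclid d) scalars f vs x = iter_dird f vs x"
  using scalar.Cinf_reads[OF Cinf_open[OF assms(1)], of f vs] assms by (simp add: scalar.reads_def)

lemma dir_deriv_euclid:
  assumes U: "open_Rn d U" "!!y. y \<in> U ==> f y \<in> Rn m" "!!j. j < m ==> Cinf d U (%y. f y j)"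
    and x: "x \<in> U" and v: "v \<in> Rn d"
  shows "dir_deriv (euclid d) (euclid m) f v x = (%j. if j < m then dird v (%y. f y j) x else 0)"
proof -
  have "has_dir_deriv (euclid d) (euclid m) f v x (%j. if j < m then dird v (%y. f y j) x else 0)"
    using has_dir_deriv_euclid[of d U f m, OF U(1,2) x v] Cinf_has_dird[OF U(3) x v]
    by (auto simp: Rn_iff)
  then show ?thesis using euclid.dir_deriv_reads(1)[OF U(1) _ x v] U(2) by simp
qed

section \<open>Charts and smooth scalar functions on a manifold\<close>

text \<open>The part of the definition of a manifold that concerns charts. It is separated from the
  topological conditions because the product of two manifolds is needed only at this level.\<close>

definition pre_manifold :: "'a manifold => bool" where
  "pre_manifold M \<longleftrightarrow>
     (\<Union>(U, phi)\<in>atlas M. U) = topspace (mtop M) &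
     (ALL (U, phi):atlas M.
        openin (mtop M) U & open_Rn (mdim M) (phi ` U) &
        homeomorphic_map (subtopology (mtop M) U)
          (subtopology (Euclidean_space (mdim M)) (phi ` U)) phi) &
     (ALL (U, phi):atlas M. ALL (V, psi):atlas M.
        smooth_on (euclid (mdim M)) (euclid (mdim M)) (phi ` (U Int V)) (psi o inv_into U phi))"

lemma smooth_manifold_pre: "smooth_manifold M ==> pre_manifold M"
  by (simp add: smooth_manifold_def pre_manifold_def)

locale chart =
  fixes M :: "'a manifold" and U phi
  assumes pre: "pre_manifold M" and chart: "(U, phi) \<in> atlas M"
begin

lemma dom_open: "openin (mtop M) U"
  using pre chart by (fastforce simp: pre_manifold_def)

lemma dom_subset: "U \<subseteq> topspace (mtop M)"
  using openin_subset[OF dom_open] .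

lemma homeo: "homeomorphic_map (subtopology (mtop M) U) (subtopology (Euclidean_space (mdim M)) (phi ` U)) phi"
  using pre chart by (fastforce simp: pre_manifold_def)

lemma image_open: "open_Rn (mdim M) (phi ` U)"
  using pre chart by (fastforce simp: pre_manifold_def)

lemma inj: "inj_on phi U"
  using homeomorphic_imp_injective_map[OF homeo] dom_subset by (simp add: Int_absorb1)

lemma inv_chart [simp]: "p \<in> U ==> inv_into U phi (phi p) = p"
  by (rule inv_into_f_f[OF inj])

lemma chart_inv [simp]: "x \<in> phi ` U ==> phi (inv_into U phi x) = x"
  by (rule f_inv_into_f)

lemma inv_in: "x \<in> phi ` U ==> inv_into U phi x \<in> U"
  by (rule inv_into_into)

lemma in_image_iff: "S \<subseteq> U ==> x \<in> phi ` S \<longleftrightarrow> x \<in> phi ` U & inv_into U phi x \<in> S"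
  using inv_chart chart_inv by (force simp: image_iff)

lemma in_Rn: "p \<in> U ==> phi p \<in> Rn (mdim M)"
  using openin_subset[OF image_open] by auto

lemma open_image:
  assumes "openin (mtop M) W" "W \<subseteq> U"
  shows "open_Rn (mdim M) (phi ` W)"
proof -
  have "openin (subtopology (mtop M) U) W"
    using assms dom_open by (simp add: openin_open_subtopology)
  then have "openin (subtopology (Euclidean_space (mdim M)) (phi ` U)) (phi ` W)"
    using homeomorphic_map_openness_eq[OF homeo] by blast
  then show ?thesis using image_open by (simp add: openin_open_subtopology)
qed

lemma open_preimage:
  assumes "open_Rn (mdim M) S"
  shows "openin (mtop M) {p:U. phi p \<in> S}"
proof -
  have "continuous_map (subtopology (mtop M) U) (Euclidean_space (mdim M)) phi"
    using homeomorphic_imp_continuous_map[OF homeo] continuous_map_in_subtopology by blast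
  from openin_continuous_map_preimage[OF this assms]
  have "openin (subtopology (mtop M) U) {p:U. phi p \<in> S}" using dom_subset by (simp add: Int_absorb1)
  then show ?thesis using dom_open by (simp add: openin_open_subtopology)
qed

lemma inv_continuous: "continuous_map (subtopology (Euclidean_space (mdim M)) (phi ` U)) (mtop M) (inv_into U phi)"
  unfolding continuous_map_def
proof (intro conjI allI impI)
  fix W assume W: "openin (mtop M) W"
  have "{x:topspace (subtopology (Euclidean_space (mdim M)) (phi ` U)). inv_into U phi x \<in> W} = phi ` (U Int W)"
    using openin_subset[OF image_open] by auto
  moreover have "open_Rn (mdim M) (phi ` (U Int W))" using W dom_open by (intro open_image) auto
  ultimately show "openin (subtopology (Euclidean_space (mdim M)) (phi ` U))
     {x:topspace (subtopology (Euclidean_space (mdim M)) (phi ` U)). inv_into U phi x \<in> W}"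
    using image_open by (auto simp: openin_open_subtopology)
qed (use dom_subset inv_in in auto)

lemma transition:
  assumes "(V, psi) \<in> atlas M"
  shows "j < mdim M ==> Cinf (mdim M) (phi ` (U Int V)) (%x. psi (inv_into U phi x) j)"
proof -
  have "smooth_on (euclid (mdim M)) (euclid (mdim M)) (phi ` (U Int V)) (psi o inv_into U phi)"
    using pre chart assms by (fastforce simp: pre_manifold_def)
  then show "j < mdim M ==> Cinf (mdim M) (phi ` (U Int V)) (%x. psi (inv_into U phi x) j)"
    by (simp add: smooth_on_euclid)
qed

end

lemma chartI: "pre_manifold M ==> (U, phi) \<in> atlas M ==> chart M U phi"
  by (simp add: chart_def)

lemma chart_exists:
  assumes "pre_manifold M" "p \<in> topspace (mtop M)"
  obtains U phi where "(U, phi) \<in> atlas M" "p \<in> U" "chart M U phi"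
proof -
  have "p \<in> (\<Union>(U, phi)\<in>atlas M. U)" using assms by (simp add: pre_manifold_def)
  then show ?thesis using that assms(1) by (auto simp: chart_def)
qed

definition smooth_fn :: "'a manifold => 'a set => ('a => 'b::real_normed_vector) => bool" where
  "smooth_fn M W f \<longleftrightarrow> openin (mtop M) W &
     (ALL (U, phi):atlas M. Cinf (mdim M) (phi ` (U Int W)) (%x. f (inv_into U phi x)))"

lemma smooth_fn_open: "smooth_fn M W f ==> openin (mtop M) W"
  by (simp add: smooth_fn_def)

lemma smooth_fn_in_chart:
  "smooth_fn M W f ==> (U, phi) \<in> atlas M ==> Cinf (mdim M) (phi ` (U Int W)) (%x. f (inv_into U phi x))"
  by (auto simp: smooth_fn_def)

lemma smooth_fn_cong:
  assumes "!!p. p \<in> W ==> f p = g p" "pre_manifold M"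
  shows "smooth_fn M W f \<longleftrightarrow> smooth_fn M W g"
proof -
  have "Cinf (mdim M) (phi ` (U Int W)) (%x. f (inv_into U phi x)) \<longleftrightarrow>
      Cinf (mdim M) (phi ` (U Int W)) (%x. g (inv_into U phi x))" if "(U, phi) \<in> atlas M" for U phi
  proof -
    interpret chart M U phi using assms(2) that by (rule chartI)
    show ?thesis by (rule Cinf_cong) (use assms(1) in auto)
  qed
  then show ?thesis by (auto simp: smooth_fn_def)
qed

lemma smooth_fn_subset:
  assumes M: "pre_manifold M" and f: "smooth_fn M W f" and Q: "openin (mtop M) Q" "Q \<subseteq> W"
  shows "smooth_fn M Q f"
  unfolding smooth_fn_def
proof (intro conjI Q, safe)
  fix U phi assume c: "(U, phi) \<in> atlas M"
  interpret chart M U phi using M c by (rule chartI)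
  show "Cinf (mdim M) (phi ` (U Int Q)) (%x. f (inv_into U phi x))"
    using Q dom_open by (intro Cinf_subset[OF smooth_fn_in_chart[OF f c]] open_image) auto
qed

lemma smooth_fn_local:
  assumes M: "pre_manifold M" and *: "!!p. p \<in> W ==> EX Q. p \<in> Q & Q \<subseteq> W & smooth_fn M Q f"
  shows "smooth_fn M W f"
  unfolding smooth_fn_def
proof (intro conjI, safe)
  show "openin (mtop M) W" using * by (subst openin_subopen) (meson smooth_fn_open)
  fix U phi assume c: "(U, phi) \<in> atlas M"
  interpret chart M U phi using M c by (rule chartI)
  show "Cinf (mdim M) (phi ` (U Int W)) (%x. f (inv_into U phi x))"
  proof (rule Cinf_local)
    fix x assume "x \<in> phi ` (U Int W)"
    then obtain p where p: "p \<in> U" "p \<in> W" "x = phi p" by auto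
    then obtain Q where "p \<in> Q" "Q \<subseteq> W" "smooth_fn M Q f" using * by blast
    then show "EX V. x \<in> V & V \<subseteq> phi ` (U Int W) & Cinf (mdim M) V (%x. f (inv_into U phi x))"
      using p c by (intro exI[of _ "phi ` (U Int Q)"]) (auto intro: smooth_fn_in_chart)
  qed
qed

text \<open>Smoothness may be tested in a single chart, because changes of charts are smooth.\<close>

lemma (in chart) smooth_fn_chartI:
  assumes Q: "openin (mtop M) Q" "Q \<subseteq> U" and f: "Cinf (mdim M) (phi ` Q) (%x. f (inv_into U phi x))"
  shows "smooth_fn M Q f"
  unfolding smooth_fn_def
proof (intro conjI Q, safe)
  fix V psi assume c: "(V, psi) \<in> atlas M"
  interpret V: chart M V psi using pre c by (rule chartI)
  have op: "open_Rn (mdim M) (psi ` (V Int Q))"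
    using Q V.dom_open by (intro V.open_image) auto
  have "Cinf (mdim M) (psi ` (V Int Q)) (%x. f (inv_into U phi (phi (inv_into V psi x))))"
  proof (rule Cinf_compose[OF op f])
    fix j assume "j < mdim M"
    then show "Cinf (mdim M) (psi ` (V Int Q)) (%x. phi (inv_into V psi x) j)"
      using Q by (intro Cinf_subset[OF V.transition[OF chart] op]) auto
  qed auto
  then show "Cinf (mdim M) (psi ` (V Int Q)) (%x. f (inv_into V psi x))"
    by (rule Cinf_cong[THEN iffD1, rotated]) (use Q in auto)
qed

lemma (in chart) smooth_fn_chart_compose:
  assumes Q: "openin (mtop M) Q" "Q \<subseteq> U" and f: "Cinf (mdim M) S f" "phi ` Q \<subseteq> S"
  shows "smooth_fn M Q (%p. f (phi p))"
proof (rule smooth_fn_chartI[OF Q])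
  have "Cinf (mdim M) (phi ` Q) f" by (rule Cinf_subset[OF f(1) open_image[OF Q] f(2)])
  then show "Cinf (mdim M) (phi ` Q) (%x. f (phi (inv_into U phi x)))"
    by (rule Cinf_cong[THEN iffD1, rotated]) (use Q in auto)
qed

lemma (in chart) smooth_fn_coord: "smooth_fn M U (%p. phi p j)"
  using smooth_fn_chart_compose[OF dom_open subset_refl Cinf_coord[OF image_open] subset_refl] .

lemma smooth_fn_lift1:
  assumes M: "pre_manifold M" and f: "smooth_fn M W f"
    and H: "!!d U g. Cinf d U g ==> (!!x. x \<in> U ==> g x \<in> S) ==> Cinf d U (%x. H (g x))"
    and S: "!!p. p \<in> W ==> f p \<in> S"
  shows "smooth_fn M W (%p. H (f p))"
  unfolding smooth_fn_def
proof (intro conjI smooth_fn_open[OF f], safe)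
  fix U phi assume c: "(U, phi) \<in> atlas M"
  interpret chart M U phi using M c by (rule chartI)
  show "Cinf (mdim M) (phi ` (U Int W)) (%x. H (f (inv_into U phi x)))"
    by (rule H[OF smooth_fn_in_chart[OF f c]]) (use S in auto)
qed

lemma smooth_fn_lift2:
  assumes M: "pre_manifold M" and f: "smooth_fn M W f" "smooth_fn M W g"
    and H: "!!d U f g. Cinf d U f ==> Cinf d U g ==> Cinf d U (%x. H (f x) (g x))"
  shows "smooth_fn M W (%p. H (f p) (g p))"
  unfolding smooth_fn_def
  by (intro conjI smooth_fn_open[OF f(1)], safe) (rule H[OF smooth_fn_in_chart[OF f(1)] smooth_fn_in_chart[OF f(2)]])

lemma smooth_fn_const:
  assumes "pre_manifold M" "openin (mtop M) W"
  shows "smooth_fn M W (%_. c)"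
  unfolding smooth_fn_def
proof (intro conjI assms(2), safe)
  fix U phi assume c: "(U, phi) \<in> atlas M"
  interpret chart M U phi using assms(1) c by (rule chartI)
  show "Cinf (mdim M) (phi ` (U Int W)) (%x. c)"
    using assms(2) dom_open by (intro Cinf_const open_image) auto
qed

context
  fixes M :: "'a manifold" assumes M: "pre_manifold M"
begin

lemmas smooth_fn_add = smooth_fn_lift2[OF M _ _ Cinf_add]
lemmas smooth_fn_diff = smooth_fn_lift2[OF M _ _ Cinf_diff]
lemmas smooth_fn_mult = smooth_fn_lift2[OF M _ _ Cinf_mult]

lemma smooth_fn_prod:
  fixes f :: "'i => 'a => 'b::real_normed_field"
  assumes "openin (mtop M) W" "!!i. i \<in> I ==> smooth_fn M W (f i)"
  shows "smooth_fn M W (%p. \<Prod>i\<in>I. f i p)"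
  using assms(2)
  by (induction I rule: infinite_finite_induct) (auto intro: smooth_fn_const[OF M assms(1)] smooth_fn_mult)

lemma smooth_fn_linear: "bounded_linear L ==> smooth_fn M W f ==> smooth_fn M W (%p. L (f p))"
  by (rule smooth_fn_lift1[OF M, where S = UNIV]) (auto intro: bounded_linear.Cinf_linear)

lemma smooth_fn_inverse:
  fixes f :: "'a => 'b::real_normed_field"
  shows "smooth_fn M W f ==> (!!p. p \<in> W ==> f p ~= 0) ==> smooth_fn M W (%p. inverse (f p))"
  by (rule smooth_fn_lift1[OF M, where S = "- {0}"]) (auto intro: Cinf_inverse)

lemma smooth_fn_compose_Rn:
  assumes W: "openin (mtop M) W" and g: "!!j. j < m ==> smooth_fn M W (%p. g p j)"
    and f: "Cinf m V f" "!!p. p \<in> W ==> g p \<in> V"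
  shows "smooth_fn M W (%p. f (g p))"
  unfolding smooth_fn_def
proof (intro conjI W, safe)
  fix U phi assume c: "(U, phi) \<in> atlas M"
  interpret chart M U phi using M c by (rule chartI)
  show "Cinf (mdim M) (phi ` (U Int W)) (%x. f (g (inv_into U phi x)))"
  proof (rule Cinf_compose[OF _ f(1)])
    show "open_Rn (mdim M) (phi ` (U Int W))"
      using W dom_open by (intro open_image) auto
  qed (use f(2) smooth_fn_in_chart[OF g c] in auto)
qed

lemma smooth_fn_preimage_open:
  assumes f: "smooth_fn M W f" and S: "open S"
  shows "openin (mtop M) {p:W. f p \<in> S}"
proof (subst openin_subopen, safe)
  fix p assume p: "p \<in> W" "f p \<in> S"
  have "p \<in> topspace (mtop M)" using openin_subset[OF smooth_fn_open[OF f]] p by auto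
  then obtain U phi where c: "(U, phi) \<in> atlas M" "p \<in> U" "chart M U phi"
    using chart_exists[OF M] by blast
  interpret chart M U phi by fact
  have C: "Cinf (mdim M) (phi ` (U Int W)) (%x. f (inv_into U phi x))"
    by (rule smooth_fn_in_chart[OF f c(1)])
  have "open_Rn (mdim M) {x:phi ` (U Int W). f (inv_into U phi x) \<in> S}"
    by (rule openin_continuous_preimage_Euclidean[OF Cinf_open[OF C] Cinf_continuous[OF C] S])
  from open_preimage[OF this] show "EX T. openin (mtop M) T & p \<in> T & T \<subseteq> {p:W. f p \<in> S}"
    using p c(2) by (intro exI conjI) (assumption, auto dest: inj_onD[OF inj])
qed

lemma smooth_fn_continuous_map:
  assumes f: "smooth_fn M W f"
  shows "continuous_map (subtopology (mtop M) W) euclidean f"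
  unfolding continuous_map_def
proof (intro conjI allI impI)
  fix S :: "'b set" assume "openin euclidean S"
  then have "openin (mtop M) {p:W. f p \<in> S}" using smooth_fn_preimage_open[OF f] by simp
  moreover have "{p:topspace (subtopology (mtop M) W). f p \<in> S} = {p:W. f p \<in> S}"
    using openin_subset[OF smooth_fn_open[OF f]] by auto
  ultimately show "openin (subtopology (mtop M) W) {p:topspace (subtopology (mtop M) W). f p \<in> S}"
    by (simp add: openin_open_subtopology[OF smooth_fn_open[OF f]])
qed auto

lemma smooth_functions_iff:
  "f \<in> smooth_functions M \<longleftrightarrow> f \<in> extensional (topspace (mtop M)) & smooth_fn M (topspace (mtop M)) f"
proof -
  have "U Int topspace (mtop M) = U" if "(U, phi) \<in> atlas M" for U phi
    using chart.dom_subset[OF chartI[OF M that]] by blast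
  then show ?thesis
    unfolding smooth_functions_def smooth_fn_def by (force simp: smooth_on_scalars o_def)
qed

end

section \<open>Smooth maps between manifolds\<close>

text \<open>Coordinates reduce smooth maps to smooth scalar functions, where locality and algebra are
  available.\<close>

lemma smooth_map_iff:
  assumes M: "pre_manifold M" and N: "pre_manifold N"
  shows "smooth_map M N f \<longleftrightarrow> continuous_map (mtop M) (mtop N) f &
     (ALL (V, psi):atlas N. ALL j<mdim N. smooth_fn M {p:topspace (mtop M). f p \<in> V} (%p. psi (f p) j))"
    (is "?L \<longleftrightarrow> ?c & ?R")
proof (cases ?c)
  case True
  have "(ALL (U, phi):atlas M. smooth_on (euclid (mdim M)) (euclid (mdim N)) (phi ` (U Int f -` V)) (psi o f o inv_into U phi))
     \<longleftrightarrow> (ALL j<mdim N. smooth_fn M {p:topspace (mtop M). f p \<in> V} (%p. psi (f p) j))"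
    if V: "(V, psi) \<in> atlas N" for V psi
  proof -
    interpret V: chart N V psi using N V by (rule chartI)
    let ?W = "{p:topspace (mtop M). f p \<in> V}"
    have W: "openin (mtop M) ?W" by (rule openin_continuous_map_preimage[OF True V.dom_open])
    have "smooth_on (euclid (mdim M)) (euclid (mdim N)) (phi ` (U Int f -` V)) (psi o f o inv_into U phi) \<longleftrightarrow>
       (ALL j<mdim N. Cinf (mdim M) (phi ` (U Int ?W)) (%x. psi (f (inv_into U phi x)) j))"
      if U: "(U, phi) \<in> atlas M" for U phi
    proof -
      interpret U: chart M U phi using M U by (rule chartI)
      have eq: "U Int f -` V = U Int ?W" using U.dom_subset by auto
      have "open_Rn (mdim M) (phi ` (U Int ?W))"
        using W U.dom_open by (intro U.open_image) auto
      moreover have "psi (f (inv_into U phi x)) \<in> Rn (mdim N)" if "x \<in> phi ` (U Int ?W)" for x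
        using that V.in_Rn by auto
      ultimately show ?thesis unfolding eq by (simp add: smooth_on_euclid o_def)
    qed
    then show ?thesis using W unfolding smooth_fn_def by blast
  qed
  then show ?thesis using True unfolding smooth_map_def by fast
qed (simp add: smooth_map_def)

lemma smooth_map_continuous: "smooth_map M N f ==> continuous_map (mtop M) (mtop N) f"
  by (simp add: smooth_map_def)

lemma smooth_map_in: "smooth_map M N f ==> p \<in> topspace (mtop M) ==> f p \<in> topspace (mtop N)"
  using continuous_map_funspace[OF smooth_map_continuous] by blast

lemma smooth_map_pullback:
  assumes M: "pre_manifold M" and N: "pre_manifold N" and f: "smooth_map M N f" and h: "smooth_fn N W h"
  shows "smooth_fn M {p:topspace (mtop M). f p \<in> W} (%p. h (f p))"
proof (rule smooth_fn_local[OF M])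
  fix p assume p: "p \<in> {p:topspace (mtop M). f p \<in> W}"
  then have "f p \<in> topspace (mtop N)" using smooth_map_in[OF f] by auto
  then obtain V psi where c: "(V, psi) \<in> atlas N" "f p \<in> V" "chart N V psi" using chart_exists[OF N] by blast
  interpret chart N V psi by fact
  let ?Q = "{q:topspace (mtop M). f q \<in> V Int W}"
  have Q: "openin (mtop M) ?Q"
    using dom_open smooth_fn_open[OF h] by (intro openin_continuous_map_preimage[OF smooth_map_continuous[OF f]]) auto
  have "smooth_fn M ?Q (%p. h (inv_into V psi (psi (f p))))"
  proof (rule smooth_fn_compose_Rn[OF M Q _ smooth_fn_in_chart[OF h c(1)]])
    fix j assume "j < mdim N"
    then have "smooth_fn M {p:topspace (mtop M). f p \<in> V} (%p. psi (f p) j)"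
      using f c(1) unfolding smooth_map_iff[OF M N] by fast
    then show "smooth_fn M ?Q (%p. psi (f p) j)"
      by (rule smooth_fn_subset[OF M _ Q]) auto
  qed auto
  then have "smooth_fn M ?Q (%p. h (f p))"
    by (rule smooth_fn_cong[THEN iffD1, OF _ M, rotated]) auto
  then show "EX Q. p \<in> Q & Q \<subseteq> {p:topspace (mtop M). f p \<in> W} & smooth_fn M Q (%p. h (f p))"
    using p c(2) by (intro exI[of _ ?Q]) auto
qed

text \<open>A criterion that avoids charts of the source altogether.\<close>

lemma smooth_mapI:
  assumes M: "pre_manifold M" and N: "pre_manifold N" and c: "continuous_map (mtop M) (mtop N) f"
    and *: "!!W (h :: _ => real). smooth_fn N W h ==> smooth_fn M {p:topspace (mtop M). f p \<in> W} (%p. h (f p))"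
  shows "smooth_map M N f"
  unfolding smooth_map_iff[OF M N] using c *[OF chart.smooth_fn_coord[OF chartI[OF N]]] by auto

lemma smooth_map_compose:
  assumes M: "pre_manifold M" and N: "pre_manifold N" and L: "pre_manifold L"
    and f: "smooth_map M N f" and g: "smooth_map N L g"
  shows "smooth_map M L (%p. g (f p))"
proof (rule smooth_mapI[OF M L])
  show "continuous_map (mtop M) (mtop L) (%p. g (f p))"
    using continuous_map_compose[OF smooth_map_continuous[OF f] smooth_map_continuous[OF g]] by (simp add: o_def)
  fix W and h :: "_ => real" assume "smooth_fn L W h"
  from smooth_map_pullback[OF M N f smooth_map_pullback[OF N L g this]]
  show "smooth_fn M {p:topspace (mtop M). g (f p) \<in> W} (%p. h (g (f p)))"
    using smooth_map_in[OF f] by (simp add: conj_ac cong: conj_cong)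
qed

lemma smooth_map_cong:
  assumes M: "pre_manifold M" and N: "pre_manifold N"
    and eq: "!!p. p \<in> topspace (mtop M) ==> f p = g p" and f: "smooth_map M N f"
  shows "smooth_map M N g"
proof (rule smooth_mapI[OF M N])
  show "continuous_map (mtop M) (mtop N) g"
    by (rule continuous_map_eq[OF smooth_map_continuous[OF f] eq])
  fix W and h :: "_ => real" assume "smooth_fn N W h"
  from smooth_map_pullback[OF M N f this] have "smooth_fn M {p:topspace (mtop M). f p \<in> W} (%p. h (g p))"
    by (rule smooth_fn_cong[THEN iffD1, OF _ M, rotated]) (simp add: eq)
  moreover have "{p:topspace (mtop M). f p \<in> W} = {p:topspace (mtop M). g p \<in> W}" using eq by auto
  ultimately show "smooth_fn M {p:topspace (mtop M). g p \<in> W} (%p. h (g p))" by simp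
qed

lemma smooth_map_id: "pre_manifold M ==> smooth_map M M (%p. p)"
proof (rule smooth_mapI)
  assume M: "pre_manifold M"
  fix W and h :: "'a => real" assume h: "smooth_fn M W h"
  then have "{p:topspace (mtop M). p \<in> W} = W" using openin_subset[OF smooth_fn_open[OF h]] by auto
  then show "smooth_fn M {p:topspace (mtop M). p \<in> W} h" using h by simp
qed auto

lemma smooth_map_const:
  assumes M: "pre_manifold M" and N: "pre_manifold N" and q: "q \<in> topspace (mtop N)"
  shows "smooth_map M N (%_. q)"
proof (rule smooth_mapI[OF M N])
  show "continuous_map (mtop M) (mtop N) (%_. q)" using q by simp
  fix W and h :: "_ => real"
  show "smooth_fn M {p:topspace (mtop M). q \<in> W} (%p. h q)"
    by (rule smooth_fn_const[OF M]) (cases "q \<in> W"; simp)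
qed

section \<open>Products of manifolds\<close>

lemma continuous_map_coord: "i < d ==> continuous_map (Euclidean_space d) euclideanreal (%w. w i)"
  using continuous_map_Euclidean_space[of "Euclidean_space d" d "%w. w"] by simp

definition fst_part :: "nat => vec => vec" where
  "fst_part d w = (%i. if i < d then w i else 0)"

definition snd_part :: "nat => vec => vec" where
  "snd_part d w = (%i. w (i + d))"

definition join_vec :: "nat => vec => vec => vec" where
  "join_vec d x y = (%i. if i < d then x i else y (i - d))"

lemma fst_part_Rn [simp]: "fst_part d w \<in> Rn d"
  by (simp add: fst_part_def Rn_iff)

lemma snd_part_Rn [simp]: "w \<in> Rn (d + e) ==> snd_part d w \<in> Rn e"
  by (simp add: snd_part_def Rn_iff)

lemma join_vec_Rn [simp]: "y \<in> Rn e ==> join_vec d x y \<in> Rn (d + e)"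
  by (auto simp: join_vec_def Rn_iff)

lemma join_parts [simp]: "join_vec d (fst_part d w) (snd_part d w) = w"
  by (auto simp: join_vec_def fst_part_def snd_part_def)

lemma fst_part_join [simp]: "x \<in> Rn d ==> fst_part d (join_vec d x y) = x"
  by (auto simp: join_vec_def fst_part_def Rn_iff fun_eq_iff)

lemma snd_part_join [simp]: "snd_part d (join_vec d x y) = y"
  by (auto simp: join_vec_def snd_part_def)

lemma openin_parts:
  assumes A: "open_Rn d A" and B: "open_Rn e B"
  shows "open_Rn (d + e) {w:Rn (d + e). fst_part d w \<in> A & snd_part d w \<in> B}"
proof (rule openin_EuclideanI)
  fix w assume w: "w \<in> {w:Rn (d + e). fst_part d w \<in> A & snd_part d w \<in> B}"
  obtain r where r: "r > 0" "!!y. y \<in> Rn d ==> (!!i. i < d ==> \<bar>y i - fst_part d w i\<bar> < r) ==> y \<in> A"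
    using openin_Euclidean_box[OF A, of "fst_part d w"] w by auto
  obtain s where s: "s > 0" "!!y. y \<in> Rn e ==> (!!i. i < e ==> \<bar>y i - snd_part d w i\<bar> < s) ==> y \<in> B"
    using openin_Euclidean_box[OF B, of "snd_part d w"] w by auto
  show "EX r>0. ALL y:Rn (d + e). (ALL i<d + e. \<bar>y i - w i\<bar> < r) -->
     y \<in> {w:Rn (d + e). fst_part d w \<in> A & snd_part d w \<in> B}"
  proof (intro exI[of _ "min r s"] conjI ballI impI)
    fix y assume y: "y \<in> Rn (d + e)" "ALL i<d + e. \<bar>y i - w i\<bar> < min r s"
    have "fst_part d y \<in> A" using y by (intro r(2)) (auto simp: fst_part_def Rn_iff)
    moreover have "snd_part d y \<in> B" using y by (intro s(2)) (auto simp: snd_part_def Rn_iff)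
    ultimately show "y \<in> {w:Rn (d + e). fst_part d w \<in> A & snd_part d w \<in> B}" using y by simp
  qed (use r s in auto)
qed auto

lemma Cinf_compose_fst_part:
  assumes "open_Rn (d + e) Q" "Cinf d A f" "!!w. w \<in> Q ==> fst_part d w \<in> A"
  shows "Cinf (d + e) Q (%w. f (fst_part d w))"
  by (rule Cinf_compose[OF assms]) (auto simp: fst_part_def intro: Cinf_coord assms)

lemma Cinf_compose_snd_part:
  assumes "open_Rn (d + e) Q" "Cinf e B f" "!!w. w \<in> Q ==> snd_part d w \<in> B"
  shows "Cinf (d + e) Q (%w. f (snd_part d w))"
  by (rule Cinf_compose[OF assms]) (auto simp: snd_part_def intro: Cinf_coord assms)

definition prod_chart :: "nat => ('a => nat => real) => ('b => nat => real) => 'a \<times> 'b => vec" where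
  "prod_chart d phi psi = (%(x, y). join_vec d (phi x) (psi y))"

lemma prod_manifold_simps [simp]:
  "mtop (prod_manifold M N) = prod_topology (mtop M) (mtop N)"
  "mdim (prod_manifold M N) = mdim M + mdim N"
  by (simp_all add: prod_manifold_def)

lemma atlas_prod_manifold:
  "atlas (prod_manifold M N) = {(U \<times> V, prod_chart (mdim M) phi psi) |U phi V psi. (U, phi) \<in> atlas M & (V, psi) \<in> atlas N}"
  by (simp add: prod_manifold_def prod_chart_def join_vec_def fun_eq_iff)

locale prod_charts = U: chart M U phi + V: chart N V psi
  for M :: "'a manifold" and U phi and N :: "'b manifold" and V psi
begin

abbreviation "\<kappa> == prod_chart (mdim M) phi psi"

lemma prod_chart_image:
  assumes "A \<subseteq> U" "B \<subseteq> V"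
  shows "\<kappa> ` (A \<times> B) = {w:Rn (mdim M + mdim N). fst_part (mdim M) w \<in> phi ` A & snd_part (mdim M) w \<in> psi ` B}"
proof (intro equalityI subsetI)
  fix w assume "w \<in> {w:Rn (mdim M + mdim N). fst_part (mdim M) w \<in> phi ` A & snd_part (mdim M) w \<in> psi ` B}"
  then obtain a b where ab: "a \<in> A" "b \<in> B" "fst_part (mdim M) w = phi a" "snd_part (mdim M) w = psi b" by auto
  have "w = join_vec (mdim M) (fst_part (mdim M) w) (snd_part (mdim M) w)" by simp
  also have "... = \<kappa> (a, b)" by (simp add: ab prod_chart_def del: join_parts)
  finally show "w \<in> \<kappa> ` (A \<times> B)" using ab by blast
next
  fix w assume "w \<in> \<kappa> ` (A \<times> B)"
  then obtain a b where "a \<in> A" "b \<in> B" "w = join_vec (mdim M) (phi a) (psi b)" by (auto simp: prod_chart_def)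
  then show "w \<in> {w:Rn (mdim M + mdim N). fst_part (mdim M) w \<in> phi ` A & snd_part (mdim M) w \<in> psi ` B}"
    using assms U.in_Rn V.in_Rn by auto
qed

lemma prod_chart_inj: "inj_on \<kappa> (U \<times> V)"
proof (rule inj_onI)
  fix p q assume pq: "p \<in> U \<times> V" "q \<in> U \<times> V" "\<kappa> p = \<kappa> q"
  have "fst_part (mdim M) (\<kappa> p) = phi (fst p)" "snd_part (mdim M) (\<kappa> p) = psi (snd p)" if "p \<in> U \<times> V" for p
    using that U.in_Rn by (auto simp: prod_chart_def)
  then have "phi (fst p) = phi (fst q)" "psi (snd p) = psi (snd q)"
    using pq by metis+
  then show "p = q"
    using pq inj_onD[OF U.inj] inj_onD[OF V.inj] by (auto simp: mem_Times_iff prod_eq_iff)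
qed

lemma inv_prod_chart:
  assumes "w \<in> \<kappa> ` (U \<times> V)"
  shows "inv_into (U \<times> V) \<kappa> w = (inv_into U phi (fst_part (mdim M) w), inv_into V psi (snd_part (mdim M) w))"
proof -
  obtain a b where ab: "a \<in> U" "b \<in> V" "w = \<kappa> (a, b)" using assms by blast
  then have "inv_into (U \<times> V) \<kappa> w = (a, b)" using inv_into_f_f[OF prod_chart_inj] by auto
  then show ?thesis using ab U.in_Rn by (simp add: prod_chart_def)
qed

lemma prod_chart_open: "open_Rn (mdim M + mdim N) (\<kappa> ` (U \<times> V))"
  unfolding prod_chart_image[OF subset_refl subset_refl] by (rule openin_parts[OF U.image_open V.image_open])

lemma prod_chart_homeo:
  "homeomorphic_map (subtopology (prod_topology (mtop M) (mtop N)) (U \<times> V))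
     (subtopology (Euclidean_space (mdim M + mdim N)) (\<kappa> ` (U \<times> V))) \<kappa>"
proof -
  let ?X = "subtopology (prod_topology (mtop M) (mtop N)) (U \<times> V)"
  let ?Y = "subtopology (Euclidean_space (mdim M + mdim N)) (\<kappa> ` (U \<times> V))"
  have X: "?X = prod_topology (subtopology (mtop M) U) (subtopology (mtop N) V)"
    by (simp add: subtopology_Times)
  have cU: "continuous_map (subtopology (mtop M) U) (Euclidean_space (mdim M)) phi"
    and cV: "continuous_map (subtopology (mtop N) V) (Euclidean_space (mdim N)) psi"
    using homeomorphic_imp_continuous_map[OF U.homeo] homeomorphic_imp_continuous_map[OF V.homeo]
      continuous_map_in_subtopology by blast+
  have "homeomorphic_maps ?X ?Y \<kappa> (inv_into (U \<times> V) \<kappa>)"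
    unfolding homeomorphic_maps_def
  proof (intro conjI ballI)
    show "continuous_map ?X ?Y \<kappa>"
      unfolding continuous_map_in_subtopology continuous_map_Euclidean_space
    proof (intro conjI ballI allI impI)
      fix i assume i: "i < mdim M + mdim N"
      show "continuous_map ?X euclideanreal (%p. \<kappa> p i)"
      proof (cases "i < mdim M")
        case True
        then have "continuous_map (subtopology (mtop M) U) euclideanreal (%p. phi p i)"
          using cU by (simp add: continuous_map_Euclidean_space)
        from continuous_map_compose[OF continuous_map_fst this] show ?thesis
          unfolding X using True by (simp add: o_def prod_chart_def join_vec_def case_prod_unfold)
      next
        case False
        then have "continuous_map (subtopology (mtop N) V) euclideanreal (%p. psi p (i - mdim M))"
          using cV i by (simp add: continuous_map_Euclidean_space)
        from continuous_map_compose[OF continuous_map_snd this] show ?thesis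
          unfolding X using False by (simp add: o_def prod_chart_def join_vec_def case_prod_unfold)
      qed
    qed (auto simp: prod_chart_def V.in_Rn)
    have "continuous_map ?Y (subtopology (Euclidean_space (mdim M)) (phi ` U)) (fst_part (mdim M))"
      unfolding continuous_map_in_subtopology continuous_map_Euclidean_space prod_chart_image[OF subset_refl subset_refl]
      by (auto intro!: continuous_map_from_subtopology fst_part_Rn) (auto simp: fst_part_def intro!: continuous_map_coord)
    from continuous_map_compose[OF this U.inv_continuous]
    have "continuous_map ?Y (mtop M) (%w. inv_into U phi (fst_part (mdim M) w))" by (simp add: o_def)
    moreover have "continuous_map ?Y (subtopology (Euclidean_space (mdim N)) (psi ` V)) (snd_part (mdim M))"
      unfolding continuous_map_in_subtopology continuous_map_Euclidean_space prod_chart_image[OF subset_refl subset_refl]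
      by (auto intro!: continuous_map_from_subtopology) (auto simp: snd_part_def intro!: continuous_map_coord)
    from continuous_map_compose[OF this V.inv_continuous]
    have "continuous_map ?Y (mtop N) (%w. inv_into V psi (snd_part (mdim M) w))" by (simp add: o_def)
    ultimately have "continuous_map ?Y (prod_topology (mtop M) (mtop N))
       (%w. (inv_into U phi (fst_part (mdim M) w), inv_into V psi (snd_part (mdim M) w)))"
      by (simp add: continuous_map_pairwise o_def)
    then have "continuous_map ?Y (prod_topology (mtop M) (mtop N)) (inv_into (U \<times> V) \<kappa>)"
      by (rule continuous_map_eq) (simp add: inv_prod_chart)
    moreover have "inv_into (U \<times> V) \<kappa> w \<in> U \<times> V" if "w \<in> topspace ?Y" for w
      using that by (intro inv_into_into) simp
    ultimately show "continuous_map ?Y ?X (inv_into (U \<times> V) \<kappa>)"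
      unfolding continuous_map_in_subtopology by blast
  qed (auto simp: inv_into_f_f[OF prod_chart_inj] f_inv_into_f)
  then show ?thesis using homeomorphic_map_maps by blast
qed

end

lemma prod_chartsI:
  "pre_manifold M ==> pre_manifold N ==> (U, phi) \<in> atlas M ==> (V, psi) \<in> atlas N ==> prod_charts M U phi N V psi"
  by (simp add: prod_charts_def chart_def)

lemma pre_manifold_prod:
  assumes M: "pre_manifold M" and N: "pre_manifold N"
  shows "pre_manifold (prod_manifold M N)"
  unfolding pre_manifold_def prod_manifold_simps
proof (intro conjI)
  have "(\<Union>(U, phi)\<in>atlas (prod_manifold M N). U) = (\<Union>(U, phi)\<in>atlas M. U) \<times> (\<Union>(V, psi)\<in>atlas N. V)"
  proof (intro equalityI subsetI)
    fix p assume "p \<in> (\<Union>(U, phi)\<in>atlas M. U) \<times> (\<Union>(V, psi)\<in>atlas N. V)"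
    then obtain U phi V psi where "(U, phi) \<in> atlas M" "(V, psi) \<in> atlas N" "p \<in> U \<times> V"
      by (auto simp: mem_Times_iff)
    then show "p \<in> (\<Union>(U, phi)\<in>atlas (prod_manifold M N). U)"
      unfolding atlas_prod_manifold by blast
  qed (auto simp: atlas_prod_manifold)
  then show "(\<Union>(U, phi)\<in>atlas (prod_manifold M N). U) = topspace (prod_topology (mtop M) (mtop N))"
    using M N by (simp add: pre_manifold_def)
  show "ALL (W, \<kappa>):atlas (prod_manifold M N). openin (prod_topology (mtop M) (mtop N)) W &
      open_Rn (mdim M + mdim N) (\<kappa> ` W) &
      homeomorphic_map (subtopology (prod_topology (mtop M) (mtop N)) W)
        (subtopology (Euclidean_space (mdim M + mdim N)) (\<kappa> ` W)) \<kappa>"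
  proof clarify
    fix W \<kappa> assume "(W, \<kappa>) \<in> atlas (prod_manifold M N)"
    then obtain U phi V psi where c: "(U, phi) \<in> atlas M" "(V, psi) \<in> atlas N"
      and W: "W = U \<times> V" "\<kappa> = prod_chart (mdim M) phi psi" unfolding atlas_prod_manifold by blast
    interpret prod_charts M U phi N V psi using M N c by (rule prod_chartsI)
    show "openin (prod_topology (mtop M) (mtop N)) W &
      open_Rn (mdim M + mdim N) (\<kappa> ` W) &
      homeomorphic_map (subtopology (prod_topology (mtop M) (mtop N)) W)
        (subtopology (Euclidean_space (mdim M + mdim N)) (\<kappa> ` W)) \<kappa>"
      unfolding W using prod_chart_open prod_chart_homeo U.dom_open V.dom_open by (simp add: openin_prod_Times_iff)
  qed
  show "ALL (W, \<kappa>):atlas (prod_manifold M N). ALL (W', \<kappa>'):atlas (prod_manifold M N).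
      smooth_on (euclid (mdim M + mdim N)) (euclid (mdim M + mdim N)) (\<kappa> ` (W Int W')) (\<kappa>' o inv_into W \<kappa>)"
  proof clarify
    fix W \<kappa> W' \<kappa>'
    assume "(W, \<kappa>) \<in> atlas (prod_manifold M N)" "(W', \<kappa>') \<in> atlas (prod_manifold M N)"
    then obtain U phi V psi U' phi' V' psi' where c: "(U, phi) \<in> atlas M" "(V, psi) \<in> atlas N"
      and W: "W = U \<times> V" "\<kappa> = prod_chart (mdim M) phi psi"
      and c': "(U', phi') \<in> atlas M" "(V', psi') \<in> atlas N"
      and W': "W' = U' \<times> V'" "\<kappa>' = prod_chart (mdim M) phi' psi'" unfolding atlas_prod_manifold by blast
    interpret prod_charts M U phi N V psi using M N c by (rule prod_chartsI)
    interpret pc': prod_charts M U' phi' N V' psi' using M N c' by (rule prod_chartsI)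
    let ?Q = "prod_chart (mdim M) phi psi ` ((U Int U') \<times> (V Int V'))"
    have O_eq: "?Q = {w:Rn (mdim M + mdim N). fst_part (mdim M) w \<in> phi ` (U Int U') & snd_part (mdim M) w \<in> psi ` (V Int V')}"
      by (rule prod_chart_image) auto
    have Q: "open_Rn (mdim M + mdim N) ?Q"
      unfolding O_eq using U.dom_open V.dom_open pc'.U.dom_open pc'.V.dom_open
      by (intro openin_parts U.open_image V.open_image) auto
    have inv: "inv_into (U \<times> V) (prod_chart (mdim M) phi psi) w =
        (inv_into U phi (fst_part (mdim M) w), inv_into V psi (snd_part (mdim M) w))" if "w \<in> ?Q" for w
      using that by (intro inv_prod_chart) blast
    have mem: "fst_part (mdim M) w \<in> phi ` (U Int U')" "snd_part (mdim M) w \<in> psi ` (V Int V')" if "w \<in> ?Q" for w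
      using that unfolding O_eq by auto
    have "smooth_on (euclid (mdim M + mdim N)) (euclid (mdim M + mdim N)) ?Q
        (%w. prod_chart (mdim M) phi' psi' (inv_into (U \<times> V) (prod_chart (mdim M) phi psi) w))"
      unfolding smooth_on_euclid
    proof (intro conjI Q ballI allI impI)
      fix w assume w: "w \<in> ?Q"
      show "prod_chart (mdim M) phi' psi' (inv_into (U \<times> V) (prod_chart (mdim M) phi psi) w) \<in> Rn (mdim M + mdim N)"
        unfolding inv[OF w] using mem[OF w] pc'.V.in_Rn by (auto simp: prod_chart_def)
    next
      fix j assume j: "j < mdim M + mdim N"
      have "Cinf (mdim M + mdim N) ?Q (%w. if j < mdim M then phi' (inv_into U phi (fst_part (mdim M) w)) j
         else psi' (inv_into V psi (snd_part (mdim M) w)) (j - mdim M))"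
      proof (cases "j < mdim M")
        case True
        then show ?thesis
          using mem Cinf_compose_fst_part[OF Q U.transition[OF c'(1) True]] by simp
      next
        case False
        then show ?thesis
          using mem j Cinf_compose_snd_part[OF Q V.transition[OF c'(2), of "j - mdim M"]] by simp
      qed
      then show "Cinf (mdim M + mdim N) ?Q (%w. prod_chart (mdim M) phi' psi' (inv_into (U \<times> V) (prod_chart (mdim M) phi psi) w) j)"
        by (rule Cinf_cong[THEN iffD1, rotated]) (subst inv, assumption, simp add: prod_chart_def join_vec_def)
    qed
    moreover have "(U \<times> V) Int (U' \<times> V') = (U Int U') \<times> (V Int V')" by auto
    ultimately show "smooth_on (euclid (mdim M + mdim N)) (euclid (mdim M + mdim N)) (\<kappa> ` (W Int W')) (\<kappa>' o inv_into W \<kappa>)"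
      unfolding W W' by (simp add: o_def)
  qed
qed

lemma atlas_prodI:
  "(U, phi) \<in> atlas M ==> (V, psi) \<in> atlas N ==> (U \<times> V, prod_chart (mdim M) phi psi) \<in> atlas (prod_manifold M N)"
  unfolding atlas_prod_manifold by blast

lemma smooth_map_fst:
  assumes M: "pre_manifold M" and N: "pre_manifold N"
  shows "smooth_map (prod_manifold M N) M fst"
  unfolding smooth_map_iff[OF pre_manifold_prod[OF M N] M]
proof (intro conjI, simp add: continuous_map_fst, clarify)
  fix U phi j assume c: "(U, phi) \<in> atlas M" "j < mdim M"
  let ?W = "{p:topspace (mtop (prod_manifold M N)). fst p \<in> U}"
  show "smooth_fn (prod_manifold M N) ?W (%p. phi (fst p) j)"
  proof (rule smooth_fn_local[OF pre_manifold_prod[OF M N]])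
    fix p assume p: "p \<in> ?W"
    then have "snd p \<in> topspace (mtop N)" by (auto simp: mem_Times_iff)
    then obtain V psi where V: "(V, psi) \<in> atlas N" "snd p \<in> V" using chart_exists[OF N] by blast
    interpret prod_charts M U phi N V psi using M N c(1) V(1) by (rule prod_chartsI)
    interpret P: chart "prod_manifold M N" "U \<times> V" \<kappa>
      by (rule chartI[OF pre_manifold_prod[OF M N] atlas_prodI[OF c(1) V(1)]])
    have "smooth_fn (prod_manifold M N) (U \<times> V) (%p. \<kappa> p j)" by (rule P.smooth_fn_coord)
    then have "smooth_fn (prod_manifold M N) (U \<times> V) (%p. phi (fst p) j)"
      using c(2) by (simp add: prod_chart_def join_vec_def case_prod_unfold)
    then show "EX Q. p \<in> Q & Q \<subseteq> ?W & smooth_fn (prod_manifold M N) Q (%p. phi (fst p) j)"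
      using p V P.dom_subset by (intro exI[of _ "U \<times> V"]) (auto simp: mem_Times_iff)
  qed
qed

lemma smooth_map_snd:
  assumes M: "pre_manifold M" and N: "pre_manifold N"
  shows "smooth_map (prod_manifold M N) N snd"
  unfolding smooth_map_iff[OF pre_manifold_prod[OF M N] N]
proof (intro conjI, simp add: continuous_map_snd, clarify)
  fix V psi j assume c: "(V, psi) \<in> atlas N" "j < mdim N"
  let ?W = "{p:topspace (mtop (prod_manifold M N)). snd p \<in> V}"
  show "smooth_fn (prod_manifold M N) ?W (%p. psi (snd p) j)"
  proof (rule smooth_fn_local[OF pre_manifold_prod[OF M N]])
    fix p assume p: "p \<in> ?W"
    then have "fst p \<in> topspace (mtop M)" by (auto simp: mem_Times_iff)
    then obtain U phi where U: "(U, phi) \<in> atlas M" "fst p \<in> U" using chart_exists[OF M] by blast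
    interpret prod_charts M U phi N V psi using M N U(1) c(1) by (rule prod_chartsI)
    interpret P: chart "prod_manifold M N" "U \<times> V" \<kappa>
      by (rule chartI[OF pre_manifold_prod[OF M N] atlas_prodI[OF U(1) c(1)]])
    have "smooth_fn (prod_manifold M N) (U \<times> V) (%p. \<kappa> p (j + mdim M))" by (rule P.smooth_fn_coord)
    then have "smooth_fn (prod_manifold M N) (U \<times> V) (%p. psi (snd p) j)"
      by (simp add: prod_chart_def join_vec_def case_prod_unfold)
    then show "EX Q. p \<in> Q & Q \<subseteq> ?W & smooth_fn (prod_manifold M N) Q (%p. psi (snd p) j)"
      using p U P.dom_subset by (intro exI[of _ "U \<times> V"]) (auto simp: mem_Times_iff)
  qed
qed

lemma smooth_map_pair:
  assumes L: "pre_manifold L" and M: "pre_manifold M" and N: "pre_manifold N"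
    and f: "smooth_map L M f" and g: "smooth_map L N g"
  shows "smooth_map L (prod_manifold M N) (%p. (f p, g p))"
  unfolding smooth_map_iff[OF L pre_manifold_prod[OF M N]]
proof (intro conjI, simp add: continuous_map_pairwise o_def smooth_map_continuous[OF f] smooth_map_continuous[OF g], clarify)
  fix W \<kappa> j assume "(W, \<kappa>) \<in> atlas (prod_manifold M N)" and j: "j < mdim (prod_manifold M N)"
  then obtain U phi V psi where c: "(U, phi) \<in> atlas M" "(V, psi) \<in> atlas N"
    and W: "W = U \<times> V" "\<kappa> = prod_chart (mdim M) phi psi" unfolding atlas_prod_manifold by blast
  interpret prod_charts M U phi N V psi using M N c by (rule prod_chartsI)
  let ?W = "{p:topspace (mtop L). (f p, g p) \<in> W}"
  have Q: "openin (mtop L) ?W"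
  proof -
    have "?W = {p:topspace (mtop L). f p \<in> U} Int {p:topspace (mtop L). g p \<in> V}" by (auto simp: W)
    then show ?thesis
      using openin_continuous_map_preimage[OF smooth_map_continuous[OF f] U.dom_open]
        openin_continuous_map_preimage[OF smooth_map_continuous[OF g] V.dom_open] by auto
  qed
  show "smooth_fn L ?W (%p. \<kappa> (f p, g p) j)"
  proof (cases "j < mdim M")
    case True
    have "smooth_fn L ?W (%p. phi (f p) j)"
      by (rule smooth_fn_subset[OF L smooth_map_pullback[OF L M f U.smooth_fn_coord] Q]) (auto simp: W)
    then show ?thesis using True by (simp add: W prod_chart_def join_vec_def)
  next
    case False
    have "smooth_fn L ?W (%p. psi (g p) (j - mdim M))"
      by (rule smooth_fn_subset[OF L smooth_map_pullback[OF L N g V.smooth_fn_coord] Q]) (auto simp: W)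
    then show ?thesis using False by (simp add: W prod_chart_def join_vec_def)
  qed
qed

section \<open>Cut-off functions\<close>

lemma compactin_Rn: "compactin (Euclidean_space d) K \<longleftrightarrow> compact K & K \<subseteq> Rn d"
  using compactin_subtopology[of euclidean "Rn d" K] by (simp add: top_of_set_Rn)

lemma compact_box: "compact {y:Rn d. ALL i<d. \<bar>y i - x i\<bar> <= r}"
proof -
  have "{t. \<bar>t - x i\<bar> <= r} = {x i - r..x i + r}" for i by auto
  then have "compact {t. \<bar>t - x i\<bar> <= r}" for i by simp
  then have "compactin (product_topology (%_. euclideanreal) UNIV)
      (\<Pi>\<^sub>E i\<in>UNIV. if i < d then {t. \<bar>t - x i\<bar> <= r} else {0})"
    by (subst compactin_PiE) auto
  moreover have "(\<Pi>\<^sub>E i\<in>UNIV. if i < d then {t. \<bar>t - x i\<bar> <= r} else {0}) = {y:Rn d. ALL i<d. \<bar>y i - x i\<bar> <= r}"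
    by (auto simp: Rn_iff PiE_iff split: if_splits)
  ultimately show ?thesis by (simp add: euclidean_product_topology)
qed

lemma openin_Rn: "open_Rn d (Rn d)"
  by (rule openin_topspace)

lemma (in chart) compactin_inv_image:
  assumes "compact K" "K \<subseteq> phi ` U"
  shows "compactin (mtop M) (inv_into U phi ` K)"
proof (rule image_compactin[OF _ inv_continuous])
  have "K \<subseteq> Rn (mdim M)" using assms openin_subset[OF image_open] by auto
  then show "compactin (subtopology (Euclidean_space (mdim M)) (phi ` U)) K"
    using assms by (simp add: compactin_subtopology compactin_Rn)
qed

text \<open>The function is a cut-off of the square \<open>N\<close> of the distance in a chart. The
  closed set \<open>C\<close> is compact in the chart, hence closed by the Hausdorff property, which
  makes extension by zero smooth.\<close>

lemma exists_plateau:
  assumes M: "smooth_manifold M" and W: "openin (mtop M) W" and p: "p \<in> W"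
  obtains \<beta> :: "'a => real" and W' C where
    "smooth_fn M (topspace (mtop M)) \<beta>" "openin (mtop M) W'" "p \<in> W'" "W' \<subseteq> W"
    "!!q. q \<in> W' ==> \<beta> q = 1" "closedin (mtop M) C" "C \<subseteq> W" "!!q. q ~: C ==> \<beta> q = 0"
proof -
  have pre: "pre_manifold M" using M by (rule smooth_manifold_pre)
  have "p \<in> topspace (mtop M)" using openin_subset[OF W] p by auto
  then obtain U phi where c: "(U, phi) \<in> atlas M" "p \<in> U" "chart M U phi" using chart_exists[OF pre] by blast
  interpret chart M U phi by fact
  let ?d = "mdim M"
  have UW: "openin (mtop M) (U Int W)" using dom_open W by auto
  have img: "open_Rn ?d (phi ` (U Int W))" using UW by (intro open_image) auto
  obtain r where r: "r > 0" "!!y. y \<in> Rn ?d ==> (!!i. i < ?d ==> \<bar>y i - phi p i\<bar> < r) ==> y \<in> phi ` (U Int W)"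
    using openin_Euclidean_box[OF img, of "phi p"] p c(2) by blast
  define K where "K = {y:Rn ?d. ALL i<?d. \<bar>y i - phi p i\<bar> <= r / 2}"
  have KUW: "K \<subseteq> phi ` (U Int W)"
  proof
    fix y assume "y \<in> K"
    then show "y \<in> phi ` (U Int W)" unfolding K_def using r(1) by (intro r(2)) force+
  qed
  define C where "C = inv_into U phi ` K"
  have "compact K" unfolding K_def by (rule compact_box)
  then have "compactin (mtop M) C" unfolding C_def
    using KUW by (intro compactin_inv_image) auto
  then have C: "closedin (mtop M) C"
    using M by (intro compactin_imp_closedin) (simp add: smooth_manifold_def)
  have CW: "C \<subseteq> W" using KUW by (auto simp: C_def)
  define N where "N y = (\<Sum>i<?d. (y i - phi p i) * (y i - phi p i))" for y
  define s where "s = (r / 2) * (r / 2)"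
  have s: "s > 0" using r(1) by (simp add: s_def)
  have NK: "y \<in> K" if "y \<in> Rn ?d" "N y <= s" for y
    unfolding K_def
  proof (intro CollectI conjI that allI impI)
    fix i assume i: "i < ?d"
    have "(y i - phi p i) * (y i - phi p i) <= N y"
      unfolding N_def using i by (intro member_le_sum[of i _ "%i. (y i - phi p i) * (y i - phi p i)"]) auto
    then have "\<bar>y i - phi p i\<bar>\<^sup>2 <= (r / 2)\<^sup>2" using that(2) by (simp add: s_def power2_eq_square)
    then show "\<bar>y i - phi p i\<bar> <= r / 2" using r(1) by (simp add: abs_le_square_iff[symmetric])
  qed
  have N: "Cinf ?d (Rn ?d) N"
    unfolding N_def by (intro Cinf_sum Cinf_mult Cinf_diff Cinf_coord Cinf_const openin_Rn)
  define b where "b y = flat 0 (s - N y)" for y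
  define g where "g y = flat 0 (N y - s / 2)" for y
  have bg: "b y + g y > 0" for y
    using s by (auto simp: b_def g_def flat_def add_nonneg_pos add_pos_nonneg)
  define \<beta>0 where "\<beta>0 y = b y * inverse (b y + g y)" for y
  have bC: "Cinf ?d (Rn ?d) b" "Cinf ?d (Rn ?d) g"
    unfolding b_def g_def by (intro Cinf_flat Cinf_diff N Cinf_const openin_Rn)+
  have \<beta>0: "Cinf ?d (Rn ?d) \<beta>0"
    unfolding \<beta>0_def using bg by (intro Cinf_mult Cinf_inverse Cinf_add bC) (simp add: less_imp_neq[symmetric])
  define \<beta> where "\<beta> q = (if q \<in> U then \<beta>0 (phi q) else 0)" for q
  have zero: "\<beta> q = 0" if "q ~: C" for q
  proof (cases "q \<in> U")
    case True
    then have "phi q ~: K" using that inv_chart unfolding C_def by (metis imageI)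
    then have "N (phi q) > s" using NK in_Rn[OF True] by force
    then show ?thesis using True by (simp add: \<beta>_def \<beta>0_def b_def flat_def)
  qed (simp add: \<beta>_def)
  show ?thesis
  proof
    show "smooth_fn M (topspace (mtop M)) \<beta>"
    proof (rule smooth_fn_local[OF pre])
      fix q assume q: "q \<in> topspace (mtop M)"
      show "EX Q. q \<in> Q & Q \<subseteq> topspace (mtop M) & smooth_fn M Q \<beta>"
      proof (cases "q \<in> U")
        case True
        have "smooth_fn M U (%q. \<beta>0 (phi q))"
          using in_Rn by (intro smooth_fn_chart_compose[OF dom_open subset_refl \<beta>0]) auto
        then have "smooth_fn M U \<beta>" by (rule smooth_fn_cong[THEN iffD1, OF _ pre, rotated]) (simp add: \<beta>_def)
        then show ?thesis using True dom_subset by blast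
      next
        case False
        have "C \<subseteq> U" using KUW inv_in by (auto simp: C_def)
        then have q': "q \<in> topspace (mtop M) - C" using q False by auto
        have "smooth_fn M (topspace (mtop M) - C) (%_. 0 :: real)"
          using C by (intro smooth_fn_const[OF pre]) auto
        then have "smooth_fn M (topspace (mtop M) - C) \<beta>"
          by (rule smooth_fn_cong[THEN iffD1, OF _ pre, rotated]) (simp add: zero)
        then show ?thesis using q' by (intro exI[of _ "topspace (mtop M) - C"] conjI) auto
      qed
    qed
    have opN: "open_Rn ?d {y:Rn ?d. N y \<in> {..<s / 2}}"
      by (rule openin_continuous_preimage_Euclidean[OF openin_Rn Cinf_continuous[OF N]]) simp
    show "openin (mtop M) {q:U. phi q \<in> {y:Rn ?d. N y \<in> {..<s / 2}}}" by (rule open_preimage[OF opN])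
    show "p \<in> {q:U. phi q \<in> {y:Rn ?d. N y \<in> {..<s / 2}}}"
      using c(2) in_Rn s by (auto simp: N_def)
    show "{q:U. phi q \<in> {y:Rn ?d. N y \<in> {..<s / 2}}} \<subseteq> W"
    proof clarify
      fix q assume q: "q \<in> U" "phi q \<in> Rn ?d" "N (phi q) < s / 2"
      then have "phi q \<in> phi ` (U Int W)" using NK[of "phi q"] s KUW by auto
      then show "q \<in> W" using q(1) inj_onD[OF inj] by blast
    qed
    show "\<beta> q = 1" if "q \<in> {q:U. phi q \<in> {y:Rn ?d. N y \<in> {..<s / 2}}}" for q
    proof -
      have "g (phi q) = 0" using that by (simp add: g_def flat_def)
      then show ?thesis using that bg[of "phi q"] by (simp add: \<beta>_def \<beta>0_def)
    qed
  qed (use C CW zero in auto)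
qed

text \<open>Algebra elements are globally defined; this lets them replace local coordinate functions.\<close>

lemma extend_smooth_fn:
  assumes M: "smooth_manifold M" and h: "smooth_fn M W h" and p: "p \<in> W"
  obtains F W' where "smooth_fn M (topspace (mtop M)) F" "openin (mtop M) W'" "p \<in> W'" "W' \<subseteq> W"
    "!!q. q \<in> W' ==> F q = h q"
proof -
  have pre: "pre_manifold M" using M by (rule smooth_manifold_pre)
  note W = smooth_fn_open[OF h]
  obtain \<beta> :: "'a => real" and W' C where
    b: "smooth_fn M (topspace (mtop M)) \<beta>" "openin (mtop M) W'" "p \<in> W'" "W' \<subseteq> W"
    "!!q. q \<in> W' ==> \<beta> q = 1" "closedin (mtop M) C" "C \<subseteq> W" "!!q. q ~: C ==> \<beta> q = 0"
    using exists_plateau[OF M W p] by metis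
  define F where "F q = (if q \<in> W then \<beta> q *\<^sub>R h q else 0)" for q
  have "smooth_fn M (topspace (mtop M)) F"
  proof (rule smooth_fn_local[OF pre])
    fix q assume q: "q \<in> topspace (mtop M)"
    show "EX Q. q \<in> Q & Q \<subseteq> topspace (mtop M) & smooth_fn M Q F"
    proof (cases "q \<in> W")
      case True
      have "smooth_fn M W (%q. \<beta> q *\<^sub>R h q)"
        by (rule smooth_fn_lift2[OF pre smooth_fn_subset[OF pre b(1) W openin_subset[OF W]] h Cinf_scaleR])
      then have "smooth_fn M W F" by (rule smooth_fn_cong[THEN iffD1, OF _ pre, rotated]) (simp add: F_def)
      then show ?thesis using True openin_subset[OF W] by blast
    next
      case False
      then have q': "q \<in> topspace (mtop M) - C" using q b(7) by auto
      have "smooth_fn M (topspace (mtop M) - C) (%_. 0 :: 'b)"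
        using b(6) by (intro smooth_fn_const[OF pre]) auto
      then have "smooth_fn M (topspace (mtop M) - C) F"
        by (rule smooth_fn_cong[THEN iffD1, OF _ pre, rotated]) (simp add: F_def b(8))
      then show ?thesis using q' by (intro exI[of _ "topspace (mtop M) - C"] conjI) auto
    qed
  qed
  moreover have "F q = h q" if "q \<in> W'" for q using that b(4,5) by (auto simp: F_def)
  ultimately show ?thesis using that b(2-4) by blast
qed

section \<open>The Frechet algebra of smooth functions\<close>

lemma C_infinity_simps [simp]:
  "carrier (C_infinity P) = smooth_functions P"
  "f \<otimes>\<^bsub>C_infinity P\<^esub> g = (\<lambda>x\<in>topspace (mtop P). f x * g x)"
  "\<one>\<^bsub>C_infinity P\<^esub> = (\<lambda>x\<in>topspace (mtop P). 1)"
  "\<zero>\<^bsub>C_infinity P\<^esub> = (\<lambda>x\<in>topspace (mtop P). 0)"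
  "f \<oplus>\<^bsub>C_infinity P\<^esub> g = (\<lambda>x\<in>topspace (mtop P). f x + g x)"
  "c \<odot>\<^bsub>C_infinity P\<^esub> f = (\<lambda>x\<in>topspace (mtop P). c * f x)"
  "topo (C_infinity P) = smooth_functions_topology P"
  by (simp_all add: C_infinity_def)

definition fdiff :: "'a manifold => ('a => complex) => ('a => complex) => 'a => complex" where
  "fdiff P f g = (\<lambda>x\<in>topspace (mtop P). f x - g x)"

type_synonym 'a seminorm_index = "('a set \<times> ('a => nat => real)) \<times> vec set \<times> vec list"

definition valid_index :: "'a manifold => 'a seminorm_index => bool" where
  "valid_index P j \<longleftrightarrow> (case j of ((U, phi), K, vs) =>
     (U, phi) \<in> atlas P & compact K & K \<subseteq> phi ` U & set vs \<subseteq> Rn (mdim P))"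

lemma valid_indexE:
  assumes "valid_index P j"
  obtains U phi K vs where "j = ((U, phi), K, vs)" "(U, phi) \<in> atlas P" "compact K" "K \<subseteq> phi ` U" "set vs \<subseteq> Rn (mdim P)"
  using assms by (cases j) (auto simp: valid_index_def)

definition chart_deriv :: "'a set \<times> ('a => nat => real) => vec list => ('a => complex) => vec => complex" where
  "chart_deriv c vs f = iter_dird (%x. f (inv_into (fst c) (snd c) x)) vs"

text \<open>The value \<open>0\<close> is inserted so that the supremum makes sense for empty \<open>K\<close>.\<close>

definition sn :: "'a seminorm_index => ('a => complex) => real" where
  "sn j f = (case j of (c, K, vs) => Sup (insert 0 ((%x. cmod (chart_deriv c vs f x)) ` K)))"

locale smooth_algebra =
  fixes P :: "'a manifold" assumes P: "pre_manifold P"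
begin

abbreviation "A == smooth_functions P"
abbreviation "X == topspace (mtop P)"
abbreviation "d == mdim P"
abbreviation "T == smooth_functions_topology P"

lemma A_iff: "f \<in> A \<longleftrightarrow> f \<in> extensional X & smooth_fn P X f"
  by (rule smooth_functions_iff[OF P])

lemma restrict_A: "smooth_fn P X f ==> restrict f X \<in> A"
  unfolding A_iff by (auto intro: smooth_fn_cong[THEN iffD1, OF _ P, rotated])

lemma smooth_A: "f \<in> A ==> smooth_fn P X f"
  by (simp add: A_iff)

lemma A_ext: "f \<in> A ==> f \<in> extensional X"
  by (simp add: A_iff)

lemma A_eqI: "f \<in> A ==> g \<in> A ==> (!!x. x \<in> X ==> f x = g x) ==> f = g"
  by (rule extensionalityI[OF A_ext A_ext])

lemma openin_X: "openin (mtop P) X" by (rule openin_topspace)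

lemma A_const: "(\<lambda>x\<in>X. c) \<in> A"
  by (intro restrict_A smooth_fn_const[OF P openin_X])

lemma A_add: "f \<in> A ==> g \<in> A ==> (\<lambda>x\<in>X. f x + g x) \<in> A"
  by (intro restrict_A smooth_fn_add[OF P] smooth_A)

lemma A_diff: "f \<in> A ==> g \<in> A ==> fdiff P f g \<in> A"
  unfolding fdiff_def by (intro restrict_A smooth_fn_diff[OF P] smooth_A)

lemma A_mult: "f \<in> A ==> g \<in> A ==> (\<lambda>x\<in>X. f x * g x) \<in> A"
  by (intro restrict_A smooth_fn_mult[OF P] smooth_A)

lemma A_smult: "f \<in> A ==> (\<lambda>x\<in>X. c * f x) \<in> A"
  by (intro restrict_A smooth_fn_mult[OF P] smooth_A smooth_fn_const[OF P openin_X])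

lemma in_chart:
  assumes "f \<in> A" "(U, phi) \<in> atlas P"
  shows "Cinf d (phi ` U) (%x. f (inv_into U phi x))"
proof -
  have "U Int X = U" using chart.dom_subset[OF chartI[OF P assms(2)]] by auto
  then show ?thesis using smooth_fn_in_chart[OF smooth_A[OF assms(1)] assms(2)] by simp
qed

lemma inv_in_X:
  assumes "(U, phi) \<in> atlas P" "x \<in> phi ` U"
  shows "inv_into U phi x \<in> X"
  using chart.dom_subset[OF chartI[OF P assms(1)]] inv_into_into[OF assms(2)] by auto

lemma chart_deriv_cong:
  assumes "(U, phi) \<in> atlas P" "set vs \<subseteq> Rn d" "x \<in> phi ` U" "!!p. p \<in> X ==> f p = g p"
  shows "chart_deriv (U, phi) vs f x = chart_deriv (U, phi) vs g x"
  unfolding chart_deriv_def fst_conv snd_conv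
  by (rule iter_dird_cong[OF chart.image_open[OF chartI[OF P assms(1)]] _ assms(2,3)])
    (rule assms(4)[OF inv_in_X[OF assms(1)]])

lemma chart_deriv_add:
  assumes "f \<in> A" "g \<in> A" "(U, phi) \<in> atlas P" "set vs \<subseteq> Rn d" "x \<in> phi ` U"
  shows "chart_deriv (U, phi) vs (\<lambda>x\<in>X. f x + g x) x = chart_deriv (U, phi) vs f x + chart_deriv (U, phi) vs g x"
proof -
  have "chart_deriv (U, phi) vs (\<lambda>x\<in>X. f x + g x) x = chart_deriv (U, phi) vs (%x. f x + g x) x"
    by (rule chart_deriv_cong[OF assms(3-5)]) simp
  also have "... = chart_deriv (U, phi) vs f x + chart_deriv (U, phi) vs g x"
    unfolding chart_deriv_def fst_conv snd_conv
    by (rule iter_dird_add[OF in_chart in_chart assms(4,5)]) (use assms in auto)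
  finally show ?thesis .
qed

lemma chart_deriv_smult:
  assumes "f \<in> A" "(U, phi) \<in> atlas P" "set vs \<subseteq> Rn d" "x \<in> phi ` U"
  shows "chart_deriv (U, phi) vs (\<lambda>x\<in>X. c * f x) x = c * chart_deriv (U, phi) vs f x"
proof -
  have "chart_deriv (U, phi) vs (\<lambda>x\<in>X. c * f x) x = chart_deriv (U, phi) vs (%x. c * f x) x"
    by (rule chart_deriv_cong[OF assms(2-4)]) simp
  also have "... = c * chart_deriv (U, phi) vs f x"
    unfolding chart_deriv_def fst_conv snd_conv
    by (rule bounded_linear.iter_dird_linear[OF bounded_linear_mult_right in_chart[OF assms(1,2)] assms(3,4)])
  finally show ?thesis .
qed

lemma fdiff_eq: "fdiff P f g = (\<lambda>x\<in>X. f x + (\<lambda>x\<in>X. (-1) * g x) x)"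
  by (auto simp: fdiff_def)

lemma chart_deriv_fdiff:
  assumes "f \<in> A" "g \<in> A" "(U, phi) \<in> atlas P" "set vs \<subseteq> Rn d" "x \<in> phi ` U"
  shows "chart_deriv (U, phi) vs (fdiff P f g) x = chart_deriv (U, phi) vs f x - chart_deriv (U, phi) vs g x"
  unfolding fdiff_eq using chart_deriv_add[OF assms(1) A_smult[OF assms(2)] assms(3-5), of "-1"]
    chart_deriv_smult[OF assms(2-5), of "-1"] by simp

lemma chart_deriv_continuous:
  assumes "f \<in> A" "(U, phi) \<in> atlas P" "set vs \<subseteq> Rn d"
  shows "continuous_on (phi ` U) (chart_deriv (U, phi) vs f)"
  unfolding chart_deriv_def fst_conv snd_conv
  by (rule Cinf_continuous[OF Cinf_iter_dird[OF in_chart[OF assms(1,2)] assms(3)]])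

lemma sn_bdd:
  assumes "f \<in> A" "valid_index P (c, K, vs)"
  shows "bdd_above (insert 0 ((%x. cmod (chart_deriv c vs f x)) ` K))"
proof -
  obtain U phi where c: "c = (U, phi)" by (cases c)
  have "continuous_on K (%x. cmod (chart_deriv c vs f x))"
    using chart_deriv_continuous[OF assms(1), of U phi vs] assms(2)
    by (auto simp: valid_index_def c intro!: continuous_on_norm continuous_on_subset[of "phi ` U"])
  then have "compact ((%x. cmod (chart_deriv c vs f x)) ` K)"
    using assms(2) by (intro compact_continuous_image) (auto simp: valid_index_def c)
  then show ?thesis by (simp add: bounded_imp_bdd_above compact_imp_bounded)
qed

lemma sn_bound:
  assumes "f \<in> A" "valid_index P (c, K, vs)" "x \<in> K"
  shows "cmod (chart_deriv c vs f x) <= sn (c, K, vs) f"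
  unfolding sn_def prod.case using assms sn_bdd[OF assms(1,2)] by (intro cSup_upper) auto

lemma sn_le:
  assumes "0 <= B" "!!x. x \<in> K ==> cmod (chart_deriv c vs f x) <= B"
  shows "sn (c, K, vs) f <= B"
  unfolding sn_def prod.case using assms by (intro cSup_least) auto

lemma sn_nonneg: "f \<in> A ==> valid_index P j ==> 0 <= sn j f"
  by (cases j) (auto simp: sn_def intro!: cSup_upper[OF _ sn_bdd])

lemma sn_less_iff:
  assumes f: "f \<in> A" and j: "valid_index P (c, K, vs)" and e: "e > 0"
  shows "sn (c, K, vs) f < e \<longleftrightarrow> (ALL x:K. cmod (chart_deriv c vs f x) < e)"
proof
  assume "sn (c, K, vs) f < e"
  then show "ALL x:K. cmod (chart_deriv c vs f x) < e" using sn_bound[OF f j] by force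
next
  assume *: "ALL x:K. cmod (chart_deriv c vs f x) < e"
  obtain U phi where c: "c = (U, phi)" by (cases c)
  have cont: "continuous_on K (%x. cmod (chart_deriv c vs f x))"
    using chart_deriv_continuous[OF f, of U phi vs] j
    by (auto simp: valid_index_def c intro!: continuous_on_norm continuous_on_subset[of "phi ` U"])
  show "sn (c, K, vs) f < e"
  proof (cases "K = {}")
    case True
    then show ?thesis using e by (simp add: sn_def)
  next
    case False
    have "compact K" using j by (simp add: valid_index_def split_beta)
    then obtain x where x: "x \<in> K" "!!y. y \<in> K ==> cmod (chart_deriv c vs f y) <= cmod (chart_deriv c vs f x)"
      using continuous_attains_sup[OF _ False cont] by blast
    have "sn (c, K, vs) f <= cmod (chart_deriv c vs f x)" by (rule sn_le) (use x in auto)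
    then show ?thesis using * x(1) by force
  qed
qed

lemma valid_indexD:
  assumes "valid_index P (c, K, vs)" "x \<in> K"
  obtains U phi where "c = (U, phi)" "(U, phi) \<in> atlas P" "set vs \<subseteq> Rn d" "x \<in> phi ` U"
  using assms by (cases c) (auto simp: valid_index_def)

lemma sn_add:
  assumes "f \<in> A" "g \<in> A" "valid_index P j"
  shows "sn j (\<lambda>x\<in>X. f x + g x) <= sn j f + sn j g"
proof -
  obtain c K vs where j: "j = (c, K, vs)" by (cases j)
  show ?thesis unfolding j
  proof (rule sn_le)
    show "0 <= sn (c, K, vs) f + sn (c, K, vs) g" using sn_nonneg assms j by (simp add: add_nonneg_nonneg)
    fix x assume x: "x \<in> K"
    obtain U phi where c: "c = (U, phi)" "(U, phi) \<in> atlas P" "set vs \<subseteq> Rn d" "x \<in> phi ` U"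
      using valid_indexD x assms(3) j by metis
    have "cmod (chart_deriv c vs (\<lambda>x\<in>X. f x + g x) x) <= cmod (chart_deriv c vs f x) + cmod (chart_deriv c vs g x)"
      unfolding c(1) chart_deriv_add[OF assms(1,2) c(2-4)] by (rule norm_triangle_ineq)
    then show "cmod (chart_deriv c vs (\<lambda>x\<in>X. f x + g x) x) <= sn (c, K, vs) f + sn (c, K, vs) g"
      using sn_bound[OF assms(1) assms(3)[unfolded j] x] sn_bound[OF assms(2) assms(3)[unfolded j] x] by linarith
  qed
qed

lemma sn_smult:
  assumes "f \<in> A" "valid_index P j"
  shows "sn j (\<lambda>x\<in>X. a * f x) <= cmod a * sn j f"
proof -
  obtain c K vs where j: "j = (c, K, vs)" by (cases j)
  show ?thesis unfolding j
  proof (rule sn_le)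
    show "0 <= cmod a * sn (c, K, vs) f" using sn_nonneg assms j by simp
    fix x assume x: "x \<in> K"
    obtain U phi where c: "c = (U, phi)" "(U, phi) \<in> atlas P" "set vs \<subseteq> Rn d" "x \<in> phi ` U"
      using valid_indexD x assms(2) j by metis
    show "cmod (chart_deriv c vs (\<lambda>x\<in>X. a * f x) x) <= cmod a * sn (c, K, vs) f"
      unfolding c(1) chart_deriv_smult[OF assms(1) c(2-4)] norm_mult
      using sn_bound[OF assms(1) _ x, of c vs] assms(2) j c(1) by (intro mult_left_mono) auto
  qed
qed

lemma sn_zero: "valid_index P j ==> sn j (\<lambda>x\<in>X. 0) = 0"
  using sn_smult[OF A_const[of 0], of j 0] sn_nonneg[OF A_const[of 0], of j] by (simp cong: restrict_cong)

lemma fdiff_self: "fdiff P f f = (\<lambda>x\<in>X. 0)"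
  by (simp add: fdiff_def)

lemma sn_triangle:
  assumes "f \<in> A" "g \<in> A" "h \<in> A" "valid_index P j"
  shows "sn j (fdiff P f h) <= sn j (fdiff P f g) + sn j (fdiff P g h)"
proof -
  have "fdiff P f h = (\<lambda>x\<in>X. fdiff P f g x + fdiff P g h x)" by (auto simp: fdiff_def)
  then show ?thesis using sn_add[OF A_diff[OF assms(1,2)] A_diff[OF assms(2,3)] assms(4)] by simp
qed

lemma sn_sym:
  assumes "f \<in> A" "g \<in> A" "valid_index P j"
  shows "sn j (fdiff P f g) = sn j (fdiff P g f)"
proof -
  have eq: "fdiff P f g = (\<lambda>x\<in>X. (-1) * fdiff P g f x)" for f g by (auto simp: fdiff_def)
  have "sn j (fdiff P f g) <= sn j (fdiff P g f)" if "f \<in> A" "g \<in> A" for f g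
    unfolding eq[of f g] using sn_smult[OF A_diff[OF that(2,1)] assms(3), of "-1"] by simp
  then show ?thesis using assms by (intro antisym) auto
qed

definition sn_ball :: "'a seminorm_index set => real => ('a => complex) => ('a => complex) set" where
  "sn_ball J e f = {g:A. ALL j:J. sn j (fdiff P g f) < e}"

text \<open>The topology is the one of the seminorms \<open>sn\<close>: a pointwise strict bound on a
  compact set is a strict bound of the supremum.\<close>

lemma T_subbasis:
  "T = topology_generated_by (insert A {sn_ball {j} e f | j e f. valid_index P j & 0 < e & f \<in> A})"
proof -
  have *: "{g:A. ALL x:K. cmod (iter_deriv (euclid d) scalars (g o inv_into U phi) vs x -
               iter_deriv (euclid d) scalars (f o inv_into U phi) vs x) < e} = sn_ball {((U, phi), K, vs)} e f"
    if "f \<in> A" "valid_index P ((U, phi), K, vs)" "0 < e" for f U phi K vs e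
  proof -
    have v: "(U, phi) \<in> atlas P" "set vs \<subseteq> Rn d" "K \<subseteq> phi ` U" using that(2) by (auto simp: valid_index_def)
    have "iter_deriv (euclid d) scalars (g o inv_into U phi) vs x = chart_deriv (U, phi) vs g x"
      if "g \<in> A" "x \<in> K" for g x
      using iter_deriv_scalars[OF in_chart[OF that(1) v(1)] v(2), of x] v(3) that(2)
      by (auto simp: chart_deriv_def o_def)
    then show ?thesis
      using sn_less_iff[OF A_diff[OF _ that(1)] that(2,3)] chart_deriv_fdiff[OF _ that(1) v(1,2)] v(3) that(1)
      by (auto simp: sn_ball_def subset_iff)
  qed
  have "{{g:A. ALL x:K. cmod (iter_deriv (euclid d) scalars (g o inv_into U phi) vs x -
               iter_deriv (euclid d) scalars (f o inv_into U phi) vs x) < \<epsilon>}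
      |f U phi K vs \<epsilon>. f \<in> A & (U, phi) \<in> atlas P &
        compactin (Euclidean_space d) K & K \<subseteq> phi ` U &
        set vs \<subseteq> carrier (euclid d) & 0 < \<epsilon>} = {sn_ball {j} e f | j e f. valid_index P j & 0 < e & f \<in> A}"
    (is "?L = ?R")
  proof (intro equalityI subsetI)
    fix S assume "S \<in> ?L"
    then obtain f U phi K vs e where S: "S = {g:A. ALL x:K. cmod (iter_deriv (euclid d) scalars (g o inv_into U phi) vs x -
               iter_deriv (euclid d) scalars (f o inv_into U phi) vs x) < e}"
      and v: "f \<in> A" "(U, phi) \<in> atlas P" "compactin (Euclidean_space d) K" "K \<subseteq> phi ` U" "set vs \<subseteq> Rn d" "0 < e"
      by auto
    then have vi: "valid_index P ((U, phi), K, vs)" by (simp add: valid_index_def compactin_Rn)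
    show "S \<in> ?R" unfolding S *[OF v(1) vi v(6)] using v vi by blast
  next
    fix S assume "S \<in> ?R"
    then obtain j e f where S: "S = sn_ball {j} e f" "valid_index P j" "0 < e" "f \<in> A" by blast
    obtain U phi K vs where j: "j = ((U, phi), K, vs)" and v: "(U, phi) \<in> atlas P" "compact K" "K \<subseteq> phi ` U" "set vs \<subseteq> Rn d"
      using S(2) by (rule valid_indexE)
    have "K \<subseteq> Rn d" using v(3) openin_subset[OF chart.image_open[OF chartI[OF P v(1)]]] by auto
    then have "compactin (Euclidean_space d) K" using v(2) by (simp add: compactin_Rn)
    then show "S \<in> ?L"
      using *[OF S(4), of U phi K vs e] S v unfolding j euclid_simps(1) by blast
  qed
  then show ?thesis unfolding smooth_functions_topology_def by simp
qed

lemma topspace_T [simp]: "topspace T = A"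
  unfolding T_subbasis topology_generated_by_topspace by (auto simp: sn_ball_def)

lemma sn_ball_open:
  assumes "finite J" "!!j. j \<in> J ==> valid_index P j" "0 < e" "f \<in> A"
  shows "openin T (sn_ball J e f)"
  using assms(1,2)
proof (induction J)
  case empty
  have "sn_ball {} e f = topspace T" by (simp add: sn_ball_def)
  then show ?case by (metis openin_topspace)
next
  case (insert j J)
  have "openin T (sn_ball {j} e f)"
    unfolding T_subbasis using insert.prems assms by (intro topology_generated_by_Basis) blast
  moreover have "sn_ball (insert j J) e f = sn_ball {j} e f Int sn_ball J e f" by (auto simp: sn_ball_def)
  ultimately show ?case using insert by auto
qed

lemma sn_ball_center: "f \<in> A ==> 0 < e ==> (!!j. j \<in> J ==> valid_index P j) ==> f \<in> sn_ball J e f"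
  by (simp add: sn_ball_def fdiff_self sn_zero)

lemma sn_ball_nbhd:
  assumes "openin T W" "f \<in> W"
  obtains J e where "finite J" "!!j. j \<in> J ==> valid_index P j" "e > 0" "sn_ball J e f \<subseteq> W"
proof -
  let ?B = "insert A {sn_ball {j} e f | j e f. valid_index P j & 0 < e & f \<in> A}"
  have "generate_topology_on ?B W"
    using assms(1) unfolding T_subbasis openin_topology_generated_by_iff .
  then have "ALL f:W. EX J e. finite J & (ALL j:J. valid_index P j) & e > 0 & sn_ball J e f \<subseteq> W"
  proof induction
    case (Int a b)
    show ?case
    proof
      fix f assume "f \<in> a Int b"
      then have f: "f \<in> a" "f \<in> b" by auto
      obtain J e where J: "finite J" "ALL j:J. valid_index P j" "e > 0" "sn_ball J e f \<subseteq> a"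
        using bspec[OF Int.IH(1) f(1)] by blast
      obtain K e' where K: "finite K" "ALL j:K. valid_index P j" "e' > 0" "sn_ball K e' f \<subseteq> b"
        using bspec[OF Int.IH(2) f(2)] by blast
      note * = J K
      have "sn_ball (J Un K) (min e e') f \<subseteq> a Int b" using *(4,8) by (auto simp: sn_ball_def)
      then show "EX J e. finite J & (ALL j:J. valid_index P j) & e > 0 & sn_ball J e f \<subseteq> a Int b"
        using * by (intro exI[of _ "J Un K"] exI[of _ "min e e'"]) auto
    qed
  next
    case (UN K)
    show ?case
    proof
      fix f assume "f \<in> \<Union> K"
      then obtain k where k: "k \<in> K" "f \<in> k" by blast
      then obtain J e where "finite J" "ALL j:J. valid_index P j" "e > 0" "sn_ball J e f \<subseteq> k"
        using bspec[OF UN.IH[OF k(1)] k(2)] by blast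
      then show "EX J e. finite J & (ALL j:J. valid_index P j) & e > 0 & sn_ball J e f \<subseteq> \<Union> K"
        using k by (intro exI[of _ J] exI[of _ e]) auto
    qed
  next
    case (Basis S)
    show ?case
    proof
      fix f assume f: "f \<in> S"
      show "EX J e. finite J & (ALL j:J. valid_index P j) & e > 0 & sn_ball J e f \<subseteq> S"
      proof (cases "S = A")
        case True
        then show ?thesis by (intro exI[of _ "{}"] exI[of _ 1]) (auto simp: sn_ball_def)
      next
        case False
        then obtain j e f0 where S: "S = sn_ball {j} e f0" "valid_index P j" "0 < e" "f0 \<in> A"
          using Basis by blast
        have fA: "f \<in> A" and less: "sn j (fdiff P f f0) < e" using f by (auto simp: S(1) sn_ball_def)
        have "g \<in> S" if g: "g \<in> sn_ball {j} (e - sn j (fdiff P f f0)) f" for g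
        proof -
          have "g \<in> A" "sn j (fdiff P g f) < e - sn j (fdiff P f f0)" using g by (auto simp: sn_ball_def)
          then show ?thesis
            using sn_triangle[of g f f0 j] fA S by (auto simp: sn_ball_def)
        qed
        then show ?thesis using S less by (intro exI[of _ "{j}"] exI[of _ "e - sn j (fdiff P f f0)"]) auto
      qed
    qed
  qed auto
  then show ?thesis using assms(2) that by meson
qed

lemma limitin_T:
  "limitin T F f L \<longleftrightarrow> f \<in> A & (\<forall>\<^sub>F t in L. F t \<in> A) &
     (ALL j. valid_index P j --> ((%t. sn j (fdiff P (F t) f)) \<longlongrightarrow> 0) L)"
proof (intro iffI conjI allI impI)
  assume lim: "limitin T F f L"
  then show f: "f \<in> A" using limitin_topspace by fastforce
  show ev: "\<forall>\<^sub>F t in L. F t \<in> A" using limitinD[OF lim, of A] f openin_topspace[of T] by simp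
  fix j assume j: "valid_index P j"
  show "((%t. sn j (fdiff P (F t) f)) \<longlongrightarrow> 0) L"
  proof (rule tendstoI)
    fix e :: real assume e: "e > 0"
    have "\<forall>\<^sub>F t in L. F t \<in> sn_ball {j} e f"
      using j e f by (intro limitinD[OF lim] sn_ball_open sn_ball_center) auto
    then show "\<forall>\<^sub>F t in L. dist (sn j (fdiff P (F t) f)) 0 < e"
      by eventually_elim (use sn_nonneg[OF A_diff[OF _ f] j] in "auto simp: sn_ball_def")
  qed
next
  assume *: "f \<in> A & (\<forall>\<^sub>F t in L. F t \<in> A) &
     (ALL j. valid_index P j --> ((%t. sn j (fdiff P (F t) f)) \<longlongrightarrow> 0) L)"
  show "limitin T F f L"
    unfolding limitin_def
  proof (intro conjI allI impI)
    show "f \<in> topspace T" using * by simp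
    fix W assume "openin T W & f \<in> W"
    then obtain J e where J: "finite J" "!!j. j \<in> J ==> valid_index P j" "e > 0" "sn_ball J e f \<subseteq> W"
      using sn_ball_nbhd by metis
    have "\<forall>\<^sub>F t in L. sn j (fdiff P (F t) f) < e" if "j \<in> J" for j
    proof -
      have "((%t. sn j (fdiff P (F t) f)) \<longlongrightarrow> 0) L" using * J(2)[OF that] by blast
      then show ?thesis using J(3) by (rule order_tendstoD)
    qed
    then have "\<forall>\<^sub>F t in L. ALL j:J. sn j (fdiff P (F t) f) < e" using J(1) by (intro eventually_ball_finite) auto
    moreover have "\<forall>\<^sub>F t in L. F t \<in> A" using * by blast
    ultimately show "\<forall>\<^sub>F t in L. F t \<in> W"
      by eventually_elim (use J(4) in "auto simp: sn_ball_def")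
  qed
qed

lemma continuous_map_T:
  "continuous_map Y T F \<longleftrightarrow> (ALL y:topspace Y. F y \<in> A) &
     (ALL y:topspace Y. ALL j. valid_index P j --> ((%t. sn j (fdiff P (F t) (F y))) \<longlongrightarrow> 0) (atin Y y))"
  unfolding continuous_map_atin limitin_T by (auto simp: eventually_atin)

end

lemma norm_sum_list: "norm (\<Sum>x\<leftarrow>xs. f x) <= (\<Sum>x\<leftarrow>xs. norm (f x))"
  by (induction xs) (auto intro: norm_triangle_le)

context smooth_algebra
begin

lemma limitin_T_squeeze:
  assumes "f \<in> A" "\<forall>\<^sub>F t in L. F t \<in> A"
    and "!!j. valid_index P j ==> EX G. (\<forall>\<^sub>F t in L. sn j (fdiff P (F t) f) <= G t) & (G \<longlongrightarrow> 0) L"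
  shows "limitin T F f L"
  unfolding limitin_T
proof (intro conjI assms allI impI)
  fix j assume j: "valid_index P j"
  obtain G where G: "\<forall>\<^sub>F t in L. sn j (fdiff P (F t) f) <= G t" "(G \<longlongrightarrow> 0) L" using assms(3)[OF j] by blast
  have "\<forall>\<^sub>F t in L. 0 <= sn j (fdiff P (F t) f)"
    using assms(2) by eventually_elim (use sn_nonneg[OF A_diff[OF _ assms(1)] j] in auto)
  then show "((%t. sn j (fdiff P (F t) f)) \<longlongrightarrow> 0) L"
    by (rule tendsto_sandwich[OF _ G(1) tendsto_const G(2)])
qed

lemma limitin_T_tendsto:
  "limitin T F f L ==> valid_index P j ==> ((%t. sn j (fdiff P (F t) f)) \<longlongrightarrow> 0) L"
  unfolding limitin_T by blast

lemma continuous_map_T_in: "continuous_map Y T F ==> y \<in> topspace Y ==> F y \<in> A"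
  by (auto simp: continuous_map_T)

lemma limitin_T_add:
  assumes "limitin T F f L" "limitin T G g L"
  shows "limitin T (%y. \<lambda>x\<in>X. F y x + G y x) (\<lambda>x\<in>X. f x + g x) L"
proof (rule limitin_T_squeeze)
  have fg: "f \<in> A" "g \<in> A" and ev: "\<forall>\<^sub>F t in L. F t \<in> A" "\<forall>\<^sub>F t in L. G t \<in> A"
    using assms unfolding limitin_T by auto
  then show "(\<lambda>x\<in>X. f x + g x) \<in> A" by (intro A_add)
  from ev show "\<forall>\<^sub>F t in L. (\<lambda>x\<in>X. F t x + G t x) \<in> A" by eventually_elim (rule A_add)
  fix j assume j: "valid_index P j"
  show "EX H. (\<forall>\<^sub>F t in L. sn j (fdiff P (\<lambda>x\<in>X. F t x + G t x) (\<lambda>x\<in>X. f x + g x)) <= H t) & (H \<longlongrightarrow> 0) L"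
  proof (intro exI conjI)
    from ev show "\<forall>\<^sub>F t in L. sn j (fdiff P (\<lambda>x\<in>X. F t x + G t x) (\<lambda>x\<in>X. f x + g x))
        <= sn j (fdiff P (F t) f) + sn j (fdiff P (G t) g)"
    proof eventually_elim
      case (elim t)
      have "fdiff P (\<lambda>x\<in>X. F t x + G t x) (\<lambda>x\<in>X. f x + g x) = (\<lambda>x\<in>X. fdiff P (F t) f x + fdiff P (G t) g x)"
        by (auto simp: fdiff_def)
      then show ?case using sn_add[OF A_diff[OF elim(1) fg(1)] A_diff[OF elim(2) fg(2)] j] by simp
    qed
    have "((%t. sn j (fdiff P (F t) f) + sn j (fdiff P (G t) g)) \<longlongrightarrow> 0 + 0) L"
      by (intro tendsto_add limitin_T_tendsto assms j)
    then show "((%t. sn j (fdiff P (F t) f) + sn j (fdiff P (G t) g)) \<longlongrightarrow> 0) L" by simp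
  qed
qed

lemma limitin_T_smult:
  assumes "(c \<longlongrightarrow> c0) L" "limitin T F f L"
  shows "limitin T (%y. \<lambda>x\<in>X. c y * F y x) (\<lambda>x\<in>X. c0 * f x) L"
proof (rule limitin_T_squeeze)
  have f: "f \<in> A" and ev: "\<forall>\<^sub>F t in L. F t \<in> A" using assms unfolding limitin_T by auto
  then show "(\<lambda>x\<in>X. c0 * f x) \<in> A" by (intro A_smult)
  from ev show "\<forall>\<^sub>F t in L. (\<lambda>x\<in>X. c t * F t x) \<in> A" by eventually_elim (rule A_smult)
  fix j assume j: "valid_index P j"
  show "EX H. (\<forall>\<^sub>F t in L. sn j (fdiff P (\<lambda>x\<in>X. c t * F t x) (\<lambda>x\<in>X. c0 * f x)) <= H t) & (H \<longlongrightarrow> 0) L"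
  proof (intro exI conjI)
    from ev show "\<forall>\<^sub>F t in L. sn j (fdiff P (\<lambda>x\<in>X. c t * F t x) (\<lambda>x\<in>X. c0 * f x))
        <= cmod (c t) * sn j (fdiff P (F t) f) + cmod (c t - c0) * sn j f"
    proof eventually_elim
      case (elim t)
      have "fdiff P (\<lambda>x\<in>X. c t * F t x) (\<lambda>x\<in>X. c0 * f x) =
          (\<lambda>x\<in>X. (\<lambda>x\<in>X. c t * fdiff P (F t) f x) x + (\<lambda>x\<in>X. (c t - c0) * f x) x)"
        by (auto simp: fdiff_def algebra_simps)
      then have "sn j (fdiff P (\<lambda>x\<in>X. c t * F t x) (\<lambda>x\<in>X. c0 * f x)) <=
          sn j (\<lambda>x\<in>X. c t * fdiff P (F t) f x) + sn j (\<lambda>x\<in>X. (c t - c0) * f x)"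
        using sn_add[OF A_smult[OF A_diff[OF elim f]] A_smult[OF f] j] by simp
      also have "... <= cmod (c t) * sn j (fdiff P (F t) f) + cmod (c t - c0) * sn j f"
        by (intro add_mono sn_smult A_diff elim f j)
      finally show ?case .
    qed
    have "((%t. cmod (c t) * sn j (fdiff P (F t) f) + cmod (c t - c0) * sn j f) \<longlongrightarrow> cmod c0 * 0 + cmod (c0 - c0) * sn j f) L"
      by (intro tendsto_intros limitin_T_tendsto assms j)
    then show "((%t. cmod (c t) * sn j (fdiff P (F t) f) + cmod (c t - c0) * sn j f) \<longlongrightarrow> 0) L" by simp
  qed
qed

text \<open>Leibniz' rule bounds each seminorm of a product.\<close>

lemma sn_mult:
  assumes j: "valid_index P j"
  obtains ps where "!!a b. (a, b) \<in> set ps ==> valid_index P a & valid_index P b"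
    "!!f g. f \<in> A ==> g \<in> A ==> sn j (\<lambda>x\<in>X. f x * g x) <= (\<Sum>(a, b)\<leftarrow>ps. sn a f * sn b g)"
proof -
  obtain U phi K vs where jj: "j = ((U, phi), K, vs)" and v: "(U, phi) \<in> atlas P" "compact K" "K \<subseteq> phi ` U" "set vs \<subseteq> Rn d"
    using j by (rule valid_indexE)
  obtain ps where ps: "!!us ws. (us, ws) \<in> set ps ==> set us \<subseteq> Rn d & set ws \<subseteq> Rn d"
    "!!U (f :: _ => complex) g x. Cinf d U f ==> Cinf d U g ==> x \<in> U ==>
      iter_dird (%x. f x * g x) vs x = (\<Sum>(us, ws)\<leftarrow>ps. iter_dird f us x * iter_dird g ws x)"
    by (rule bounded_bilinear.iter_dird_prod[OF bounded_bilinear_mult v(4)]) (rule that)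
  define qs where "qs = map (%(us, ws). (((U, phi), K, us), ((U, phi), K, ws))) ps"
  have val: "valid_index P a & valid_index P b" if "(a, b) \<in> set qs" for a b
    using that ps(1) v by (fastforce simp: qs_def valid_index_def)
  show ?thesis
  proof (rule that[of qs])
    fix f g assume fg: "f \<in> A" "g \<in> A"
    have nn: "0 <= sn a f * sn b g" if "(a, b) \<in> set qs" for a b
      using val[OF that] fg by (intro mult_nonneg_nonneg sn_nonneg) auto
    show "sn j (\<lambda>x\<in>X. f x * g x) <= (\<Sum>(a, b)\<leftarrow>qs. sn a f * sn b g)"
      unfolding jj
    proof (rule sn_le)
      show "0 <= (\<Sum>(a, b)\<leftarrow>qs. sn a f * sn b g)" using nn by (intro sum_list_nonneg) auto
      fix x assume x: "x \<in> K"
      have "chart_deriv (U, phi) vs (\<lambda>x\<in>X. f x * g x) x = chart_deriv (U, phi) vs (%x. f x * g x) x"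
        using x v by (intro chart_deriv_cong) auto
      also have "... = (\<Sum>(us, ws)\<leftarrow>ps. chart_deriv (U, phi) us f x * chart_deriv (U, phi) ws g x)"
        unfolding chart_deriv_def fst_conv snd_conv
        using x v by (intro ps(2)[of "phi ` U"] in_chart fg) auto
      finally have "cmod (chart_deriv (U, phi) vs (\<lambda>x\<in>X. f x * g x) x) <=
          (\<Sum>(us, ws)\<leftarrow>ps. cmod (chart_deriv (U, phi) us f x * chart_deriv (U, phi) ws g x))"
        using norm_sum_list[of "%(us, ws). chart_deriv (U, phi) us f x * chart_deriv (U, phi) ws g x" ps]
        by (simp add: case_prod_unfold)
      also have "... <= (\<Sum>(us, ws)\<leftarrow>ps. sn ((U, phi), K, us) f * sn ((U, phi), K, ws) g)"
      proof (rule sum_list_mono)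
        fix p assume "p \<in> set ps"
        then have p: "set (fst p) \<subseteq> Rn d" "set (snd p) \<subseteq> Rn d" using ps(1)[of "fst p" "snd p"] by auto
        have vv: "valid_index P ((U, phi), K, fst p)" "valid_index P ((U, phi), K, snd p)"
          using p v by (auto simp: valid_index_def)
        show "(case p of (us, ws) => cmod (chart_deriv (U, phi) us f x * chart_deriv (U, phi) ws g x))
          <= (case p of (us, ws) => sn ((U, phi), K, us) f * sn ((U, phi), K, ws) g)"
          unfolding case_prod_unfold norm_mult
          by (intro mult_mono sn_bound fg vv x sn_nonneg norm_ge_zero)
      qed
      also have "... = (\<Sum>(a, b)\<leftarrow>qs. sn a f * sn b g)"
        by (simp add: qs_def o_def case_prod_unfold)
      finally show "cmod (chart_deriv (U, phi) vs (\<lambda>x\<in>X. f x * g x) x) <= (\<Sum>(a, b)\<leftarrow>qs. sn a f * sn b g)" .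
    qed
  qed (use val in auto)
qed

lemma limitin_T_mult:
  assumes "limitin T F f L" "limitin T G g L"
  shows "limitin T (%y. \<lambda>x\<in>X. F y x * G y x) (\<lambda>x\<in>X. f x * g x) L"
proof (rule limitin_T_squeeze)
  have fg: "f \<in> A" "g \<in> A" and ev: "\<forall>\<^sub>F t in L. F t \<in> A" "\<forall>\<^sub>F t in L. G t \<in> A"
    using assms unfolding limitin_T by auto
  then show "(\<lambda>x\<in>X. f x * g x) \<in> A" by (intro A_mult)
  from ev show "\<forall>\<^sub>F t in L. (\<lambda>x\<in>X. F t x * G t x) \<in> A" by eventually_elim (rule A_mult)
  fix j assume j: "valid_index P j"
  obtain ps where ps: "!!a b. (a, b) \<in> set ps ==> valid_index P a & valid_index P b"
    "!!f g. f \<in> A ==> g \<in> A ==> sn j (\<lambda>x\<in>X. f x * g x) <= (\<Sum>(a, b)\<leftarrow>ps. sn a f * sn b g)"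
    by (rule sn_mult[OF j]) (rule that)
  let ?S = "%f g. \<Sum>(a, b)\<leftarrow>ps. sn a f * sn b g"
  let ?H = "%t. ?S (fdiff P (F t) f) (fdiff P (G t) g) + ?S (fdiff P (F t) f) g + ?S f (fdiff P (G t) g)"
  have tend: "((%t. \<Sum>(a, b)\<leftarrow>qs. U a b t) \<longlongrightarrow> 0) L"
    if "!!a b. (a, b) \<in> set qs ==> (U a b \<longlongrightarrow> 0) L" for qs and U :: "_ => _ => _ => real"
    using that
  proof (induction qs)
    case (Cons q qs)
    have "((%t. (case q of (a, b) => U a b t) + (\<Sum>(a, b)\<leftarrow>qs. U a b t)) \<longlongrightarrow> 0 + 0) L"
      using Cons by (cases q, intro tendsto_add) auto
    then show ?case by simp
  qed simp
  show "EX H. (\<forall>\<^sub>F t in L. sn j (fdiff P (\<lambda>x\<in>X. F t x * G t x) (\<lambda>x\<in>X. f x * g x)) <= H t) & (H \<longlongrightarrow> 0) L"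
  proof (intro exI[of _ ?H] conjI)
    from ev show "\<forall>\<^sub>F t in L. sn j (fdiff P (\<lambda>x\<in>X. F t x * G t x) (\<lambda>x\<in>X. f x * g x)) <= ?H t"
    proof eventually_elim
      case (elim t)
      let ?u = "fdiff P (F t) f" and ?w = "fdiff P (G t) g"
      have uw: "?u \<in> A" "?w \<in> A" using elim fg by (auto intro: A_diff)
      have "fdiff P (\<lambda>x\<in>X. F t x * G t x) (\<lambda>x\<in>X. f x * g x) =
          (\<lambda>x\<in>X. (\<lambda>x\<in>X. (\<lambda>x\<in>X. ?u x * ?w x) x + (\<lambda>x\<in>X. ?u x * g x) x) x + (\<lambda>x\<in>X. f x * ?w x) x)"
        by (auto simp: fdiff_def algebra_simps)
      then have "sn j (fdiff P (\<lambda>x\<in>X. F t x * G t x) (\<lambda>x\<in>X. f x * g x)) <=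
          sn j (\<lambda>x\<in>X. (\<lambda>x\<in>X. ?u x * ?w x) x + (\<lambda>x\<in>X. ?u x * g x) x) + sn j (\<lambda>x\<in>X. f x * ?w x)"
        using sn_add[OF A_add[OF A_mult[OF uw] A_mult[OF uw(1) fg(2)]] A_mult[OF fg(1) uw(2)] j] by simp
      also have "... <= sn j (\<lambda>x\<in>X. ?u x * ?w x) + sn j (\<lambda>x\<in>X. ?u x * g x) + sn j (\<lambda>x\<in>X. f x * ?w x)"
        by (intro add_mono sn_add A_mult uw fg j order_refl)
      also have "... <= ?H t" by (intro add_mono ps(2) uw fg)
      finally show ?case .
    qed
    have z: "((%t. sn a (fdiff P (F t) f)) \<longlongrightarrow> 0) L" "((%t. sn b (fdiff P (G t) g)) \<longlongrightarrow> 0) L"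
      if "(a, b) \<in> set ps" for a b using ps(1)[OF that] by (auto intro: limitin_T_tendsto assms)
    have "(?H \<longlongrightarrow> 0 + 0 + 0) L"
      by (intro tendsto_add tend tendsto_mult_zero tendsto_mult_left_zero tendsto_mult_right_zero z)
    then show "(?H \<longlongrightarrow> 0) L" by simp
  qed
qed

lemma abelian_group_A: "abelian_group (C_infinity P)"
proof (rule abelian_groupI)
  fix f assume "f \<in> carrier (C_infinity P)"
  then have f: "f \<in> A" by simp
  show "\<zero>\<^bsub>C_infinity P\<^esub> \<oplus>\<^bsub>C_infinity P\<^esub> f = f"
    using A_ext[OF f] by (auto simp: extensional_def fun_eq_iff)
  show "EX g:carrier (C_infinity P). g \<oplus>\<^bsub>C_infinity P\<^esub> f = \<zero>\<^bsub>C_infinity P\<^esub>"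
    using A_smult[OF f, of "-1"] by (intro bexI[of _ "\<lambda>x\<in>X. (-1) * f x"]) (auto simp: fun_eq_iff)
qed (auto simp: A_add A_const add_ac fun_eq_iff)

lemma ring_A: "ring (C_infinity P)"
proof (rule ringI[OF abelian_group_A])
  show "monoid (C_infinity P)"
  proof (rule monoidI)
    fix f assume "f \<in> carrier (C_infinity P)"
    then have f: "f \<in> A" by simp
    show "\<one>\<^bsub>C_infinity P\<^esub> \<otimes>\<^bsub>C_infinity P\<^esub> f = f" "f \<otimes>\<^bsub>C_infinity P\<^esub> \<one>\<^bsub>C_infinity P\<^esub> = f"
      using A_ext[OF f] by (auto simp: extensional_def fun_eq_iff)
  qed (auto simp: A_mult A_const fun_eq_iff)
qed (auto simp: fun_eq_iff algebra_simps)

lemma minus_A: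
  assumes "f \<in> A" "g \<in> A"
  shows "f \<ominus>\<^bsub>C_infinity P\<^esub> g = fdiff P f g"
proof -
  have "\<ominus>\<^bsub>C_infinity P\<^esub> g = (\<lambda>x\<in>X. (-1) * g x)"
    using assms A_smult[OF assms(2), of "-1"]
    by (intro abelian_group.minus_equality[OF abelian_group_A]) (auto simp: fun_eq_iff)
  then show ?thesis by (auto simp: a_minus_def fdiff_def fun_eq_iff)
qed

lemma module_A: "module (scalar_ring :: complex ring) (C_infinity P)"
proof (rule moduleI[OF _ abelian_group_A])
  show "cring (scalar_ring :: complex ring)"
  proof (rule cringI)
    show "abelian_group (scalar_ring :: complex ring)"
    proof (rule abelian_groupI)
      fix x :: complex
      show "EX y:carrier scalar_ring. y \<oplus>\<^bsub>scalar_ring\<^esub> x = \<zero>\<^bsub>scalar_ring\<^esub>"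
        by (intro bexI[of _ "- x"]) (auto simp: scalar_ring_def)
    qed (auto simp: scalar_ring_def)
    show "Group.comm_monoid (scalar_ring :: complex ring)"
      by (rule comm_monoidI) (auto simp: scalar_ring_def)
  qed (auto simp: scalar_ring_def algebra_simps)
  fix f assume "f \<in> carrier (C_infinity P)"
  then have f: "f \<in> A" by simp
  show "\<one>\<^bsub>scalar_ring\<^esub> \<odot>\<^bsub>C_infinity P\<^esub> f = f"
    using A_ext[OF f] by (auto simp: extensional_def fun_eq_iff scalar_ring_def)
qed (auto simp: A_smult fun_eq_iff algebra_simps scalar_ring_def)

lemma point_index:
  assumes "p \<in> X"
  obtains j where "valid_index P j" "!!f. f \<in> A ==> cmod (f p) <= sn j f"
proof -
  obtain U phi where c: "(U, phi) \<in> atlas P" "p \<in> U" "chart P U phi" using chart_exists[OF P assms] by blast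
  interpret chart P U phi by fact
  have v: "valid_index P ((U, phi), {phi p}, [])" using c by (simp add: valid_index_def)
  have "cmod (f p) <= sn ((U, phi), {phi p}, []) f" if "f \<in> A" for f
    using sn_bound[OF that v, of "phi p"] c(2) by (simp add: chart_deriv_def)
  then show ?thesis using v that by blast
qed

lemma Hausdorff_T: "Hausdorff_space T"
  unfolding Hausdorff_space_def
proof (intro allI impI)
  fix f g assume "f \<in> topspace T & g \<in> topspace T & f ~= g"
  then have fg: "f \<in> A" "g \<in> A" "f ~= g" by auto
  then obtain p where p: "p \<in> X" "f p ~= g p" using A_eqI by blast
  obtain j where j: "valid_index P j" "!!f. f \<in> A ==> cmod (f p) <= sn j f" using point_index[OF p(1)] by blast
  define e where "e = sn j (fdiff P f g) / 2"
  have "0 < cmod (fdiff P f g p)" using p by (simp add: fdiff_def)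
  then have e: "e > 0" unfolding e_def using j(2)[OF A_diff[OF fg(1,2)]] by linarith
  have "disjnt (sn_ball {j} e f) (sn_ball {j} e g)"
  proof -
    have False if "h \<in> A" "sn j (fdiff P h f) < e" "sn j (fdiff P h g) < e" for h
      using sn_triangle[OF fg(1) that(1) fg(2) j(1)] sn_sym[OF fg(1) that(1) j(1)] that by (simp add: e_def)
    then show ?thesis by (auto simp: disjnt_iff sn_ball_def)
  qed
  then show "EX U V. openin T U & openin T V & f \<in> U & g \<in> V & disjnt U V"
    using fg e j(1)
    by (intro exI[of _ "sn_ball {j} e f"] exI[of _ "sn_ball {j} e g"])
      (auto intro!: sn_ball_open sn_ball_center)
qed

lemma fdiff_zero: "f \<in> A ==> fdiff P f (\<lambda>x\<in>X. 0) = f"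
  using A_ext[of f] by (auto simp: fdiff_def extensional_def fun_eq_iff)

text \<open>The algebra axioms hold pointwise, continuity of the operations is that of seminorm limits,
  and balls of seminorms are convex.\<close>

lemma lc_algebra_A: "lc_algebra (C_infinity P)"
proof -
  let ?C = "C_infinity P"
  have fst_snd: "limitin T fst (fst p) (atin (prod_topology T T) p)"
    "limitin T snd (snd p) (atin (prod_topology T T) p)" if "p \<in> topspace (prod_topology T T)" for p
    using continuous_map_fst[of T T] continuous_map_snd[of T T] that by (auto simp: continuous_map_atin)
  have cadd: "continuous_map (prod_topology (topo ?C) (topo ?C)) (topo ?C) (%(x, y). x \<oplus>\<^bsub>?C\<^esub> y)"
    and cmult: "continuous_map (prod_topology (topo ?C) (topo ?C)) (topo ?C) (%(x, y). x \<otimes>\<^bsub>?C\<^esub> y)"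
    unfolding C_infinity_simps continuous_map_atin case_prod_unfold
    using limitin_T_add[OF fst_snd] limitin_T_mult[OF fst_snd] by blast+
  have csm: "continuous_map (prod_topology euclidean (topo ?C)) (topo ?C) (%(c, x). c \<odot>\<^bsub>?C\<^esub> x)"
    unfolding C_infinity_simps continuous_map_atin case_prod_unfold
  proof
    fix p assume p: "p \<in> topspace (prod_topology (euclidean :: complex topology) T)"
    show "limitin T (%p. \<lambda>x\<in>X. fst p * snd p x) (\<lambda>x\<in>X. fst p * snd p x) (atin (prod_topology euclidean T) p)"
    proof (rule limitin_T_smult)
      have "limitin euclidean fst (fst p) (atin (prod_topology euclidean T) p)"
        using continuous_map_fst[of euclidean T] p unfolding continuous_map_atin by blast
      then show "(fst \<longlongrightarrow> fst p) (atin (prod_topology euclidean T) p)" by simp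
      show "limitin T snd (snd p) (atin (prod_topology euclidean T) p)"
        using continuous_map_snd[of euclidean T] p unfolding continuous_map_atin by blast
    qed
  qed
  have conv: "EX V. openin (topo ?C) V & \<zero>\<^bsub>?C\<^esub> \<in> V & V \<subseteq> U & (ALL f:V. ALL g:V. ALL t::real. 0 <= t & t <= 1 -->
      (of_real t \<odot>\<^bsub>?C\<^esub> f) \<oplus>\<^bsub>?C\<^esub> (of_real (1 - t) \<odot>\<^bsub>?C\<^esub> g) \<in> V)" if "openin (topo ?C) U & \<zero>\<^bsub>?C\<^esub> \<in> U" for U
  proof -
    have U: "openin T U" "(\<lambda>x\<in>X. 0) \<in> U" using that by simp_all
    obtain J e where J: "finite J" "!!j. j \<in> J ==> valid_index P j" "e > 0" "sn_ball J e (\<lambda>x\<in>X. 0) \<subseteq> U"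
      using sn_ball_nbhd[OF U] by metis
    have "(of_real t \<odot>\<^bsub>?C\<^esub> f) \<oplus>\<^bsub>?C\<^esub> (of_real (1 - t) \<odot>\<^bsub>?C\<^esub> g) \<in> sn_ball J e (\<lambda>x\<in>X. 0)"
      if fg: "f \<in> sn_ball J e (\<lambda>x\<in>X. 0)" "g \<in> sn_ball J e (\<lambda>x\<in>X. 0)" and t: "0 <= t" "t <= 1" for f g and t :: real
    proof -
      have A: "f \<in> A" "g \<in> A" using fg by (auto simp: sn_ball_def)
      let ?h = "\<lambda>x\<in>X. (\<lambda>x\<in>X. of_real t * f x) x + (\<lambda>x\<in>X. of_real (1 - t) * g x) x"
      have h: "?h \<in> A" by (intro A_add A_smult A)
      have "sn j ?h < e" if j: "j \<in> J" for j
      proof -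
        have l: "sn j f < e" "sn j g < e" using fg j A by (auto simp: sn_ball_def fdiff_zero)
        have "sn j ?h <= sn j (\<lambda>x\<in>X. of_real t * f x) + sn j (\<lambda>x\<in>X. of_real (1 - t) * g x)"
          by (intro sn_add A_smult A J(2) j)
        also have "... <= cmod (of_real t) * sn j f + cmod (of_real (1 - t)) * sn j g"
          by (intro add_mono sn_smult A J(2) j)
        also have "... = t * sn j f + (1 - t) * sn j g"
          using t by (simp add: norm_of_real del: of_real_diff)
        also have "... < e" using convex_bound_lt[OF l, of t "1 - t"] t by simp
        finally show ?thesis .
      qed
      then show ?thesis using h by (simp add: sn_ball_def fdiff_zero)
    qed
    then show ?thesis
      using J by (intro exI[of _ "sn_ball J e (\<lambda>x\<in>X. 0)"]) (auto intro: sn_ball_open sn_ball_center A_const)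
  qed
  have "lc_space ?C"
    unfolding lc_space_def
  proof (intro conjI module_A cadd csm allI impI)
    show "topspace (topo ?C) = carrier ?C" "Hausdorff_space (topo ?C)" using Hausdorff_T by simp_all
  qed (rule conv)
  then show ?thesis
    unfolding lc_algebra_def by (intro conjI ring_A cmult) (auto simp: fun_eq_iff)
qed

lemma A_inverse: "f \<in> A ==> (!!x. x \<in> X ==> f x ~= 0) ==> (\<lambda>x\<in>X. inverse (f x)) \<in> A"
  by (intro restrict_A smooth_fn_inverse[OF P] smooth_A)

text \<open>Pointwise inverses of nowhere vanishing smooth functions are smooth.\<close>

lemma Units_A: "f \<in> A ==> f \<in> Units (C_infinity P) \<longleftrightarrow> (ALL x:X. f x ~= 0)"
proof
  assume f: "f \<in> A" "f \<in> Units (C_infinity P)"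
  then obtain g where g: "(\<lambda>x\<in>X. f x * g x) = (\<lambda>x\<in>X. 1)" by (auto simp: Units_def)
  show "ALL x:X. f x ~= 0"
  proof
    fix x assume x: "x \<in> X"
    then have "f x * g x = 1" using fun_cong[OF g, of x] by simp
    then show "f x ~= 0" by auto
  qed
next
  assume f: "f \<in> A" "ALL x:X. f x ~= 0"
  then show "f \<in> Units (C_infinity P)"
    using A_inverse[OF f(1)] by (auto simp: Units_def fun_eq_iff intro!: bexI[of _ "\<lambda>x\<in>X. inverse (f x)"])
qed

end

section \<open>Straightening independent functions\<close>

lemma openin_coord_preimage:
  assumes V: "open_Rn d V" and W: "open_Rn m W"
    and g: "!!x. x \<in> V ==> g x \<in> Rn m" "!!j. j < m ==> continuous_on V (%x. g x j)"
  shows "open_Rn d {x:V. g x \<in> W}"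
proof -
  have sub: "subtopology (Euclidean_space d) V = top_of_set V" by (rule subtopology_Rn[OF openin_subset[OF V]])
  have "continuous_map (subtopology (Euclidean_space d) V) (Euclidean_space m) g"
    unfolding continuous_map_Euclidean_space sub using g by auto
  from openin_continuous_map_preimage[OF this W]
  have "openin (subtopology (Euclidean_space d) V) {x:V. g x \<in> W}"
    using openin_subset[OF V] by (simp add: Int_absorb1)
  then show ?thesis using V by (simp add: openin_open_subtopology)
qed

text \<open>A pair of mutually inverse smooth maps between open sets, with the second one given
  explicitly.\<close>

definition diffeo_on ::
  "nat => vec set => (vec => nat => real) => (vec => nat => real) => bool" where
  "diffeo_on d S f g \<longleftrightarrow>
     open_Rn d S & open_Rn d (f ` S) & (ALL x:S. g (f x) = x) &
     (ALL i<d. Cinf d S (%x. f x i)) & (ALL i<d. Cinf d (f ` S) (%y. g y i))"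

lemma diffeo_onD:
  assumes "diffeo_on d S f g"
  shows "open_Rn d S" "open_Rn d (f ` S)" "!!x. x \<in> S ==> g (f x) = x"
    "!!i. i < d ==> Cinf d S (%x. f x i)" "!!i. i < d ==> Cinf d (f ` S) (%y. g y i)"
    "!!x. x \<in> S ==> f x \<in> Rn d" "!!y. y \<in> f ` S ==> g y \<in> S" "!!y. y \<in> f ` S ==> f (g y) = y" "S \<subseteq> Rn d"
  using assms openin_subset[of "Euclidean_space d" "f ` S"] openin_subset[of "Euclidean_space d" S]
  unfolding diffeo_on_def by auto

lemma diffeo_on_compose:
  assumes f: "diffeo_on d S f g" and f': "diffeo_on d S' f' g'"
  shows "diffeo_on d {x:S. f x \<in> S'} (%x. f' (f x)) (%y. g (g' y))"
proof -
  note D = diffeo_onD[OF f] and D' = diffeo_onD[OF f']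
  have S: "open_Rn d {x:S. f x \<in> S'}"
    by (rule openin_coord_preimage[OF D(1) D'(1) D(6) Cinf_continuous[OF D(4)]])
  have img: "(%x. f' (f x)) ` {x:S. f x \<in> S'} = {y:f' ` S'. g' y \<in> f ` S}"
    using D(3,8) D'(3,8) by (auto simp: image_iff)
  have I: "open_Rn d {y:f' ` S'. g' y \<in> f ` S}"
    using D'(7,9) by (intro openin_coord_preimage[OF D'(2) D(2) _ Cinf_continuous[OF D'(5)]]) auto
  show ?thesis
    unfolding diffeo_on_def img
  proof (intro conjI S I ballI allI impI)
    fix i assume i: "i < d"
    show "Cinf d {x:S. f x \<in> S'} (%x. f' (f x) i)"
      by (rule Cinf_compose[OF S D'(4)[OF i]]) (auto intro: Cinf_subset[OF D(4) S])
    show "Cinf d {y:f' ` S'. g' y \<in> f ` S} (%y. g (g' y) i)"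
      by (rule Cinf_compose[OF I D(5)[OF i]]) (auto intro: Cinf_subset[OF D'(5) I])
  qed (use D(3) D'(3) in auto)
qed

lemma diffeo_on_swap:
  assumes "j < d" "k < d"
  shows "diffeo_on d (Rn d) (%x i. x (Transposition.transpose j k i)) (%x i. x (Transposition.transpose j k i))"
proof -
  let ?f = "\<lambda>x :: nat => real. %i. x (Transposition.transpose j k i)"
  have inv: "?f (?f x) = x" for x by auto
  have mem: "?f x \<in> Rn d" if "x \<in> Rn d" for x
    using that assms by (auto simp: Rn_iff Transposition.transpose_def)
  have img: "?f ` Rn d = Rn d"
  proof
    show "?f ` Rn d \<subseteq> Rn d" using mem by blast
    show "Rn d \<subseteq> ?f ` Rn d"
    proof
      fix x assume "x \<in> Rn d"
      then show "x \<in> ?f ` Rn d" using mem inv[of x] by (intro image_eqI[of _ _ "?f x"]) auto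
    qed
  qed
  show ?thesis unfolding diffeo_on_def img by (auto intro: Cinf_coord openin_Rn)
qed

lemma diffeo_on_id: "open_Rn d S ==> diffeo_on d S (%x. x) (%x. x)"
  by (auto simp: diffeo_on_def intro: Cinf_coord)

text \<open>Extracts \<open>q \<approx> c / D\<close> from a relative estimate in which \<open>q\<close>
  itself occurs in the error: the part of the error proportional to \<open>q\<close> is absorbed by
  \<open>q * D\<close>.\<close>

lemma approximate_quotient:
  fixes c D :: real
  assumes D: "D ~= 0" and \<epsilon>: "\<epsilon> > 0"
  shows "EX e>0. ALL q. \<bar>c - q * D\<bar> <= e * (\<bar>q\<bar> + 1) --> \<bar>q - c / D\<bar> < \<epsilon>"
proof -
  define e where "e = min (\<bar>D\<bar> / 2) (\<epsilon> * \<bar>D\<bar>\<^sup>2 / (4 * (\<bar>c\<bar> + \<bar>D\<bar>)))"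
  have e1: "e <= \<bar>D\<bar> / 2" unfolding e_def by (rule min.cobounded1)
  have "e > 0" using assms by (auto simp: e_def intro!: divide_pos_pos add_nonneg_pos)
  moreover have "\<bar>q - c / D\<bar> < \<epsilon>" if q: "\<bar>c - q * D\<bar> <= e * (\<bar>q\<bar> + 1)" for q
  proof -
    have absorb: "k + a < 4 * (b + a)" if "k <= b + k / 2 + a / 2" "0 < a" "0 <= b" for k a b :: real
      using that by argo
    have "\<bar>q\<bar> * \<bar>D\<bar> <= \<bar>c\<bar> + \<bar>c - q * D\<bar>" by (simp add: abs_mult[symmetric])
    also have "\<bar>c - q * D\<bar> <= \<bar>D\<bar> / 2 * (\<bar>q\<bar> + 1)"
      by (rule order_trans[OF q mult_right_mono[OF e1]]) simp
    finally have "\<bar>q\<bar> * \<bar>D\<bar> <= \<bar>c\<bar> + (\<bar>q\<bar> * \<bar>D\<bar>) / 2 + \<bar>D\<bar> / 2" by (simp add: algebra_simps add_divide_distrib)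
    from absorb[OF this] have "\<bar>q\<bar> * \<bar>D\<bar> + \<bar>D\<bar> < 4 * (\<bar>c\<bar> + \<bar>D\<bar>)" using D by simp
    then have 1: "(\<bar>q\<bar> + 1) * \<bar>D\<bar> < 4 * (\<bar>c\<bar> + \<bar>D\<bar>)" by (simp add: distrib_right)
    have "\<bar>q - c / D\<bar> * \<bar>D\<bar> = \<bar>c - q * D\<bar>"
      unfolding abs_mult[symmetric] using D by (simp add: left_diff_distrib abs_minus_commute)
    then have "\<bar>q - c / D\<bar> * \<bar>D\<bar>\<^sup>2 = \<bar>c - q * D\<bar> * \<bar>D\<bar>" by (simp only: power2_eq_square mult.assoc[symmetric])
    also have "... <= e * ((\<bar>q\<bar> + 1) * \<bar>D\<bar>)" using mult_right_mono[OF q, of "\<bar>D\<bar>"] by (simp add: mult.assoc)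
    also have "... < e * (4 * (\<bar>c\<bar> + \<bar>D\<bar>))" using 1 \<open>e > 0\<close> by simp
    also have "... <= \<epsilon> * \<bar>D\<bar>\<^sup>2 / (4 * (\<bar>c\<bar> + \<bar>D\<bar>)) * (4 * (\<bar>c\<bar> + \<bar>D\<bar>))"
      by (rule mult_right_mono) (auto simp: e_def)
    also have "... = \<epsilon> * \<bar>D\<bar>\<^sup>2" using D by (simp add: add_nonneg_eq_0_iff)
    finally show ?thesis by (rule mult_right_less_imp_less) simp
  qed
  ultimately show ?thesis by blast
qed

text \<open>Exchanging one coordinate for a function with non-vanishing partial derivative in that
  direction. The function is strictly monotone along the coordinate, so the intermediate value theorem
  inverts the exchange; the inverse has partial derivatives built from itself and those of the function.\<close>

lemma exchange_coordinate:
  assumes F: "Cinf d U F" and x0: "x0 \<in> U" and k: "k < d" and nz: "dird (unitv k) F x0 ~= (0 :: real)"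
  obtains S g where "x0 \<in> S" "S \<subseteq> U" "diffeo_on d S (%x. x(k := F x)) g"
proof -
  note U = Cinf_open[OF F]
  \<comment> \<open>The sign makes \<open>s * F\<close> increasing in the coordinate \<open>k\<close> near \<open>x0\<close>.\<close>
  define s where "s = sgn (dird (unitv k) F x0)"
  have s: "s * s = 1" "s ~= 0" using nz by (auto simp: s_def sgn_if)
  have Dk: "Cinf d U (dird (unitv k) F)" by (rule Cinf_dird[OF F unitv_in_Rn[OF k]])
  have "open_Rn d {x:U. dird (unitv k) F x \<in> {t. 0 < s * t}}"
    by (intro openin_continuous_preimage_Euclidean[OF U Cinf_continuous[OF Dk]] open_Collect_less continuous_intros)
  moreover have "x0 \<in> {x:U. dird (unitv k) F x \<in> {t. 0 < s * t}}"
    using x0 nz by (auto simp: s_def sgn_if)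
  ultimately obtain r where r: "r > 0"
    "!!y. y \<in> Rn d ==> (!!i. i < d ==> \<bar>y i - x0 i\<bar> < r) ==> y \<in> U & 0 < s * dird (unitv k) F y"
    by (rule openin_Euclidean_box) blast
  have x0R: "x0 \<in> Rn d" using x0 openin_subset[OF U] by blast
  define Q where "Q = {x:Rn d. ALL i<d. \<bar>x i - x0 i\<bar> < r}"
  have Q: "open_Rn d Q" unfolding Q_def by (rule open_box[OF x0R])
  have QU: "x \<in> U" "0 < s * dird (unitv k) F x" if "x \<in> Q" for x using r(2)[of x] that by (auto simp: Q_def)
  have FQ: "Cinf d Q F" using QU by (intro Cinf_subset[OF F Q]) auto
  define \<tau> where "\<tau> x = x(k := F x)" for x
  have upd: "x(k := t) \<in> Q" if "x \<in> Q" "\<bar>t - x0 k\<bar> < r" for x t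
    using that k by (auto simp: Q_def Rn_iff)
  have line: "((%t. F (x(k := t))) has_real_derivative dird (unitv k) F (x(k := t))) (at t)"
    if "x(k := t) \<in> Q" for x t
  proof -
    have eq: "x(k := u) = (%i. (x(k := 0)) i + u * unitv k i)" for u by (auto simp: unitv_def)
    have "has_dird F (unitv k) (x(k := t)) (dird (unitv k) F (x(k := t)))"
      by (rule Cinf_has_dird[OF FQ that unitv_in_Rn[OF k]])
    then have "has_dird F (unitv k) (%i. (x(k := 0)) i + t * unitv k i) (dird (unitv k) F (x(k := t)))"
      unfolding eq[symmetric] .
    from has_dird_line[OF this] show ?thesis
      unfolding eq[symmetric] by (simp add: has_real_derivative_iff_has_vector_derivative)
  qed
  have mono: "s * F (x(k := a)) < s * F (x(k := b))"
    if "a < b" "x \<in> Q" "\<bar>a - x0 k\<bar> < r" "\<bar>b - x0 k\<bar> < r" for x a b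
  proof -
    have "EX y. ((%t. s * F (x(k := t))) has_real_derivative y) (at t) & 0 < y" if "a <= t" "t <= b" for t
    proof -
      have t: "x(k := t) \<in> Q" using \<open>x \<in> Q\<close> \<open>\<bar>a - x0 k\<bar> < r\<close> \<open>\<bar>b - x0 k\<bar> < r\<close> that by (intro upd) auto
      show ?thesis using DERIV_cmult[OF line[OF t], of s] QU(2)[OF t] by blast
    qed
    then show ?thesis by (rule DERIV_pos_imp_increasing[OF \<open>a < b\<close>, of "%t. s * F (x(k := t))"])
  qed
  have inj: "inj_on \<tau> Q"
  proof (rule inj_onI)
    fix x y assume xy: "x \<in> Q" "y \<in> Q" "\<tau> x = \<tau> y"
    have off: "x i = y i" if "i ~= k" for i using fun_cong[OF xy(3), of i] that by (simp add: \<tau>_def)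
    have Feq: "F x = F y" using fun_cong[OF xy(3), of k] by (simp add: \<tau>_def)
    have y: "y = x(k := y k)" and x: "x = x(k := x k)" using off by auto
    have b: "\<bar>x k - x0 k\<bar> < r" "\<bar>y k - x0 k\<bar> < r" using xy k by (auto simp: Q_def)
    have "\<not> x k < y k" using mono[OF _ xy(1) b] x y Feq by (metis less_irrefl)
    moreover have "\<not> y k < x k" using mono[OF _ xy(1) b(2,1)] x y Feq by (metis less_irrefl)
    ultimately have "x k = y k" by simp
    then show "x = y" using y x by metis
  qed
  define g where "g = inv_into Q \<tau>"
  have g\<tau>: "g (\<tau> x) = x" if "x \<in> Q" for x unfolding g_def by (rule inv_into_f_f[OF inj that])
  have gQ: "g y \<in> Q" "\<tau> (g y) = y" if "y \<in> \<tau> ` Q" for y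
    unfolding g_def using inv_into_into[OF that] f_inv_into_f[OF that] by auto
  have goff: "g y i = y i" if "y \<in> \<tau> ` Q" "i ~= k" for y i
    using fun_cong[OF gQ(2)[OF that(1)], of i] that(2) by (simp add: \<tau>_def)
  have Fg: "F (g y) = y k" if "y \<in> \<tau> ` Q" for y
    using fun_cong[OF gQ(2)[OF that], of k] by (simp add: \<tau>_def)
  have nbhd: "EX \<delta>>0. ALL y:Rn d. (ALL i<d. \<bar>y i - \<tau> x i\<bar> < \<delta>) --> y \<in> \<tau> ` Q & \<bar>g y k - x k\<bar> <= e"
    if x: "x \<in> Q" and e: "e > 0" for x e
  proof -
    define e' where "e' = min e ((r - \<bar>x k - x0 k\<bar>) / 2)"
    have xk: "\<bar>x k - x0 k\<bar> < r" using x k by (simp add: Q_def)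
    then have e': "e' > 0" "e' <= e" using e by (auto simp: e'_def)
    have "e' <= (r - \<bar>x k - x0 k\<bar>) / 2" unfolding e'_def by (rule min.cobounded2)
    then have e'2: "2 * e' <= r - \<bar>x k - x0 k\<bar>" by simp
    define a b where "a = x k - e'" and "b = x k + e'"
    have ab: "\<bar>a - x0 k\<bar> < r" "\<bar>b - x0 k\<bar> < r" using xk e'(1) e'2 unfolding a_def b_def by (auto simp: abs_if split: if_splits)
    define Q' where "Q' = {y:Rn d. ALL i<d. \<bar>(y(k := x0 k)) i - x0 i\<bar> < r}"
    have Q': "open_Rn d Q'"
    proof -
      have "open_Rn d {y:Rn d. y(k := x0 k) \<in> Q}"
      proof (rule openin_coord_preimage[OF openin_Rn Q])
        show "continuous_on (Rn d) (%y. (y(k := x0 k)) j)" for j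
          by (cases "j = k") (auto intro: continuous_on_subset[OF continuous_on_product_coordinates])
      qed (use k in "auto simp: Rn_iff")
      moreover have "{y:Rn d. y(k := x0 k) \<in> Q} = Q'" using k by (auto simp: Q'_def Q_def Rn_iff)
      ultimately show ?thesis by simp
    qed
    have updQ: "y(k := t) \<in> Q" if "y \<in> Q'" "\<bar>t - x0 k\<bar> < r" for y t
      using that k unfolding Q_def Q'_def by (auto simp: Rn_iff split: if_splits)
    have cont: "continuous_on Q' (%y. s * F (y(k := t)) - s * y k)" if "\<bar>t - x0 k\<bar> < r" for t
    proof -
      have "Cinf d Q' (%y. F (y(k := t)))"
      proof (rule Cinf_compose[OF Q' FQ])
        show "Cinf d Q' (%y. (y(k := t)) j)" for j
          by (cases "j = k") (auto intro: Cinf_const Cinf_coord Q')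
      qed (use updQ that in auto)
      then show ?thesis
        using Cinf_continuous[of d Q' "%y. F (y(k := t))"] continuous_on_subset[OF continuous_on_product_coordinates, of Q' k]
        by (intro continuous_intros) auto
    qed
    define N where "N = {y:Q'. s * F (y(k := a)) - s * y k \<in> {..<0}} Int {y:Q'. s * F (y(k := b)) - s * y k \<in> {0<..}}"
    have N: "open_Rn d N"
      unfolding N_def by (intro openin_Int openin_continuous_preimage_Euclidean[OF Q' cont] ab) auto
    have "s * F (x(k := a)) < s * F (x(k := x k))" "s * F (x(k := x k)) < s * F (x(k := b))"
      using e'(1) by (intro mono x ab xk; simp add: a_def b_def)+
    moreover have "\<tau> x \<in> Q'" using x k by (auto simp: \<tau>_def Q_def Q'_def Rn_iff)
    ultimately have "\<tau> x \<in> N" by (simp add: N_def \<tau>_def)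
    then obtain \<delta> where \<delta>: "\<delta> > 0" "!!y. y \<in> Rn d ==> (!!i. i < d ==> \<bar>y i - \<tau> x i\<bar> < \<delta>) ==> y \<in> N"
      using openin_Euclidean_box[OF N] by metis
    have "y \<in> \<tau> ` Q & \<bar>g y k - x k\<bar> <= e" if y: "y \<in> N" for y
    proof -
      have yQ: "y \<in> Q'" "s * F (y(k := a)) <= s * y k" "s * y k <= s * F (y(k := b))" using y by (auto simp: N_def)
      have tb: "\<bar>t - x0 k\<bar> < r" if "a <= t" "t <= b" for t using ab that by linarith
      have "isCont (%t. s * F (y(k := t))) t" if "a <= t & t <= b" for t
        using line[OF updQ[OF yQ(1) tb]] that by (intro isCont_mult continuous_const) (auto intro: DERIV_isCont)
      then obtain t where t: "a <= t" "t <= b" "s * F (y(k := t)) = s * y k"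
        using IVT[of "%t. s * F (y(k := t))" a "s * y k" b] yQ e'(1) by (auto simp: a_def b_def)
      have tQ: "y(k := t) \<in> Q" by (rule updQ[OF yQ(1) tb[OF t(1,2)]])
      have y\<tau>: "\<tau> (y(k := t)) = y" using t(3) s(2) by (auto simp: \<tau>_def)
      then have "g y = y(k := t)" using g\<tau>[OF tQ] by simp
      then have "\<bar>g y k - x k\<bar> <= e" using t e' by (auto simp: a_def b_def)
      then show ?thesis using tQ y\<tau> by (metis imageI)
    qed
    then show ?thesis using \<delta> by blast
  qed
  have \<tau>R: "\<tau> ` Q \<subseteq> Rn d" using k by (auto simp: \<tau>_def Q_def Rn_iff)
  have img: "open_Rn d (\<tau> ` Q)"
  proof (rule openin_EuclideanI[OF \<tau>R])
    fix y assume "y \<in> \<tau> ` Q"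
    then show "EX r>0. ALL z:Rn d. near d r y z --> z \<in> \<tau> ` Q"
      using nbhd[OF _ zero_less_one] by blast
  qed
  have hcont: "continuous_on (\<tau> ` Q) (%y. g y k)"
  proof (rule continuous_on_boxI[OF \<tau>R])
    fix y and e :: real assume y: "y \<in> \<tau> ` Q" and e: "e > 0"
    obtain \<delta> where \<delta>: "\<delta> > 0" "ALL z:Rn d. near d \<delta> y z --> z \<in> \<tau> ` Q & \<bar>g z k - g y k\<bar> <= e / 2"
      using nbhd[OF gQ(1)[OF y], of "e / 2"] gQ(2)[OF y] e by auto
    show "EX r>0. ALL z:\<tau> ` Q. near d r y z --> dist (g z k) (g y k) < e"
    proof (intro exI[of _ \<delta>] conjI \<delta>(1) ballI impI)
      fix z assume z: "z \<in> \<tau> ` Q" "near d \<delta> y z"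
      then have "\<bar>g z k - g y k\<bar> <= e / 2" using \<delta>(2) \<tau>R by blast
      then show "dist (g z k) (g y k) < e" using e by (simp add: dist_real_def)
    qed
  qed
  define c where "c i x = (if i = k then 1 else - dird (unitv i) F x)" for i x
  define G where "G i x = c i x * inverse (dird (unitv k) F x)" for i x
  have Gc: "Cinf d Q (G i)" if "i < d" for i
  proof -
    have "Cinf d Q (c i)" unfolding c_def
      using Cinf_const[OF Q] Cinf_minus[OF Cinf_dird[OF FQ unitv_in_Rn[OF that]]] by (cases "i = k") auto
    moreover have "dird (unitv k) F x ~= 0" if "x \<in> Q" for x using QU(2)[OF that] by auto
    ultimately show ?thesis unfolding G_def by (intro Cinf_mult Cinf_inverse Cinf_dird FQ unitv_in_Rn k)
  qed
  have hder: "has_dird (%y. g y k) (unitv i) y (G i (g y))" if i: "i < d" and y: "y \<in> \<tau> ` Q" for i y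
    unfolding has_dird_def has_vector_derivative_at_0_iff
  proof (rule tendstoI)
    fix \<epsilon> :: real assume \<epsilon>: "\<epsilon> > 0"
    define x where "x = g y"
    have x: "x \<in> Q" using gQ(1)[OF y] by (simp add: x_def)
    define D where "D = dird (unitv k) F x"
    have D: "D ~= 0" using QU(2)[OF x] by (auto simp: D_def)
    obtain e where e: "e > 0" "!!q. \<bar>c i x - q * D\<bar> <= e * (\<bar>q\<bar> + 1) ==> \<bar>q - c i x / D\<bar> < \<epsilon>"
      using approximate_quotient[OF D \<epsilon>, of "c i x"] by blast
    obtain \<rho> where \<rho>: "\<rho> > 0" "!!z. z \<in> Rn d ==> (!!i. i < d ==> \<bar>z i - x i\<bar> < \<rho>) ==>
        norm (F z - F x - (\<Sum>j<d. (z j - x j) *\<^sub>R dird (unitv j) F x)) <= e * (\<Sum>j<d. \<bar>z j - x j\<bar>)"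
      using C1_linear_approximation[OF Q Cinf_1[OF FQ] x e(1)] by blast
    define w where "w t = (%l. y l + t * unitv i l)" for t
    have "open_Rn d {z:\<tau> ` Q. g z k \<in> {u. \<bar>u - x k\<bar> < \<rho>}}"
      by (intro openin_continuous_preimage_Euclidean[OF img hcont] open_Collect_less continuous_intros)
    moreover have "y \<in> {z:\<tau> ` Q. g z k \<in> {u. \<bar>u - x k\<bar> < \<rho>}}" using y \<rho>(1) by (simp add: x_def)
    ultimately have ev1: "\<forall>\<^sub>F t in at 0. w t \<in> {z:\<tau> ` Q. g z k \<in> {u. \<bar>u - x k\<bar> < \<rho>}}"
      unfolding w_def by (rule line_eventually_at[OF _ _ unitv_in_Rn[OF i]])
    have ev2: "\<forall>\<^sub>F t in at (0::real). t ~= 0 & \<bar>t\<bar> < \<rho>"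
      using \<rho>(1) by (auto simp: eventually_at dist_real_def intro!: exI[of _ \<rho>])
    have "\<forall>\<^sub>F t in at 0. dist ((1 / t) *\<^sub>R (g (w t) k - g (w 0) k)) (G i (g y)) < \<epsilon>"
      using ev1 ev2
    proof eventually_elim
      case (elim t)
      then have wt: "w t \<in> \<tau> ` Q" and dk: "\<bar>g (w t) k - x k\<bar> < \<rho>" and t: "t ~= 0" "\<bar>t\<bar> < \<rho>" by auto
      define \<Delta> where "\<Delta> = g (w t) k - x k"
      define z where "z = g (w t)"
      have zoff: "z j - x j = t * unitv i j" if "j ~= k" for j
        using goff[OF wt that] goff[OF y that] by (simp add: z_def x_def w_def)
      have zk: "z k - x k = \<Delta>" by (simp add: z_def \<Delta>_def)
      have zR: "z \<in> Rn d" using gQ(1)[OF wt] by (simp add: z_def Q_def)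
      have small: "\<bar>z j - x j\<bar> < \<rho>" if "j < d" for j
        using zoff[of j] zk dk t \<rho>(1) by (cases "j = k") (auto simp: \<Delta>_def unitv_def)
      have Fz: "F z - F x = t * unitv i k" using Fg[OF wt] Fg[OF y] by (simp add: z_def x_def w_def)
      have split: "(\<Sum>j<d. h j) = h k + (\<Sum>j\<in>{..<d} - {k}. h j)" for h :: "vec"
        using k by (subst sum.remove[of _ k]) auto
      have s1: "(\<Sum>j<d. (z j - x j) *\<^sub>R dird (unitv j) F x) = \<Delta> * D + (if i = k then 0 else t * dird (unitv i) F x)"
      proof -
        have "(\<Sum>j\<in>{..<d} - {k}. (z j - x j) *\<^sub>R dird (unitv j) F x) =
            (\<Sum>j\<in>{..<d} - {k}. if j = i then t * dird (unitv i) F x else 0)"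
          using zoff by (intro sum.cong) (auto simp: unitv_def)
        also have "... = (if i = k then 0 else t * dird (unitv i) F x)" using i by (simp add: sum.delta)
        finally show ?thesis unfolding split[of "%j. (z j - x j) *\<^sub>R dird (unitv j) F x"] by (simp add: zk D_def)
      qed
      have s2: "(\<Sum>j<d. \<bar>z j - x j\<bar>) <= \<bar>\<Delta>\<bar> + \<bar>t\<bar>"
      proof -
        have "(\<Sum>j\<in>{..<d} - {k}. \<bar>z j - x j\<bar>) = (\<Sum>j\<in>{..<d} - {k}. if j = i then \<bar>t\<bar> else 0)"
          using zoff by (intro sum.cong) (auto simp: unitv_def)
        also have "... <= \<bar>t\<bar>" by (simp add: sum.delta)
        finally show ?thesis unfolding split[of "%j. \<bar>z j - x j\<bar>"] by (simp add: zk)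
      qed
      have "norm (F z - F x - (\<Sum>j<d. (z j - x j) *\<^sub>R dird (unitv j) F x)) <= e * (\<bar>\<Delta>\<bar> + \<bar>t\<bar>)"
        using \<rho>(2)[OF zR small] s2 e(1) by (meson mult_left_mono less_imp_le order_trans)
      moreover have "F z - F x - (\<Sum>j<d. (z j - x j) *\<^sub>R dird (unitv j) F x) = c i x * t - \<Delta> * D"
        unfolding s1 Fz by (simp add: c_def unitv_def)
      ultimately have est: "\<bar>c i x * t - \<Delta> * D\<bar> <= e * (\<bar>\<Delta>\<bar> + \<bar>t\<bar>)" by simp
      \<comment> \<open>The difference quotient of the inverse satisfies a relative estimate with error \<open>e\<close>.\<close>
      define q where "q = \<Delta> / t"
      have "\<Delta> = t * q" using t(1) by (simp add: q_def)
      then have "\<bar>t\<bar> * \<bar>c i x - q * D\<bar> <= \<bar>t\<bar> * (e * (\<bar>q\<bar> + 1))"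
        using est by (simp add: abs_mult[symmetric] algebra_simps)
      then have "\<bar>q - c i x / D\<bar> < \<epsilon>" using t(1) by (intro e(2)) simp
      then show ?case
        by (simp add: dist_real_def q_def \<Delta>_def w_def x_def G_def D_def divide_inverse mult.commute)
    qed
    then show "\<forall>\<^sub>F t in at 0. dist ((1 / t) *\<^sub>R (g (%l. y l + t * unitv i l) k - g (%l. y l + 0 * unitv i l) k)) (G i (g y)) < \<epsilon>"
      by (simp add: w_def)
  qed
  have hC: "Cinf d (\<tau> ` Q) (%y. g y k)"
  proof (rule Cinf_coinduct[of d _ _ "{%y. g y k}", OF img])
    fix h i assume h: "h \<in> {%y. g y k}" and i: "i < d"
    have "Ck l d (\<tau> ` Q) (%y. G i (g y))" if "ALL h:{%y. g y k}. Ck l d (\<tau> ` Q) h" for l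
    proof (rule Ck_compose[OF img Q gQ(1)])
      fix j assume "j < d"
      show "Ck l d (\<tau> ` Q) (%y. g y j)"
      proof (cases "j = k")
        case False
        then show ?thesis
          using Ck_cong[OF img, of "%y. g y j" "%y. y j" l] goff Ck_coord[OF img, of l j] by simp
      qed (use that in simp)
    qed (use Gc[OF i] in "auto simp: Cinf_def")
    then show "EX ga. (ALL x:\<tau> ` Q. has_dird h (unitv i) x (ga x)) &
       (ALL l. (ALL h:{%y. g y k}. Ck l d (\<tau> ` Q) h) --> Ck l d (\<tau> ` Q) ga)"
      using h hder[OF i] by (intro exI[of _ "%y. G i (g y)"]) auto
  qed (use hcont in auto)
  have "diffeo_on d Q \<tau> g"
    unfolding diffeo_on_def
  proof (intro conjI Q img ballI g\<tau> allI impI)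
    fix i assume i: "i < d"
    show "Cinf d Q (%x. \<tau> x i)" unfolding \<tau>_def using FQ Cinf_coord[OF Q] by (cases "i = k") auto
    show "Cinf d (\<tau> ` Q) (%y. g y i)"
    proof (cases "i = k")
      case False
      then show ?thesis
        using Cinf_cong[of "\<tau> ` Q" "%y. g y i" "%y. y i" d] goff Cinf_coord[OF img, of i] by simp
    qed (use hC in simp)
  qed
  then have "diffeo_on d Q (%x. x(k := F x)) g" by (simp add: \<tau>_def[abs_def])
  moreover have "x0 \<in> Q" using x0R r(1) by (simp add: Q_def)
  ultimately show ?thesis using QU(1) by (intro that) auto
qed

text \<open>The functions become coordinates one at a time. In the coordinates reached so far,
  independence gives the next function a non-vanishing partial derivative in a direction not yet used,
  which may be exchanged for it.\<close>

theorem straighten: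
  assumes S0: "open_Rn d S0" and x0: "x0 \<in> S0"
    and g: "!!j. j < m ==> Cinf d S0 (g j)"
    and indep: "!!j. j < m ==> EX v:Rn d. ALL i<m. dird v (g i) x0 = (if i = j then 1 else (0::real))"
  obtains S f h where "m <= d" "x0 \<in> S" "S \<subseteq> S0" "diffeo_on d S f h"
    "!!x i. x \<in> S ==> i < m ==> f x i = g i x"
proof -
  have "l <= d & (EX S f h. x0 \<in> S & S \<subseteq> S0 & diffeo_on d S f h & (ALL x:S. ALL i<l. f x i = g i x))" if "l <= m" for l
    using that
  proof (induction l)
    case 0
    then show ?case using S0 x0 diffeo_on_id by blast
  next
    case (Suc l)
    then obtain S f h where S: "x0 \<in> S" "S \<subseteq> S0" "diffeo_on d S f h" "!!x i. x \<in> S ==> i < l ==> f x i = g i x"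
      by auto
    note D = diffeo_onD[OF S(3)]
    have lm: "l < m" using Suc.prems by simp
    obtain v where v: "v \<in> Rn d" "!!i. i < m ==> dird v (g i) x0 = (if i = l then 1 else 0)"
      using indep[OF lm] by blast
    define F where "F y = g l (h y)" for y
    have F: "Cinf d (f ` S) F"
      unfolding F_def using S(2) D(7) by (intro Cinf_compose[OF D(2) g[OF lm]] D(5)) auto
    have "dird v (g l) x0 = dird v (%x. F (f x)) x0"
      using D(3) by (intro dird_cong[OF D(1) S(1) v(1)]) (simp add: F_def)
    also have "... = (\<Sum>i<d. dird v (%x. f x i) x0 *\<^sub>R dird (unitv i) F (f x0))"
      by (rule has_dird_dird[OF has_dird_compose[OF D(1) F _ D(4) S(1) v(1)]]) auto
    finally have sum1: "(\<Sum>i<d. dird v (%x. f x i) x0 *\<^sub>R dird (unitv i) F (f x0)) = 1"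
      using v(2)[OF lm] by simp
    have low: "dird v (%x. f x i) x0 = 0" if "i < l" for i
    proof -
      have "dird v (%x. f x i) x0 = dird v (g i) x0"
        using S(4) that by (intro dird_cong[OF D(1) S(1) v(1)]) auto
      then show ?thesis using v(2)[of i] that lm by simp
    qed
    have "EX k<d. l <= k & dird (unitv k) F (f x0) ~= 0"
    proof (rule ccontr)
      assume "\<not> ?thesis"
      then have "dird v (%x. f x i) x0 *\<^sub>R dird (unitv i) F (f x0) = 0" if "i < d" for i
        using low[of i] that by (cases "i < l") auto
      then have "(\<Sum>i<d. dird v (%x. f x i) x0 *\<^sub>R dird (unitv i) F (f x0)) = 0" by (intro sum.neutral) auto
      then show False using sum1 by simp
    qed
    then obtain k where k: "k < d" "l <= k" "dird (unitv k) F (f x0) ~= 0" by blast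
    have fx0: "f x0 \<in> f ` S" using S(1) by blast
    obtain S' g' where S': "f x0 \<in> S'" "S' \<subseteq> f ` S" "diffeo_on d S' (%x. x(k := F x)) g'"
      using exchange_coordinate[OF F fx0 k(1,3)] by blast
    have ld: "l < d" using k by simp
    have C1: "diffeo_on d {x:S. f x \<in> S'} (%x. (f x)(k := F (f x))) (%y. h (g' y))"
      by (rule diffeo_on_compose[OF S(3) S'(3)])
    note C2 = diffeo_on_compose[OF C1 diffeo_on_swap[OF ld k(1)]]
    let ?S = "{x \<in> {x:S. f x \<in> S'}. (f x)(k := F (f x)) \<in> Rn d}"
    let ?f = "%x i. ((f x)(k := F (f x))) (Transposition.transpose l k i)"
    have "x0 \<in> ?S" using S(1) S'(1) D(6)[OF S(1)] k(1) by (auto simp: Rn_iff)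
    moreover have "?f x i = g i x" if x: "x \<in> ?S" and i: "i < Suc l" for x i
    proof (cases "i = l")
      case True
      then show ?thesis using x D(3) by (simp add: F_def)
    next
      case False
      then have "i < l" "Transposition.transpose l k i = i" "i ~= k" using i k(2) by auto
      then show ?thesis using x S(4) by simp
    qed
    moreover have "?S \<subseteq> S0" using S(2) by auto
    ultimately have "x0 \<in> ?S & ?S \<subseteq> S0 &
        diffeo_on d ?S ?f (%y. h (g' (%i. y (Transposition.transpose l k i)))) & (ALL x:?S. ALL i<Suc l. ?f x i = g i x)"
      using C2 by (intro conjI ballI allI impI)
    then have "EX S f h. x0 \<in> S & S \<subseteq> S0 & diffeo_on d S f h & (ALL x:S. ALL i<Suc l. f x i = g i x)"
      by (intro exI)
    then show ?case using ld by simp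
  qed
  from this[OF order_refl] show ?thesis using that by blast
qed

section \<open>The torus\<close>

abbreviation torus_manifold :: "nat => (nat => complex) manifold" where
  "torus_manifold n == lie_manifold (torus n)"

definition torus_dom :: "nat => (nat => complex) => (nat => complex) set" where
  "torus_dom n w = {z:torus_set n. ALL i<n. z i ~= - w i}"

definition torus_chart :: "nat => (nat => complex) => (nat => complex) => vec" where
  "torus_chart n w = (%z i. if i < n then Arg (z i / w i) else 0)"

definition cube :: "nat => vec set" where
  "cube n = {x:Rn n. ALL i<n. - pi < x i & x i < pi}"

text \<open>The inverse of \<open>torus_chart n w\<close> on \<open>cube n\<close>.\<close>

definition torus_exp :: "nat => (nat => complex) => vec => nat => complex" where
  "torus_exp n w x = (\<lambda>i\<in>{..<n}. w i * exp (\<i> * of_real (x i)))"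

definition torus_one :: "nat => nat => complex" where
  "torus_one n = (\<lambda>i\<in>{..<n}. 1)"

lemma torus_simps [simp]:
  "carrier (torus n) = torus_set n" "z \<otimes>\<^bsub>torus n\<^esub> w = (\<lambda>i\<in>{..<n}. z i * w i)"
  "\<one>\<^bsub>torus n\<^esub> = torus_one n" "mdim (torus_manifold n) = n"
  by (simp_all add: torus_def torus_one_def)

lemma atlas_torus: "atlas (torus_manifold n) = (%w. (torus_dom n w, torus_chart n w)) ` torus_set n"
  by (simp add: torus_def torus_dom_def torus_chart_def)

lemma mtop_torus: "mtop (torus_manifold n) = product_topology (%_. top_of_set (sphere 0 1)) {..<n}"
  by (simp add: torus_def)

lemma topspace_torus [simp]: "topspace (mtop (torus_manifold n)) = torus_set n"
  by (simp add: mtop_torus torus_set_def)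

lemma torus_set_norm: "z \<in> torus_set n ==> i < n ==> cmod (z i) = 1"
  by (auto simp: torus_set_def PiE_iff)

lemma torus_set_nz: "z \<in> torus_set n ==> i < n ==> z i ~= 0"
  using torus_set_norm by fastforce

lemma torus_eqI: "z \<in> torus_set n ==> w \<in> torus_set n ==> (!!i. i < n ==> z i = w i) ==> z = w"
  unfolding torus_set_def by (rule PiE_ext) auto

lemma torus_one_in [simp]: "torus_one n \<in> torus_set n"
  by (auto simp: torus_set_def torus_one_def)

lemma torus_mult_in: "z \<in> torus_set n ==> w \<in> torus_set n ==> (\<lambda>i\<in>{..<n}. z i * w i) \<in> torus_set n"
  by (auto simp: torus_set_def PiE_iff norm_mult)

lemma torus_exp_in: "w \<in> torus_set n ==> torus_exp n w x \<in> torus_set n"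
  by (auto simp: torus_set_def torus_exp_def PiE_iff norm_mult)

lemma torus_exp_zero: "w \<in> torus_set n ==> torus_exp n w (%_. 0) = w"
  by (rule torus_eqI[of _ n]) (auto simp: torus_exp_in, simp add: torus_exp_def)

lemma torus_exp_add:
  "torus_exp n w (%i. x i + y i) = (\<lambda>i\<in>{..<n}. torus_exp n w x i * torus_exp n (torus_one n) y i)"
  by (auto simp: torus_exp_def torus_one_def distrib_left exp_add)

lemma torus_exp_chart:
  assumes w: "w \<in> torus_set n" and x: "x \<in> cube n"
  shows "torus_exp n w x \<in> torus_dom n w" "torus_chart n w (torus_exp n w x) = x"
proof -
  have A: "Arg (exp (\<i> * of_real (x i))) = x i" if "i < n" for i
    using x that by (intro Arg_unique[of 1]) (auto simp: cube_def)
  have q: "torus_exp n w x i / w i = exp (\<i> * of_real (x i))" if "i < n" for i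
    using that torus_set_nz[OF w that] by (simp add: torus_exp_def)
  have "torus_exp n w x i ~= - w i" if i: "i < n" for i
  proof
    assume "torus_exp n w x i = - w i"
    then have "exp (\<i> * of_real (x i)) = -1" using q[OF i] torus_set_nz[OF w i] by simp
    moreover have "Arg (- 1) = pi" using Arg_of_real[of "-1"] by simp
    ultimately have "x i = pi" using A[OF i] by simp
    then show False using x i by (auto simp: cube_def)
  qed
  then show "torus_exp n w x \<in> torus_dom n w" using torus_exp_in[OF w] by (simp add: torus_dom_def)
  have "x i = 0" if "i >= n" for i using x that by (auto simp: cube_def Rn_iff)
  then show "torus_chart n w (torus_exp n w x) = x"
    using A q by (auto simp: torus_chart_def fun_eq_iff)
qed

lemma torus_chart_exp:
  assumes w: "w \<in> torus_set n" and z: "z \<in> torus_dom n w"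
  shows "torus_chart n w z \<in> cube n" "torus_exp n w (torus_chart n w z) = z"
proof -
  have zT: "z \<in> torus_set n" using z by (simp add: torus_dom_def)
  have e: "z i / w i = exp (\<i> * of_real (Arg (z i / w i)))" if "i < n" for i
  proof -
    have "cmod (z i / w i) = 1" using torus_set_norm[OF zT that] torus_set_norm[OF w that] by (simp add: norm_divide)
    moreover have "z i / w i ~= 0" using torus_set_nz[OF zT that] torus_set_nz[OF w that] by simp
    ultimately show ?thesis using Arg_eq[of "z i / w i"] by simp
  qed
  have "Arg (z i / w i) ~= pi" if "i < n" for i
  proof
    assume "Arg (z i / w i) = pi"
    then have "z i / w i = -1" using e[OF that] by simp
    then have "z i = - w i" using torus_set_nz[OF w that] by (simp add: field_simps)
    then show False using z that by (auto simp: torus_dom_def)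
  qed
  then show "torus_chart n w z \<in> cube n"
    using Arg_bounded by (auto simp: cube_def torus_chart_def Rn_iff order_less_le)
  show "torus_exp n w (torus_chart n w z) = z"
  proof (rule torus_eqI[OF torus_exp_in[OF w] zT])
    fix i assume i: "i < n"
    then show "torus_exp n w (torus_chart n w z) i = z i"
      using e[OF i] torus_set_nz[OF w i] by (simp add: torus_exp_def torus_chart_def field_simps)
  qed
qed

lemma torus_chart_image: "w \<in> torus_set n ==> torus_chart n w ` torus_dom n w = cube n"
proof (intro equalityI subsetI)
  fix x assume w: "w \<in> torus_set n" and "x \<in> cube n"
  from torus_exp_chart[OF this] show "x \<in> torus_chart n w ` torus_dom n w" by (metis imageI)
qed (auto dest: torus_chart_exp(1))

lemma torus_chart_inv:
  assumes "w \<in> torus_set n" "x \<in> cube n"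
  shows "inv_into (torus_dom n w) (torus_chart n w) x = torus_exp n w x"
proof -
  have "inj_on (torus_chart n w) (torus_dom n w)"
    by (rule inj_on_inverseI[of _ "torus_exp n w"]) (rule torus_chart_exp(2)[OF assms(1)])
  then show ?thesis using inv_into_f_f torus_exp_chart[OF assms] by metis
qed

lemma zero_in_cube [simp]: "(%_. 0) \<in> cube n"
  by (simp add: cube_def Rn_iff)

lemma cube_subset: "cube n \<subseteq> Rn n"
  by (auto simp: cube_def)

lemma openin_cube: "open_Rn n (cube n)"
proof -
  have "cube n = {y:Rn n. ALL i<n. \<bar>y i - (%_. 0) i\<bar> < pi}" by (auto simp: cube_def abs_less_iff)
  then show ?thesis using open_box[of "%_. 0" n pi] by (simp add: Rn_iff)
qed

lemma lie_group_pre: "lie_group G ==> pre_manifold (lie_manifold G)"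
  by (simp add: lie_group_def smooth_manifold_pre)

lemma smooth_fn_torus_coord:
  assumes T: "pre_manifold (torus_manifold n)" and i: "i < n"
  shows "smooth_fn (torus_manifold n) (torus_set n) (%z. z i)"
proof (rule smooth_fn_local[OF T])
  fix w assume w: "w \<in> torus_set n"
  interpret chart "torus_manifold n" "torus_dom n w" "torus_chart n w"
    using w by (intro chartI[OF T]) (auto simp: atlas_torus)
  have "Cinf n (cube n) (%x. w i * exp (\<i> * of_real (x i)))"
    by (intro Cinf_mult Cinf_const Cinf_exp bounded_linear.Cinf_linear[OF bounded_linear_of_real]
        Cinf_coord openin_cube)
  then have "Cinf n (cube n) (%x. inv_into (torus_dom n w) (torus_chart n w) x i)"
    by (rule Cinf_cong[THEN iffD1, rotated]) (use w i in "simp add: torus_chart_inv torus_exp_def")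
  then have "smooth_fn (torus_manifold n) (torus_dom n w) (%z. z i)"
    using w by (intro smooth_fn_chartI[OF dom_open subset_refl]) (simp add: torus_chart_image)
  moreover have "w \<in> torus_dom n w" using torus_exp_chart(1)[OF w zero_in_cube] torus_exp_zero[OF w] by simp
  ultimately show "EX Q. w \<in> Q & Q \<subseteq> torus_set n & smooth_fn (torus_manifold n) Q (%z. z i)"
    by (intro exI[of _ "torus_dom n w"]) (auto simp: torus_dom_def)
qed

lemma torus_chart_eq_Ln:
  assumes "w \<in> torus_set n" "z \<in> torus_dom n w" "i < n"
  shows "torus_chart n w z i = Im (Ln (z i * inverse (w i)))" "z i * inverse (w i) ~: \<real>\<^sub>\<le>\<^sub>0"
proof -
  have z: "z \<in> torus_set n" using assms(2) by (simp add: torus_dom_def)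
  have nz: "z i / w i ~= 0" using torus_set_nz[OF z assms(3)] torus_set_nz[OF assms(1,3)] by simp
  have c: "torus_chart n w z i = Arg (z i / w i)" using assms(3) by (simp add: torus_chart_def)
  then show "torus_chart n w z i = Im (Ln (z i * inverse (w i)))"
    using nz by (simp add: Arg_eq_Im_Ln divide_inverse)
  show "z i * inverse (w i) ~: \<real>\<^sub>\<le>\<^sub>0"
  proof
    assume "z i * inverse (w i) \<in> \<real>\<^sub>\<le>\<^sub>0"
    then obtain t where t: "z i / w i = of_real t" "t <= 0" by (auto simp: divide_inverse nonpos_Reals_def)
    have "cmod (z i / w i) = 1"
      using torus_set_norm[OF z assms(3)] torus_set_norm[OF assms(1,3)] by (simp add: norm_divide)
    then have "\<bar>t\<bar> = 1" using t(1) by simp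
    then have "t = -1" using t(2) by linarith
    then have "z i = - w i" using t torus_set_nz[OF assms(1,3)] by (simp add: field_simps)
    then show False using assms(2,3) by (auto simp: torus_dom_def)
  qed
qed

text \<open>The angle is the imaginary part of a logarithm, which is smooth off the negative axis; hence
  smooth coordinates in the plane give a smooth map into the torus.\<close>

lemma smooth_map_torusI:
  assumes M: "pre_manifold M" and T: "pre_manifold (torus_manifold n)"
    and u: "!!p. p \<in> topspace (mtop M) ==> u p \<in> torus_set n"
    and s: "!!i. i < n ==> smooth_fn M (topspace (mtop M)) (%p. u p i)"
  shows "smooth_map M (torus_manifold n) u"
proof -
  have c: "continuous_map (mtop M) (mtop (torus_manifold n)) u"
    unfolding mtop_torus continuous_map_componentwise
  proof (intro conjI ballI)
    fix i assume "i \<in> {..<n}"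
    then have "continuous_map (mtop M) euclidean (%p. u p i)"
      using smooth_fn_continuous_map[OF M s] by simp
    then show "continuous_map (mtop M) (top_of_set (sphere 0 1)) (%p. u p i)"
      using u \<open>i \<in> {..<n}\<close> by (auto simp: continuous_map_in_subtopology torus_set_def PiE_iff)
  qed (use u in "auto simp: torus_set_def PiE_def")
  show ?thesis
    unfolding smooth_map_iff[OF M T]
  proof (intro conjI c, clarify)
    fix V psi j assume V: "(V, psi) \<in> atlas (torus_manifold n)" and j: "j < mdim (torus_manifold n)"
    then obtain w where w: "w \<in> torus_set n" "V = torus_dom n w" "psi = torus_chart n w"
      by (auto simp: atlas_torus)
    interpret chart "torus_manifold n" V psi using T V by (rule chartI)
    let ?W = "{p:topspace (mtop M). u p \<in> V}"
    have W: "openin (mtop M) ?W" by (rule openin_continuous_map_preimage[OF c dom_open])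
    have jn: "j < n" using j by simp
    have "smooth_fn M ?W (%p. Im (Ln (u p j * inverse (w j))))"
    proof (rule smooth_fn_lift1[OF M, where S = "- \<real>\<^sub>\<le>\<^sub>0" and H = "%z. Im (Ln z)"])
      show "smooth_fn M ?W (%p. u p j * inverse (w j))"
        by (intro smooth_fn_mult[OF M] smooth_fn_const[OF M W] smooth_fn_subset[OF M s[OF jn] W]) auto
      show "u p j * inverse (w j) \<in> - \<real>\<^sub>\<le>\<^sub>0" if "p \<in> ?W" for p
        using torus_chart_eq_Ln(2)[OF w(1) _ jn, of "u p"] that w(2) by simp
    qed (auto intro!: bounded_linear.Cinf_linear[OF bounded_linear_Im] Cinf_Ln)
    then show "smooth_fn M ?W (%p. psi (u p) j)"
      by (rule smooth_fn_cong[THEN iffD1, OF _ M, rotated])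
        (use torus_chart_eq_Ln(1)[OF w(1) _ jn] w in auto)
  qed
qed

section \<open>Pulling back smooth functions along a torus action\<close>

text \<open>A compact set of parameters \<open>y\<close> and a fixed \<open>x\<^sub>0\<close>: local statements near \<open>(y, x\<^sub>0)\<close> hold for
  all these \<open>y\<close> and one neighbourhood of \<open>x\<^sub>0\<close>.\<close>

lemma compact_uniform:
  fixes Q :: "'c => vec => vec => bool"
  assumes K: "compact K" "K \<subseteq> Rn d"
    and loc: "!!y0. y0 \<in> K ==> EX \<rho>>0. EX c. ALL y:Rn d. ALL x:Rn n. near d \<rho> y0 y -->
      near n \<rho> x0 x --> Q c y x"
  obtains \<delta> Cs where "\<delta> > 0" "finite Cs"
    "ALL y:K. ALL x:Rn n. near n \<delta> x0 x --> (EX c:Cs. Q c y x)"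
proof -
  obtain \<rho> c where \<rho>: "!!y0. y0 \<in> K ==> \<rho> y0 > 0"
    "!!y0 y x. y0 \<in> K ==> y \<in> Rn d ==> x \<in> Rn n ==> (ALL i<d. \<bar>y i - y0 i\<bar> < \<rho> y0) ==>
      (ALL i<n. \<bar>x i - x0 i\<bar> < \<rho> y0) ==> Q (c y0) y x"
    using loc by metis
  let ?B = "%y0. \<Inter>i\<in>{..<d}. {y :: nat => real. \<bar>y i - y0 i\<bar> < \<rho> y0}"
  have opB: "open (?B y0)" for y0
    by (intro open_INT ballI open_Collect_less continuous_intros continuous_on_product_coordinates) auto
  have cov: "K \<subseteq> (\<Union>y0\<in>K. ?B y0)" using \<rho>(1) by fastforce
  obtain F where F: "F \<subseteq> K" "finite F" "K \<subseteq> (\<Union>y0\<in>F. ?B y0)"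
    by (rule compactE_image[OF K(1) _ cov]) (auto intro: opB)
  define \<delta> where "\<delta> = Min (insert 1 (\<rho> ` F))"
  have \<delta>: "\<delta> > 0" "!!y0. y0 \<in> F ==> \<delta> <= \<rho> y0" unfolding \<delta>_def using F \<rho>(1) by auto
  show ?thesis
  proof (rule that[OF \<delta>(1), of "c ` F"], safe)
    fix y x assume y: "y \<in> K" and x: "x \<in> Rn n" "near n \<delta> x0 x"
    obtain y0 where y0: "y0 \<in> F" "y \<in> ?B y0" using F(3) y by blast
    have "Q (c y0) y x"
      using y0 F(1) K(2) y x \<delta>(2)[OF y0(1)] by (intro \<rho>(2)) force+
    then show "EX c:c ` F. Q c y x" using y0(1) by blast
  qed (use F in auto)
qed

lemma join_vec_near:
  assumes "near d \<rho> y0 y" "near n \<rho> x0 x" "i < d + n"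
  shows "\<bar>join_vec d y x i - join_vec d y0 x0 i\<bar> < \<rho>"
  using assms by (auto simp: join_vec_def)

text \<open>Continuity at \<open>x0\<close>, uniformly for \<open>y\<close> in the compact sets
  occurring in seminorms.\<close>

lemma uniform_in_parameter:
  fixes H :: "vec => 'b::metric_space"
  assumes K: "compact K" "K \<subseteq> Rn d" and D: "open_Rn (d + n) D" and H: "continuous_on D H"
    and x0: "x0 \<in> Rn n" and KD: "!!y. y \<in> K ==> join_vec d y x0 \<in> D" and e: "e > 0"
  obtains \<delta> where "\<delta> > 0" "!!y x. y \<in> K ==> x \<in> Rn n ==> (!!i. i < n ==> \<bar>x i - x0 i\<bar> < \<delta>) ==>
      join_vec d y x \<in> D & dist (H (join_vec d y x)) (H (join_vec d y x0)) < e"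
proof -
  let ?Q = "%_::unit. %y x. join_vec d y x \<in> D & dist (H (join_vec d y x)) (H (join_vec d y x0)) < e"
  have "EX \<rho>>0. EX c. ALL y:Rn d. ALL x:Rn n. near d \<rho> y0 y -->
      near n \<rho> x0 x --> ?Q c y x" if y0: "y0 \<in> K" for y0
  proof -
    obtain \<rho> where \<rho>: "\<rho> > 0" "!!v. v \<in> Rn (d + n) ==> (!!i. i < d + n ==> \<bar>v i - join_vec d y0 x0 i\<bar> < \<rho>) ==>
        v \<in> D & dist (H v) (H (join_vec d y0 x0)) < e / 2"
      using continuous_on_box[OF D H KD[OF y0], of "e / 2"] e by (metis half_gt_zero)
    have "join_vec d y x \<in> D & dist (H (join_vec d y x)) (H (join_vec d y x0)) < e"
      if yx: "y \<in> Rn d" "x \<in> Rn n" "near d \<rho> y0 y" "near n \<rho> x0 x" for y x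
    proof -
      have 1: "join_vec d y x \<in> D & dist (H (join_vec d y x)) (H (join_vec d y0 x0)) < e / 2"
        using yx by (intro \<rho>(2) join_vec_near) auto
      have 2: "join_vec d y x0 \<in> D & dist (H (join_vec d y x0)) (H (join_vec d y0 x0)) < e / 2"
        using yx x0 \<rho>(1) by (intro \<rho>(2) join_vec_near) auto
      show ?thesis using 1 2 dist_triangle_half_l[of "H (join_vec d y x)" "H (join_vec d y0 x0)" e "H (join_vec d y x0)"]
        by blast
    qed
    then show ?thesis using \<rho>(1) by blast
  qed
  then obtain \<delta> Cs where "\<delta> > 0" "ALL y:K. ALL x:Rn n. near n \<delta> x0 x --> (EX c:Cs. ?Q c y x)"
    by (rule compact_uniform[OF K]) (assumption, rule that)
  then show ?thesis using that[of \<delta>] by blast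
qed

abbreviation ex_fst :: "nat => vec => vec" where
  "ex_fst d v == join_vec d v (%_. 0)"

abbreviation ex_snd :: "nat => vec => vec" where
  "ex_snd d v == join_vec d (%_. 0) v"

lemma join_add_fst: "join_vec d (%i. y i + t * v i) x = (%i. join_vec d y x i + t * ex_fst d v i)"
  by (auto simp: join_vec_def)

lemma join_add_snd: "join_vec d y (%i. x i + t * v i) = (%i. join_vec d y x i + t * ex_snd d v i)"
  by (auto simp: join_vec_def)

lemma ex_fst_Rn: "v \<in> Rn d ==> ex_fst d v \<in> Rn (d + n)"
  by (auto simp: join_vec_def Rn_iff)

lemma ex_snd_Rn: "v \<in> Rn n ==> ex_snd d v \<in> Rn (d + n)"
  by (auto simp: join_vec_def Rn_iff)

lemma iter_dird_slice:
  "iter_dird (%y. H (join_vec d y x)) vs y = iter_dird H (map (ex_fst d) vs) (join_vec d y x)"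
proof (induction vs arbitrary: y)
  case (Cons v vs)
  have "iter_dird (%y. H (join_vec d y x)) vs = (%y. iter_dird H (map (ex_fst d) vs) (join_vec d y x))"
    using Cons.IH by (intro ext)
  then show ?case by (simp add: dird_def join_add_fst)
qed simp

lemma dird_slice_snd: "dird v (%x. H (join_vec d y x)) x = dird (ex_snd d v) H (join_vec d y x)"
  by (simp add: dird_def join_add_snd)

locale torus_action = smooth_algebra P for P :: "'a manifold" +
  fixes n :: nat and \<sigma> :: "'a => (nat => complex) => 'a"
  assumes lie: "lie_group (torus n)" and action: "smooth_right_action P (torus n) \<sigma>"
begin

abbreviation "TM == torus_manifold n"

lemma TM: "pre_manifold TM" by (rule lie_group_pre[OF lie])

lemma PT: "pre_manifold (prod_manifold P TM)" by (rule pre_manifold_prod[OF P TM])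

lemma \<sigma>_smooth: "smooth_map (prod_manifold P TM) P (%(p, z). \<sigma> p z)"
  using action by (simp add: smooth_right_action_def)

lemma \<sigma>_in: "p \<in> X ==> z \<in> torus_set n ==> \<sigma> p z \<in> X"
  using smooth_map_in[OF \<sigma>_smooth, of "(p, z)"] by simp

lemma \<sigma>_one: "p \<in> X ==> \<sigma> p (torus_one n) = p"
  using action by (simp add: smooth_right_action_def)

lemma \<sigma>_mult: "p \<in> X ==> z \<in> torus_set n ==> w \<in> torus_set n ==> \<sigma> (\<sigma> p z) w = \<sigma> p (\<lambda>i\<in>{..<n}. z i * w i)"
  using action by (simp add: smooth_right_action_def)

lemma \<sigma>_slice: "z \<in> torus_set n ==> smooth_map P P (%p. \<sigma> p z)"
  using smooth_map_compose[OF P PT P smooth_map_pair[OF P P TM smooth_map_id[OF P] smooth_map_const[OF P TM]] \<sigma>_smooth]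
  by simp

definition act :: "(nat => complex) => ('a => complex) => 'a => complex" where
  "act z f = (\<lambda>p\<in>X. f (\<sigma> p z))"

lemma act_A: "z \<in> torus_set n ==> f \<in> A ==> act z f \<in> A"
  unfolding act_def
proof (rule restrict_A)
  assume z: "z \<in> torus_set n" and f: "f \<in> A"
  have "{p:X. \<sigma> p z \<in> X} = X" using \<sigma>_in z by auto
  then show "smooth_fn P X (%p. f (\<sigma> p z))"
    using smooth_map_pullback[OF P P \<sigma>_slice[OF z] smooth_A[OF f]] by simp
qed

text \<open>The pulled back function in the chart \<open>phi\<close> of \<open>P\<close> and the
  exponential chart at \<open>w\<close>; the coordinates of the torus follow those of \<open>P\<close>.\<close>

definition loc :: "'a set => ('a => nat => real) => (nat => complex) => ('a => 'b) => vec => 'b" where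
  "loc U phi w f v = f (\<sigma> (inv_into U phi (fst_part d v)) (torus_exp n w (snd_part d v)))"

definition loc_dom :: "'a set => ('a => nat => real) => vec set" where
  "loc_dom U phi = {v:Rn (d + n). fst_part d v \<in> phi ` U & snd_part d v \<in> cube n}"

lemma loc_smooth:
  fixes f :: "'a => 'b::real_normed_vector"
  assumes c: "(U, phi) \<in> atlas P" and w: "w \<in> torus_set n" and f: "smooth_fn P W f"
  defines "D == {v:loc_dom U phi. \<sigma> (inv_into U phi (fst_part d v)) (torus_exp n w (snd_part d v)) \<in> W}"
  shows "Cinf (d + n) D (loc U phi w f)"
proof -
  have cw: "(torus_dom n w, torus_chart n w) \<in> atlas TM" using w by (auto simp: atlas_torus)
  interpret prod_charts P U phi TM "torus_dom n w" "torus_chart n w" using P TM c cw by (rule prod_chartsI)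
  let ?W = "{p:topspace (mtop (prod_manifold P TM)). (case p of (p, z) => \<sigma> p z) \<in> W}"
  interpret PC: chart "prod_manifold P TM" "U \<times> torus_dom n w" \<kappa>
    by (rule chartI[OF PT atlas_prodI[OF c cw]])
  have C: "Cinf (mdim (prod_manifold P TM)) (\<kappa> ` ((U \<times> torus_dom n w) Int ?W))
      (%v. f (case inv_into (U \<times> torus_dom n w) \<kappa> v of (p, z) => \<sigma> p z))"
    by (rule smooth_fn_in_chart[OF smooth_map_pullback[OF PT P \<sigma>_smooth f] atlas_prodI[OF c cw]])
  have img: "\<kappa> ` (U \<times> torus_dom n w) = loc_dom U phi"
    unfolding prod_chart_image[OF subset_refl subset_refl] by (simp add: loc_dom_def torus_chart_image[OF w])
  have inv: "inv_into (U \<times> torus_dom n w) \<kappa> v = (inv_into U phi (fst_part d v), torus_exp n w (snd_part d v))"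
    if "v \<in> loc_dom U phi" for v
    using inv_prod_chart[of v] that torus_chart_inv[OF w, of "snd_part d v"] by (simp add: img loc_dom_def)
  have D: "D = \<kappa> ` ((U \<times> torus_dom n w) Int ?W)"
  proof (rule Set.set_eqI)
    fix v
    have "v \<in> \<kappa> ` ((U \<times> torus_dom n w) Int ?W) \<longleftrightarrow> v \<in> loc_dom U phi & inv_into (U \<times> torus_dom n w) \<kappa> v \<in> (U \<times> torus_dom n w) Int ?W"
      by (subst PC.in_image_iff) (auto simp: img)
    also have "... \<longleftrightarrow> v \<in> D"
      using PC.inv_in[of v] PC.dom_subset unfolding img D_def by (auto simp: inv)
    finally show "v \<in> D \<longleftrightarrow> v \<in> \<kappa> ` ((U \<times> torus_dom n w) Int ?W)" by simp
  qed
  have "Cinf (d + n) D (%v. f (case inv_into (U \<times> torus_dom n w) \<kappa> v of (p, z) => \<sigma> p z))"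
    using C unfolding D by simp
  then show ?thesis
    by (rule Cinf_cong[THEN iffD1, rotated]) (auto simp: D_def inv loc_def)
qed

lemma loc_dom_open: "(U, phi) \<in> atlas P ==> open_Rn (d + n) (loc_dom U phi)"
  unfolding loc_dom_def by (intro openin_parts openin_cube chart.image_open chartI[OF P])

lemma loc_A:
  assumes c: "(U, phi) \<in> atlas P" and w: "w \<in> torus_set n" and f: "f \<in> A"
  shows "Cinf (d + n) (loc_dom U phi) (loc U phi w f)"
proof -
  have "{v:loc_dom U phi. \<sigma> (inv_into U phi (fst_part d v)) (torus_exp n w (snd_part d v)) \<in> X} = loc_dom U phi"
    using \<sigma>_in[OF inv_in_X[OF c] torus_exp_in[OF w]] by (auto simp: loc_dom_def)
  then show ?thesis using loc_smooth[OF c w smooth_A[OF f]] by simp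
qed

lemma join_loc_dom:
  assumes "(U, phi) \<in> atlas P" "y \<in> phi ` U" "x \<in> cube n"
  shows "join_vec d y x \<in> loc_dom U phi"
proof -
  have "y \<in> Rn d" using openin_subset[OF chart.image_open[OF chartI[OF P assms(1)]]] assms(2) by blast
  moreover have "x \<in> Rn n" using assms(3) cube_subset by blast
  ultimately show ?thesis using assms by (simp add: loc_dom_def)
qed

text \<open>Derivatives of \<open>(y, x) \<mapsto> f (\<sigma> y x)\<close> of any order are bounded by seminorms of \<open>f\<close>, locally
  uniformly.\<close>

lemma loc_estimate_local:
  assumes c: "(U, phi) \<in> atlas P" and w: "w \<in> torus_set n" and v0: "v0 \<in> loc_dom U phi"
    and us: "set us \<subseteq> Rn (d + n)"
  obtains \<rho> J C where "\<rho> > 0" "finite J" "!!j. j \<in> J ==> valid_index P j" "C >= 0"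
    "ALL f:A. ALL v:Rn (d + n). near (d + n) \<rho> v0 v -->
      v \<in> loc_dom U phi & cmod (iter_dird (loc U phi w f) us v) <= C * (\<Sum>j\<in>J. sn j f)"
proof -
  let ?\<sigma> = "%v. \<sigma> (inv_into U phi (fst_part d v)) (torus_exp n w (snd_part d v))"
  have "?\<sigma> v0 \<in> X" using v0 by (intro \<sigma>_in inv_in_X[OF c] torus_exp_in[OF w]) (auto simp: loc_dom_def)
  then obtain V psi where V: "(V, psi) \<in> atlas P" "?\<sigma> v0 \<in> V" "chart P V psi" using chart_exists[OF P] by blast
  interpret V: chart P V psi by fact
  define D where "D = {v:loc_dom U phi. ?\<sigma> v \<in> V}"
  define g where "g = loc U phi w psi"
  have gj: "Cinf (d + n) D (%v. g v j)" for j
    using loc_smooth[OF c w V.smooth_fn_coord[of j]] by (simp add: D_def g_def loc_def[abs_def])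
  have D: "open_Rn (d + n) D" using Cinf_open[OF gj[of 0]] .
  have gV: "g v \<in> psi ` V" if "v \<in> D" for v using that by (auto simp: g_def loc_def D_def)
  have fg: "loc U phi w f v = f (inv_into V psi (g v))" if "v \<in> D" for f :: "'a => complex" and v
    using that by (simp add: g_def loc_def D_def)
  obtain cs where cs: "!!vs c. (vs, c) \<in> set cs ==> set vs \<subseteq> Rn d & Cinf (d + n) D c"
    "!!(f :: vec => complex) x. Cinf d (psi ` V) f ==> x \<in> D ==>
      iter_dird (%x. f (g x)) us x = (\<Sum>(vs, c)\<leftarrow>cs. c x *\<^sub>R iter_dird f vs (g x))"
    by (rule iter_dird_compose[OF D V.image_open gV gj us]) (assumption, rule that)
  have v0D: "v0 \<in> D" using v0 V(2) by (simp add: D_def)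
  obtain r where r: "r > 0" "!!v. v \<in> Rn (d + n) ==> (!!i. i < d + n ==> \<bar>v i - v0 i\<bar> < r) ==> v \<in> D"
    using openin_Euclidean_box[OF D v0D] by metis
  define B where "B = {v:Rn (d + n). ALL i<d + n. \<bar>v i - v0 i\<bar> <= r / 2}"
  have B: "compact B" unfolding B_def by (rule compact_box)
  have BD: "B \<subseteq> D"
  proof
    fix v assume v: "v \<in> B"
    have "\<bar>v i - v0 i\<bar> < r" if "i < d + n" for i
    proof -
      have "\<bar>v i - v0 i\<bar> <= r / 2" using v that by (simp add: B_def)
      then show ?thesis using r(1) by linarith
    qed
    then show "v \<in> D" using v by (intro r(2)) (auto simp: B_def)
  qed
  have gB: "compact (g ` B)"
  proof (rule compact_continuous_image[OF continuous_on_coordinatewise_then_product B])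
    show "continuous_on B (%v. g v j)" for j by (rule continuous_on_subset[OF Cinf_continuous[OF gj] BD])
  qed
  have "compact (\<Union>p\<in>set cs. snd p ` B)"
  proof (rule compact_UN)
    fix p assume "p \<in> set cs"
    then have "Cinf (d + n) D (snd p)" using cs(1)[of "fst p" "snd p"] by simp
    then show "compact (snd p ` B)"
      using compact_continuous_image[OF continuous_on_subset[OF Cinf_continuous BD] B] by blast
  qed simp
  then obtain b where "b > 0" "ALL t:(\<Union>p\<in>set cs. snd p ` B). norm t <= b"
    using compact_imp_bounded bounded_pos by metis
  then have b: "b >= 0" "!!vs c v. (vs, c) \<in> set cs ==> v \<in> B ==> \<bar>c v\<bar> <= b" by force+
  define ix where "ix vs = ((V, psi), g ` B, vs)" for vs :: "vec list"
  define J where "J = (ix o fst) ` set cs"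
  have ixv: "valid_index P (ix vs)" if "(vs, c) \<in> set cs" for vs c
    using V(1) gB gV BD cs(1)[OF that] by (auto simp: ix_def valid_index_def)
  have Jv: "valid_index P j" if "j \<in> J" for j using that ixv by (force simp: J_def)
  show ?thesis
  proof (rule that[of "r / 2" J "real (length cs) * b"], goal_cases)
    case 5
    show ?case
    proof (intro ballI impI)
    fix f v assume f: "f \<in> A" and v: "v \<in> Rn (d + n)" "ALL i<d + n. \<bar>v i - v0 i\<bar> < r / 2"
    have vB: "v \<in> B" using v by (force simp: B_def)
    then have vD: "v \<in> D" using BD by blast
    let ?S = "\<Sum>j\<in>J. sn j f"
    have fV: "Cinf d (psi ` V) (%x. f (inv_into V psi x))" by (rule in_chart[OF f V(1)])
    have "iter_dird (loc U phi w f) us v = iter_dird (%x. f (inv_into V psi (g x))) us v"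
      by (rule iter_dird_cong[OF D fg us vD])
    also have "... = (\<Sum>(vs, c)\<leftarrow>cs. c v *\<^sub>R iter_dird (%x. f (inv_into V psi x)) vs (g v))"
      by (rule cs(2)[OF fV vD])
    finally have "cmod (iter_dird (loc U phi w f) us v) <=
        (\<Sum>p\<leftarrow>cs. cmod (snd p v *\<^sub>R iter_dird (%x. f (inv_into V psi x)) (fst p) (g v)))"
      using norm_sum_list[of "%p. snd p v *\<^sub>R iter_dird (%x. f (inv_into V psi x)) (fst p) (g v)" cs]
      by (simp add: case_prod_unfold)
    also have "... <= (\<Sum>p\<leftarrow>cs. b * ?S)"
    proof (rule sum_list_mono)
      fix p assume p: "p \<in> set cs"
      then have p': "(fst p, snd p) \<in> set cs" by simp
      have "cmod (iter_dird (%x. f (inv_into V psi x)) (fst p) (g v)) <= sn (ix (fst p)) f"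
        using sn_bound[OF f, of "(V, psi)" "g ` B" "fst p" "g v"] ixv[OF p'] vB by (simp add: ix_def chart_deriv_def)
      also have "... <= ?S"
        using p Jv sn_nonneg[OF f] by (intro member_le_sum[of "ix (fst p)" J "%j. sn j f"]) (auto simp: J_def)
      finally have "cmod (iter_dird (%x. f (inv_into V psi x)) (fst p) (g v)) <= ?S" .
      then show "cmod (snd p v *\<^sub>R iter_dird (%x. f (inv_into V psi x)) (fst p) (g v)) <= b * ?S"
        unfolding norm_scaleR by (intro mult_mono b(2)[OF p' vB] b(1)) auto
    qed
    also have "... = real (length cs) * b * ?S" by (simp add: sum_list_triv)
    finally show "v \<in> loc_dom U phi & cmod (iter_dird (loc U phi w f) us v) <= real (length cs) * b * ?S"
      using vD by (simp add: D_def)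
    qed
  qed (use r(1) b(1) Jv in "auto simp: J_def")
qed

text \<open>Finitely many of the local estimates suffice over a compact \<open>K\<close>.\<close>

lemma loc_estimate:
  assumes c: "(U, phi) \<in> atlas P" and w: "w \<in> torus_set n" and us: "set us \<subseteq> Rn (d + n)"
    and K: "compact K" "K \<subseteq> phi ` U" and x0: "x0 \<in> cube n"
  obtains \<delta> J C where "\<delta> > 0" "finite J" "!!j. j \<in> J ==> valid_index P j" "C >= 0"
    "ALL f:A. ALL y:K. ALL x:Rn n. near n \<delta> x0 x -->
      cmod (iter_dird (loc U phi w f) us (join_vec d y x)) <= C * (\<Sum>j\<in>J. sn j f)"
proof -
  define ok where "ok p \<longleftrightarrow> finite (fst p) & (ALL j:fst p. valid_index P j) & snd p >= (0::real)" for p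
  let ?Q = "%p y x. ok p & (ALL f:A. cmod (iter_dird (loc U phi w f) us (join_vec d y x)) <= snd p * (\<Sum>j\<in>fst p. sn j f))"
  have KR: "K \<subseteq> Rn d" using K(2) openin_subset[OF chart.image_open[OF chartI[OF P c]]] by blast
  have "EX \<rho>>0. EX p. ALL y:Rn d. ALL x:Rn n. near d \<rho> y0 y -->
      near n \<rho> x0 x --> ?Q p y x" if y0: "y0 \<in> K" for y0
  proof -
    have v0: "join_vec d y0 x0 \<in> loc_dom U phi" using y0 K(2) by (intro join_loc_dom[OF c _ x0]) auto
    obtain \<rho> J C where *: "\<rho> > 0" "finite J" "!!j. j \<in> J ==> valid_index P j" "C >= 0"
      "ALL f:A. ALL v:Rn (d + n). (ALL i<d + n. \<bar>v i - join_vec d y0 x0 i\<bar> < \<rho>) -->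
        v \<in> loc_dom U phi & cmod (iter_dird (loc U phi w f) us v) <= C * (\<Sum>j\<in>J. sn j f)"
      by (rule loc_estimate_local[OF c w v0 us]) (rule that)
    show ?thesis
    proof (intro exI[of _ \<rho>] exI[of _ "(J, C)"] conjI ballI impI)
      show "ok (J, C)" using * by (simp add: ok_def)
      fix y x f assume "y \<in> Rn d" "x \<in> Rn n" "near d \<rho> y0 y" "near n \<rho> x0 x" "f \<in> A"
      then show "cmod (iter_dird (loc U phi w f) us (join_vec d y x)) <= snd (J, C) * (\<Sum>j\<in>fst (J, C). sn j f)"
        using *(5) join_vec_near[of d y y0 \<rho> n x x0] by simp
    qed fact
  qed
  then obtain \<delta> Cs where Cs: "\<delta> > 0" "finite Cs"
    "ALL y:K. ALL x:Rn n. near n \<delta> x0 x --> (EX p:Cs. ?Q p y x)"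
    by (rule compact_uniform[OF K(1) KR]) (assumption, rule that)
  let ?Cs = "{p:Cs. ok p}"
  define J where "J = (\<Union>p\<in>?Cs. fst p)"
  define C where "C = (\<Sum>p\<in>?Cs. snd p)"
  have fJ: "finite J" and vJ: "!!j. j \<in> J ==> valid_index P j" using Cs(2) by (auto simp: J_def ok_def)
  show ?thesis
  proof (rule that[OF Cs(1) fJ])
    show "C >= 0" unfolding C_def by (intro sum_nonneg) (auto simp: ok_def)
    show "ALL f:A. ALL y:K. ALL x:Rn n. near n \<delta> x0 x -->
      cmod (iter_dird (loc U phi w f) us (join_vec d y x)) <= C * (\<Sum>j\<in>J. sn j f)"
    proof (intro ballI impI)
    fix f y x assume f: "f \<in> A" and yx: "y \<in> K" "x \<in> Rn n" "near n \<delta> x0 x"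
    obtain p where p: "p \<in> Cs" "?Q p y x" using Cs(3) yx by blast
    then have p': "p \<in> ?Cs" by blast
    have "cmod (iter_dird (loc U phi w f) us (join_vec d y x)) <= snd p * (\<Sum>j\<in>fst p. sn j f)" using p f by blast
    also have "... <= C * (\<Sum>j\<in>J. sn j f)"
    proof (rule mult_mono)
      show "snd p <= C" unfolding C_def using p' Cs(2) by (intro member_le_sum) (auto simp: ok_def)
      show "(\<Sum>j\<in>fst p. sn j f) <= (\<Sum>j\<in>J. sn j f)"
        using p' fJ vJ sn_nonneg[OF f] by (intro sum_mono2) (auto simp: J_def)
      show "0 <= C" unfolding C_def by (intro sum_nonneg) (auto simp: ok_def)
      show "0 <= (\<Sum>j\<in>fst p. sn j f)" using p' sn_nonneg[OF f] by (intro sum_nonneg) (auto simp: ok_def)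
    qed
    finally show "cmod (iter_dird (loc U phi w f) us (join_vec d y x)) <= C * (\<Sum>j\<in>J. sn j f)" .
    qed
  qed (rule vJ)
qed

end

context smooth_algebra
begin

abbreviation fadd :: "('a => complex) => ('a => complex) => 'a => complex" where
  "fadd f g == (\<lambda>p\<in>X. f p + g p)"

abbreviation fsm :: "complex => ('a => complex) => 'a => complex" where
  "fsm c f == (\<lambda>p\<in>X. c * f p)"

lemma limitin_T_const: "f \<in> A ==> limitin T (%_. f) f L"
  by simp

lemma limitin_T_sum:
  assumes "finite I" "!!i. i \<in> I ==> limitin T (F i) (f i) L"
  shows "limitin T (%t. \<lambda>p\<in>X. \<Sum>i\<in>I. F i t p) (\<lambda>p\<in>X. \<Sum>i\<in>I. f i p) L"
  using assms
proof (induction I)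
  case empty
  then show ?case using limitin_T_const[OF A_const[of 0]] by (simp add: restrict_def)
next
  case (insert i I)
  have "limitin T (%t. fadd (F i t) (\<lambda>p\<in>X. \<Sum>i\<in>I. F i t p)) (fadd (f i) (\<lambda>p\<in>X. \<Sum>i\<in>I. f i p)) L"
    using insert by (intro limitin_T_add) auto
  moreover have "fadd (F i t) (\<lambda>p\<in>X. \<Sum>i\<in>I. F i t p) = (\<lambda>p\<in>X. \<Sum>i\<in>insert i I. F i t p)" for t
    using insert by auto
  moreover have "fadd (f i) (\<lambda>p\<in>X. \<Sum>i\<in>I. f i p) = (\<lambda>p\<in>X. \<Sum>i\<in>insert i I. f i p)"
    using insert by auto
  ultimately show ?case by (simp only:)
qed

lemma limitin_T_bounded_op:
  assumes \<Phi>: "!!f. f \<in> A ==> \<Phi> f \<in> A" "!!f g. f \<in> A ==> g \<in> A ==> \<Phi> (fdiff P f g) = fdiff P (\<Phi> f) (\<Phi> g)"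
    and bd: "!!j. valid_index P j ==> EX J C. finite J & (ALL i:J. valid_index P i) &
      (ALL f:A. sn j (\<Phi> f) <= C * (\<Sum>i\<in>J. sn i f))"
    and F: "limitin T F f L"
  shows "limitin T (%t. \<Phi> (F t)) (\<Phi> f) L"
proof (rule limitin_T_squeeze)
  have f: "f \<in> A" and ev: "\<forall>\<^sub>F t in L. F t \<in> A" using F unfolding limitin_T by auto
  show "\<Phi> f \<in> A" by (rule \<Phi>(1)[OF f])
  from ev show "\<forall>\<^sub>F t in L. \<Phi> (F t) \<in> A" by eventually_elim (rule \<Phi>(1))
  fix j assume "valid_index P j"
  then obtain J C where J: "finite J" "ALL i:J. valid_index P i" "ALL f:A. sn j (\<Phi> f) <= C * (\<Sum>i\<in>J. sn i f)"
    using bd by meson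
  show "EX G. (\<forall>\<^sub>F t in L. sn j (fdiff P (\<Phi> (F t)) (\<Phi> f)) <= G t) & (G \<longlongrightarrow> 0) L"
  proof (intro exI conjI)
    from ev show "\<forall>\<^sub>F t in L. sn j (fdiff P (\<Phi> (F t)) (\<Phi> f)) <= C * (\<Sum>i\<in>J. sn i (fdiff P (F t) f))"
    proof eventually_elim
      case (elim t)
      then show ?case using J(3) A_diff[OF elim f] by (simp add: \<Phi>(2)[OF elim f, symmetric])
    qed
    have "((%t. C * (\<Sum>i\<in>J. sn i (fdiff P (F t) f))) \<longlongrightarrow> C * (\<Sum>i\<in>J. 0)) L"
      using J(2) by (intro tendsto_intros limitin_T_tendsto[OF F]) auto
    then show "((%t. C * (\<Sum>i\<in>J. sn i (fdiff P (F t) f))) \<longlongrightarrow> 0) L" by simp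
  qed
qed

lemma dir_deriv_C_infinity:
  assumes "has_dir_deriv E (C_infinity P) f v x u"
  shows "dir_deriv E (C_infinity P) f v x = u"
  unfolding dir_deriv_def
proof (rule the_equality[of _ u])
  fix u' assume u': "has_dir_deriv E (C_infinity P) f v x u'"
  have "at (0::real) ~= bot" by simp
  then show "u' = u"
    using limitin_Hausdorff_unique[OF _ _ _ Hausdorff_T] u' assms unfolding has_dir_deriv_def C_infinity_simps(7) by blast
qed (rule assms)

end

lemma prod_lcs_simps [simp]:
  "carrier (prod_lcs E F) = carrier E \<times> carrier F"
  "(x, y) \<oplus>\<^bsub>prod_lcs E F\<^esub> (x', y') = (x \<oplus>\<^bsub>E\<^esub> x', y \<oplus>\<^bsub>F\<^esub> y')"
  "t \<odot>\<^bsub>prod_lcs E F\<^esub> (x, y) = (of_real t \<odot>\<^bsub>E\<^esub> x, of_real t \<odot>\<^bsub>F\<^esub> y)"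
  "topo (prod_lcs E F) = prod_topology (topo E) (topo F)"
  by (simp_all add: prod_lcs_def)

context torus_action
begin

lemma act_apply: "p \<in> X ==> act z f p = f (\<sigma> p z)"
  by (simp add: act_def)

lemma act_one: "f \<in> A ==> act (torus_one n) f = f"
  by (rule A_eqI) (auto simp: act_A act_apply \<sigma>_one)

lemma act_act:
  assumes "z \<in> torus_set n" "w \<in> torus_set n" "f \<in> A"
  shows "act z (act w f) = act (\<lambda>i\<in>{..<n}. z i * w i) f"
  using assms by (intro A_eqI act_A torus_mult_in) (auto simp: act_apply \<sigma>_in \<sigma>_mult)

lemma act_fdiff: "z \<in> torus_set n ==> act z (fdiff P f g) = fdiff P (act z f) (act z g)"
  using \<sigma>_in by (auto simp: act_def fdiff_def fun_eq_iff)

lemma act_fadd: "z \<in> torus_set n ==> act z (fadd f g) = fadd (act z f) (act z g)"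
  using \<sigma>_in by (auto simp: act_def fun_eq_iff)

lemma act_fsm: "z \<in> torus_set n ==> act z (fsm c f) = fsm c (act z f)"
  using \<sigma>_in by (auto simp: act_def fun_eq_iff)

lemma chart_subset_Rn: "(U, phi) \<in> atlas P ==> phi ` U \<subseteq> Rn d"
  using openin_subset[OF chart.image_open[OF chartI[OF P]]] .

lemma set_map_ex_fst: "set vs \<subseteq> Rn d ==> set (map (ex_fst d) vs) \<subseteq> Rn (d + n)"
  using ex_fst_Rn by auto

lemma chart_deriv_act:
  assumes c: "(U, phi) \<in> atlas P" and y: "y \<in> phi ` U" and vs: "set vs \<subseteq> Rn d"
  shows "chart_deriv (U, phi) vs (act (torus_exp n w x) f) y =
     iter_dird (loc U phi w f) (map (ex_fst d) vs) (join_vec d y x)"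
proof -
  have "chart_deriv (U, phi) vs (act (torus_exp n w x) f) y = iter_dird (%y. loc U phi w f (join_vec d y x)) vs y"
    unfolding chart_deriv_def fst_conv snd_conv
  proof (rule iter_dird_cong[OF chart.image_open[OF chartI[OF P c]] _ vs y])
    fix y assume y: "y \<in> phi ` U"
    then have "y \<in> Rn d" using chart_subset_Rn[OF c] by blast
    then show "act (torus_exp n w x) f (inv_into U phi y) = loc U phi w f (join_vec d y x)"
      by (simp add: loc_def act_apply[OF inv_in_X[OF c y]])
  qed
  then show ?thesis by (simp add: iter_dird_slice)
qed

lemma act_estimate:
  assumes j: "valid_index P j" and w: "w \<in> torus_set n" and x0: "x0 \<in> cube n"
  obtains \<delta> J C where "\<delta> > 0" "finite J" "!!i. i \<in> J ==> valid_index P i"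
    "ALL f:A. ALL x:Rn n. near n \<delta> x0 x --> sn j (act (torus_exp n w x) f) <= C * (\<Sum>i\<in>J. sn i f)"
proof -
  obtain U phi K vs where jj: "j = ((U, phi), K, vs)" and v: "(U, phi) \<in> atlas P" "compact K" "K \<subseteq> phi ` U" "set vs \<subseteq> Rn d"
    using j by (rule valid_indexE)
  obtain \<delta> J C where J: "\<delta> > 0" "finite J" "!!i. i \<in> J ==> valid_index P i" "C >= 0"
    "ALL f:A. ALL y:K. ALL x:Rn n. near n \<delta> x0 x -->
      cmod (iter_dird (loc U phi w f) (map (ex_fst d) vs) (join_vec d y x)) <= C * (\<Sum>j\<in>J. sn j f)"
    by (rule loc_estimate[OF v(1) w set_map_ex_fst[OF v(4)] v(2,3) x0]) (rule that)
  show ?thesis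
  proof (rule that[OF J(1,2,3)])
    show "ALL f:A. ALL x:Rn n. near n \<delta> x0 x --> sn j (act (torus_exp n w x) f) <= C * (\<Sum>i\<in>J. sn i f)"
    proof (intro ballI impI)
      fix f x assume f: "f \<in> A" and x: "x \<in> Rn n" "near n \<delta> x0 x"
      show "sn j (act (torus_exp n w x) f) <= C * (\<Sum>i\<in>J. sn i f)"
        unfolding jj
      proof (rule sn_le)
        show "0 <= C * (\<Sum>i\<in>J. sn i f)" using J(3,4) sn_nonneg[OF f] by (intro mult_nonneg_nonneg sum_nonneg) auto
        fix y assume y: "y \<in> K"
        show "cmod (chart_deriv (U, phi) vs (act (torus_exp n w x) f) y) <= C * (\<Sum>i\<in>J. sn i f)"
          using J(5) f x y v(3) by (subst chart_deriv_act[OF v(1) _ v(4)]) auto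
      qed
    qed
  qed
qed

lemma coordinates_eventually_near:
  assumes "ALL i<n. ((%t. x t i) \<longlongrightarrow> x0 i) L" "\<delta> > (0::real)"
  shows "\<forall>\<^sub>F t in L. ALL i<n. \<bar>x t i - x0 i\<bar> < \<delta>"
proof -
  have "\<forall>\<^sub>F t in L. \<bar>x t i - x0 i\<bar> < \<delta>" if "i < n" for i
    using tendstoD[OF assms(1)[rule_format, OF that] assms(2)] by (simp add: dist_real_def)
  then have "\<forall>\<^sub>F t in L. ALL i:{..<n}. \<bar>x t i - x0 i\<bar> < \<delta>" by (intro eventually_ball_finite) auto
  then show ?thesis by (auto elim: eventually_mono)
qed

lemma act_param_continuous:
  assumes j: "valid_index P j" and w: "w \<in> torus_set n" and x0: "x0 \<in> cube n" and f: "f \<in> A"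
    and x: "ALL i<n. ((%t. x t i) \<longlongrightarrow> x0 i) L" "\<forall>\<^sub>F t in L. x t \<in> Rn n"
  shows "((%t. sn j (fdiff P (act (torus_exp n w (x t)) f) (act (torus_exp n w x0) f))) \<longlongrightarrow> 0) L"
proof (rule tendstoI)
  fix e :: real assume e: "e > 0"
  obtain U phi K vs where jj: "j = ((U, phi), K, vs)" and v: "(U, phi) \<in> atlas P" "compact K" "K \<subseteq> phi ` U" "set vs \<subseteq> Rn d"
    using j by (rule valid_indexE)
  let ?H = "iter_dird (loc U phi w f) (map (ex_fst d) vs)"
  have H: "continuous_on (loc_dom U phi) ?H"
    by (rule Cinf_continuous[OF Cinf_iter_dird[OF loc_A[OF v(1) w f] set_map_ex_fst[OF v(4)]]])
  have KR: "K \<subseteq> Rn d" using v(3) chart_subset_Rn[OF v(1)] by blast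
  have x0R: "x0 \<in> Rn n" using x0 cube_subset by blast
  obtain \<delta> where \<delta>: "\<delta> > 0" "!!y x. y \<in> K ==> x \<in> Rn n ==> (!!i. i < n ==> \<bar>x i - x0 i\<bar> < \<delta>) ==>
      join_vec d y x \<in> loc_dom U phi & dist (?H (join_vec d y x)) (?H (join_vec d y x0)) < e"
    using uniform_in_parameter[OF v(2) KR loc_dom_open[OF v(1)] H x0R join_loc_dom[OF v(1) _ x0] e] v(3) by blast
  have in_A: "act (torus_exp n w x) f \<in> A" for x by (intro act_A torus_exp_in w f)
  show "\<forall>\<^sub>F t in L. dist (sn j (fdiff P (act (torus_exp n w (x t)) f) (act (torus_exp n w x0) f))) 0 < e"
    using coordinates_eventually_near[OF x(1) \<delta>(1)] x(2)
  proof eventually_elim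
    case (elim t)
    have "sn j (fdiff P (act (torus_exp n w (x t)) f) (act (torus_exp n w x0) f)) < e"
      unfolding jj sn_less_iff[OF A_diff[OF in_A in_A] j[unfolded jj] e]
    proof
      fix y assume y: "y \<in> K"
      then have yU: "y \<in> phi ` U" using v(3) by blast
      have "dist (?H (join_vec d y (x t))) (?H (join_vec d y x0)) < e" using \<delta>(2)[OF y] elim by blast
      then show "cmod (chart_deriv (U, phi) vs (fdiff P (act (torus_exp n w (x t)) f) (act (torus_exp n w x0) f)) y) < e"
        unfolding chart_deriv_fdiff[OF in_A in_A v(1,4) yU] chart_deriv_act[OF v(1) yU v(4)] dist_norm .
    qed
    then show ?case using sn_nonneg[OF A_diff[OF in_A in_A] j] by simp
  qed
qed

text \<open>The estimate controls the change of the function uniformly in the group element, so the two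
  arguments may move separately.\<close>

lemma act_limit:
  assumes w: "w \<in> torus_set n" and x0: "x0 \<in> cube n" and F: "limitin T F f L"
    and x: "ALL i<n. ((%t. x t i) \<longlongrightarrow> x0 i) L" "\<forall>\<^sub>F t in L. x t \<in> Rn n"
  shows "limitin T (%t. act (torus_exp n w (x t)) (F t)) (act (torus_exp n w x0) f) L"
proof (rule limitin_T_squeeze)
  have f: "f \<in> A" and ev: "\<forall>\<^sub>F t in L. F t \<in> A" using F unfolding limitin_T by auto
  let ?z = "%t. torus_exp n w (x t)"
  have z: "?z t \<in> torus_set n" for t by (rule torus_exp_in[OF w])
  show "act (torus_exp n w x0) f \<in> A" by (intro act_A torus_exp_in w f)
  from ev show "\<forall>\<^sub>F t in L. act (?z t) (F t) \<in> A" by eventually_elim (rule act_A[OF z])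
  fix j assume j: "valid_index P j"
  obtain \<delta> J C where J: "\<delta> > 0" "finite J" "!!i. i \<in> J ==> valid_index P i"
    "ALL f:A. ALL x:Rn n. near n \<delta> x0 x --> sn j (act (torus_exp n w x) f) <= C * (\<Sum>i\<in>J. sn i f)"
    by (rule act_estimate[OF j w x0]) (rule that)
  let ?G = "%t. C * (\<Sum>i\<in>J. sn i (fdiff P (F t) f)) + sn j (fdiff P (act (?z t) f) (act (torus_exp n w x0) f))"
  show "EX G. (\<forall>\<^sub>F t in L. sn j (fdiff P (act (?z t) (F t)) (act (torus_exp n w x0) f)) <= G t) & (G \<longlongrightarrow> 0) L"
  proof (intro exI[of _ ?G] conjI)
    show "\<forall>\<^sub>F t in L. sn j (fdiff P (act (?z t) (F t)) (act (torus_exp n w x0) f)) <= ?G t"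
      using ev coordinates_eventually_near[OF x(1) J(1)] x(2)
    proof eventually_elim
      case (elim t)
      have "sn j (fdiff P (act (?z t) (F t)) (act (torus_exp n w x0) f)) <=
          sn j (fdiff P (act (?z t) (F t)) (act (?z t) f)) + sn j (fdiff P (act (?z t) f) (act (torus_exp n w x0) f))"
        by (intro sn_triangle act_A z elim f j torus_exp_in w)
      moreover have "sn j (fdiff P (act (?z t) (F t)) (act (?z t) f)) <= C * (\<Sum>i\<in>J. sn i (fdiff P (F t) f))"
        unfolding act_fdiff[OF z, symmetric] using J(4) A_diff[OF elim(1) f] elim(2,3) by blast
      ultimately show ?case by linarith
    qed
    have "(?G \<longlongrightarrow> C * (\<Sum>i\<in>J. 0) + 0) L"
      using J(3) by (intro tendsto_intros limitin_T_tendsto[OF F] act_param_continuous[OF j w x0 f x]) auto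
    then show "(?G \<longlongrightarrow> 0) L" by simp
  qed
qed

subsection \<open>Infinitesimal generators\<close>

definition inf_gen :: "vec => ('a => complex) => 'a => complex" where
  "inf_gen xi f = (\<lambda>p\<in>X. dird xi (%x. f (\<sigma> p (torus_exp n (torus_one n) x))) (%_. 0))"

lemma join_compose_fst:
  assumes "open_Rn d S" "Cinf (d + m) D H" "!!y. y \<in> S ==> join_vec d y x \<in> D"
  shows "Cinf d S (%y. H (join_vec d y x))"
proof (rule Cinf_compose[OF assms])
  fix j show "Cinf d S (%y. join_vec d y x j)"
    by (cases "j < d") (auto simp: join_vec_def intro: Cinf_coord Cinf_const assms(1))
qed

lemma join_compose_snd:
  assumes "open_Rn m S" "Cinf (d + m) D H" "!!x. x \<in> S ==> join_vec d y x \<in> D"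
  shows "Cinf m S (%x. H (join_vec d y x))"
proof (rule Cinf_compose[OF assms])
  fix j show "Cinf m S (%x. join_vec d y x j)"
    by (cases "j < d") (auto simp: join_vec_def intro: Cinf_coord Cinf_const assms(1))
qed

lemma orbit_fn_eq:
  assumes "(U, phi) \<in> atlas P" "y \<in> phi ` U"
  shows "f (\<sigma> (inv_into U phi y) (torus_exp n w x)) = loc U phi w f (join_vec d y x)"
  using chart_subset_Rn[OF assms(1)] assms(2) by (auto simp: loc_def subset_iff)

lemma inf_gen_chart:
  assumes c: "(U, phi) \<in> atlas P" and y: "y \<in> phi ` U"
  shows "inf_gen xi f (inv_into U phi y) = dird (ex_snd d xi) (loc U phi (torus_one n) f) (join_vec d y (%_. 0))"
  unfolding inf_gen_def dird_slice_snd[symmetric] orbit_fn_eq[OF c y, symmetric]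
  using inv_in_X[OF c y] by simp

lemma inf_gen_A:
  assumes f: "f \<in> A" and xi: "xi \<in> Rn n"
  shows "inf_gen xi f \<in> A"
  unfolding A_iff
proof
  show "inf_gen xi f \<in> extensional X" by (simp add: inf_gen_def)
  show "smooth_fn P X (inf_gen xi f)"
    unfolding smooth_fn_def
  proof (intro conjI openin_X, safe)
    fix U phi assume c: "(U, phi) \<in> atlas P"
    have UX: "U Int X = U" using chart.dom_subset[OF chartI[OF P c]] by auto
    have "Cinf d (phi ` U) (%y. dird (ex_snd d xi) (loc U phi (torus_one n) f) (join_vec d y (%_. 0)))"
      by (rule join_compose_fst[OF chart.image_open[OF chartI[OF P c]]
            Cinf_dird[OF loc_A[OF c torus_one_in f] ex_snd_Rn[OF xi]] join_loc_dom[OF c _ zero_in_cube]])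
    then show "Cinf d (phi ` (U Int X)) (%y. inf_gen xi f (inv_into U phi y))"
      unfolding UX by (rule Cinf_cong[THEN iffD1, rotated]) (simp add: inf_gen_chart[OF c])
  qed
qed

text \<open>The two forms differ by the symmetry of mixed derivatives: the first is estimated by
  seminorms of \<open>f\<close>, the second is a derivative along the flow.\<close>

lemma chart_deriv_inf_gen:
  assumes c: "(U, phi) \<in> atlas P" and y: "y \<in> phi ` U" and vs: "set vs \<subseteq> Rn d" and f: "f \<in> A" and xi: "xi \<in> Rn n"
  shows "chart_deriv (U, phi) vs (inf_gen xi f) y =
      iter_dird (loc U phi (torus_one n) f) (map (ex_fst d) vs @ [ex_snd d xi]) (join_vec d y (%_. 0))"
    "chart_deriv (U, phi) vs (inf_gen xi f) y =
      dird (ex_snd d xi) (iter_dird (loc U phi (torus_one n) f) (map (ex_fst d) vs)) (join_vec d y (%_. 0))"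
proof -
  have "chart_deriv (U, phi) vs (inf_gen xi f) y =
      iter_dird (%y. dird (ex_snd d xi) (loc U phi (torus_one n) f) (join_vec d y (%_. 0))) vs y"
    unfolding chart_deriv_def fst_conv snd_conv
    by (rule iter_dird_cong[OF chart.image_open[OF chartI[OF P c]] inf_gen_chart[OF c] vs y])
  also have "... = iter_dird (dird (ex_snd d xi) (loc U phi (torus_one n) f)) (map (ex_fst d) vs) (join_vec d y (%_. 0))"
    by (rule iter_dird_slice)
  finally have eq: "chart_deriv (U, phi) vs (inf_gen xi f) y =
      iter_dird (dird (ex_snd d xi) (loc U phi (torus_one n) f)) (map (ex_fst d) vs) (join_vec d y (%_. 0))" .
  then show "chart_deriv (U, phi) vs (inf_gen xi f) y =
      iter_dird (loc U phi (torus_one n) f) (map (ex_fst d) vs @ [ex_snd d xi]) (join_vec d y (%_. 0))"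
    by (simp only: iter_dird_snoc)
  show "chart_deriv (U, phi) vs (inf_gen xi f) y =
      dird (ex_snd d xi) (iter_dird (loc U phi (torus_one n) f) (map (ex_fst d) vs)) (join_vec d y (%_. 0))"
    unfolding eq
    by (rule dird_iter_dird_commute[OF loc_A[OF c torus_one_in f] ex_snd_Rn[OF xi] set_map_ex_fst[OF vs]
          join_loc_dom[OF c y zero_in_cube], symmetric])
qed

text \<open>The difference quotient converges with all derivatives: along the flow the mean value
  inequality applies to each derivative, whose flow derivative is continuous.\<close>

lemma inf_gen_limit:
  assumes f: "f \<in> A" and xi: "xi \<in> Rn n"
  shows "limitin T (%t. fsm (of_real (1 / t)) (fdiff P (act (torus_exp n (torus_one n) (%i. t * xi i)) f) f))
     (inf_gen xi f) (at 0)"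
  unfolding limitin_T
proof (intro conjI allI impI)
  let ?e = "torus_exp n (torus_one n)"
  have aA: "act (?e x) f \<in> A" for x by (intro act_A torus_exp_in torus_one_in f)
  have qA: "fsm c (fdiff P (act (?e x) f) f) \<in> A" for c x by (intro A_smult A_diff aA f)
  show "inf_gen xi f \<in> A" by (rule inf_gen_A[OF f xi])
  show "\<forall>\<^sub>F t in at 0. fsm (of_real (1 / t)) (fdiff P (act (?e (%i. t * xi i)) f) f) \<in> A"
    using qA by (simp del: of_real_divide)
  fix j assume j: "valid_index P j"
  obtain U phi K vs where jj: "j = ((U, phi), K, vs)" and v: "(U, phi) \<in> atlas P" "compact K" "K \<subseteq> phi ` U" "set vs \<subseteq> Rn d"
    using j by (rule valid_indexE)
  let ?L = "loc U phi (torus_one n) f"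
  let ?H = "iter_dird ?L (map (ex_fst d) vs)"
  have HC: "Cinf (d + n) (loc_dom U phi) ?H"
    by (rule Cinf_iter_dird[OF loc_A[OF v(1) torus_one_in f] set_map_ex_fst[OF v(4)]])
  let ?H' = "dird (ex_snd d xi) ?H"
  have H': "continuous_on (loc_dom U phi) ?H'" by (rule Cinf_continuous[OF Cinf_dird[OF HC ex_snd_Rn[OF xi]]])
  have KR: "K \<subseteq> Rn d" using v(3) chart_subset_Rn[OF v(1)] by blast
  show "((%t. sn j (fdiff P (fsm (of_real (1 / t)) (fdiff P (act (?e (%i. t * xi i)) f) f)) (inf_gen xi f))) \<longlongrightarrow> 0) (at 0)"
  proof (rule tendstoI)
    fix e :: real assume e: "e > 0"
    then have e2: "e / 2 > 0" by simp
    have z0: "(%_. 0) \<in> Rn n" by (simp add: Rn_iff)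
    obtain \<delta> where \<delta>: "\<delta> > 0" "!!y x. y \<in> K ==> x \<in> Rn n ==> (!!i. i < n ==> \<bar>x i - 0\<bar> < \<delta>) ==>
        join_vec d y x \<in> loc_dom U phi & dist (?H' (join_vec d y x)) (?H' (join_vec d y (%_. 0))) < e / 2"
      using uniform_in_parameter[OF v(2) KR loc_dom_open[OF v(1)] H' z0 join_loc_dom[OF v(1) _ zero_in_cube] e2] v(3)
      by blast
    have "((%t. t * xi i) \<longlongrightarrow> 0) (at 0)" for i
      using tendsto_mult_left_zero[OF tendsto_ident_at[of "0::real" UNIV], of "xi i"] by simp
    then have "\<forall>\<^sub>F t in at 0. ALL i<n. \<bar>t * xi i - 0\<bar> < \<delta>"
      using coordinates_eventually_near[of "%t i. t * xi i" "%_. 0" "at 0" \<delta>] \<delta>(1) by simp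
    moreover have "\<forall>\<^sub>F t in at (0::real). t ~= 0" by (simp add: eventually_at_filter)
    ultimately show "\<forall>\<^sub>F t in at 0. dist (sn j (fdiff P (fsm (of_real (1 / t)) (fdiff P (act (?e (%i. t * xi i)) f) f)) (inf_gen xi f))) 0 < e"
    proof eventually_elim
      case (elim t)
      let ?q = "fdiff P (fsm (of_real (1 / t)) (fdiff P (act (?e (%i. t * xi i)) f) f)) (inf_gen xi f)"
      have qqA: "?q \<in> A" by (intro A_diff qA inf_gen_A f xi)
      have "sn j ?q <= e / 2"
        unfolding jj
      proof (rule sn_le)
        fix y assume y: "y \<in> K"
        then have yU: "y \<in> phi ` U" using v(3) by blast
        let ?h = "%s. ?H (join_vec d y (%i. s * xi i))"
        have "norm (?h t - ?h 0 - (t - 0) *\<^sub>R ?H' (join_vec d y (%_. 0))) <= e / 2 * \<bar>t - 0\<bar>"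
        proof (rule vector_mvt_bound[where f' = "%s. ?H' (join_vec d y (%i. s * xi i))"])
          fix s assume "s \<in> closed_segment 0 t"
          then have s: "\<bar>s\<bar> <= \<bar>t\<bar>" by (auto simp: closed_segment_eq_real_ivl split: if_splits)
          have "\<bar>s * xi i - 0\<bar> < \<delta>" if "i < n" for i
          proof -
            have "\<bar>s * xi i\<bar> <= \<bar>t * xi i\<bar>" unfolding abs_mult using s by (intro mult_right_mono) auto
            then show ?thesis using elim(1) that by force
          qed
          moreover have "(%i. s * xi i) \<in> Rn n" using xi by (simp add: Rn_iff)
          ultimately have *: "join_vec d y (%i. s * xi i) \<in> loc_dom U phi"
            "dist (?H' (join_vec d y (%i. s * xi i))) (?H' (join_vec d y (%_. 0))) < e / 2"
            using \<delta>(2)[OF y] by blast+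
          then show "norm (?H' (join_vec d y (%i. s * xi i)) - ?H' (join_vec d y (%_. 0))) <= e / 2"
            by (simp add: dist_norm)
          have eq: "join_vec d y (%i. s * xi i) = (%i. join_vec d y (%_. 0) i + s * ex_snd d xi i)" for s
            using join_add_snd[of d y "%_. 0" s xi] by simp
          have "has_dird ?H (ex_snd d xi) (join_vec d y (%i. s * xi i)) (?H' (join_vec d y (%i. s * xi i)))"
            by (rule Cinf_has_dird[OF HC *(1) ex_snd_Rn[OF xi]])
          then show "(?h has_vector_derivative ?H' (join_vec d y (%i. s * xi i))) (at s)"
            unfolding eq by (rule has_dird_line)
        qed
        then have mv: "cmod (?h t - ?h 0 - t *\<^sub>R ?H' (join_vec d y (%_. 0))) <= e / 2 * \<bar>t\<bar>" by simp
        have h0: "chart_deriv (U, phi) vs f y = ?h 0"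
          using chart_deriv_act[OF v(1) yU v(4), of "torus_one n" "%_. 0" f]
          by (simp add: torus_exp_zero act_one[OF f])
        have "chart_deriv (U, phi) vs ?q y = of_real (1 / t) * (?h t - ?h 0) - ?H' (join_vec d y (%_. 0))"
          unfolding chart_deriv_fdiff[OF qA inf_gen_A[OF f xi] v(1,4) yU]
            chart_deriv_smult[OF A_diff[OF aA f] v(1,4) yU] chart_deriv_fdiff[OF aA f v(1,4) yU]
            chart_deriv_act[OF v(1) yU v(4)] chart_deriv_inf_gen(2)[OF v(1) yU v(4) f xi] h0 ..
        also have "... = of_real (1 / t) * (?h t - ?h 0 - t *\<^sub>R ?H' (join_vec d y (%_. 0)))"
          using elim(2) by (simp add: algebra_simps scaleR_conv_of_real)
        finally have "cmod (chart_deriv (U, phi) vs ?q y) =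
            \<bar>1 / t\<bar> * cmod (?h t - ?h 0 - t *\<^sub>R ?H' (join_vec d y (%_. 0)))"
          by (simp only: norm_mult norm_of_real)
        also have "... <= \<bar>1 / t\<bar> * (e / 2 * \<bar>t\<bar>)" by (rule mult_left_mono[OF mv]) simp
        also have "... = e / 2" using elim(2) by simp
        finally show "cmod (chart_deriv (U, phi) vs ?q y) <= e / 2" .
      qed (use e in simp)
      then show ?case using sn_nonneg[OF qqA j] e by simp
    qed
  qed
qed

end

context torus_action
begin

lemma orbit_fn_Cinf:
  assumes f: "f \<in> A" and p: "p \<in> X"
  shows "Cinf n (cube n) (%x. f (\<sigma> p (torus_exp n (torus_one n) x)))"
proof -
  obtain U phi where c: "(U, phi) \<in> atlas P" "p \<in> U" "chart P U phi" using chart_exists[OF P p] by blast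
  interpret chart P U phi by fact
  have pU: "phi p \<in> phi ` U" using c by blast
  have "Cinf n (cube n) (%x. loc U phi (torus_one n) f (join_vec d (phi p) x))"
    by (rule join_compose_snd[OF openin_cube loc_A[OF c(1) torus_one_in f] join_loc_dom[OF c(1) pU]])
  then show ?thesis unfolding orbit_fn_eq[OF c(1) pU, symmetric] using c(2) by simp
qed

lemma inf_gen_fadd:
  assumes "f \<in> A" "g \<in> A" "xi \<in> Rn n"
  shows "inf_gen xi (fadd f g) = fadd (inf_gen xi f) (inf_gen xi g)"
proof (rule A_eqI)
  fix p assume p: "p \<in> X"
  have "inf_gen xi (fadd f g) p = iter_dird (%x. f (\<sigma> p (torus_exp n (torus_one n) x)) +
      g (\<sigma> p (torus_exp n (torus_one n) x))) [xi] (%_. 0)"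
    using p \<sigma>_in[OF p torus_exp_in[OF torus_one_in]] by (simp add: inf_gen_def)
  also have "... = inf_gen xi f p + inf_gen xi g p"
    using p assms(3) by (subst iter_dird_add[OF orbit_fn_Cinf[OF assms(1) p] orbit_fn_Cinf[OF assms(2) p]])
      (auto simp: inf_gen_def)
  finally show "inf_gen xi (fadd f g) p = fadd (inf_gen xi f) (inf_gen xi g) p" using p by simp
qed (auto intro: inf_gen_A A_add assms)

lemma inf_gen_fsm:
  assumes "f \<in> A" "xi \<in> Rn n"
  shows "inf_gen xi (fsm c f) = fsm c (inf_gen xi f)"
proof (rule A_eqI)
  fix p assume p: "p \<in> X"
  have "inf_gen xi (fsm c f) p = iter_dird (%x. c * f (\<sigma> p (torus_exp n (torus_one n) x))) [xi] (%_. 0)"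
    using p \<sigma>_in[OF p torus_exp_in[OF torus_one_in]] by (simp add: inf_gen_def)
  also have "... = c * inf_gen xi f p"
    using p assms(2) by (subst bounded_linear.iter_dird_linear[OF bounded_linear_mult_right orbit_fn_Cinf[OF assms(1) p]])
      (auto simp: inf_gen_def)
  finally show "inf_gen xi (fsm c f) p = fsm c (inf_gen xi f) p" using p by simp
qed (auto intro: inf_gen_A A_smult assms)

lemma inf_gen_fdiff:
  assumes "f \<in> A" "g \<in> A" "xi \<in> Rn n"
  shows "inf_gen xi (fdiff P f g) = fdiff P (inf_gen xi f) (inf_gen xi g)"
  unfolding fdiff_eq inf_gen_fadd[OF assms(1) A_smult[OF assms(2)] assms(3)] inf_gen_fsm[OF assms(2,3)] ..

text \<open>Linearity in the direction reduces limits with varying directions to the fixed operators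
  \<open>inf_gen (unitv i)\<close>.\<close>

lemma inf_gen_sum:
  assumes "f \<in> A" "xi \<in> Rn n"
  shows "inf_gen xi f = (\<lambda>p\<in>X. \<Sum>i<n. fsm (of_real (xi i)) (inf_gen (unitv i) f) p)"
proof
  fix p show "inf_gen xi f p = (\<lambda>p\<in>X. \<Sum>i<n. fsm (of_real (xi i)) (inf_gen (unitv i) f) p) p"
    using dird_sum[OF orbit_fn_Cinf[OF assms(1)] zero_in_cube assms(2)]
    by (cases "p \<in> X") (simp_all add: inf_gen_def scaleR_conv_of_real)
qed

text \<open>Generators are differential operators of order one, so they are continuous on the algebra.\<close>

lemma inf_gen_bounded:
  assumes j: "valid_index P j" and xi: "xi \<in> Rn n"
  shows "EX J C. finite J & (ALL i:J. valid_index P i) & (ALL f:A. sn j (inf_gen xi f) <= C * (\<Sum>i\<in>J. sn i f))"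
proof -
  obtain U phi K vs where jj: "j = ((U, phi), K, vs)" and v: "(U, phi) \<in> atlas P" "compact K" "K \<subseteq> phi ` U" "set vs \<subseteq> Rn d"
    using j by (rule valid_indexE)
  have us: "set (map (ex_fst d) vs @ [ex_snd d xi]) \<subseteq> Rn (d + n)"
    using set_map_ex_fst[OF v(4)] ex_snd_Rn[OF xi] by auto
  obtain \<delta> J C where J: "\<delta> > 0" "finite J" "!!i. i \<in> J ==> valid_index P i" "C >= 0"
    "ALL f:A. ALL y:K. ALL x:Rn n. (ALL i<n. \<bar>x i - (%_. 0) i\<bar> < \<delta>) -->
      cmod (iter_dird (loc U phi (torus_one n) f) (map (ex_fst d) vs @ [ex_snd d xi]) (join_vec d y x)) <= C * (\<Sum>j\<in>J. sn j f)"
    by (rule loc_estimate[OF v(1) torus_one_in us v(2,3) zero_in_cube]) (rule that)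
  have "sn j (inf_gen xi f) <= C * (\<Sum>i\<in>J. sn i f)" if f: "f \<in> A" for f
    unfolding jj
  proof (rule sn_le)
    show "0 <= C * (\<Sum>i\<in>J. sn i f)" using J(3,4) sn_nonneg[OF f] by (intro mult_nonneg_nonneg sum_nonneg) auto
    fix y assume y: "y \<in> K"
    have "(%_. 0) \<in> Rn n" by (simp add: Rn_iff)
    then show "cmod (chart_deriv (U, phi) vs (inf_gen xi f) y) <= C * (\<Sum>i\<in>J. sn i f)"
      using J(1,5) f y v(3) by (subst chart_deriv_inf_gen(1)[OF v(1) _ v(4) f xi]) auto
  qed
  then show ?thesis using J(2,3) by blast
qed

lemma inf_gen_limit_joint:
  assumes F: "limitin T F f L" and x: "ALL i<n. ((%t. xi t i) \<longlongrightarrow> xi0 i) L" "\<forall>\<^sub>F t in L. xi t \<in> Rn n" "xi0 \<in> Rn n"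
  shows "limitin T (%t. inf_gen (xi t) (F t)) (inf_gen xi0 f) L"
proof -
  have f: "f \<in> A" and ev: "\<forall>\<^sub>F t in L. F t \<in> A" using F unfolding limitin_T by auto
  have "limitin T (%t. \<lambda>p\<in>X. \<Sum>i<n. fsm (of_real (xi t i)) (inf_gen (unitv i) (F t)) p)
      (\<lambda>p\<in>X. \<Sum>i<n. fsm (of_real (xi0 i)) (inf_gen (unitv i) f) p) L"
  proof (rule limitin_T_sum)
    fix i assume i: "i \<in> {..<n}"
    then have u: "unitv i \<in> Rn n" by (simp add: unitv_in_Rn)
    have "limitin T (%t. inf_gen (unitv i) (F t)) (inf_gen (unitv i) f) L"
      by (rule limitin_T_bounded_op[OF inf_gen_A[OF _ u] inf_gen_fdiff[OF _ _ u] inf_gen_bounded[OF _ u] F])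
    moreover have "((%t. complex_of_real (xi t i)) \<longlongrightarrow> of_real (xi0 i)) L"
      using x(1) i by (intro tendsto_of_real) auto
    ultimately show "limitin T (%t. fsm (of_real (xi t i)) (inf_gen (unitv i) (F t))) (fsm (of_real (xi0 i)) (inf_gen (unitv i) f)) L"
      by (intro limitin_T_smult)
  qed simp
  then have "limitin T (%t. \<lambda>p\<in>X. \<Sum>i<n. fsm (of_real (xi t i)) (inf_gen (unitv i) (F t)) p) (inf_gen xi0 f) L"
    by (simp only: inf_gen_sum[OF f x(3)])
  moreover have "\<forall>\<^sub>F t in L. (\<lambda>p\<in>X. \<Sum>i<n. fsm (of_real (xi t i)) (inf_gen (unitv i) (F t)) p) = inf_gen (xi t) (F t)"
    using ev x(2) by eventually_elim (rule inf_gen_sum[symmetric])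
  ultimately show ?thesis by (rule limitin_transform_eventually[rotated])
qed

subsection \<open>The orbit map of the function algebra is smooth\<close>

lemma line_coordinates: "((%t. x i + t * xi i) \<longlongrightarrow> x i) (at (0::real))" for x xi :: "vec"
  using tendsto_add[OF tendsto_const tendsto_mult_left_zero[OF tendsto_ident_at[of "0::real" UNIV], of "xi i"], of "x i"] by simp

text \<open>Since \<open>torus_exp n w (x + t xi)\<close> is the product of \<open>torus_exp n w
  x\<close> and the flow \<open>torus_exp n (torus_one n) (t xi)\<close>, the derivative at any point
  comes from that at the identity.\<close>

lemma act_derivative:
  assumes w: "w \<in> torus_set n" and x: "x \<in> cube n" and xi: "xi \<in> Rn n" and a: "a \<in> A" and b: "b \<in> A"
  shows "limitin T (%t. fsm (of_real (1 / t)) (fdiff P (act (torus_exp n w (%i. x i + t * xi i)) (fadd a (fsm (of_real t) b)))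
      (act (torus_exp n w x) a))) (act (torus_exp n w x) (fadd (inf_gen xi a) b)) (at 0)"
proof -
  let ?z = "torus_exp n w x" and ?e = "torus_exp n (torus_one n)"
  have z: "?z \<in> torus_set n" by (rule torus_exp_in[OF w])
  have e: "?e y \<in> torus_set n" for y by (rule torus_exp_in[OF torus_one_in])
  have zt: "torus_exp n w (%i. x i + t * xi i) \<in> torus_set n" for t by (rule torus_exp_in[OF w])
  have xR: "x \<in> Rn n" using x cube_subset by blast
  let ?Q = "%t. fsm (of_real (1 / t)) (fdiff P (act (?e (%i. t * xi i)) a) a)"
  have 1: "limitin T (%t. act (torus_exp n w x) (?Q t)) (act ?z (inf_gen xi a)) (at 0)"
    using xR by (intro act_limit[OF w x inf_gen_limit[OF a xi], of "%_. x"]) auto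
  have 2: "limitin T (%t. act (torus_exp n w (%i. x i + t * xi i)) b) (act ?z b) (at 0)"
    using Rn_add_scale[OF xR xi] line_coordinates
    by (intro act_limit[OF w x limitin_T_const[OF b], of "%t i. x i + t * xi i"]) auto
  have lim: "limitin T (%t. fadd (act ?z (?Q t)) (act (torus_exp n w (%i. x i + t * xi i)) b))
      (fadd (act ?z (inf_gen xi a)) (act ?z b)) (at 0)" by (rule limitin_T_add[OF 1 2])
  have eq: "fadd (act ?z (?Q t)) (act (torus_exp n w (%i. x i + t * xi i)) b) =
      fsm (of_real (1 / t)) (fdiff P (act (torus_exp n w (%i. x i + t * xi i)) (fadd a (fsm (of_real t) b)))
      (act ?z a))" if t: "t ~= 0" for t
  proof -
    have ww: "act ?z (act (?e (%i. t * xi i)) a) = act (torus_exp n w (%i. x i + t * xi i)) a"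
      unfolding act_act[OF z e a] torus_exp_add ..
    show ?thesis
      unfolding act_fsm[OF z] act_fdiff[OF z] ww act_fadd[OF zt] act_fsm[OF zt]
      using t by (auto simp: fdiff_def fun_eq_iff field_simps)
  qed
  have "\<forall>\<^sub>F t in at (0::real). t ~= 0" by (simp add: eventually_at_filter)
  then have "\<forall>\<^sub>F t in at 0. fadd (act ?z (?Q t)) (act (torus_exp n w (%i. x i + t * xi i)) b) =
      fsm (of_real (1 / t)) (fdiff P (act (torus_exp n w (%i. x i + t * xi i)) (fadd a (fsm (of_real t) b)))
      (act ?z a))" by eventually_elim (rule eq)
  from limitin_transform_eventually[OF this lim] show ?thesis by (simp only: act_fadd[OF z])
qed

text \<open>The iterated derivatives of \<open>(x, a) \<mapsto> act x a\<close> are \<open>act x (aff vs a)\<close>, because the map is linear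
  in \<open>a\<close> and the action commutes with its generators.\<close>

primrec lin :: "(vec \<times> ('a => complex)) list => ('a => complex) => 'a => complex" where
  "lin [] b = b"
| "lin (v # vs) b = inf_gen (fst v) (lin vs b)"

primrec aff :: "(vec \<times> ('a => complex)) list => ('a => complex) => 'a => complex" where
  "aff [] a = a"
| "aff (v # vs) a = fadd (inf_gen (fst v) (aff vs a)) (lin vs (snd v))"

lemma lin_A: "set vs \<subseteq> Rn n \<times> A ==> b \<in> A ==> lin vs b \<in> A"
  by (induction vs) (auto intro: inf_gen_A)

lemma aff_A: "set vs \<subseteq> Rn n \<times> A ==> a \<in> A ==> aff vs a \<in> A"
  by (induction vs) (auto intro!: A_add inf_gen_A lin_A)

lemma aff_line:
  assumes "a \<in> A" "b \<in> A"
  shows "set vs \<subseteq> Rn n \<times> A ==> aff vs (fadd a (fsm c b)) = fadd (aff vs a) (fsm c (lin vs b))"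
proof (induction vs)
  case (Cons v vs)
  have v: "fst v \<in> Rn n" "snd v \<in> A" and vs: "set vs \<subseteq> Rn n \<times> A" using Cons.prems by auto
  have "aff (v # vs) (fadd a (fsm c b)) = fadd (inf_gen (fst v) (fadd (aff vs a) (fsm c (lin vs b)))) (lin vs (snd v))"
    by (simp only: aff.simps Cons.IH[OF vs])
  also have "... = fadd (fadd (inf_gen (fst v) (aff vs a)) (fsm c (inf_gen (fst v) (lin vs b)))) (lin vs (snd v))"
    unfolding inf_gen_fadd[OF aff_A[OF vs assms(1)] A_smult[OF lin_A[OF vs assms(2)]] v(1)]
      inf_gen_fsm[OF lin_A[OF vs assms(2)] v(1)] ..
  also have "... = fadd (aff (v # vs) a) (fsm c (lin (v # vs) b))" by (auto simp: fun_eq_iff)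
  finally show ?case .
qed simp

abbreviation "EA == prod_lcs (euclid n) (C_infinity P)"

context
  fixes w psi
  assumes w: "w \<in> torus_set n" and psi: "!!x a. x \<in> cube n ==> a \<in> A ==> psi (x, a) = act (torus_exp n w x) a"
begin

lemma iter_deriv_act_step:
  assumes vs: "set vs \<subseteq> Rn n \<times> A" and v: "v \<in> Rn n \<times> A" and x: "x \<in> cube n" and a: "a \<in> A"
    and IH: "!!x a. x \<in> cube n ==> a \<in> A ==> iter_deriv EA (C_infinity P) psi vs (x, a) = act (torus_exp n w x) (aff vs a)"
  shows "has_dir_deriv EA (C_infinity P) (iter_deriv EA (C_infinity P) psi vs) v (x, a)
     (act (torus_exp n w x) (aff (v # vs) a))"
proof -
  obtain xi b where vv: "v = (xi, b)" and xi: "xi \<in> Rn n" and b: "b \<in> A" using v by auto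
  let ?f = "iter_deriv EA (C_infinity P) psi vs"
  let ?z = "%t. torus_exp n w (%i. x i + t * xi i)"
  have aA: "aff vs a \<in> A" and bA: "lin vs b \<in> A" using aff_A[OF vs a] lin_A[OF vs b] by auto
  have lim: "limitin T (%t. fsm (of_real (1 / t)) (fdiff P (act (?z t) (fadd (aff vs a) (fsm (of_real t) (lin vs b))))
      (act (torus_exp n w x) (aff vs a)))) (act (torus_exp n w x) (fadd (inf_gen xi (aff vs a)) (lin vs b))) (at 0)"
    by (rule act_derivative[OF w x xi aA bA])
  from line_eventually_at[OF openin_cube x xi]
  have ev: "\<forall>\<^sub>F t in at 0. fsm (of_real (1 / t)) (fdiff P (act (?z t) (fadd (aff vs a) (fsm (of_real t) (lin vs b))))
      (act (torus_exp n w x) (aff vs a))) =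
      of_real (1 / t) \<odot>\<^bsub>C_infinity P\<^esub> (?f ((x, a) \<oplus>\<^bsub>EA\<^esub> (of_real t \<odot>\<^bsub>EA\<^esub> v)) \<ominus>\<^bsub>C_infinity P\<^esub> ?f (x, a))"
  proof eventually_elim
    case (elim t)
    have abA: "fadd a (fsm (of_real t) b) \<in> A" by (intro A_add A_smult a b)
    have "(x, a) \<oplus>\<^bsub>EA\<^esub> (of_real t \<odot>\<^bsub>EA\<^esub> v) = (%i. x i + t * xi i, fadd a (fsm (of_real t) b))"
      by (simp add: vv)
    then have "?f ((x, a) \<oplus>\<^bsub>EA\<^esub> (of_real t \<odot>\<^bsub>EA\<^esub> v)) = act (?z t) (fadd (aff vs a) (fsm (of_real t) (lin vs b)))"
      using IH[OF elim abA] aff_line[OF a b vs] by simp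
    moreover have "act (?z t) (fadd (aff vs a) (fsm (of_real t) (lin vs b))) \<ominus>\<^bsub>C_infinity P\<^esub> act (torus_exp n w x) (aff vs a) =
       fdiff P (act (?z t) (fadd (aff vs a) (fsm (of_real t) (lin vs b)))) (act (torus_exp n w x) (aff vs a))"
      by (intro minus_A act_A torus_exp_in w A_add A_smult aA bA)
    ultimately show ?case using IH[OF x a] by simp
  qed
  show ?thesis
    unfolding has_dir_deriv_def C_infinity_simps(7)
    using limitin_transform_eventually[OF ev lim] by (simp add: vv)
qed

lemma iter_deriv_act:
  assumes "set vs \<subseteq> Rn n \<times> A"
  shows "!!x a. x \<in> cube n ==> a \<in> A ==> iter_deriv EA (C_infinity P) psi vs (x, a) = act (torus_exp n w x) (aff vs a)"
  using assms
proof (induction vs)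
  case Nil
  then show ?case by (simp add: psi)
next
  case (Cons v vs)
  then have v: "v \<in> Rn n \<times> A" and vs: "set vs \<subseteq> Rn n \<times> A" by auto
  have "has_dir_deriv EA (C_infinity P) (iter_deriv EA (C_infinity P) psi vs) v (x, a) (act (torus_exp n w x) (aff (v # vs) a))"
    by (rule iter_deriv_act_step[OF vs v Cons.prems(1,2) Cons.IH[OF _ _ vs]])
  from dir_deriv_C_infinity[OF this] show ?case by (simp only: iter_deriv.simps)
qed

lemma limitin_lin:
  assumes v: "!!v. v \<in> set vs ==> limitin T (%s. snd (v s)) (snd (v s0)) (atin Y s0) & fst (v s0) \<in> Rn n &
      (\<forall>\<^sub>F s in atin Y s0. fst (v s) \<in> Rn n) & (ALL i<n. ((%s. fst (v s) i) \<longlongrightarrow> fst (v s0) i) (atin Y s0))"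
    and b: "limitin T b (b s0) (atin Y s0)"
  shows "limitin T (%s. lin (map (%v. v s) vs) (b s)) (lin (map (%v. v s0) vs) (b s0)) (atin Y s0)"
  using v
proof (induction vs)
  case (Cons v vs)
  have "limitin T (%s. lin (map (%v. v s) vs) (b s)) (lin (map (%v. v s0) vs) (b s0)) (atin Y s0)"
    using Cons by auto
  then show ?case using Cons.prems[of v] by (auto intro!: inf_gen_limit_joint)
qed (use b in simp)

lemma limitin_aff:
  assumes v: "!!v. v \<in> set vs ==> limitin T (%s. snd (v s)) (snd (v s0)) (atin Y s0) & fst (v s0) \<in> Rn n &
      (\<forall>\<^sub>F s in atin Y s0. fst (v s) \<in> Rn n) & (ALL i<n. ((%s. fst (v s) i) \<longlongrightarrow> fst (v s0) i) (atin Y s0))"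
    and a: "limitin T a (a s0) (atin Y s0)"
  shows "limitin T (%s. aff (map (%v. v s) vs) (a s)) (aff (map (%v. v s0) vs) (a s0)) (atin Y s0)"
  using v
proof (induction vs)
  case (Cons v vs)
  have 1: "limitin T (%s. aff (map (%v. v s) vs) (a s)) (aff (map (%v. v s0) vs) (a s0)) (atin Y s0)"
    using Cons by auto
  have "limitin T (%s. snd (v s)) (snd (v s0)) (atin Y s0)" using Cons.prems[of v] by auto
  then have 2: "limitin T (%s. lin (map (%v. v s) vs) (snd (v s))) (lin (map (%v. v s0) vs) (snd (v s0))) (atin Y s0)"
    using Cons.prems by (intro limitin_lin) auto
  have 3: "limitin T (%s. inf_gen (fst (v s)) (aff (map (%v. v s) vs) (a s)))
      (inf_gen (fst (v s0)) (aff (map (%v. v s0) vs) (a s0))) (atin Y s0)"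
    using Cons.prems[of v] by (intro inf_gen_limit_joint[OF 1]) auto
  show ?case unfolding list.map aff.simps by (rule limitin_T_add[OF 3 2])
qed (use a in simp)

text \<open>All iterated derivatives are known explicitly, so their continuity is that of the action and
  of its generators.\<close>

lemma smooth_on_act: "smooth_on EA (C_infinity P) (cube n \<times> A) psi"
  unfolding smooth_on_def
proof (intro conjI allI impI ballI)
  show "openin (topo EA) (cube n \<times> A)"
    using openin_topspace[of T] openin_cube by (simp add: openin_prod_Times_iff)
next
  fix vs v and y :: "vec \<times> ('a => complex)"
  assume "set vs \<subseteq> carrier EA" "v \<in> carrier EA" "y \<in> cube n \<times> A"
  then show "EX u. has_dir_deriv EA (C_infinity P) (iter_deriv EA (C_infinity P) psi vs) v y u"
    using iter_deriv_act_step[OF _ _ _ _ iter_deriv_act] by (cases y) fastforce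
next
  fix k :: nat
  let ?Y = "prod_topology (subtopology (topo EA) (cube n \<times> A)) (product_topology (%_. topo EA) {..<k})"
  have top: "fst (fst s) \<in> cube n" "snd (fst s) \<in> A" "!!i. i < k ==> snd s i \<in> Rn n \<times> A" if "s \<in> topspace ?Y" for s
    using that by (auto simp: PiE_iff mem_Times_iff Pi_def)
  have vsR: "set (map (snd s) [0..<k]) \<subseteq> Rn n \<times> A" if "s \<in> topspace ?Y" for s
    using top(3)[OF that] by (simp add: image_subset_iff)
  have eq: "(case s of (y, v) => iter_deriv EA (C_infinity P) psi (map v [0..<k]) y) =
     act (torus_exp n w (fst (fst s))) (aff (map (snd s) [0..<k]) (snd (fst s)))" if "s \<in> topspace ?Y" for s
    using iter_deriv_act[OF vsR[OF that] top(1,2)[OF that]] by (simp add: case_prod_unfold)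
  have c1: "continuous_map ?Y (prod_topology (Euclidean_space n) T) fst"
    using continuous_map_fst[of "subtopology (topo EA) (cube n \<times> A)" "product_topology (%_. topo EA) {..<k}"]
    by (auto simp: continuous_map_in_subtopology)
  have c2: "continuous_map ?Y (prod_topology (Euclidean_space n) T) (%s. snd s i)" if "i < k" for i
  proof -
    have "continuous_map (product_topology (%_. topo EA) {..<k}) (topo EA) (%v. v i)"
      using that by (intro continuous_map_product_projection) auto
    from continuous_map_compose[OF continuous_map_snd this]
    show ?thesis by (simp add: o_def)
  qed
  have parts: "limitin T (%s. snd (g s)) (snd (g s0)) (atin ?Y s0) & fst (g s0) \<in> Rn n &
      (\<forall>\<^sub>F s in atin ?Y s0. fst (g s) \<in> Rn n) & (ALL i<n. ((%s. fst (g s) i) \<longlongrightarrow> fst (g s0) i) (atin ?Y s0))"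
    if g: "continuous_map ?Y (prod_topology (Euclidean_space n) T) g" and s0: "s0 \<in> topspace ?Y" for g s0
  proof -
    have "continuous_map ?Y (Euclidean_space n) (%s. fst (g s))" "continuous_map ?Y T (%s. snd (g s))"
      using g by (auto simp: continuous_map_pairwise o_def)
    then have "limitin (Euclidean_space n) (%s. fst (g s)) (fst (g s0)) (atin ?Y s0)"
      "limitin T (%s. snd (g s)) (snd (g s0)) (atin ?Y s0)"
      using s0 unfolding continuous_map_atin by blast+
    then show ?thesis by (simp add: limitin_Euclidean_space)
  qed
  have "continuous_map ?Y T (%s. act (torus_exp n w (fst (fst s))) (aff (map (snd s) [0..<k]) (snd (fst s))))"
    unfolding continuous_map_atin
  proof
    fix s0 assume s0: "s0 \<in> topspace ?Y"
    note p1 = parts[OF c1 s0]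
    let ?vs = "map (%i s. snd s i) [0..<k]"
    have "limitin T (%s. aff (map (%v. v s) ?vs) (snd (fst s))) (aff (map (%v. v s0) ?vs) (snd (fst s0))) (atin ?Y s0)"
      using p1 parts[OF c2 s0] by (intro limitin_aff) auto
    then have lim: "limitin T (%s. aff (map (snd s) [0..<k]) (snd (fst s))) (aff (map (snd s0) [0..<k]) (snd (fst s0))) (atin ?Y s0)"
      by (simp add: o_def)
    show "limitin T (%s. act (torus_exp n w (fst (fst s))) (aff (map (snd s) [0..<k]) (snd (fst s))))
       (act (torus_exp n w (fst (fst s0))) (aff (map (snd s0) [0..<k]) (snd (fst s0)))) (atin ?Y s0)"
      using p1 by (intro act_limit[OF w top(1)[OF s0] lim]) auto
  qed
  then show "continuous_map ?Y (topo (C_infinity P)) (%(y, v). iter_deriv EA (C_infinity P) psi (map v [0..<k]) y)"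
    unfolding C_infinity_simps(7) by (rule continuous_map_eq) (rule eq[symmetric])
qed

end

section \<open>The pulled back action is a smooth dynamical system\<close>

lemma pullback_eq: "f \<in> A ==> pullback_action P \<sigma> z f = act z f"
  by (simp add: pullback_action_def act_def)

lemma torus_group: "group (torus n)"
  using lie by (simp add: lie_group_def)

lemma pullback_continuous:
  assumes z: "z \<in> torus_set n"
  shows "continuous_map T T (pullback_action P \<sigma> z)"
proof -
  have "continuous_map T T (act z)"
    unfolding continuous_map_atin
  proof
    fix f assume f: "f \<in> topspace T"
    have "limitin T (%g. g) f (atin T f)" using f continuous_map_id[of T] unfolding continuous_map_atin by (simp add: id_def)
    then have "limitin T (%g. act (torus_exp n z (%_. 0)) g) (act (torus_exp n z (%_. 0)) f) (atin T f)"
      by (intro act_limit[OF z zero_in_cube, of _ _ _ "%_ _. 0"]) (auto simp: Rn_iff)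
    then show "limitin T (act z) (act z f) (atin T f)" by (simp add: torus_exp_zero[OF z])
  qed
  then show ?thesis by (rule continuous_map_eq) (simp add: pullback_eq)
qed

lemma pullback_hom: "pullback_action P \<sigma> \<in> hom (torus n) (alg_Aut (C_infinity P))"
proof -
  let ?C = "C_infinity P" and ?\<alpha> = "pullback_action P \<sigma>"
  interpret G: group "torus n" by (rule torus_group)
  have inv: "inv\<^bsub>torus n\<^esub> z \<in> torus_set n" if "z \<in> torus_set n" for z using G.inv_closed[of z] that by simp
  have cancel: "act z (act (inv\<^bsub>torus n\<^esub> z) f) = f" "act (inv\<^bsub>torus n\<^esub> z) (act z f) = f"
    if "z \<in> torus_set n" "f \<in> A" for z f
    using act_act[OF that(1) inv[OF that(1)] that(2)] act_act[OF inv[OF that(1)] that]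
      G.r_inv[of z] G.l_inv[of z] that act_one[OF that(2)] by simp_all
  have maps: "homeomorphic_maps T T (?\<alpha> z) (?\<alpha> (inv\<^bsub>torus n\<^esub> z))" if z: "z \<in> torus_set n" for z
    unfolding homeomorphic_maps_def
    using z inv[OF z] cancel[OF z] by (auto simp: pullback_continuous pullback_eq act_A)
  then have homeo: "homeomorphic_map T T (?\<alpha> z)" if "z \<in> torus_set n" for z
    using that homeomorphic_map_maps by blast
  have Bij: "?\<alpha> z \<in> Bij A" if z: "z \<in> torus_set n" for z
  proof -
    have "bij_betw (?\<alpha> z) A A"
      using cancel[OF z] inv[OF z] z by (intro bij_betwI[of _ _ _ "?\<alpha> (inv\<^bsub>torus n\<^esub> z)"]) (auto simp: pullback_eq act_A)
    then show ?thesis by (auto simp: Bij_def pullback_action_def)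
  qed
  have aut: "?\<alpha> z \<in> carrier (alg_Aut ?C)" if z: "z \<in> torus_set n" for z
  proof -
    have "?\<alpha> z \<in> ring_hom ?C ?C"
      using z \<sigma>_in by (intro ring_hom_memI) (auto simp: pullback_eq act_A A_mult A_add A_const, auto simp: act_def fun_eq_iff)
    moreover have "?\<alpha> z (c \<odot>\<^bsub>?C\<^esub> f) = c \<odot>\<^bsub>?C\<^esub> ?\<alpha> z f" if "f \<in> A" for c f
      using that z by (simp only: C_infinity_simps pullback_eq A_smult act_fsm)
    ultimately show ?thesis using Bij[OF z] homeo[OF z] by (simp add: alg_Aut_def)
  qed
  show ?thesis
  proof (rule homI)
    show "?\<alpha> z \<in> carrier (alg_Aut ?C)" if "z \<in> carrier (torus n)" for z using aut that by simp
    fix z w assume "z \<in> carrier (torus n)" "w \<in> carrier (torus n)"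
    then have zw: "z \<in> torus_set n" "w \<in> torus_set n" by auto
    have "?\<alpha> (\<lambda>i\<in>{..<n}. z i * w i) f = compose A (?\<alpha> z) (?\<alpha> w) f" for f
    proof (cases "f \<in> A")
      case True
      then show ?thesis using act_act[OF zw True] act_A[OF zw(2) True] by (simp add: compose_def pullback_eq)
    qed (simp add: compose_def pullback_action_def)
    then show "?\<alpha> (z \<otimes>\<^bsub>torus n\<^esub> w) = ?\<alpha> z \<otimes>\<^bsub>alg_Aut ?C\<^esub> ?\<alpha> w"
      using Bij zw by (simp add: alg_Aut_def BijGroup_def fun_eq_iff)
  qed
qed

lemma pullback_smooth_dynamical_system:
  "smooth_dynamical_system (C_infinity P) (torus n) (pullback_action P \<sigma>)"
  unfolding smooth_dynamical_system_def
proof (intro conjI lc_algebra_A lie pullback_hom, clarify)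
  fix U phi assume "(U, phi) \<in> atlas TM"
  then obtain w where w: "w \<in> torus_set n" "U = torus_dom n w" "phi = torus_chart n w" by (auto simp: atlas_torus)
  have "smooth_on EA (C_infinity P) (cube n \<times> A) (%(x, a). pullback_action P \<sigma> (inv_into U phi x) a)"
    using w by (intro smooth_on_act[OF w(1)]) (simp add: pullback_eq torus_chart_inv)
  then show "smooth_on (prod_lcs (euclid (mdim TM)) (C_infinity P)) (C_infinity P) (phi ` U \<times> carrier (C_infinity P))
     (%(x, a). pullback_action P \<sigma> (inv_into U phi x) a)"
    using w by (simp add: torus_chart_image)
qed

lemma prod_powi_smooth:
  assumes "smooth_map P TM u"
  shows "smooth_fn P X (%p. \<Prod>i<n. u p i powi k i)"
proof (rule smooth_fn_prod[OF P openin_X])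
  fix i assume i: "i \<in> {..<n}"
  have "{p:X. u p \<in> torus_set n} = X" using smooth_map_in[OF assms] by auto
  then have ui: "smooth_fn P X (%p. u p i)"
    using smooth_map_pullback[OF P TM assms smooth_fn_torus_coord[OF TM]] i by simp
  have nz: "u p i ~= 0" if "p \<in> X" for p
    using smooth_map_in[OF assms that] torus_set_nz i by auto
  have pow: "smooth_fn P X (%p. v p ^ m)" if "smooth_fn P X v" for v :: "'a => complex" and m :: nat
    by (induction m) (auto intro: smooth_fn_const[OF P openin_X] smooth_fn_mult[OF P] that)
  show "smooth_fn P X (%p. u p i powi k i)"
  proof (cases "k i >= 0")
    case True
    then show ?thesis using pow[OF ui, of "nat (k i)"] by (simp add: power_int_def)
  next
    case False
    then show ?thesis using pow[OF smooth_fn_inverse[OF P ui nz], of "nat (- k i)"] by (simp add: power_int_def)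
  qed
qed

text \<open>An equivariant \<open>u\<close> supplies the unit \<open>\<Prod>i<n. u p i powi k i\<close>
  of the isotypic component of \<open>k\<close>.\<close>

lemma pullback_trivial_NCP:
  assumes u: "smooth_map P TM u" and eqv: "!!p z. p \<in> X ==> z \<in> torus_set n ==> u (\<sigma> p z) = (\<lambda>i\<in>{..<n}. u p i * z i)"
  shows "smooth_trivial_NCP_torus_bundle n (C_infinity P) (pullback_action P \<sigma>)"
  unfolding smooth_trivial_NCP_torus_bundle_def
proof (intro conjI pullback_smooth_dynamical_system allI)
  fix k :: "nat => int"
  let ?a = "\<lambda>p\<in>X. \<Prod>i<n. u p i powi k i"
  have a: "?a \<in> A" by (rule restrict_A[OF prod_powi_smooth[OF u]])
  have "u p i ~= 0" if "p \<in> X" "i < n" for p i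
    using smooth_map_in[OF u that(1)] torus_set_nz that(2) by auto
  then have "?a \<in> Units (C_infinity P)" unfolding Units_A[OF a] by auto
  moreover have "?a \<in> isotypic_component n (C_infinity P) (pullback_action P \<sigma>) k"
    unfolding isotypic_component_def
  proof (intro CollectI conjI ballI)
    fix z assume "z \<in> carrier (torus n)"
    then have z: "z \<in> torus_set n" by simp
    have "(\<Prod>i<n. (u p i * z i) powi k i) = (\<Prod>i<n. z i powi k i) * (\<Prod>i<n. u p i powi k i)" for p
      by (simp add: power_int_mult_distrib prod.distrib mult.commute)
    then show "pullback_action P \<sigma> z ?a = (\<Prod>i<n. z i powi k i) \<odot>\<^bsub>C_infinity P\<^esub> ?a"
      unfolding pullback_eq[OF a] using eqv[OF _ z] \<sigma>_in[OF _ z] by (auto simp: act_def fun_eq_iff)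
  qed (use a in simp)
  ultimately show "EX a:isotypic_component n (C_infinity P) (pullback_action P \<sigma>) k. a \<in> Units (C_infinity P)" by blast
qed

end

theorem trivial_bundle_imp_trivial_NCP:
  assumes triv: "trivial_principal_bundle P M (torus n) q \<sigma>"
  shows "smooth_trivial_NCP_torus_bundle n (C_infinity P) (pullback_action P \<sigma>)"
proof -
  have pb: "principal_bundle P M (torus n) q \<sigma>" and gt: "globally_trivial P M (torus n) q \<sigma>"
    using triv by (auto simp: trivial_principal_bundle_def)
  then have P: "pre_manifold P" and M: "pre_manifold M" and lie: "lie_group (torus n)" and act: "smooth_right_action P (torus n) \<sigma>"
    by (auto simp: principal_bundle_def smooth_manifold_pre)
  interpret torus_action P n \<sigma> by unfold_locales (rule P lie act)+
  obtain \<Phi> where \<Phi>: "smooth_map P (prod_manifold M TM) \<Phi>"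
    "!!p z. p \<in> X ==> z \<in> torus_set n ==> \<Phi> (\<sigma> p z) = (case \<Phi> p of (m, g) => %h. (m, g \<otimes>\<^bsub>torus n\<^esub> h)) z"
    using gt by (auto simp: globally_trivial_def bundle_equivalence_def diffeomorphism_def)
  show ?thesis
  proof (rule pullback_trivial_NCP[of "%p. snd (\<Phi> p)"])
    show "smooth_map P TM (%p. snd (\<Phi> p))"
      by (rule smooth_map_compose[OF P pre_manifold_prod[OF M TM] TM \<Phi>(1) smooth_map_snd[OF M TM]])
  qed (simp add: \<Phi>(2) case_prod_unfold)
qed

section \<open>Continuous characters are point evaluations\<close>

context smooth_algebra
begin

lemma chart_deriv_vanishing:
  assumes c: "(U, phi) \<in> atlas P" and W: "openin (mtop P) W" "!!p. p \<in> W ==> f p = 0"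
    and y: "y \<in> phi ` U" "inv_into U phi y \<in> W" and vs: "set vs \<subseteq> Rn d"
  shows "chart_deriv (U, phi) vs f y = 0"
proof -
  interpret chart P U phi using P c by (rule chartI)
  have op: "open_Rn d (phi ` (U Int W))" using W dom_open by (intro open_image) auto
  have "y \<in> phi ` (U Int W)" using y inv_in[OF y(1)] chart_inv[OF y(1)] by (metis IntI imageI)
  then have "iter_dird (%x. f (inv_into U phi x)) vs y = iter_dird (%_. 0) vs y"
    using W(2) by (intro iter_dird_cong[OF op _ vs]) auto
  then show ?thesis by (simp add: chart_deriv_def iter_dird_zero)
qed

lemma A_of_real: "smooth_fn P X r ==> (\<lambda>x\<in>X. complex_of_real (r x)) \<in> A"
  by (intro restrict_A smooth_fn_linear[OF P bounded_linear_of_real])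

text \<open>If no point evaluation equals the character \<open>\<chi>\<close>, then a finite sum \<open>h\<close> of squares \<open>|g|\<^sup>2\<close> with
  \<open>g\<close> in the kernel is positive on the compact set controlling \<open>\<chi>\<close>. Adding a function which
  vanishes near that set, and hence is killed by \<open>\<chi>\<close> too, makes \<open>h\<close> invertible.\<close>

lemma continuous_character:
  assumes add: "!!f g. f \<in> A ==> g \<in> A ==> \<chi>' (\<lambda>x\<in>X. f x + g x) = \<chi>' f + \<chi>' g"
    and mult: "!!f g. f \<in> A ==> g \<in> A ==> \<chi>' (\<lambda>x\<in>X. f x * g x) = \<chi>' f * \<chi>' g"
    and one: "\<chi>' (\<lambda>x\<in>X. 1) = (1 :: complex)" and smult: "!!c f. f \<in> A ==> \<chi>' (\<lambda>x\<in>X. c * f x) = c * \<chi>' f"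
    and J: "finite J" "!!j. j \<in> J ==> valid_index P j" "e > 0"
    and bd: "!!f. f \<in> A ==> (!!j. j \<in> J ==> sn j f < e) ==> cmod (\<chi>' f) < 1"
  shows "EX p:X. ALL f:A. \<chi>' f = f p"
proof (rule ccontr)
  assume no: "\<not> (EX p:X. ALL f:A. \<chi>' f = f p)"
  have "EX g. g \<in> A & \<chi>' g = 0 & g p ~= 0" if p: "p \<in> X" for p
  proof -
    obtain f where f: "f \<in> A" "\<chi>' f ~= f p" using no p by blast
    define k where "k = (\<lambda>x\<in>X. (- \<chi>' f) * (\<lambda>x\<in>X. 1) x)"
    have k: "k \<in> A" unfolding k_def by (rule A_smult[OF A_const])
    have \<chi>k: "\<chi>' k = - \<chi>' f"
      unfolding k_def smult[OF A_const, of "- \<chi>' f" 1] one by simp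
    have "\<chi>' (\<lambda>x\<in>X. f x + k x) = 0" unfolding add[OF f(1) k] \<chi>k by simp
    moreover have "(\<lambda>x\<in>X. f x + k x) p ~= 0" using p f(2) by (simp add: k_def)
    ultimately show ?thesis using A_add[OF f(1) k] by blast
  qed
  then obtain g where g: "!!p. p \<in> X ==> g p \<in> A" "!!p. p \<in> X ==> \<chi>' (g p) = 0" "!!p. p \<in> X ==> g p p ~= 0"
    by metis
  define pts where "pts j = inv_into (fst (fst j)) (snd (fst j)) ` fst (snd j)" for j :: "'a seminorm_index"
  define K where "K = (\<Union>j\<in>J. pts j)"
  have "compactin (mtop P) (pts j)" if "j \<in> J" for j
  proof -
    obtain U phi L vs where j: "j = ((U, phi), L, vs)" and v: "(U, phi) \<in> atlas P" "compact L" "L \<subseteq> phi ` U"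
      using J(2)[OF \<open>j \<in> J\<close>] by (rule valid_indexE)
    show ?thesis using chart.compactin_inv_image[OF chartI[OF P v(1)] v(2,3)] by (simp add: pts_def j)
  qed
  then have K: "compactin (mtop P) K" unfolding K_def using J(1) by (intro compactin_Union) auto
  let ?\<U> = "(%p. {x:X. g p x \<in> - {0}}) ` X"
  have KX: "K \<subseteq> X" using K compactin_subset_topspace by blast
  have "EX \<F>. finite \<F> & \<F> \<subseteq> ?\<U> & K \<subseteq> \<Union> \<F>"
  proof (rule compactinD[OF K])
    show "openin (mtop P) S" if "S \<in> ?\<U>" for S
    proof -
      obtain p where p: "p \<in> X" "S = {x:X. g p x \<in> - {0}}" using \<open>S \<in> ?\<U>\<close> by blast
      show ?thesis unfolding p(2) by (rule smooth_fn_preimage_open[OF P smooth_A[OF g(1)[OF p(1)]]]) (simp add: open_Compl)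
    qed
    show "K \<subseteq> \<Union> ?\<U>" using KX g(3) by fastforce
  qed
  then obtain F where F: "finite F" "F \<subseteq> X" "K \<subseteq> (\<Union>p\<in>F. {x:X. g p x \<in> - {0}})"
    by (metis (no_types, lifting) finite_subset_image)
  define r where "r x = (\<Sum>p\<in>F. (cmod (g p x))\<^sup>2)" for x
  have "EX h:A. \<chi>' h = 0 & (ALL x:X. h x = of_real (\<Sum>p\<in>F. (cmod (g p x))\<^sup>2))"
    using F(1,2)
  proof (induction F rule: finite_induct)
    case empty
    have "\<chi>' (\<lambda>x\<in>X. 0) = 0" using smult[OF A_const[of 1], of 0] by (simp cong: restrict_cong)
    then show ?case by (intro bexI[OF _ A_const[of 0]] conjI) (assumption, simp)
  next
    case (insert p F)
    then obtain h where h: "h \<in> A" "\<chi>' h = 0" "!!x. x \<in> X ==> h x = of_real (\<Sum>p\<in>F. (cmod (g p x))\<^sup>2)" by auto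
    have p: "p \<in> X" using insert by auto
    let ?b = "\<lambda>x\<in>X. cnj (g p x)"
    have b: "?b \<in> A" by (intro restrict_A smooth_fn_linear[OF P bounded_linear_cnj] smooth_A g(1) p)
    let ?k = "\<lambda>x\<in>X. (\<lambda>x\<in>X. g p x * ?b x) x + h x"
    have "\<chi>' ?k = \<chi>' (g p) * \<chi>' ?b + \<chi>' h"
      using add[OF A_mult[OF g(1)[OF p] b] h(1)] mult[OF g(1)[OF p] b] by simp
    then have "\<chi>' ?k = 0" using g(2)[OF p] h(2) by simp
    moreover have "?k \<in> A" by (intro A_add A_mult g(1) p b h(1))
    moreover have "?k x = of_real (\<Sum>p\<in>insert p F. (cmod (g p x))\<^sup>2)" if "x \<in> X" for x
      using that insert h(3)[OF that] by (simp add: complex_norm_square del: of_real_power)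
    ultimately show ?case by blast
  qed
  then obtain h where h: "h \<in> A" "\<chi>' h = 0" "!!x. x \<in> X ==> h x = of_real (r x)" unfolding r_def by blast
  have rs: "smooth_fn P X r"
    by (rule smooth_fn_cong[THEN iffD1, OF _ P smooth_fn_linear[OF P bounded_linear_Re smooth_A[OF h(1)]]]) (simp add: h(3))
  have r0: "r x >= 0" for x unfolding r_def by (intro sum_nonneg) auto
  have rK: "r x > 0" if "x \<in> K" for x
  proof -
    obtain p where p: "p \<in> F" "g p x ~= 0" using subsetD[OF F(3) \<open>x \<in> K\<close>] by auto
    have "0 < (cmod (g p x))\<^sup>2" using p by simp
    also have "... <= r x" unfolding r_def using F(1) p by (intro member_le_sum) auto
    finally show ?thesis .
  qed
  have "EX c>0. ALL x:K. c <= r x"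
  proof (cases "K = {}")
    case True
    then show ?thesis by (intro exI[of _ 1]) auto
  next
    case False
    have "continuous_map (mtop P) euclidean r" using smooth_fn_continuous_map[OF P rs] by simp
    from image_compactin[OF K this] have "compact (r ` K)" by simp
    then obtain x where "x \<in> K" "!!y. y \<in> K ==> r x <= r y"
      using compact_attains_inf[of "r ` K"] False by auto
    then show ?thesis using rK by (intro exI[of _ "r x"]) auto
  qed
  then obtain c where c: "c > 0" "!!x. x \<in> K ==> c <= r x" by blast
  \<comment> \<open>\<open>k\<close> is positive where \<open>r < c / 2\<close>, in particular at the zeros of \<open>r\<close>, and vanishes near \<open>K\<close>.\<close>
  define k where "k = (\<lambda>x\<in>X. complex_of_real (flat 0 (c / 2 - r x)))"
  have k: "k \<in> A" unfolding k_def
  proof (rule A_of_real)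
    have "smooth_fn P X (%x. c / 2 - r x)" by (intro smooth_fn_diff[OF P] smooth_fn_const[OF P openin_X] rs)
    then show "smooth_fn P X (%x. flat 0 (c / 2 - r x))"
      by (rule smooth_fn_lift1[OF P, where S = UNIV]) (auto intro: Cinf_flat)
  qed
  let ?W = "{x:X. r x \<in> {c / 2<..}}"
  have W: "openin (mtop P) ?W" by (rule smooth_fn_preimage_open[OF P rs]) simp
  have kW: "k x = 0" if "x \<in> ?W" for x using that by (simp add: k_def flat_def)
  \<comment> \<open>All multiples of \<open>k\<close> lie in the neighbourhood on which the character is bounded.\<close>
  have "cmod (\<chi>' (\<lambda>x\<in>X. s * k x)) < 1" for s
  proof (rule bd[OF A_smult[OF k]])
    fix j assume j: "j \<in> J"
    obtain U phi L vs where jj: "j = ((U, phi), L, vs)" and v: "(U, phi) \<in> atlas P" "L \<subseteq> phi ` U" "set vs \<subseteq> Rn d"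
      using J(2)[OF j] by (rule valid_indexE)
    have "sn j (\<lambda>x\<in>X. s * k x) <= 0"
      unfolding jj
    proof (rule sn_le)
      fix y assume y: "y \<in> L"
      have "inv_into U phi y \<in> pts j" using y by (auto simp: pts_def jj)
      then have yK: "inv_into U phi y \<in> K" using j by (auto simp: K_def)
      then have "inv_into U phi y \<in> ?W" using c(2)[OF yK] c(1) KX by auto
      then have "chart_deriv (U, phi) vs (\<lambda>x\<in>X. s * k x) y = 0"
        using kW y v(2) by (intro chart_deriv_vanishing[OF v(1) W _ _ _ v(3)]) auto
      then show "cmod (chart_deriv (U, phi) vs (\<lambda>x\<in>X. s * k x) y) <= 0" by simp
    qed simp
    then show "sn j (\<lambda>x\<in>X. s * k x) < e" using J(3) by linarith
  qed
  then have small: "cmod (s * \<chi>' k) < 1" for s using smult[OF k] by simp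
  have \<chi>k: "\<chi>' k = 0"
  proof (rule ccontr)
    assume "\<chi>' k ~= 0"
    then show False using small[of "1 / \<chi>' k"] by simp
  qed
  let ?m = "\<lambda>x\<in>X. h x + k x"
  have nz: "?m x ~= 0" if "x \<in> X" for x
  proof -
    have "r x + flat 0 (c / 2 - r x) > 0" using r0[of x] c(1) by (auto simp: flat_def add_nonneg_pos)
    moreover have "?m x = of_real (r x + flat 0 (c / 2 - r x))" using that h(3) by (simp add: k_def)
    ultimately show ?thesis by (metis of_real_eq_0_iff less_irrefl)
  qed
  have mA: "?m \<in> A" by (rule A_add[OF h(1) k])
  have "(\<lambda>x\<in>X. ?m x * (\<lambda>x\<in>X. inverse (?m x)) x) = (\<lambda>x\<in>X. 1)" using nz by (auto simp: fun_eq_iff)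
  then have "1 = \<chi>' ?m * \<chi>' (\<lambda>x\<in>X. inverse (?m x))"
    using mult[OF mA A_inverse[OF mA nz]] one by simp
  then show False using add[OF h(1) k] h(2) \<chi>k by simp
qed

end

text \<open>A plateau function at one point supported away from the other.\<close>

lemma separate_points:
  assumes M: "smooth_manifold P" and pq: "p \<in> topspace (mtop P)" "q \<in> topspace (mtop P)" "p ~= q"
  obtains f where "f \<in> smooth_functions P" "f p ~= f q"
proof -
  interpret smooth_algebra P by unfold_locales (rule smooth_manifold_pre[OF M])
  have "closedin (mtop P) {q}"
    using M pq by (intro closedin_Hausdorff_singleton) (auto simp: smooth_manifold_def)
  then have W: "openin (mtop P) (X - {q})" by blast
  obtain \<beta> :: "'a => real" and W' C where
    b: "smooth_fn P X \<beta>" "openin (mtop P) W'" "p \<in> W'" "W' \<subseteq> X - {q}"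
    "!!x. x \<in> W' ==> \<beta> x = 1" "closedin (mtop P) C" "C \<subseteq> X - {q}" "!!x. x ~: C ==> \<beta> x = 0"
    by (rule exists_plateau[OF M W, of p]) (use pq in simp, rule that)
  have "\<beta> p = 1" "\<beta> q = 0" using b(3,5,7,8) by blast+
  then have "(\<lambda>x\<in>X. complex_of_real (\<beta> x)) p ~= (\<lambda>x\<in>X. complex_of_real (\<beta> x)) q"
    using pq by simp
  then show ?thesis using that A_of_real[OF b(1)] by blast
qed

section \<open>From a smooth dynamical system to a smooth action\<close>

locale smooth_torus_system = smooth_algebra P for P :: "'a manifold" +
  fixes n :: nat and \<alpha> :: "(nat => complex) => ('a => complex) => 'a => complex"
  assumes M: "smooth_manifold P" and sys: "smooth_dynamical_system (C_infinity P) (torus n) \<alpha>"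
begin

lemma lie: "lie_group (torus n)" using sys by (simp add: smooth_dynamical_system_def)

abbreviation "TM == torus_manifold n"

lemma TM: "pre_manifold TM" by (rule lie_group_pre[OF lie])

lemma PT: "pre_manifold (prod_manifold P TM)" by (rule pre_manifold_prod[OF P TM])

lemma \<alpha>_hom: "\<alpha> \<in> hom (torus n) (alg_Aut (C_infinity P))"
  using sys by (simp add: smooth_dynamical_system_def)

lemma \<alpha>_aut:
  assumes "z \<in> torus_set n"
  shows "\<alpha> z \<in> Bij A" "\<alpha> z \<in> ring_hom (C_infinity P) (C_infinity P)"
    "f \<in> A ==> \<alpha> z (\<lambda>x\<in>X. c * f x) = (\<lambda>x\<in>X. c * \<alpha> z f x)" "continuous_map T T (\<alpha> z)"
proof -
  have "\<alpha> z \<in> carrier (alg_Aut (C_infinity P))" using \<alpha>_hom assms by (auto simp: hom_def)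
  then have *: "\<alpha> z \<in> Bij A & \<alpha> z \<in> ring_hom (C_infinity P) (C_infinity P) &
     (ALL c. ALL f:A. \<alpha> z (c \<odot>\<^bsub>C_infinity P\<^esub> f) = c \<odot>\<^bsub>C_infinity P\<^esub> \<alpha> z f) & homeomorphic_map T T (\<alpha> z)"
    unfolding alg_Aut_def by (simp del: C_infinity_simps(6))
  then show "\<alpha> z \<in> Bij A" "\<alpha> z \<in> ring_hom (C_infinity P) (C_infinity P)" "continuous_map T T (\<alpha> z)"
    by (auto dest: homeomorphic_imp_continuous_map)
  show "\<alpha> z (\<lambda>x\<in>X. c * f x) = (\<lambda>x\<in>X. c * \<alpha> z f x)" if "f \<in> A"
    using * that by (metis C_infinity_simps(6))
qed

lemma \<alpha>_A: "z \<in> torus_set n ==> f \<in> A ==> \<alpha> z f \<in> A"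
  using \<alpha>_aut(1)[of z] by (auto simp: Bij_def bij_betw_def)

lemma \<alpha>_ring:
  assumes "z \<in> torus_set n"
  shows "f \<in> A ==> g \<in> A ==> \<alpha> z (\<lambda>x\<in>X. f x + g x) = (\<lambda>x\<in>X. \<alpha> z f x + \<alpha> z g x)"
    "f \<in> A ==> g \<in> A ==> \<alpha> z (\<lambda>x\<in>X. f x * g x) = (\<lambda>x\<in>X. \<alpha> z f x * \<alpha> z g x)"
    "\<alpha> z (\<lambda>x\<in>X. 1) = (\<lambda>x\<in>X. 1)"
  using ring_hom_add[OF \<alpha>_aut(2)[OF assms]] ring_hom_mult[OF \<alpha>_aut(2)[OF assms]] ring_hom_one[OF \<alpha>_aut(2)[OF assms]]
  by (simp_all only: C_infinity_simps)

lemma \<alpha>_mult: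
  assumes "z \<in> torus_set n" "w \<in> torus_set n" "f \<in> A"
  shows "\<alpha> (\<lambda>i\<in>{..<n}. z i * w i) f = \<alpha> z (\<alpha> w f)"
proof -
  have "\<alpha> (z \<otimes>\<^bsub>torus n\<^esub> w) = \<alpha> z \<otimes>\<^bsub>alg_Aut (C_infinity P)\<^esub> \<alpha> w"
    using \<alpha>_hom assms by (intro hom_mult[of \<alpha> "torus n"]) auto
  also have "... = compose A (\<alpha> z) (\<alpha> w)"
    using \<alpha>_aut(1) assms by (simp add: alg_Aut_def BijGroup_def)
  finally show ?thesis using assms(3) by (simp add: compose_def)
qed

lemma \<alpha>_one:
  assumes f: "f \<in> A"
  shows "\<alpha> (torus_one n) f = f"
proof -
  have "(\<lambda>i\<in>{..<n}. torus_one n i * torus_one n i) = torus_one n" by (auto simp: torus_one_def)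
  then have "\<alpha> (torus_one n) (\<alpha> (torus_one n) f) = \<alpha> (torus_one n) f"
    using \<alpha>_mult[OF torus_one_in torus_one_in f] by simp
  moreover have "inj_on (\<alpha> (torus_one n)) A"
    using \<alpha>_aut(1)[OF torus_one_in] by (auto simp: Bij_def bij_betw_def)
  ultimately show ?thesis using \<alpha>_A[OF torus_one_in f] f by (meson inj_onD)
qed

abbreviation "\<sigma> == induced_action P \<alpha>"

text \<open>The character \<open>f \<mapsto> \<alpha> z f p\<close> is continuous because
  \<open>\<alpha> z\<close> is, hence it is a point evaluation; the point is unique because functions
  separate points.\<close>

lemma induced_point:
  assumes p: "p \<in> X" and z: "z \<in> torus_set n"
  shows "\<sigma> p z \<in> X" "!!f. f \<in> A ==> f (\<sigma> p z) = \<alpha> z f p"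
proof -
  obtain j0 where j0: "valid_index P j0" "!!f. f \<in> A ==> cmod (f p) <= sn j0 f" using point_index[OF p] by blast
  let ?Z = "\<lambda>x\<in>X. 0 :: complex"
  have ZA: "?Z \<in> A" by (rule A_const)
  have \<alpha>Z: "\<alpha> z ?Z = ?Z"
    using \<alpha>_aut(3)[OF z ZA, of 0] by (simp cong: restrict_cong)
  have "openin T (sn_ball {j0} 1 ?Z)" by (rule sn_ball_open) (use j0 ZA in auto)
  from openin_continuous_map_preimage[OF \<alpha>_aut(4)[OF z] this]
  have op: "openin T {f:A. \<alpha> z f \<in> sn_ball {j0} 1 ?Z}" by simp
  have "?Z \<in> {f:A. \<alpha> z f \<in> sn_ball {j0} 1 ?Z}" using ZA \<alpha>Z sn_ball_center[OF ZA, of 1 "{j0}"] j0(1) by simp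
  then obtain J e where J: "finite J" "!!j. j \<in> J ==> valid_index P j" "e > 0"
    "sn_ball J e ?Z \<subseteq> {f:A. \<alpha> z f \<in> sn_ball {j0} 1 ?Z}"
    by (rule sn_ball_nbhd[OF op]) (rule that)
  have "EX q:X. ALL f:A. \<alpha> z f p = f q"
  proof (rule continuous_character[OF _ _ _ _ J(1-3)])
    fix f assume f: "f \<in> A" "!!j. j \<in> J ==> sn j f < e"
    then have "f \<in> sn_ball J e ?Z" by (simp add: sn_ball_def fdiff_zero)
    then have "\<alpha> z f \<in> sn_ball {j0} 1 ?Z" using J(4) by blast
    then have "sn j0 (\<alpha> z f) < 1" using \<alpha>_A[OF z f(1)] by (simp add: sn_ball_def fdiff_zero)
    then show "cmod (\<alpha> z f p) < 1" using j0(2)[OF \<alpha>_A[OF z f(1)]] by linarith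
  qed (use p z in "simp_all add: \<alpha>_ring \<alpha>_aut(3)")
  then obtain q where q: "q \<in> X" "ALL f:A. f q = \<alpha> z f p" by force
  have "\<sigma> p z = q"
    unfolding induced_action_def
  proof (rule the_equality)
    show "q \<in> X & (ALL f:carrier (C_infinity P). f q = \<alpha> z f p)" using q by simp
    fix q' assume q': "q' \<in> X & (ALL f:carrier (C_infinity P). f q' = \<alpha> z f p)"
    show "q' = q"
    proof (rule ccontr)
      assume "q' ~= q"
      then obtain f where "f \<in> A" "f q' ~= f q" using separate_points[OF M] q' q(1) by metis
      then show False using q' q(2) by simp
    qed
  qed
  then show "\<sigma> p z \<in> X" "!!f. f \<in> A ==> f (\<sigma> p z) = \<alpha> z f p" using q by auto
qed

lemma X_eqI:
  assumes "p \<in> X" "q \<in> X" "!!f. f \<in> A ==> f p = f q"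
  shows "p = q"
  using separate_points[OF M assms(1,2)] assms(3) by metis

lemma induced_one: "p \<in> X ==> \<sigma> p (torus_one n) = p"
  using induced_point[OF _ torus_one_in] by (intro X_eqI) (auto simp: \<alpha>_one)

lemma induced_mult:
  assumes "p \<in> X" "z \<in> torus_set n" "w \<in> torus_set n"
  shows "\<sigma> (\<sigma> p z) w = \<sigma> p (\<lambda>i\<in>{..<n}. z i * w i)"
proof (rule X_eqI)
  have zw: "(\<lambda>i\<in>{..<n}. z i * w i) \<in> torus_set n" using assms by (simp add: torus_mult_in)
  have pz: "\<sigma> p z \<in> X" by (rule induced_point(1)[OF assms(1,2)])
  show "\<sigma> (\<sigma> p z) w \<in> X" by (rule induced_point(1)[OF pz assms(3)])
  show "\<sigma> p (\<lambda>i\<in>{..<n}. z i * w i) \<in> X" by (rule induced_point(1)[OF assms(1) zw])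
  fix f assume f: "f \<in> A"
  show "f (\<sigma> (\<sigma> p z) w) = f (\<sigma> p (\<lambda>i\<in>{..<n}. z i * w i))"
    unfolding induced_point(2)[OF pz assms(3) f] induced_point(2)[OF assms(1,2) \<alpha>_A[OF assms(3) f]]
      induced_point(2)[OF assms(1) zw f] \<alpha>_mult[OF assms(2,3) f] ..
qed

subsection \<open>Joint smoothness of \<open>(p, z) \<mapsto> \<alpha> z f p\<close>\<close>

abbreviation "EA == prod_lcs (euclid n) (C_infinity P)"

context
  fixes w U phi f
  assumes w: "w \<in> torus_set n" and c: "(U, phi) \<in> atlas P" and f: "f \<in> A"
begin

definition psi :: "vec \<times> ('a => complex) => 'a => complex" where
  "psi = (%(x, a). \<alpha> (inv_into (torus_dom n w) (torus_chart n w) x) a)"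

definition param_deriv :: "vec list => vec => 'a => complex" where
  "param_deriv xis x = iter_deriv EA (C_infinity P) psi (map (%xi. (xi, \<lambda>x\<in>X. 0)) xis) (x, f)"

lemma psi_smooth: "smooth_on EA (C_infinity P) (cube n \<times> A) psi"
proof -
  have "(torus_dom n w, torus_chart n w) \<in> atlas TM" using w by (auto simp: atlas_torus)
  then have "smooth_on (prod_lcs (euclid (mdim TM)) (C_infinity P)) (C_infinity P)
     (torus_chart n w ` torus_dom n w \<times> carrier (C_infinity P))
     (%(x, a). \<alpha> (inv_into (torus_dom n w) (torus_chart n w) x) a)"
    using sys unfolding smooth_dynamical_system_def by blast
  then show ?thesis using w by (simp add: torus_chart_image psi_def)
qed

lemma directions: "set xis \<subseteq> Rn n ==> set (map (%xi. (xi, \<lambda>x\<in>X. 0 :: complex)) xis) \<subseteq> carrier EA"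
  using A_const[of 0] by auto

lemma param_deriv_continuous:
  assumes xis: "set xis \<subseteq> Rn n"
  shows "continuous_map (subtopology (Euclidean_space n) (cube n)) T (param_deriv xis)"
proof -
  let ?vs = "map (%xi. (xi, \<lambda>x\<in>X. 0 :: complex)) xis"
  let ?k = "length ?vs" and ?v = "restrict (nth ?vs) {..<length ?vs}"
  have m: "map ?v [0..<?k] = ?vs" by (intro nth_equalityI) auto
  have c1: "continuous_map (prod_topology (subtopology (topo EA) (cube n \<times> A)) (product_topology (%_. topo EA) {..<?k}))
      T (%(x, v). iter_deriv EA (C_infinity P) psi (map v [0..<?k]) x)"
    using psi_smooth unfolding smooth_on_def C_infinity_simps(7) by blast
  have vE: "?vs ! i \<in> carrier EA" if "i < ?k" for i
    using nth_mem[OF that] directions[OF xis] by blast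
  have "continuous_map (subtopology (Euclidean_space n) (cube n)) (prod_topology (Euclidean_space n) T) (%x. (x, f))"
    using f by (auto simp: continuous_map_pairwise o_def intro: continuous_map_from_subtopology)
  then have 1: "continuous_map (subtopology (Euclidean_space n) (cube n)) (subtopology (topo EA) (cube n \<times> A)) (%x. (x, f))"
    using f by (auto simp: continuous_map_in_subtopology)
  have "?v \<in> topspace (product_topology (%_. topo EA) {..<?k})"
    using vE by (auto simp: PiE_iff simp del: nth_map)
  then have 2: "continuous_map (subtopology (Euclidean_space n) (cube n)) (product_topology (%_. topo EA) {..<?k}) (%_. ?v)"
    by simp
  have "continuous_map (subtopology (Euclidean_space n) (cube n))
      (prod_topology (subtopology (topo EA) (cube n \<times> A)) (product_topology (%_. topo EA) {..<?k})) (%x. ((x, f), ?v))"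
    using 1 2 by (simp add: continuous_map_pairwise o_def)
  from continuous_map_compose[OF this c1] show ?thesis
    by (simp only: o_def prod.case m param_deriv_def[abs_def])
qed

lemma param_deriv_A: "set xis \<subseteq> Rn n ==> x \<in> cube n ==> param_deriv xis x \<in> A"
  using continuous_map_T_in[OF param_deriv_continuous] cube_subset by fastforce

lemma param_deriv_limit:
  assumes xis: "set xis \<subseteq> Rn n" and xi: "xi \<in> Rn n" and x: "x \<in> cube n"
  shows "limitin T (%t. fsm (of_real (1 / t)) (fdiff P (param_deriv xis (%i. x i + t * xi i)) (param_deriv xis x)))
     (param_deriv (xi # xis) x) (at 0)"
proof -
  let ?vs = "map (%xi. (xi, \<lambda>x\<in>X. 0 :: complex)) xis" and ?v = "(xi, \<lambda>x\<in>X. 0 :: complex)"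
  let ?g = "iter_deriv EA (C_infinity P) psi ?vs"
  have "?v \<in> carrier EA" using xi A_const[of 0] by simp
  then obtain u where u: "has_dir_deriv EA (C_infinity P) ?g ?v (x, f) u"
    using psi_smooth directions[OF xis] x f unfolding smooth_on_def by blast
  have u_eq: "u = param_deriv (xi # xis) x" using dir_deriv_C_infinity[OF u] by (simp add: param_deriv_def)
  have lim: "limitin T (%t. of_real (1 / t) \<odot>\<^bsub>C_infinity P\<^esub> (?g ((x, f) \<oplus>\<^bsub>EA\<^esub> (of_real t \<odot>\<^bsub>EA\<^esub> ?v)) \<ominus>\<^bsub>C_infinity P\<^esub> ?g (x, f)))
      (param_deriv (xi # xis) x) (at 0)"
    using u unfolding has_dir_deriv_def u_eq C_infinity_simps(7) .
  from line_eventually_at[OF openin_cube x xi]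
  have "\<forall>\<^sub>F t in at 0. of_real (1 / t) \<odot>\<^bsub>C_infinity P\<^esub> (?g ((x, f) \<oplus>\<^bsub>EA\<^esub> (of_real t \<odot>\<^bsub>EA\<^esub> ?v)) \<ominus>\<^bsub>C_infinity P\<^esub> ?g (x, f)) =
     fsm (of_real (1 / t)) (fdiff P (param_deriv xis (%i. x i + t * xi i)) (param_deriv xis x))"
  proof eventually_elim
    case (elim t)
    have "fadd f (fsm (of_real t) (\<lambda>x\<in>X. 0)) = f" using A_ext[OF f] by (auto simp: fun_eq_iff extensional_def)
    then have "(x, f) \<oplus>\<^bsub>EA\<^esub> (of_real t \<odot>\<^bsub>EA\<^esub> ?v) = (%i. x i + t * xi i, f)" by simp
    moreover have "?g (y, f) = param_deriv xis y" for y by (simp add: param_deriv_def)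
    ultimately show ?case
      using minus_A[OF param_deriv_A[OF xis elim] param_deriv_A[OF xis x]] by (simp only: C_infinity_simps)
  qed
  from limitin_transform_eventually[OF this lim] show ?thesis .
qed

abbreviation "D == {v:Rn (d + n). fst_part d v \<in> phi ` U & snd_part d v \<in> cube n}"

text \<open>The family of candidates for the mixed derivatives of \<open>\<alpha> z f p\<close>:
  derivatives \<open>vs\<close> in \<open>P\<close> of the derivative of the dynamical system at
  \<open>f\<close> in the directions \<open>(xi, 0)\<close>.\<close>

definition joint :: "vec list => vec list => vec => complex" where
  "joint xis vs v = chart_deriv (U, phi) vs (param_deriv xis (snd_part d v)) (fst_part d v)"

text \<open>The function \<open>param_deriv xis x\<close> depends continuously on \<open>x\<close> in
  the seminorm over a compact box around the point, and each single one has continuous derivatives.\<close>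

lemma joint_continuous:
  assumes xis: "set xis \<subseteq> Rn n" and vs: "set vs \<subseteq> Rn d"
  shows "continuous_on D (joint xis vs)"
proof (rule continuous_on_boxI[of D "d + n"])
  fix v0 and e :: real assume v0: "v0 \<in> D" and e: "e > 0"
  let ?yo = "fst_part d v0" and ?xo = "snd_part d v0"
  interpret chart P U phi using P c by (rule chartI)
  have y0: "?yo \<in> phi ` U" and x0: "?xo \<in> cube n" using v0 by auto
  let ?F = "param_deriv xis"
  have F0: "?F ?xo \<in> A" by (rule param_deriv_A[OF xis x0])
  have e2: "e / 2 > 0" using e by simp
  obtain r1 where r1: "r1 > 0" "!!y. y \<in> Rn d ==> (!!i. i < d ==> \<bar>y i - ?yo i\<bar> < r1) ==>
      y \<in> phi ` U & dist (chart_deriv (U, phi) vs (?F ?xo) y) (chart_deriv (U, phi) vs (?F ?xo) ?yo) < e / 2"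
    using continuous_on_box[OF image_open chart_deriv_continuous[OF F0 c vs] y0 e2] by blast
  define K where "K = {y:Rn d. ALL i<d. \<bar>y i - ?yo i\<bar> <= r1 / 2}"
  have KU: "K \<subseteq> phi ` U"
  proof
    fix y assume y: "y \<in> K"
    have "\<bar>y i - ?yo i\<bar> < r1" if "i < d" for i
    proof -
      have "\<bar>y i - ?yo i\<bar> <= r1 / 2" using y that by (simp add: K_def)
      then show ?thesis using r1(1) by linarith
    qed
    then show "y \<in> phi ` U" using r1(2)[of y] y by (simp add: K_def)
  qed
  have "compact K" unfolding K_def by (rule compact_box)
  then have j: "valid_index P ((U, phi), K, vs)" using c KU vs by (simp add: valid_index_def)
  let ?B = "sn_ball {((U, phi), K, vs)} (e / 2) (?F ?xo)"
  have "openin T ?B" by (rule sn_ball_open) (use j e2 F0 in auto)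
  from openin_continuous_map_preimage[OF param_deriv_continuous[OF xis] this]
  have "openin (subtopology (Euclidean_space n) (cube n)) {x:cube n. ?F x \<in> ?B}"
    using cube_subset by (simp add: Int_absorb1)
  then have "open_Rn n {x:cube n. ?F x \<in> ?B}"
    by (simp add: openin_open_subtopology[OF openin_cube])
  moreover have "?xo \<in> {x:cube n. ?F x \<in> ?B}" using x0 sn_ball_center[OF F0 e2, of "{((U, phi), K, vs)}"] j by simp
  ultimately obtain r2 where r2: "r2 > 0" "!!x. x \<in> Rn n ==> (!!i. i < n ==> \<bar>x i - ?xo i\<bar> < r2) ==> ?F x \<in> ?B"
    by (rule openin_Euclidean_box) blast
  show "EX r>0. ALL v:D. near (d + n) r v0 v --> dist (joint xis vs v) (joint xis vs v0) < e"
  proof (intro exI[of _ "min (r1 / 2) r2"] conjI ballI impI)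
    show "min (r1 / 2) r2 > 0" using r1 r2 by simp
    fix v assume v: "v \<in> D" "ALL i<d + n. \<bar>v i - v0 i\<bar> < min (r1 / 2) r2"
    let ?y = "fst_part d v" and ?x = "snd_part d v"
    have yn: "\<bar>?y i - ?yo i\<bar> < r1 / 2" if "i < d" for i using v(2) that r1(1) by (simp add: fst_part_def)
    have xn: "\<bar>?x i - ?xo i\<bar> < r2" if "i < n" for i using v(2) that r2(1) by (simp add: snd_part_def)
    have xc: "?x \<in> cube n" using v(1) by simp
    have FB: "?F ?x \<in> ?B" by (rule r2(2)[OF subsetD[OF cube_subset xc]]) (rule xn)
    have FA: "?F ?x \<in> A" using FB by (simp add: sn_ball_def)
    have yK: "?y \<in> K" unfolding K_def
    proof (intro CollectI conjI allI impI)
      show "\<bar>?y i - ?yo i\<bar> <= r1 / 2" if "i < d" for i using yn[OF that] by linarith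
    qed simp
    have yU: "?y \<in> phi ` U" using yK KU by blast
    have "cmod (chart_deriv (U, phi) vs (fdiff P (?F ?x) (?F ?xo)) ?y) <= sn ((U, phi), K, vs) (fdiff P (?F ?x) (?F ?xo))"
      by (rule sn_bound[OF A_diff[OF FA F0] j yK])
    also have "... < e / 2" using FB by (simp add: sn_ball_def)
    finally have 1: "dist (chart_deriv (U, phi) vs (?F ?x) ?y) (chart_deriv (U, phi) vs (?F ?xo) ?y) < e / 2"
      unfolding chart_deriv_fdiff[OF FA F0 c vs yU] dist_norm .
    have "\<bar>?y i - ?yo i\<bar> < r1" if "i < d" for i using yn[OF that] r1(1) by argo
    then have 2: "dist (chart_deriv (U, phi) vs (?F ?xo) ?y) (chart_deriv (U, phi) vs (?F ?xo) ?yo) < e / 2"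
      using r1(2)[of ?y] by simp
    show "dist (joint xis vs v) (joint xis vs v0) < e"
      unfolding joint_def by (rule le_less_trans[OF dist_triangle add_strict_mono[OF 1 2, simplified]])
  qed
qed auto

lemma joint_deriv_fst:
  assumes xis: "set xis \<subseteq> Rn n" and vs: "set vs \<subseteq> Rn d" and i: "i < d" and v: "v \<in> D"
  shows "has_dird (joint xis vs) (unitv i) v (joint xis (unitv i # vs) v)"
proof -
  have F: "param_deriv xis (snd_part d v) \<in> A" using v by (intro param_deriv_A[OF xis]) simp
  have "has_dird (iter_dird (%x. param_deriv xis (snd_part d v) (inv_into U phi x)) vs) (unitv i) (fst_part d v)
      (dird (unitv i) (iter_dird (%x. param_deriv xis (snd_part d v) (inv_into U phi x)) vs) (fst_part d v))"
    using v by (intro Cinf_has_dird[OF Cinf_iter_dird[OF in_chart[OF F c] vs] _ unitv_in_Rn[OF i]]) simp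
  moreover have "snd_part d (%l. v l + t * unitv i l) = snd_part d v" for t
    using i by (auto simp: snd_part_def unitv_def)
  moreover have "fst_part d (%l. v l + t * unitv i l) = (%l. fst_part d v l + t * unitv i l)" for t
    using i by (auto simp: fst_part_def unitv_def)
  ultimately show ?thesis by (simp add: has_dird_def joint_def chart_deriv_def)
qed

lemma joint_deriv_snd:
  assumes xis: "set xis \<subseteq> Rn n" and vs: "set vs \<subseteq> Rn d" and i: "d <= i" "i < d + n" and v: "v \<in> D"
  shows "has_dird (joint xis vs) (unitv i) v (joint (unitv (i - d) # xis) vs v)"
proof -
  let ?y = "fst_part d v" and ?x = "snd_part d v" and ?xi = "unitv (i - d)"
  have yU: "?y \<in> phi ` U" and x: "?x \<in> cube n" using v by auto
  have xi: "?xi \<in> Rn n" using i by (intro unitv_in_Rn) auto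
  have xis': "set (?xi # xis) \<subseteq> Rn n" using xi xis by simp
  let ?F = "param_deriv xis"
  let ?xt = "%t j. ?x j + t * ?xi j"
  let ?Q = "%t. fsm (of_real (1 / t)) (fdiff P (?F (?xt t)) (?F ?x))"
  have j: "valid_index P ((U, phi), {?y}, vs)" using c yU vs by (simp add: valid_index_def)
  have lim: "limitin T ?Q (param_deriv (?xi # xis) ?x) (at 0)" by (rule param_deriv_limit[OF xis xi x])
  have F'A: "param_deriv (?xi # xis) ?x \<in> A" by (rule param_deriv_A[OF xis' x])
  have FA: "?F ?x \<in> A" by (rule param_deriv_A[OF xis x])
  have "((%t. sn ((U, phi), {?y}, vs) (fdiff P (?Q t) (param_deriv (?xi # xis) ?x))) \<longlongrightarrow> 0) (at 0)"
    by (rule limitin_T_tendsto[OF lim j])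
  note ev = line_eventually_at[OF openin_cube x xi]
  have "((%t. (1 / t) *\<^sub>R (chart_deriv (U, phi) vs (?F (?xt t)) ?y - chart_deriv (U, phi) vs (?F ?x) ?y)) \<longlongrightarrow>
      chart_deriv (U, phi) vs (param_deriv (?xi # xis) ?x) ?y) (at 0)"
  proof (rule tendstoI)
    fix e :: real assume e: "e > 0"
    have "\<forall>\<^sub>F t in at 0. sn ((U, phi), {?y}, vs) (fdiff P (?Q t) (param_deriv (?xi # xis) ?x)) < e"
      by (rule order_tendstoD(2)[OF limitin_T_tendsto[OF lim j] e])
    then show "\<forall>\<^sub>F t in at 0. dist ((1 / t) *\<^sub>R (chart_deriv (U, phi) vs (?F (?xt t)) ?y - chart_deriv (U, phi) vs (?F ?x) ?y))
      (chart_deriv (U, phi) vs (param_deriv (?xi # xis) ?x) ?y) < e"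
      using ev
    proof eventually_elim
      case (elim t)
      have FtA: "?F (?xt t) \<in> A" by (rule param_deriv_A[OF xis elim(2)])
      have QA: "?Q t \<in> A" by (intro A_smult A_diff FtA FA)
      have "cmod (chart_deriv (U, phi) vs (fdiff P (?Q t) (param_deriv (?xi # xis) ?x)) ?y) < e"
        using sn_bound[OF A_diff[OF QA F'A] j, of ?y] elim(1) by simp
      then show ?case
        unfolding chart_deriv_fdiff[OF QA F'A c vs yU] chart_deriv_smult[OF A_diff[OF FtA FA] c vs yU]
          chart_deriv_fdiff[OF FtA FA c vs yU] dist_norm scaleR_conv_of_real .
    qed
  qed
  moreover have "snd_part d (%l. v l + t * unitv i l) = ?xt t" for t
  proof
    fix l
    show "snd_part d (%l. v l + t * unitv i l) l = ?xt t l"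
    proof (cases "l + d = i")
      case True
      then show ?thesis using i by (auto simp: snd_part_def unitv_def)
    next
      case False
      then have "l ~= i - d" using i by auto
      then show ?thesis using False by (simp add: snd_part_def unitv_def)
    qed
  qed
  moreover have "fst_part d (%l. v l + t * unitv i l) = ?y" for t
    using i by (auto simp: fst_part_def unitv_def)
  ultimately show ?thesis
    by (simp add: has_dird_def has_vector_derivative_at_0_iff joint_def)
qed

text \<open>The family \<open>joint\<close> is closed under partial derivatives, so coinduction applies.\<close>

lemma joint_smooth: "Cinf (d + n) D (joint [] [])"
proof -
  have D: "open_Rn (d + n) D"
    by (intro openin_parts openin_cube chart.image_open chartI[OF P c])
  let ?S = "{joint xis vs | xis vs. set xis \<subseteq> Rn n & set vs \<subseteq> Rn d}"
  show ?thesis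
  proof (rule Cinf_coinduct[OF D, of _ ?S])
    fix h i assume "h \<in> ?S" and i: "i < d + n"
    then obtain xis vs where h: "h = joint xis vs" "set xis \<subseteq> Rn n" "set vs \<subseteq> Rn d" by blast
    show "EX g. (ALL x:D. has_dird h (unitv i) x (g x)) & (ALL k. (ALL h:?S. Ck k (d + n) D h) --> Ck k (d + n) D g)"
    proof (cases "i < d")
      case True
      then have "joint xis (unitv i # vs) \<in> ?S" using h unitv_in_Rn[OF True] by force
      then show ?thesis using joint_deriv_fst[OF h(2,3) True] h(1) by blast
    next
      case False
      then have "unitv (i - d) \<in> Rn n" using i by (intro unitv_in_Rn) auto
      then have "joint (unitv (i - d) # xis) vs \<in> ?S" using h by force
      then show ?thesis using joint_deriv_snd[OF h(2,3) _ i] False h(1)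
        by (intro exI[of _ "joint (unitv (i - d) # xis) vs"]) auto
    qed
  qed (use joint_continuous in auto, force)
qed

end

lemma joint_smooth_fn:
  assumes f: "f \<in> A"
  shows "smooth_fn (prod_manifold P TM) (X \<times> torus_set n) (%(p, z). \<alpha> z f p)"
proof (rule smooth_fn_local[OF PT])
  fix s assume s: "s \<in> X \<times> torus_set n"
  obtain p w where pw: "s = (p, w)" "p \<in> X" and w: "w \<in> torus_set n" using s by auto
  obtain U phi where c: "(U, phi) \<in> atlas P" "p \<in> U" using chart_exists[OF P pw(2)] by blast
  have cw: "(torus_dom n w, torus_chart n w) \<in> atlas TM" using w by (auto simp: atlas_torus)
  interpret prod_charts P U phi TM "torus_dom n w" "torus_chart n w" using P TM c(1) cw by (rule prod_chartsI)
  interpret PC: chart "prod_manifold P TM" "U \<times> torus_dom n w" \<kappa>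
    by (rule chartI[OF PT atlas_prodI[OF c(1) cw]])
  have img: "\<kappa> ` (U \<times> torus_dom n w) = {v:Rn (d + n). fst_part d v \<in> phi ` U & snd_part d v \<in> cube n}"
    unfolding prod_chart_image[OF subset_refl subset_refl] by (simp add: torus_chart_image[OF w])
  have "Cinf (d + n) (\<kappa> ` (U \<times> torus_dom n w)) (joint w U phi f [] [])"
    unfolding img by (rule joint_smooth[OF w c(1) f])
  then have "Cinf (d + n) (\<kappa> ` (U \<times> torus_dom n w)) (%v. (%(p, z). \<alpha> z f p) (inv_into (U \<times> torus_dom n w) \<kappa> v))"
    by (rule Cinf_cong[THEN iffD1, rotated])
      (simp add: inv_prod_chart joint_def[OF w c(1) f] param_deriv_def[OF w c(1) f] psi_def[OF w c(1) f] chart_deriv_def)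
  then have "smooth_fn (prod_manifold P TM) (U \<times> torus_dom n w) (%(p, z). \<alpha> z f p)"
    by (intro PC.smooth_fn_chartI PC.dom_open) simp_all
  moreover have "w \<in> torus_dom n w" using torus_exp_chart(1)[OF w zero_in_cube] torus_exp_zero[OF w] by simp
  ultimately show "EX Q. s \<in> Q & Q \<subseteq> X \<times> torus_set n & smooth_fn (prod_manifold P TM) Q (%(p, z). \<alpha> z f p)"
    using pw c PC.dom_subset by (intro exI[of _ "U \<times> torus_dom n w"]) auto
qed

lemma induced_smooth_fn:
  assumes f: "f \<in> A"
  shows "smooth_fn (prod_manifold P TM) (X \<times> torus_set n) (%s. f (case s of (p, z) => \<sigma> p z))"
  by (rule smooth_fn_cong[THEN iffD1, OF _ PT joint_smooth_fn[OF f]]) (auto simp: induced_point(2) f)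

text \<open>Plateau functions turn smoothness of \<open>f (\<sigma> p z)\<close> for all
  \<open>f\<close> into continuity of \<open>\<sigma>\<close>; extensions of local functions then give
  smoothness.\<close>

lemma induced_smooth: "smooth_map (prod_manifold P TM) P (%(p, z). \<sigma> p z)"
proof -
  let ?s = "%(p, z). \<sigma> p z"
  have top: "topspace (mtop (prod_manifold P TM)) = X \<times> torus_set n" by simp
  have in_X: "?s s \<in> X" if "s \<in> X \<times> torus_set n" for s using that induced_point(1) by auto
  have c: "continuous_map (mtop (prod_manifold P TM)) (mtop P) ?s"
    unfolding continuous_map_def top
  proof (intro conjI allI impI)
    fix W assume W: "openin (mtop P) W"
    show "openin (mtop (prod_manifold P TM)) {s:X \<times> torus_set n. ?s s \<in> W}"
    proof (subst openin_subopen, intro ballI)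
      fix s assume s: "s \<in> {s:X \<times> torus_set n. ?s s \<in> W}"
      then have sW: "?s s \<in> W" by blast
      obtain \<beta> :: "'a => real" and W' C where
        b: "smooth_fn P X \<beta>" "openin (mtop P) W'" "?s s \<in> W'" "W' \<subseteq> W"
        "!!x. x \<in> W' ==> \<beta> x = 1" "closedin (mtop P) C" "C \<subseteq> W" "!!x. x ~: C ==> \<beta> x = 0"
        by (rule exists_plateau[OF M W sW]) (rule that)
      let ?f = "\<lambda>x\<in>X. complex_of_real (\<beta> x)"
      let ?N = "{s:X \<times> torus_set n. ?f (?s s) \<in> - {0}}"
      have "openin (mtop (prod_manifold P TM)) ?N"
        by (rule smooth_fn_preimage_open[OF PT induced_smooth_fn[OF A_of_real[OF b(1)]]]) (simp add: open_Compl)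
      moreover have "s \<in> ?N" using s in_X b(3,5) by auto
      moreover have "?N \<subseteq> {s:X \<times> torus_set n. ?s s \<in> W}"
      proof
        fix s' assume s': "s' \<in> ?N"
        then have "\<beta> (?s s') ~= 0" using in_X[of s'] by auto
        then show "s' \<in> {s:X \<times> torus_set n. ?s s \<in> W}" using b(7,8) s' by blast
      qed
      ultimately show "EX Q. openin (mtop (prod_manifold P TM)) Q & s \<in> Q & Q \<subseteq> {s:X \<times> torus_set n. ?s s \<in> W}" by blast
    qed
  qed (use in_X in auto)
  show ?thesis
  proof (rule smooth_mapI[OF PT P c])
    fix W and h :: "'a => real" assume h: "smooth_fn P W h"
    show "smooth_fn (prod_manifold P TM) {s:topspace (mtop (prod_manifold P TM)). ?s s \<in> W} (%s. h (?s s))"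
    proof (rule smooth_fn_local[OF PT])
      fix s assume s: "s \<in> {s:topspace (mtop (prod_manifold P TM)). ?s s \<in> W}"
      then have sW: "?s s \<in> W" by blast
      obtain F W' where F: "smooth_fn P X F" "openin (mtop P) W'" "?s s \<in> W'" "W' \<subseteq> W"
        "!!q. q \<in> W' ==> F q = h q"
        by (rule extend_smooth_fn[OF M h sW]) (rule that)
      let ?N = "{s:topspace (mtop (prod_manifold P TM)). ?s s \<in> W'}"
      have N: "openin (mtop (prod_manifold P TM)) ?N" by (rule openin_continuous_map_preimage[OF c F(2)])
      let ?f = "\<lambda>x\<in>X. complex_of_real (F x)"
      have "smooth_fn (prod_manifold P TM) (X \<times> torus_set n) (%s. Re (?f (?s s)))"
        by (rule smooth_fn_linear[OF PT bounded_linear_Re induced_smooth_fn[OF A_of_real[OF F(1)]]])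
      then have "smooth_fn (prod_manifold P TM) ?N (%s. Re (?f (?s s)))"
        by (rule smooth_fn_subset[OF PT _ N]) auto
      then have "smooth_fn (prod_manifold P TM) ?N (%s. h (?s s))"
        by (rule smooth_fn_cong[THEN iffD1, OF _ PT, rotated]) (use in_X F(5) in auto)
      then show "EX Q. s \<in> Q & Q \<subseteq> {s:topspace (mtop (prod_manifold P TM)). ?s s \<in> W} &
          smooth_fn (prod_manifold P TM) Q (%s. h (?s s))"
        using s F(3,4) by (intro exI[of _ ?N]) auto
    qed
  qed
qed

lemma induced_action_smooth: "smooth_right_action P (torus n) \<sigma>"
  unfolding smooth_right_action_def using induced_smooth induced_one induced_mult by simp

end

section \<open>Submersions\<close>

text \<open>A smooth right inverse of a map shows that its derivative is surjective, by the chain rule.\<close>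

lemma lift_direction:
  fixes G :: "nat => vec => real"
  assumes G: "!!i. i < m ==> Cinf d S (G i)"
    and C: "open_Rn m C" and \<Gamma>: "!!c. c \<in> C ==> \<Gamma> c \<in> S" "!!j. j < d ==> Cinf m C (%c. \<Gamma> c j)"
    and G\<Gamma>: "!!c i. c \<in> C ==> i < m ==> G i (\<Gamma> c) = c i" and c: "c \<in> C" and w: "w \<in> Rn m"
  shows "EX v:Rn d. ALL i<m. dird v (G i) (\<Gamma> c) = w i"
proof -
  define v where "v = (%j. if j < d then dird w (%c. \<Gamma> c j) c else 0)"
  have v: "v \<in> Rn d" by (simp add: v_def Rn_iff)
  have "dird v (G i) (\<Gamma> c) = w i" if i: "i < m" for i
  proof -
    have "dird v (G i) (\<Gamma> c) = (\<Sum>j<d. v j *\<^sub>R dird (unitv j) (G i) (\<Gamma> c))"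
      by (rule dird_sum[OF G[OF i] \<Gamma>(1)[OF c] v])
    also have "... = (\<Sum>j<d. dird w (%c. \<Gamma> c j) c *\<^sub>R dird (unitv j) (G i) (\<Gamma> c))"
      by (rule sum.cong) (simp_all add: v_def)
    also have "... = dird w (%c. G i (\<Gamma> c)) c"
      by (rule has_dird_dird[symmetric, OF has_dird_compose[OF C G[OF i] \<Gamma>(1) \<Gamma>(2) c w]])
    also have "... = dird w (%c. c i) c"
      using iter_dird_cong[OF C, of "%c. G i (\<Gamma> c)" "%c. c i" "[w]" c] G\<Gamma> i w c by simp
    also have "... = w i"
      by (rule has_dird_dird) (auto simp: has_dird_def has_vector_derivative_def intro!: derivative_eq_intros)
    finally show ?thesis .
  qed
  then show ?thesis using v by blast
qed

lemma smooth_map_coord: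
  assumes M: "pre_manifold M" and N: "pre_manifold N" and f: "smooth_map M N f"
    and c: "(V, psi) \<in> atlas N"
  shows "smooth_fn M {p:topspace (mtop M). f p \<in> V} (%p. psi (f p) j)"
  by (rule smooth_map_pullback[OF M N f chart.smooth_fn_coord[OF chartI[OF N c]]])

context
  fixes P :: "'a manifold" and B :: "'b manifold" and q U phi V psi
  assumes P: "pre_manifold P" and B: "pre_manifold B" and q: "smooth_map P B q"
    and U: "(U, phi) \<in> atlas P" and V: "(V, psi) \<in> atlas B"
begin

abbreviation "chart_region == phi ` (U Int {p:topspace (mtop P). q p \<in> V})"

abbreviation "chart_coord i == %x. psi (q (inv_into U phi x)) i"

lemma chart_region_open: "open_Rn (mdim P) chart_region"
  using chart.dom_open[OF chartI[OF P U]]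
    openin_continuous_map_preimage[OF smooth_map_continuous[OF q] chart.dom_open[OF chartI[OF B V]]]
  by (intro chart.open_image[OF chartI[OF P U]] openin_Int) auto

lemma chart_region_inv: "y \<in> chart_region ==> inv_into U phi y \<in> U & q (inv_into U phi y) \<in> V"
  using chart.in_image_iff[OF chartI[OF P U], of "U Int {p:topspace (mtop P). q p \<in> V}" y] by simp

lemma chart_coord_smooth: "Cinf (mdim P) chart_region (chart_coord i)"
  by (rule smooth_fn_in_chart[OF smooth_map_coord[OF P B q V] U])

lemma dir_deriv_chart:
  assumes x: "x \<in> chart_region" and v: "v \<in> Rn (mdim P)"
  shows "dir_deriv (euclid (mdim P)) (euclid (mdim B)) (psi o q o inv_into U phi) v x =
     (%i. if i < mdim B then dird v (chart_coord i) x else 0)"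
proof -
  have "dir_deriv (euclid (mdim P)) (euclid (mdim B)) (psi o q o inv_into U phi) v x =
     (%i. if i < mdim B then dird v (%y. (psi o q o inv_into U phi) y i) x else 0)"
    using chart.in_Rn[OF chartI[OF B V]] chart_region_inv chart_coord_smooth
    by (intro dir_deriv_euclid[OF chart_region_open _ _ x v]) auto
  then show ?thesis unfolding o_def .
qed

end

text \<open>A submersion has smooth local sections: straightening makes the coordinates of the base the
  first coordinates of the total space, and the others may be kept fixed. Composing with such a section
  expresses \<open>g\<close> locally through \<open>g \<circ> q\<close>.\<close>

lemma submersion_factor_smooth:
  assumes P: "pre_manifold P" and B: "pre_manifold B" and N: "pre_manifold N" and q: "submersion P B q"
    and surj: "q ` topspace (mtop P) = topspace (mtop B)"
    and c: "continuous_map (mtop B) (mtop N) g" and gq: "smooth_map P N (%p. g (q p))"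
  shows "smooth_map B N g"
proof (rule smooth_mapI[OF B N c])
  let ?d = "mdim P" and ?m = "mdim B"
  have qs: "smooth_map P B q" using q by (simp add: submersion_def)
  fix W and k :: "_ => real" assume k: "smooth_fn N W k"
  let ?W = "{p:topspace (mtop P). g (q p) \<in> W}"
  have kg: "smooth_fn P ?W (%p. k (g (q p)))" by (rule smooth_map_pullback[OF P N gq k])
  show "smooth_fn B {b:topspace (mtop B). g b \<in> W} (%b. k (g b))"
  proof (rule smooth_fn_local[OF B])
    fix b assume b: "b \<in> {b:topspace (mtop B). g b \<in> W}"
    then obtain p where p: "p \<in> topspace (mtop P)" "b = q p" using surj by auto
    obtain U phi where U: "(U, phi) \<in> atlas P" "p \<in> U" using chart_exists[OF P p(1)] by blast
    obtain V psi where V: "(V, psi) \<in> atlas B" "b \<in> V" using chart_exists[OF B, of b] b by blast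
    interpret U: chart P U phi using P U(1) by (rule chartI)
    interpret V: chart B V psi using B V(1) by (rule chartI)
    note ctx = P B qs U(1) V(1)
    let ?S = "phi ` (U Int {p:topspace (mtop P). q p \<in> V})"
    define G where "G i x = psi (q (inv_into U phi x)) i" for i x
    note S = chart_region_open[OF ctx] and inS = chart_region_inv[OF ctx]
    have x: "phi p \<in> ?S" using U(2) p V(2) by blast
    have G: "Cinf ?d ?S (G i)" for i unfolding G_def by (rule chart_coord_smooth[OF ctx])
    have "EX v:Rn ?d. ALL i<?m. dird v (G i) (phi p) = (if i = j then 1 else 0)" if j: "j < ?m" for j
    proof -
      let ?D = "%v. dir_deriv (euclid ?d) (euclid ?m) (psi o q o inv_into U phi) v (phi p)"
      have "p \<in> U Int q -` V" using U(2) V(2) p(2) by simp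
      then have "?D ` carrier (euclid ?d) = carrier (euclid ?m)"
        using q U(1) V(1) unfolding submersion_def by blast
      moreover have "unitv j \<in> carrier (euclid ?m)" using unitv_in_Rn[OF j] by simp
      ultimately obtain v where v: "v \<in> Rn ?d" "?D v = unitv j" by (metis (no_types, lifting) imageE euclid_simps(1))
      have "dird v (G i) (phi p) = unitv j i" if "i < ?m" for i
        using fun_cong[OF v(2), of i] that unfolding dir_deriv_chart[OF ctx x v(1)] by (simp add: G_def[abs_def])
      then show ?thesis using v(1) by (intro bexI[of _ v]) (auto simp: unitv_def)
    qed
    note * = this
    obtain S f h where f: "?m <= ?d" "phi p \<in> S" "S \<subseteq> ?S" "diffeo_on ?d S f h"
      "!!x i. x \<in> S ==> i < ?m ==> f x i = G i x"
      by (rule straighten[OF S x G *]) (assumption+, rule that)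
    note D = diffeo_onD[OF f(4)]
    define e where "e c = (%i. if i < ?m then c i else f (phi p) i)" for c :: "vec"
    let ?J = "%c. inv_into U phi (h (e c))"
    have Rm: "open_Rn ?m (Rn ?m)" by simp
    have eR: "e c \<in> Rn ?d" for c using f(1) D(6)[OF f(2)] by (auto simp: e_def Rn_iff)
    have ec: "Cinf ?m (Rn ?m) (%c. e c i)" for i
      by (cases "i < ?m") (simp_all add: e_def Cinf_coord Cinf_const)
    define E where "E = {c:Rn ?m. e c \<in> f ` S}"
    have E: "open_Rn ?m E"
      unfolding E_def by (rule openin_coord_preimage[OF Rm D(2) eR Cinf_continuous[OF ec]])
    have he: "Cinf ?m E (%c. h (e c) i)" if "i < ?d" for i
      using Cinf_subset[OF ec E] by (intro Cinf_compose[OF E D(5)[OF that]]) (auto simp: E_def)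
    have J: "?J c \<in> U" "q (?J c) \<in> V" "psi (q (?J c)) = c" "h (e c) \<in> ?S" if c: "c \<in> E" for c
    proof -
      have hS: "h (e c) \<in> S" using c D(7) by (simp add: E_def)
      then show h': "h (e c) \<in> ?S" using f(3) by blast
      then show "?J c \<in> U" "q (?J c) \<in> V" using inS by auto
      have "psi (q (?J c)) i = c i" for i
      proof (cases "i < ?m")
        case True
        then have "psi (q (?J c)) i = f (h (e c)) i" using f(5)[OF hS] by (simp add: G_def)
        also have "... = c i" using D(8)[of "e c"] c True by (simp add: E_def e_def)
        finally show ?thesis .
      next
        case False
        then show ?thesis using V.in_Rn[OF \<open>q (?J c) \<in> V\<close>] c by (simp add: E_def Rn_iff)
      qed
      then show "psi (q (?J c)) = c" by blast
    qed
    let ?T = "phi ` (U Int ?W)"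
    have T: "Cinf ?d ?T (%x. k (g (q (inv_into U phi x))))" by (rule smooth_fn_in_chart[OF kg U(1)])
    have hR: "h (e c) \<in> Rn ?d" if "c \<in> E" for c using J(4)[OF that] openin_subset[OF S] by auto
    define E' where "E' = {c:E. h (e c) \<in> ?T}"
    have E': "open_Rn ?m E'"
      unfolding E'_def by (rule openin_coord_preimage[OF E Cinf_open[OF T] hR Cinf_continuous[OF he]])
    have H: "Cinf ?m E' (%c. k (g (q (?J c))))"
      by (rule Cinf_compose[OF E' T]) (auto simp: E'_def intro: Cinf_subset[OF he E'[unfolded E'_def]])
    let ?N = "{b:V. psi b \<in> E'}"
    have N': "openin (mtop B) ?N" by (rule V.open_preimage[OF E'])
    have qJ: "q (?J (psi b)) = b" if "b \<in> ?N" for b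
    proof -
      have "psi b \<in> E" using that by (simp add: E'_def)
      from J(2,3)[OF this] show ?thesis using that V.inj by (auto dest: inj_onD)
    qed
    have "smooth_fn B ?N (%b. k (g b))"
    proof (rule V.smooth_fn_chartI[OF N'])
      have sub: "psi ` ?N \<subseteq> E'" by auto
      have "Cinf ?m (psi ` ?N) (%c. k (g (q (?J c))))"
        by (rule Cinf_subset[OF H V.open_image[OF N'] sub]) auto
      then show "Cinf ?m (psi ` ?N) (%c. k (g (inv_into V psi c)))"
        by (rule Cinf_cong[THEN iffD1, rotated]) (use qJ in auto)
    qed auto
    moreover have "b \<in> ?N"
    proof -
      have "e (psi b) = f (phi p)"
        using f(2,5) U(2) p(2) by (auto simp: e_def fun_eq_iff G_def)
      then have "psi b \<in> E" "h (e (psi b)) = phi p"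
        using V.in_Rn[OF V(2)] f(2) D(3) by (auto simp: E_def)
      then show ?thesis using V(2) U(2) p b by (auto simp: E'_def)
    qed
    moreover have "?N \<subseteq> {b:topspace (mtop B). g b \<in> W}"
    proof
      fix b assume bN: "b \<in> ?N"
      then have "h (e (psi b)) \<in> ?T" by (simp add: E'_def)
      then have "g (q (?J (psi b))) \<in> W" using U.in_image_iff[of "U Int ?W"] by auto
      then show "b \<in> {b:topspace (mtop B). g b \<in> W}" using qJ[OF bN] bN V.dom_subset by auto
    qed
    ultimately show "EX Q. b \<in> Q & Q \<subseteq> {b:topspace (mtop B). g b \<in> W} & smooth_fn B Q (%b. k (g b))"
      by (intro exI[of _ ?N] conjI)
  qed
qed

text \<open>In charts the local section \<open>\<gamma>\<close> is a right inverse of \<open>q\<close>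
  on coordinates, so every direction of the base lifts.\<close>

lemma submersionI:
  assumes P: "pre_manifold P" and B: "pre_manifold B" and q: "smooth_map P B q"
    and sections: "!!p V psi. p \<in> topspace (mtop P) ==> (V, psi) \<in> atlas B ==> q p \<in> V ==>
      EX C \<gamma>. psi (q p) \<in> C & \<gamma> (psi (q p)) = p &
        (ALL c:C. \<gamma> c \<in> topspace (mtop P) & q (\<gamma> c) \<in> V & psi (q (\<gamma> c)) = c) &
        (ALL W. ALL k :: _ => real. smooth_fn P W k --> Cinf (mdim B) {c:C. \<gamma> c \<in> W} (%c. k (\<gamma> c)))"
  shows "submersion P B q"
  unfolding submersion_def
proof (intro conjI q ballI, clarify)
  fix U phi V psi p assume U: "(U, phi) \<in> atlas P" and V: "(V, psi) \<in> atlas B" and p: "p \<in> U" "q p \<in> V"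
  let ?d = "mdim P" and ?m = "mdim B"
  interpret U: chart P U phi using P U by (rule chartI)
  interpret V: chart B V psi using B V by (rule chartI)
  note ctx = P B q U V
  let ?S = "phi ` (U Int {p:topspace (mtop P). q p \<in> V})"
  let ?D = "%v. dir_deriv (euclid ?d) (euclid ?m) (psi o q o inv_into U phi) v (phi p)"
  define G where "G i x = psi (q (inv_into U phi x)) i" for i x
  have pX: "p \<in> topspace (mtop P)" using p U.dom_subset by blast
  have x: "phi p \<in> ?S" using p pX by blast
  have G: "Cinf ?d ?S (G i)" for i unfolding G_def by (rule chart_coord_smooth[OF ctx])
  have D: "?D v = (%i. if i < ?m then dird v (G i) (phi p) else 0)" if "v \<in> Rn ?d" for v
    unfolding G_def[abs_def] by (rule dir_deriv_chart[OF ctx x that])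
  obtain C \<gamma> where C: "psi (q p) \<in> C" "\<gamma> (psi (q p)) = p"
    "!!c. c \<in> C ==> \<gamma> c \<in> topspace (mtop P)" "!!c. c \<in> C ==> q (\<gamma> c) \<in> V" "!!c. c \<in> C ==> psi (q (\<gamma> c)) = c"
    "!!W (k :: _ => real). smooth_fn P W k ==> Cinf ?m {c:C. \<gamma> c \<in> W} (%c. k (\<gamma> c))"
    using sections[OF pX V p(2)] by blast
  let ?C = "{c:C. \<gamma> c \<in> U}"
  have \<Gamma>: "Cinf ?m ?C (%c. phi (\<gamma> c) j)" for j by (rule C(6)[OF U.smooth_fn_coord])
  have lift: "EX v:Rn ?d. ALL i<?m. dird v (G i) (phi p) = w i" if w: "w \<in> Rn ?m" for w
  proof -
    have "EX v:Rn ?d. ALL i<?m. dird v (G i) (phi (\<gamma> (psi (q p)))) = w i"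
    proof (rule lift_direction[OF G Cinf_open[OF \<Gamma>] _ \<Gamma> _ _ w])
      show "phi (\<gamma> c) \<in> ?S" if "c \<in> ?C" for c using that C(3,4) by blast
      show "G i (phi (\<gamma> c)) = c i" if "c \<in> ?C" for c i using that C(5) by (simp add: G_def)
      show "psi (q p) \<in> ?C" using C(1,2) p(1) by simp
    qed
    then show ?thesis by (simp add: C(2))
  qed
  show "?D ` carrier (euclid ?d) = carrier (euclid ?m)"
  proof (intro subset_antisym subsetI)
    fix w assume "w \<in> ?D ` carrier (euclid ?d)"
    then obtain v where "v \<in> Rn ?d" "w = ?D v" by auto
    then show "w \<in> carrier (euclid ?m)" using D by (simp add: Rn_iff)
  next
    fix w assume "w \<in> carrier (euclid ?m)"
    then have w: "w \<in> Rn ?m" by simp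
    then obtain v where v: "v \<in> Rn ?d" "!!i. i < ?m ==> dird v (G i) (phi p) = w i" using lift by blast
    have "w = ?D v" unfolding D[OF v(1)] using v(2) w by (auto simp: Rn_iff fun_eq_iff)
    then show "w \<in> ?D ` carrier (euclid ?d)" using v(1) by auto
  qed
qed

lemma open_submanifold_topspace:
  assumes "pre_manifold M"
  shows "open_submanifold M (topspace (mtop M)) = M"
proof -
  have "(%(U, phi). (U Int topspace (mtop M), phi)) ` atlas M = (%c. c) ` atlas M"
    using chart.dom_subset[OF chartI[OF assms]] by (intro image_cong) (auto simp: Int_absorb2)
  then show ?thesis by (simp add: open_submanifold_def)
qed

section \<open>The equivariant map given by unitary isotypic functions\<close>

lemma Cinf_sgn:
  fixes g :: "vec => complex"
  assumes g: "Cinf d U g" and nz: "!!x. x \<in> U ==> g x ~= 0"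
  shows "Cinf d U (%x. sgn (g x))"
proof -
  have "Cinf d U (%x. Re (g x) * Re (g x) + Im (g x) * Im (g x))"
    by (intro Cinf_add Cinf_mult bounded_linear.Cinf_linear[OF bounded_linear_Re] bounded_linear.Cinf_linear[OF bounded_linear_Im] g)
  moreover have "Re (g x) * Re (g x) + Im (g x) * Im (g x) > 0" if "x \<in> U" for x
    using nz[OF that] by (metis complex_neq_0 power2_eq_square)
  ultimately have "Cinf d U (%x. sqrt (Re (g x) * Re (g x) + Im (g x) * Im (g x)))" by (rule Cinf_sqrt)
  then have "Cinf d U (%x. cmod (g x))" by (simp add: cmod_def power2_eq_square)
  from Cinf_scaleR[OF Cinf_inverse[OF this] g] show ?thesis using nz by (simp add: sgn_div_norm)
qed

text \<open>The unit \<open>a i\<close> is taken from the isotypic component of the \<open>i\<close>-th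
  unit vector. Because \<open>z i\<close> has modulus one, \<open>sgn \<circ> a i\<close> transforms in
  the same way and takes values in the circle.\<close>

lemma (in smooth_torus_system) equivariant_map:
  assumes NCP: "ALL k. EX a:isotypic_component n (C_infinity P) \<alpha> k. a \<in> Units (C_infinity P)"
  shows "EX u. smooth_map P TM u & (ALL p:X. ALL z:torus_set n. u (\<sigma> p z) = (\<lambda>i\<in>{..<n}. u p i * z i))"
proof -
  have "EX a. a \<in> A & (ALL x:X. a x ~= 0) & (ALL p:X. ALL z:torus_set n. a (\<sigma> p z) = z i * a p)" if i: "i < n" for i
  proof -
    obtain a where a: "a \<in> isotypic_component n (C_infinity P) \<alpha> (%j. if j = i then 1 else 0)" "a \<in> Units (C_infinity P)"
      using NCP by blast
    have A: "a \<in> A" using a(1) by (simp add: isotypic_component_def)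
    have "a (\<sigma> p z) = z i * a p" if p: "p \<in> X" and z: "z \<in> torus_set n" for p z
    proof -
      have "(\<Prod>j<n. z j powi (if j = i then 1 else 0)) = (\<Prod>j<n. if j = i then z j else 1)"
        by (rule prod.cong) auto
      also have "... = z i" using i by simp
      finally have "\<alpha> z a = z i \<odot>\<^bsub>C_infinity P\<^esub> a" using a(1) z unfolding isotypic_component_def by simp
      then show ?thesis using induced_point(2)[OF p z A] p by simp
    qed
    then show ?thesis using A Units_A[OF A] a(2) by blast
  qed
  then obtain a where a: "!!i. i < n ==> a i \<in> A" "!!i x. i < n ==> x \<in> X ==> a i x ~= 0"
    "!!i p z. i < n ==> p \<in> X ==> z \<in> torus_set n ==> a i (\<sigma> p z) = z i * a i p" by metis
  define u where "u p = (\<lambda>i\<in>{..<n}. sgn (a i p))" for p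
  have "smooth_map P TM u"
  proof (rule smooth_map_torusI[OF P TM])
    show "u p \<in> torus_set n" if "p \<in> X" for p using a(2) that by (auto simp: u_def torus_set_def norm_sgn)
    show "smooth_fn P X (%p. u p i)" if i: "i < n" for i
    proof -
      have "smooth_fn P X (%p. sgn (a i p))"
        by (rule smooth_fn_lift1[OF P smooth_A[OF a(1)[OF i]], where S = "- {0}"]) (use a(2) i in "auto intro: Cinf_sgn")
      then show ?thesis using i by (simp add: u_def)
    qed
  qed
  moreover have "u (\<sigma> p z) = (\<lambda>i\<in>{..<n}. u p i * z i)" if "p \<in> X" "z \<in> torus_set n" for p z
    using a(3) that by (auto simp: u_def fun_eq_iff sgn_mult sgn_div_norm[of "z _"] torus_set_norm[OF that(2)])
  ultimately show ?thesis by blast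
qed

section \<open>The slice of an equivariant map\<close>

locale equivariant_torus_action = torus_action P n \<sigma> for P :: "'a manifold" and n \<sigma> +
  fixes u :: "'a => nat => complex"
  assumes M: "smooth_manifold P" and u_smooth: "smooth_map P TM u"
    and u_act: "p \<in> X ==> z \<in> torus_set n ==> u (\<sigma> p z) = (\<lambda>i\<in>{..<n}. u p i * z i)"
begin

abbreviation "pr == orbit_map (torus n) \<sigma>"

text \<open>The point of the orbit of \<open>p\<close> at which \<open>u\<close> is trivial.\<close>

definition r :: "'a => 'a" where
  "r p = \<sigma> p (\<lambda>i\<in>{..<n}. inverse (u p i))"

definition sec :: "'a set => 'a" where
  "sec Q = r (SOME p. p \<in> X & pr p = Q)"

lemma u_in: "p \<in> X ==> u p \<in> torus_set n"
  using smooth_map_in[OF u_smooth] by simp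

lemma torus_inverse_in: "z \<in> torus_set n ==> (\<lambda>i\<in>{..<n}. inverse (z i)) \<in> torus_set n"
  by (auto simp: torus_set_def norm_inverse PiE_iff)

lemma u_inv_in: "p \<in> X ==> (\<lambda>i\<in>{..<n}. inverse (u p i)) \<in> torus_set n"
  by (intro torus_inverse_in u_in)

lemma r_in: "p \<in> X ==> r p \<in> X"
  unfolding r_def by (intro \<sigma>_in u_inv_in)

lemma u_r: "p \<in> X ==> u (r p) = torus_one n"
  unfolding r_def u_act[OF _ u_inv_in] using torus_set_nz[OF u_in] by (auto simp: torus_one_def)

lemma act_r_u: "p \<in> X ==> \<sigma> (r p) (u p) = p"
proof -
  assume p: "p \<in> X"
  have "(\<lambda>i\<in>{..<n}. (\<lambda>i\<in>{..<n}. inverse (u p i)) i * u p i) = torus_one n"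
    using torus_set_nz[OF u_in[OF p]] by (auto simp: torus_one_def)
  then show ?thesis unfolding r_def \<sigma>_mult[OF p u_inv_in[OF p] u_in[OF p]] using \<sigma>_one[OF p] by simp
qed

lemma r_act:
  assumes p: "p \<in> X" and z: "z \<in> torus_set n"
  shows "r (\<sigma> p z) = r p"
proof -
  have "(\<lambda>i\<in>{..<n}. z i * (\<lambda>i\<in>{..<n}. inverse (u (\<sigma> p z) i)) i) = (\<lambda>i\<in>{..<n}. inverse (u p i))"
    using torus_set_nz[OF z] by (auto simp: u_act[OF p z] fun_eq_iff)
  then show ?thesis unfolding r_def \<sigma>_mult[OF p z u_inv_in[OF \<sigma>_in[OF p z]]] by simp
qed

lemma r_fixed: "p \<in> X ==> u p = torus_one n ==> r p = p"
  using act_r_u[of p] \<sigma>_one[OF r_in] by simp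

lemma r_smooth: "smooth_map P P r"
proof -
  have "smooth_fn P X (%p. u p i)" if i: "i < n" for i
  proof -
    have "{p:X. u p \<in> torus_set n} = X" using u_in by auto
    then show ?thesis using smooth_map_pullback[OF P TM u_smooth smooth_fn_torus_coord[OF TM i]] by simp
  qed
  then have "smooth_map P TM (%p. \<lambda>i\<in>{..<n}. inverse (u p i))"
    using u_inv_in torus_set_nz[OF u_in] by (intro smooth_map_torusI[OF P TM]) (auto intro: smooth_fn_inverse[OF P])
  from smooth_map_compose[OF P PT P smooth_map_pair[OF P P TM smooth_map_id[OF P] this] \<sigma>_smooth]
  show ?thesis by (simp add: r_def[abs_def])
qed

lemma pr_act:
  assumes p: "p \<in> X" and z: "z \<in> torus_set n"
  shows "pr (\<sigma> p z) = pr p"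
proof -
  have "\<sigma> (\<sigma> p z) w \<in> pr p" if "w \<in> torus_set n" for w
    using \<sigma>_mult[OF p z that] torus_mult_in[OF z that] by (simp add: orbit_map_def)
  moreover have "\<sigma> p w \<in> pr (\<sigma> p z)" if w: "w \<in> torus_set n" for w
  proof -
    let ?w = "\<lambda>i\<in>{..<n}. inverse (z i) * w i"
    have w': "?w \<in> torus_set n" using torus_mult_in[OF torus_inverse_in[OF z] w] by (simp cong: restrict_cong)
    have "(\<lambda>i\<in>{..<n}. z i * ?w i) = w"
      using torus_set_nz[OF z] w by (auto simp: torus_set_def PiE_iff extensional_def fun_eq_iff)
    then have "\<sigma> p w = \<sigma> (\<sigma> p z) ?w" using \<sigma>_mult[OF p z w'] by simp
    then show ?thesis using w' by (auto simp: orbit_map_def)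
  qed
  ultimately show ?thesis by (auto simp: orbit_map_def)
qed

lemma pr_r: "p \<in> X ==> pr (r p) = pr p"
  unfolding r_def by (intro pr_act u_inv_in)

lemma pr_eq_imp_r_eq:
  assumes "p \<in> X" "q \<in> X" "pr p = pr q"
  shows "r p = r q"
proof -
  have "p \<in> pr p"
    unfolding orbit_map_def by (rule image_eqI[where x = "torus_one n"]) (simp_all add: \<sigma>_one[OF assms(1)])
  then obtain z where "z \<in> torus_set n" "p = \<sigma> q z" using assms(3) by (auto simp: orbit_map_def)
  then show ?thesis using r_act[OF assms(2)] by simp
qed

lemma sec_pr:
  assumes p: "p \<in> X"
  shows "sec (pr p) = r p"
proof -
  have "(SOME q. q \<in> X & pr q = pr p) \<in> X & pr (SOME q. q \<in> X & pr q = pr p) = pr p"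
    by (rule someI[of _ p]) (simp add: p)
  then show ?thesis unfolding sec_def using pr_eq_imp_r_eq p by blast
qed

lemma sec_facts:
  assumes "Q \<in> pr ` X"
  shows "sec Q \<in> X" "pr (sec Q) = Q" "u (sec Q) = torus_one n" "r (sec Q) = sec Q"
proof -
  obtain p where p: "p \<in> X" "Q = pr p" using assms by blast
  show "sec Q \<in> X" "pr (sec Q) = Q" "u (sec Q) = torus_one n"
    using p sec_pr r_in pr_r u_r by simp_all
  then show "r (sec Q) = sec Q" using r_fixed by blast
qed

text \<open>Over any orbit manifold the slice is the image of the section \<open>sec\<close>, smooth because
  \<open>sec \<circ> pr = r\<close> is. The pair of \<open>pr\<close> and \<open>u\<close> is then a global trivialisation.\<close>

lemma orbit_manifold_trivial:
  assumes ob: "is_orbit_manifold P (torus n) \<sigma> B"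
  shows "trivial_principal_bundle P B (torus n) pr \<sigma>"
proof -
  have BM: "smooth_manifold B" and quot: "quotient_map (mtop P) (mtop B) pr" and sub: "submersion P B pr"
    using ob by (auto simp: is_orbit_manifold_def)
  have B: "pre_manifold B" by (rule smooth_manifold_pre[OF BM])
  have BT: "pre_manifold (prod_manifold B TM)" by (rule pre_manifold_prod[OF B TM])
  have prs: "smooth_map P B pr" using sub by (simp add: submersion_def)
  have top: "pr ` X = topspace (mtop B)" using quot by (auto simp: quotient_map_def)
  have "continuous_map (mtop B) (mtop P) sec"
    by (rule continuous_compose_quotient_map[OF quot],
      rule continuous_map_eq[OF smooth_map_continuous[OF r_smooth]]) (simp add: sec_pr)
  moreover have "smooth_map P P (%p. sec (pr p))"
    by (rule smooth_map_cong[OF P P _ r_smooth]) (simp add: sec_pr)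
  ultimately have sec: "smooth_map B P sec" by (rule submersion_factor_smooth[OF P B P sub top])
  let ?\<Phi> = "%p. (pr p, u p)" and ?\<Psi> = "%b. \<sigma> (sec (fst b)) (snd b)"
  have \<Phi>: "smooth_map P (prod_manifold B TM) ?\<Phi>" by (rule smooth_map_pair[OF P B TM prs u_smooth])
  have "smooth_map (prod_manifold B TM) (prod_manifold P TM) (%b. (sec (fst b), snd b))"
    by (intro smooth_map_pair[OF BT P TM] smooth_map_compose[OF BT B P _ sec] smooth_map_fst[OF B TM] smooth_map_snd[OF B TM])
  from smooth_map_compose[OF BT PT P this \<sigma>_smooth] have \<Psi>: "smooth_map (prod_manifold B TM) P ?\<Psi>" by simp
  have "?\<Psi> (?\<Phi> p) = p" if "p \<in> X" for p using that act_r_u by (simp add: sec_pr)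
  moreover have "?\<Phi> (?\<Psi> b) = b" if b: "b \<in> topspace (mtop (prod_manifold B TM))" for b
  proof -
    obtain Q z where Q: "b = (Q, z)" "Q \<in> pr ` X" "z \<in> torus_set n" using b top by auto
    have "(\<lambda>i\<in>{..<n}. torus_one n i * z i) = z"
      using Q(3) by (auto simp: torus_one_def torus_set_def PiE_iff extensional_def fun_eq_iff)
    then show ?thesis
      using Q sec_facts[OF Q(2)] pr_act u_act by simp
  qed
  ultimately have "diffeomorphism P (prod_manifold B TM) ?\<Phi>"
    unfolding diffeomorphism_def using \<Phi> \<Psi> by blast
  then have gt: "globally_trivial P B (torus n) pr \<sigma>"
    unfolding globally_trivial_def bundle_equivalence_def
    by (intro exI[of _ ?\<Phi>]) (simp add: pr_act u_act)
  have WX: "{p:X. pr p \<in> topspace (mtop B)} = X" using top by blast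
  have "principal_bundle P B (torus n) pr \<sigma>"
    unfolding principal_bundle_def
  proof (intro conjI ballI M BM lie prs action)
    show "pr (\<sigma> p g) = pr p" if "p \<in> X" "g \<in> carrier (torus n)" for p g using pr_act that by simp
    show "EX W. openin (mtop B) W & b \<in> W &
        globally_trivial (open_submanifold P {p:X. pr p \<in> W}) (open_submanifold B W) (torus n) pr \<sigma>"
      if "b \<in> topspace (mtop B)" for b
      by (rule exI[of _ "topspace (mtop B)"])
        (simp only: WX open_submanifold_topspace[OF P] open_submanifold_topspace[OF B] gt that openin_topspace simp_thms)
  qed
  then show ?thesis using gt by (simp add: trivial_principal_bundle_def)
qed

end

section \<open>The orbit manifold\<close>

context equivariant_torus_action
begin

text \<open>Coordinates \<open>f \<circ> phi\<close> on \<open>P\<close> whose first \<open>n\<close>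
  entries are the angles of \<open>u\<close>. The slice \<open>u = torus_one n\<close> is where these
  vanish.\<close>

definition adapted where
  "adapted U phi S f h \<longleftrightarrow> (U, phi) \<in> atlas P & n <= d & diffeo_on d S f h &
     S \<subseteq> phi ` (U Int {p:X. u p \<in> torus_dom n (torus_one n)}) &
     (ALL x:S. ALL i<n. f x i = torus_chart n (torus_one n) (u (inv_into U phi x)) i)"

text \<open>The angles of \<open>u\<close> are independent at each point since they are the exponential
  coordinates along the orbit through it; so they can be straightened.\<close>

lemma adapted_exists:
  assumes p: "p \<in> X" "u p = torus_one n"
  obtains U phi S f h where "adapted U phi S f h" "p \<in> U" "phi p \<in> S"
proof -
  let ?e = "torus_one n"
  let ?V = "torus_dom n ?e" and ?psi = "torus_chart n ?e"
  obtain U phi where U: "(U, phi) \<in> atlas P" "p \<in> U" using chart_exists[OF P p(1)] by blast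
  interpret U: chart P U phi using P U(1) by (rule chartI)
  have V: "(?V, ?psi) \<in> atlas TM" by (simp add: atlas_torus)
  interpret V: chart TM ?V ?psi using TM V by (rule chartI)
  have eV: "?e \<in> ?V" using torus_exp_chart(1)[OF torus_one_in zero_in_cube] torus_exp_zero[OF torus_one_in] by simp
  let ?W = "{p:X. u p \<in> ?V}"
  let ?S = "phi ` (U Int ?W)"
  define G where "G i x = ?psi (u (inv_into U phi x)) i" for i x
  have G: "Cinf d ?S (G i)" for i
    unfolding G_def by (rule smooth_fn_in_chart[OF smooth_map_coord[OF P TM u_smooth V] U(1)])
  have x: "phi p \<in> ?S" using U(2) p eV by simp
  have orbit: "smooth_map TM P (%z. \<sigma> p z)"
    using smooth_map_compose[OF TM PT P smooth_map_pair[OF TM P TM smooth_map_const[OF TM P p(1)] smooth_map_id[OF TM]] \<sigma>_smooth]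
    by simp
  let ?Z = "{z:torus_set n. \<sigma> p z \<in> U}"
  let ?C = "?psi ` (?V Int ?Z)"
  have "EX v:Rn d. ALL i<n. dird v (G i) (phi p) = (if i = j then 1 else 0)" if j: "j < n" for j
  proof -
    let ?\<Gamma> = "%c. phi (\<sigma> p (inv_into ?V ?psi c))"
    have \<Gamma>: "Cinf n ?C (%c. ?\<Gamma> c j)" for j
      using smooth_fn_in_chart[OF smooth_map_coord[OF TM P orbit U(1)] V, of j] by simp
    have u\<sigma>: "u (\<sigma> p z) = z" if "z \<in> torus_set n" for z
      using u_act[OF p(1) that] that by (auto simp: p(2) torus_one_def torus_set_def PiE_iff extensional_def fun_eq_iff)
    have c: "inv_into ?V ?psi c \<in> ?V Int ?Z" if "c \<in> ?C" for c
      using that V.in_image_iff[of "?V Int ?Z" c] by auto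
    have "EX v:Rn d. ALL i<n. dird v (G i) (?\<Gamma> (?psi ?e)) = unitv j i"
    proof (rule lift_direction[OF G Cinf_open[OF \<Gamma>] _ \<Gamma> _ _ unitv_in_Rn[OF j]])
      show "?\<Gamma> c \<in> ?S" if "c \<in> ?C" for c using c[OF that] u\<sigma> \<sigma>_in[OF p(1)] by auto
      show "G i (?\<Gamma> c) = c i" if "c \<in> ?C" for c i
        using c[OF that] u\<sigma> V.chart_inv that by (auto simp: G_def)
      show "?psi ?e \<in> ?C" using eV U(2) \<sigma>_one[OF p(1)] by auto
    qed
    moreover have "?\<Gamma> (?psi ?e) = phi p" using eV \<sigma>_one[OF p(1)] by simp
    ultimately show ?thesis by (simp add: unitv_def)
  qed
  note * = this
  obtain S f h where f: "n <= d" "phi p \<in> S" "S \<subseteq> ?S" "diffeo_on d S f h" "!!x i. x \<in> S ==> i < n ==> f x i = G i x"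
    by (rule straighten[OF Cinf_open[OF G] x G *]) (assumption+, rule that)
  have "adapted U phi S f h" unfolding adapted_def using U(1) f by (auto simp: G_def)
  then show ?thesis using that U(2) f(2) by blast
qed

text \<open>The chart of the orbit space induced by an adapted chart: an orbit is represented by its
  slice point, whose remaining \<open>d - n\<close> coordinates are recorded. The inverse chart is
  \<open>pr \<circ> olift\<close>.\<close>

definition odom where "odom U phi S = {Q:pr ` X. sec Q \<in> U & phi (sec Q) \<in> S}"

definition ochart where "ochart phi f Q = snd_part n (f (phi (sec Q)))"

definition oimg where "oimg S f = {c:Rn (d - n). ex_snd n c \<in> f ` S}"

definition olift where "olift U phi h c = inv_into U phi (h (ex_snd n c))"

context
  fixes U phi S f h
  assumes ad: "adapted U phi S f h"
begin

lemma adapted_chart: "chart P U phi"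
  using P ad by (simp add: chartI adapted_def)

interpretation chart P U phi by (rule adapted_chart)

lemma ad_dim: "n + (d - n) = d"
  using ad by (simp add: adapted_def)

lemma ad_diffeo: "diffeo_on d S f h"
  using ad by (simp add: adapted_def)

lemmas D = diffeo_onD[OF ad_diffeo]

lemma ad_S: "x \<in> S ==> x \<in> phi ` U" "x \<in> S ==> inv_into U phi x \<in> X" "x \<in> S ==> u (inv_into U phi x) \<in> torus_dom n (torus_one n)"
  using ad by (auto simp: adapted_def)

lemma ad_f: "x \<in> S ==> i < n ==> f x i = torus_chart n (torus_one n) (u (inv_into U phi x)) i"
  using ad unfolding adapted_def by blast

lemma olift_facts:
  assumes c: "c \<in> oimg S f"
  shows "olift U phi h c \<in> X" "olift U phi h c \<in> U" "phi (olift U phi h c) \<in> S" "sec (pr (olift U phi h c)) = olift U phi h c"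
    "pr (olift U phi h c) \<in> odom U phi S" "ochart phi f (pr (olift U phi h c)) = c"
proof -
  let ?x = "h (ex_snd n c)" and ?p = "olift U phi h c"
  have x: "?x \<in> S" "f ?x = ex_snd n c" using c D(7,8) by (auto simp: oimg_def)
  have ph: "?p = inv_into U phi ?x" by (simp add: olift_def)
  show X: "?p \<in> X" unfolding ph by (rule ad_S(2)[OF x(1)])
  show U: "?p \<in> U" unfolding ph by (rule inv_in[OF ad_S(1)[OF x(1)]])
  have px: "phi ?p = ?x" unfolding ph by (rule chart_inv[OF ad_S(1)[OF x(1)]])
  show S: "phi ?p \<in> S" unfolding px by (rule x(1))
  have "torus_chart n (torus_one n) (u ?p) i = 0" for i
    using ad_f[OF x(1), of i] x(2) by (cases "i < n") (simp_all add: ph join_vec_def torus_chart_def)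
  then have "torus_chart n (torus_one n) (u ?p) = (%_. 0)" by blast
  then have "u ?p = torus_one n"
    using torus_chart_exp(2)[OF torus_one_in ad_S(3)[OF x(1)]] torus_exp_zero[OF torus_one_in] by (simp add: ph)
  then show s: "sec (pr ?p) = ?p" unfolding sec_pr[OF X] by (rule r_fixed[OF X])
  show "pr ?p \<in> odom U phi S" using X U S s by (simp add: odom_def)
  show "ochart phi f (pr ?p) = c" by (simp add: ochart_def s px x(2))
qed

lemma odom_facts:
  assumes Q: "Q \<in> odom U phi S"
  shows "ochart phi f Q \<in> oimg S f" "olift U phi h (ochart phi f Q) = sec Q" "pr (olift U phi h (ochart phi f Q)) = Q"
proof -
  let ?x = "phi (sec Q)"
  have Q': "Q \<in> pr ` X" "sec Q \<in> U" "?x \<in> S" using Q by (auto simp: odom_def)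
  have "f ?x i = 0" if i: "i < n" for i
    using ad_f[OF Q'(3) i] i Q'(2) sec_facts(3)[OF Q'(1)] by (simp add: torus_chart_def torus_one_def)
  then have e: "ex_snd n (ochart phi f Q) = f ?x" by (auto simp: ochart_def join_vec_def snd_part_def)
  have "f ?x \<in> Rn (n + (d - n))" unfolding ad_dim by (rule D(6)[OF Q'(3)])
  then show "ochart phi f Q \<in> oimg S f" using Q'(3) e by (simp add: oimg_def) (simp add: ochart_def)
  show s: "olift U phi h (ochart phi f Q) = sec Q" using D(3)[OF Q'(3)] Q'(2) by (simp add: olift_def e)
  show "pr (olift U phi h (ochart phi f Q)) = Q" unfolding s by (rule sec_facts(2)[OF Q'(1)])
qed

lemma ochart_image: "ochart phi f ` odom U phi S = oimg S f"
  using olift_facts(5,6) odom_facts(1) by (metis (no_types, lifting) image_eqI image_subsetI subsetI subset_antisym)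

lemma inv_ochart: "c \<in> oimg S f ==> inv_into (odom U phi S) (ochart phi f) c = pr (olift U phi h c)"
  using olift_facts(5,6) odom_facts(3) by (intro inv_into_f_eq inj_on_inverseI[of _ "%c. pr (olift U phi h c)"]) auto

lemma oimg_open: "open_Rn (d - n) (oimg S f)"
proof -
  have "continuous_on (Rn (d - n)) (%c. ex_snd n c j)" for j
    using Cinf_continuous[OF Cinf_coord, of "d - n" "Rn (d - n)" "j - n"] by (cases "j < n") (simp_all add: join_vec_def)
  then show ?thesis
    unfolding oimg_def using join_vec_Rn[of _ "d - n" n "%_. 0"] by (intro openin_coord_preimage[OF _ D(2)]) (auto simp: ad_dim)
qed

text \<open>The lift to the slice is smooth, tested on scalar functions of \<open>P\<close>.\<close>

lemma olift_Cinf: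
  fixes k :: "'a => real"
  assumes k: "smooth_fn P W k"
  shows "Cinf (d - n) {c:oimg S f. olift U phi h c \<in> W} (%c. k (olift U phi h c))"
proof -
  have hx: "h (ex_snd n c) \<in> S" if "c \<in> oimg S f" for c using that D(7) by (simp add: oimg_def)
  have eq: "{c:oimg S f. olift U phi h c \<in> W} = {c:oimg S f. h (ex_snd n c) \<in> phi ` (U Int W)}" (is "_ = ?E")
    using in_image_iff[of "U Int W"] hx ad_S(1) inv_in by (auto simp: olift_def)
  have ex: "Cinf (d - n) (oimg S f) (%c. ex_snd n c j)" for j
    using Cinf_coord[OF oimg_open, of "j - n"] by (cases "j < n") (simp_all add: join_vec_def Cinf_const oimg_open)
  have h: "Cinf (d - n) (oimg S f) (%c. h (ex_snd n c) j)" if "j < d" for j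
    by (rule Cinf_compose[OF oimg_open D(5)[OF that] _ ex]) (simp add: oimg_def)
  have kc: "Cinf d (phi ` (U Int W)) (%x. k (inv_into U phi x))"
    using k ad by (simp add: smooth_fn_in_chart adapted_def)
  have E: "open_Rn (d - n) ?E"
    using hx D(9) by (intro openin_coord_preimage[OF oimg_open Cinf_open[OF kc] _ Cinf_continuous[OF h]]) auto
  show ?thesis
    unfolding eq unfolding olift_def by (rule Cinf_compose[OF E kc]) (auto intro: Cinf_subset[OF h E])
qed

lemma ad_open: "openin (mtop P) {p:U. phi p \<in> S}"
  by (rule open_preimage[OF D(1)])

lemma ochart_coord: "j < d - n ==> smooth_fn P {p:U. phi p \<in> S} (%p. f (phi p) (j + n))"
  by (rule smooth_fn_chart_compose[OF ad_open _ D(4)]) auto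

end

text \<open>Since \<open>sec\<close> is injective on orbits, this makes the orbit space a copy of the slice as a subspace
  of \<open>P\<close>; topological properties are inherited along \<open>sec\<close>.\<close>

abbreviation "otop == pullback_topology (pr ` X) sec (mtop P)"

definition orbit_manifold :: "'a set manifold" where
  "orbit_manifold = \<lparr>mtop = otop, mdim = d - n,
     atlas = {(odom U phi S, ochart phi f) |U phi S f. EX h. adapted U phi S f h}\<rparr>"

lemma topspace_otop: "topspace otop = pr ` X"
  using sec_facts(1) by (auto simp: topspace_pullback_topology)

lemma sec_continuous: "continuous_map otop (mtop P) sec"
  using continuous_map_pullback[where A = "pr ` X" and f = sec, OF continuous_map_id[of "mtop P"]] by (simp add: o_def)

lemma pr_continuous: "continuous_map (mtop P) otop pr"
proof (rule continuous_map_pullback')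
  show "continuous_map (mtop P) (mtop P) (sec o pr)"
    by (rule continuous_map_eq[OF smooth_map_continuous[OF r_smooth]]) (simp add: sec_pr)
qed blast

lemma pr_quotient: "quotient_map (mtop P) otop pr"
  by (rule retraction_imp_quotient_map)
    (auto simp: retraction_map_def retraction_maps_def topspace_otop sec_facts intro!: exI[of _ sec] pr_continuous sec_continuous)

lemma sec_inj: "inj_on sec (pr ` X)"
  using sec_facts(2) by (metis inj_on_inverseI)

lemma otop_Hausdorff: "Hausdorff_space otop"
proof (rule Hausdorff_space_injective_preimage[OF _ sec_continuous])
  show "Hausdorff_space (mtop P)" using M by (simp add: smooth_manifold_def)
qed (simp add: topspace_otop sec_inj)

lemma otop_second_countable: "second_countable otop"
proof -
  have "second_countable (mtop P)" using M by (simp add: smooth_manifold_def)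
  then obtain \<B> where "countable \<B> & (ALL V:\<B>. openin (mtop P) V) &
      (ALL W x. openin (mtop P) W & x \<in> W --> (EX V:\<B>. x \<in> V & V \<subseteq> W))"
    unfolding second_countable_def ..
  then have b: "countable \<B>" "!!V. V \<in> \<B> ==> openin (mtop P) V"
    "!!W x. openin (mtop P) W ==> x \<in> W ==> EX V:\<B>. x \<in> V & V \<subseteq> W" by simp_all
  show ?thesis
    unfolding second_countable_def
  proof (intro exI[of _ "(%V. sec -` V Int pr ` X) ` \<B>"] conjI ballI allI impI)
    fix W Q assume "openin otop W & Q \<in> W"
    then obtain V where V: "openin (mtop P) V" "W = sec -` V Int pr ` X" "Q \<in> W"
      by (auto simp: openin_pullback_topology)
    then have "sec Q \<in> V" by simp
    from b(3)[OF V(1) this] obtain V' where V': "V' \<in> \<B>" "sec Q \<in> V'" "V' \<subseteq> V" by blast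
    have "Q \<in> sec -` V' Int pr ` X & sec -` V' Int pr ` X \<subseteq> W" using V(2,3) V'(2,3) by auto
    then show "EX V:(%V. sec -` V Int pr ` X) ` \<B>. Q \<in> V & V \<subseteq> W" by (rule bexI) (rule imageI[OF V'(1)])
  next
    fix V assume "V \<in> (%V. sec -` V Int pr ` X) ` \<B>"
    then obtain W where "W \<in> \<B>" "V = sec -` W Int pr ` X" by (rule imageE)
    then show "openin otop V" unfolding openin_pullback_topology by (intro exI[of _ W] conjI b(2))
  qed (use b(1) in simp)
qed

lemma otop_paracompact: "paracompact_space otop"
  unfolding paracompact_space_def
proof (intro allI impI)
  fix \<U> assume \<U>: "(ALL U:\<U>. openin otop U) & \<Union>\<U> = topspace otop"
  let ?pre = "%U. {p:X. pr p \<in> U}" and ?sec = "%V. sec -` V Int pr ` X"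
  have "(ALL W:?pre ` \<U>. openin (mtop P) W) & \<Union> (?pre ` \<U>) = topspace (mtop P)"
    using \<U> openin_continuous_map_preimage[OF pr_continuous] by (auto simp: topspace_otop)
  then obtain \<V> where \<V>: "ALL V:\<V>. openin (mtop P) V & (EX W:?pre ` \<U>. V \<subseteq> W)" "\<Union>\<V> = X" "locally_finite_in (mtop P) \<V>"
    using M unfolding smooth_manifold_def paracompact_space_def by meson
  have "openin otop (?sec V)" if "V \<in> \<V>" for V using \<V>(1) that by (auto simp: openin_pullback_topology)
  moreover have "EX U:\<U>. ?sec V \<subseteq> U" if V: "V \<in> \<V>" for V
  proof -
    obtain U where U: "U \<in> \<U>" "V \<subseteq> ?pre U" using \<V>(1) V by blast
    have "?sec V \<subseteq> U"
    proof
      fix Q assume "Q \<in> ?sec V"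
      then have "pr (sec Q) \<in> U" "Q \<in> pr ` X" using U(2) by auto
      then show "Q \<in> U" by (simp add: sec_facts(2))
    qed
    then show ?thesis using U(1) by blast
  qed
  moreover have "\<Union> (?sec ` \<V>) = topspace otop"
    unfolding topspace_otop
  proof (intro subset_antisym subsetI)
    fix Q assume Q: "Q \<in> pr ` X"
    then obtain V where "V \<in> \<V>" "sec Q \<in> V" using sec_facts(1)[OF Q] \<V>(2) by blast
    then show "Q \<in> \<Union> (?sec ` \<V>)" using Q by blast
  qed blast
  moreover have "locally_finite_in otop (?sec ` \<V>)"
    unfolding locally_finite_in_def
  proof (intro conjI ballI)
    show "\<Union> (?sec ` \<V>) \<subseteq> topspace otop" unfolding topspace_otop by blast
    fix Q assume "Q \<in> topspace otop"
    then have Q: "Q \<in> pr ` X" by (simp add: topspace_otop)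
    then obtain W where W: "openin (mtop P) W" "sec Q \<in> W" "finite {V:\<V>. V Int W ~= {}}"
      using \<V>(3) sec_facts(1)[OF Q] unfolding locally_finite_in_def by blast
    have "{V:?sec ` \<V>. V Int ?sec W ~= {}} \<subseteq> ?sec ` {V:\<V>. V Int W ~= {}}" by blast
    then have "finite {V:?sec ` \<V>. V Int ?sec W ~= {}}" using W(3) by (meson finite_imageI finite_subset)
    then show "EX W. openin otop W & Q \<in> W & finite {V:?sec ` \<V>. V Int W ~= {}}"
      using W Q by (intro exI[of _ "?sec W"]) (auto simp: openin_pullback_topology)
  qed
  ultimately show "EX \<V>. (ALL V:\<V>. openin otop V & (EX U:\<U>. V \<subseteq> U)) & \<Union>\<V> = topspace otop & locally_finite_in otop \<V>"
    by (intro exI[of _ "?sec ` \<V>"]) auto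
qed

lemma odom_open:
  assumes "adapted U phi S f h"
  shows "openin otop (odom U phi S)"
proof -
  have "odom U phi S = {Q:topspace otop. sec Q \<in> {p:U. phi p \<in> S}}" by (auto simp: odom_def topspace_otop)
  then show ?thesis using openin_continuous_map_preimage[OF sec_continuous ad_open[OF assms]] by simp
qed

lemma ochart_homeomorphic:
  assumes ad: "adapted U phi S f h"
  shows "homeomorphic_map (subtopology otop (odom U phi S)) (subtopology (Euclidean_space (d - n)) (oimg S f)) (ochart phi f)"
proof -
  let ?T = "subtopology otop (odom U phi S)" and ?E = "subtopology (Euclidean_space (d - n)) (oimg S f)"
  let ?W = "{p:U. phi p \<in> S}"
  have T: "topspace ?T = odom U phi S" using openin_subset[OF odom_open[OF ad]] by auto
  have E: "topspace ?E = oimg S f" using openin_subset[OF oimg_open[OF ad]] by auto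
  have sec: "continuous_map ?T (subtopology (mtop P) ?W) sec"
    by (auto simp: continuous_map_in_subtopology continuous_map_from_subtopology[OF sec_continuous] odom_def)
  have "continuous_map ?T (Euclidean_space (d - n)) (ochart phi f)"
    unfolding continuous_map_Euclidean_space
  proof (intro conjI ballI allI impI)
    show "ochart phi f Q \<in> Rn (d - n)" if "Q \<in> topspace ?T" for Q
      using odom_facts(1)[OF ad] that unfolding T oimg_def by blast
    show "continuous_map ?T euclideanreal (%Q. ochart phi f Q i)" if "i < d - n" for i
      using continuous_map_compose[OF sec smooth_fn_continuous_map[OF P ochart_coord[OF ad that]]]
      by (simp add: o_def ochart_def snd_part_def)
  qed
  then have c1: "continuous_map ?T ?E (ochart phi f)"
    using odom_facts(1)[OF ad] T by (auto simp: continuous_map_in_subtopology)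
  have J: "continuous_map ?E (mtop P) (olift U phi h)"
    unfolding continuous_map_def E
  proof (intro conjI allI impI)
    show "olift U phi h \<in> oimg S f \<rightarrow> X" using olift_facts(1)[OF ad] by blast
    fix W assume "openin (mtop P) W"
    then have "open_Rn (d - n) {c:oimg S f. olift U phi h c \<in> W}"
      by (rule Cinf_open[OF olift_Cinf[OF ad smooth_fn_const[OF P, of W "0 :: real"]]])
    then show "openin ?E {c:oimg S f. olift U phi h c \<in> W}"
      using oimg_open[OF ad] by (auto simp: openin_open_subtopology)
  qed
  have "continuous_map ?E otop (%c. pr (olift U phi h c))"
    using continuous_map_compose[OF J pr_continuous] by (simp add: o_def)
  then have c2: "continuous_map ?E ?T (%c. pr (olift U phi h c))"
    using olift_facts(5)[OF ad] E by (auto simp: continuous_map_in_subtopology)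
  have "homeomorphic_maps ?T ?E (ochart phi f) (%c. pr (olift U phi h c))"
    unfolding homeomorphic_maps_def T E using c1 c2 odom_facts(3)[OF ad] olift_facts(6)[OF ad] by blast
  then show ?thesis using homeomorphic_map_maps by blast
qed

lemma ochart_transition:
  assumes ad: "adapted U phi S f h" and ad': "adapted U' phi' S' f' h'"
  shows "smooth_on (euclid (d - n)) (euclid (d - n)) (ochart phi f ` (odom U phi S Int odom U' phi' S'))
     (ochart phi' f' o inv_into (odom U phi S) (ochart phi f))"
proof -
  let ?W = "{p:U'. phi' p \<in> S'}"
  let ?C = "{c:oimg S f. olift U phi h c \<in> ?W}"
  have dom: "odom U phi S Int odom U' phi' S' = {Q:odom U phi S. olift U phi h (ochart phi f Q) \<in> ?W}"
    using odom_facts(2)[OF ad] by (auto simp: odom_def)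
  have img: "ochart phi f ` (odom U phi S Int odom U' phi' S') = ?C"
    unfolding dom ochart_image[OF ad, symmetric] by blast
  have inv: "(ochart phi' f' o inv_into (odom U phi S) (ochart phi f)) c = snd_part n (f' (phi' (olift U phi h c)))"
    if "c \<in> oimg S f" for c
    using olift_facts(4)[OF ad that] by (simp add: inv_ochart[OF ad that] ochart_def)
  have "open_Rn (d - n) ?C"
    by (rule Cinf_open[OF olift_Cinf[OF ad smooth_fn_const[OF P ad_open[OF ad'], of "0 :: real"]]])
  moreover have "snd_part n (f' (phi' (olift U phi h c))) \<in> Rn (d - n)" if "c \<in> ?C" for c
    using D(6)[OF ad', of "phi' (olift U phi h c)"] that ad_dim[OF ad'] by (intro snd_part_Rn) simp
  moreover have "Cinf (d - n) ?C (%c. (ochart phi' f' o inv_into (odom U phi S) (ochart phi f)) c j)" if j: "j < d - n" for j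
    by (rule Cinf_cong[THEN iffD1, OF _ olift_Cinf[OF ad ochart_coord[OF ad' j]]]) (simp add: inv snd_part_def del: o_apply)
  ultimately show ?thesis
    unfolding smooth_on_euclid img using inv by auto
qed

lemma orbit_chartE:
  assumes "(V, psi) \<in> atlas orbit_manifold"
  obtains U phi S f h where "adapted U phi S f h" "V = odom U phi S" "psi = ochart phi f"
  using assms by (auto simp: orbit_manifold_def)

lemma orbit_manifold_pre: "pre_manifold orbit_manifold"
  unfolding pre_manifold_def
proof (intro conjI)
  have "pr ` X \<subseteq> (\<Union>(V, psi)\<in>atlas orbit_manifold. V)"
  proof
    fix Q assume Q: "Q \<in> pr ` X"
    obtain U phi S f h where "adapted U phi S f h" "sec Q \<in> U" "phi (sec Q) \<in> S"
      by (rule adapted_exists[OF sec_facts(1,3)[OF Q]]) (rule that)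
    note ad = this
    have "(odom U phi S, ochart phi f) \<in> atlas orbit_manifold" using ad(1) unfolding orbit_manifold_def by simp blast
    moreover have "Q \<in> odom U phi S" using Q ad(2,3) by (simp add: odom_def)
    ultimately show "Q \<in> (\<Union>(V, psi)\<in>atlas orbit_manifold. V)" by blast
  qed
  then show "(\<Union>(V, psi)\<in>atlas orbit_manifold. V) = topspace (mtop orbit_manifold)"
    by (auto simp: orbit_manifold_def topspace_otop odom_def)
  show "ALL (V, psi):atlas orbit_manifold. openin (mtop orbit_manifold) V &
      open_Rn (mdim orbit_manifold) (psi ` V) &
      homeomorphic_map (subtopology (mtop orbit_manifold) V)
        (subtopology (Euclidean_space (mdim orbit_manifold)) (psi ` V)) psi"
  proof (intro ballI, clarify)
    fix V psi assume "(V, psi) \<in> atlas orbit_manifold"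
    then obtain U phi S f h where ad: "adapted U phi S f h" and V: "V = odom U phi S" "psi = ochart phi f" by (rule orbit_chartE)
    show "openin (mtop orbit_manifold) V & open_Rn (mdim orbit_manifold) (psi ` V) &
      homeomorphic_map (subtopology (mtop orbit_manifold) V) (subtopology (Euclidean_space (mdim orbit_manifold)) (psi ` V)) psi"
      using odom_open[OF ad] oimg_open[OF ad] ochart_homeomorphic[OF ad] by (simp add: V orbit_manifold_def ochart_image[OF ad])
  qed
  show "ALL (V, psi):atlas orbit_manifold. ALL (V', psi'):atlas orbit_manifold.
      smooth_on (euclid (mdim orbit_manifold)) (euclid (mdim orbit_manifold)) (psi ` (V Int V')) (psi' o inv_into V psi)"
  proof (intro ballI, clarify)
    fix V psi V' psi' assume "(V, psi) \<in> atlas orbit_manifold" and V': "(V', psi') \<in> atlas orbit_manifold"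
    then obtain U phi S f h where 1: "adapted U phi S f h" "V = odom U phi S" "psi = ochart phi f" by (auto elim: orbit_chartE)
    obtain U' phi' S' f' h' where 2: "adapted U' phi' S' f' h'" "V' = odom U' phi' S'" "psi' = ochart phi' f'"
      using V' by (rule orbit_chartE)
    show "smooth_on (euclid (mdim orbit_manifold)) (euclid (mdim orbit_manifold)) (psi ` (V Int V')) (psi' o inv_into V psi)"
      using ochart_transition[OF 1(1) 2(1)] unfolding 1(2,3) 2(2,3) by (simp add: orbit_manifold_def)
  qed
qed

lemma orbit_manifold_smooth: "smooth_manifold orbit_manifold"
  using orbit_manifold_pre otop_Hausdorff otop_second_countable otop_paracompact
  by (simp add: smooth_manifold_def pre_manifold_def) (simp add: orbit_manifold_def)

lemma pr_smooth: "smooth_map P orbit_manifold pr"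
proof -
  have 1: "continuous_map (mtop P) (mtop orbit_manifold) pr" using pr_continuous by (simp add: orbit_manifold_def)
  have 2: "smooth_fn P {p:X. pr p \<in> V} (%p. psi (pr p) j)"
    if "(V, psi) \<in> atlas orbit_manifold" and "j < mdim orbit_manifold" for V psi j
  proof -
    obtain U phi S f h where ad: "adapted U phi S f h" and V: "V = odom U phi S" "psi = ochart phi f"
      by (rule orbit_chartE[OF \<open>(V, psi) \<in> atlas orbit_manifold\<close>]) (rule that)
    have j: "j < d - n" using that(2) by (simp add: orbit_manifold_def)
    have eq: "{p:X. pr p \<in> V} = {p:X. r p \<in> {p:U. phi p \<in> S}}"
      by (auto simp: V odom_def sec_pr)
    show "smooth_fn P {p:X. pr p \<in> V} (%p. psi (pr p) j)"
      unfolding eq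
      by (rule smooth_fn_cong[THEN iffD1, OF _ P smooth_map_pullback[OF P P r_smooth ochart_coord[OF ad j]]])
        (simp add: V ochart_def sec_pr snd_part_def)
  qed
  show ?thesis unfolding smooth_map_iff[OF P orbit_manifold_pre] using 1 2 by blast
qed

text \<open>Moving the lifted slice by the group element \<open>u p\<close> gives a section through
  \<open>p\<close>.\<close>

lemma pr_submersion: "submersion P orbit_manifold pr"
proof (rule submersionI[OF P orbit_manifold_pre pr_smooth])
  fix p V psi assume p: "p \<in> X" and "(V, psi) \<in> atlas orbit_manifold" and pV: "pr p \<in> V"
  then obtain U phi S f h where ad: "adapted U phi S f h" and V: "V = odom U phi S" "psi = ochart phi f"
    by (auto simp: orbit_manifold_def)
  let ?\<gamma> = "%c. \<sigma> (olift U phi h c) (u p)"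
  have up: "u p \<in> torus_set n" by (rule u_in[OF p])
  have 1: "psi (pr p) \<in> oimg S f" using odom_facts(1)[OF ad] pV by (simp add: V)
  have 2: "?\<gamma> (psi (pr p)) = p"
    using odom_facts(2)[OF ad] pV by (simp add: V sec_pr[OF p] act_r_u[OF p])
  have 3: "?\<gamma> c \<in> X & pr (?\<gamma> c) \<in> V & psi (pr (?\<gamma> c)) = c" if "c \<in> oimg S f" for c
    using olift_facts[OF ad that] \<sigma>_in pr_act up by (simp add: V)
  have 4: "Cinf (mdim orbit_manifold) {c:oimg S f. ?\<gamma> c \<in> W} (%c. k (?\<gamma> c))" if k: "smooth_fn P W k" for W and k :: "'a => real"
  proof -
    have "{c:oimg S f. olift U phi h c \<in> {p' \<in> X. \<sigma> p' (u p) \<in> W}} = {c:oimg S f. ?\<gamma> c \<in> W}"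
      using olift_facts(1)[OF ad] by blast
    then show ?thesis
      using olift_Cinf[OF ad smooth_map_pullback[OF P P \<sigma>_slice[OF up] k]] by (simp add: orbit_manifold_def)
  qed
  show "EX C \<gamma>. psi (pr p) \<in> C & \<gamma> (psi (pr p)) = p & (ALL c:C. \<gamma> c \<in> X & pr (\<gamma> c) \<in> V & psi (pr (\<gamma> c)) = c) &
      (ALL W. ALL k :: _ => real. smooth_fn P W k --> Cinf (mdim orbit_manifold) {c:C. \<gamma> c \<in> W} (%c. k (\<gamma> c)))"
    using 1 2 3 4 by (intro exI[of _ "oimg S f"] exI[of _ ?\<gamma>] conjI ballI allI impI) blast+
qed

lemma orbit_manifold_exists: "is_orbit_manifold P (torus n) \<sigma> orbit_manifold"
  unfolding is_orbit_manifold_def using orbit_manifold_smooth pr_quotient pr_submersion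
  by (simp add: orbit_manifold_def)

end

theorem theorem7p1p15:
  fixes n :: nat and P :: "'a manifold"
  assumes "smooth_manifold P"
  shows
    "(\<forall>\<alpha>. smooth_trivial_NCP_torus_bundle n (C_infinity P) \<alpha> \<longrightarrow>
        (let \<sigma> = induced_action P \<alpha>; pr = orbit_map (torus n) \<sigma> in
           (\<exists>B. is_orbit_manifold P (torus n) \<sigma> B) \<and>
           (\<forall>B. is_orbit_manifold P (torus n) \<sigma> B \<longrightarrow>
              trivial_principal_bundle P B (torus n) pr \<sigma>)))
     \<and>
     (\<forall>(M :: 'm manifold) q \<sigma>. trivial_principal_bundle P M (torus n) q \<sigma> \<longrightarrow>
        smooth_trivial_NCP_torus_bundle n (C_infinity P) (pullback_action P \<sigma>))"
  unfolding Let_def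
proof (intro conjI allI impI trivial_bundle_imp_trivial_NCP)
  fix \<alpha> assume NCP: "smooth_trivial_NCP_torus_bundle n (C_infinity P) \<alpha>"
  interpret S: smooth_torus_system P n \<alpha>
    by unfold_locales (use assms NCP in "auto simp: smooth_manifold_pre smooth_trivial_NCP_torus_bundle_def")
  let ?\<sigma> = "induced_action P \<alpha>"
  obtain u where u: "smooth_map P (torus_manifold n) u"
    "ALL p:topspace (mtop P). ALL z:torus_set n. u (?\<sigma> p z) = (\<lambda>i\<in>{..<n}. u p i * z i)"
    using S.equivariant_map NCP unfolding smooth_trivial_NCP_torus_bundle_def by blast
  interpret E: equivariant_torus_action P n ?\<sigma> u
    by unfold_locales (use S.lie S.induced_action_smooth assms u in auto)
  show "EX B. is_orbit_manifold P (torus n) ?\<sigma> B" using E.orbit_manifold_exists by blast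
  show "trivial_principal_bundle P B (torus n) (orbit_map (torus n) ?\<sigma>) ?\<sigma>"
    if "is_orbit_manifold P (torus n) ?\<sigma> B" for B
    using that by (rule E.orbit_manifold_trivial)
qed

end
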